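(* Let $\Gamma$ be an artin algebra with $\operatorname{gldim}\Gamma<\infty$ and $\operatorname{domdim}\Gamma\ge 2$, let $T_{\mathcal{C}}$ be the unique tilting module in $\mathcal{C}_\Gamma$, and let $B_{\mathcal{C}}=\operatorname{End}_\Gamma(T_{\mathcal{C}})^{op}$. Then $$\operatorname{gldim}B_{\mathcal{C}}<\operatorname{gldim}\Gamma\quad\text{if and only if}\quad\operatorname{projdim}_\Gamma(\tau T_{\mathcal{C}})<\operatorname{gldim}\Gamma.$$
   Context: All modules are finitely generated left modules; $\tau$ is the Auslander-Reiten translation (with $\tau$ of a projective module equal to $0$). The projective dimension of the zero module is taken to be $0$ here (relevant only when $\Gamma$ is semisimple). For a minimal injective resolution $0\to{}_\Gamma\Gamma\to I_0\to I_1\to\cdots$, $\operatorname{domdim}\Gamma=\sup\{k\mid I_i\text{ is projective for all }0\le i<k\}$. Let $\widetilde{Q}$ be the direct sum of representatives of the isomorphism classes of all indecomposable projective-injective $\Gamma$-modules; $\mathcal{C}_\Gamma=(\operatorname{Gen}\widetilde{Q})\cap(\operatorname{Cogen}\widetilde{Q})$ is the full subcategory of modules $M$ that admit both an epimorphism $\widetilde{Q}^m\to M$ and a monomorphism $M\to\widetilde{Q}^{m'}$ for some $m,m'$. A basic $\Gamma$-module $T$ is tilting if (1) $\operatorname{projdim}T\le 1$, (2) $\operatorname{Ext}^1_\Gamma(T,T)=0$, (3) there is an exact sequence $0\to\Gamma\to T_0\to T_1\to 0$ with $T_0,T_1\in\operatorname{add}T$. When $\operatorname{domdim}\Gamma\ge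 2$, there is a tilting module in $\mathcal{C}_\Gamma$, unique up to isomorphism; it is isomorphic to the direct sum of $\widetilde{Q}$ and the cokernels of the injective envelopes of representatives of the indecomposable projective non-injective modules. *)

theory Defs
  imports "HOL-Algebra.Module" "HOL-Algebra.QuotRing" "HOL-Algebra.Elementary_Groups" "HOL-Library.Extended_Nat"
begin

section \<open>Left modules over a not necessarily commutative ring\<close>

text \<open>
  The records are those of \<^theory>\<open>HOL-Algebra.Module\<close>, but the locale \<^locale>\<open>module\<close> demands a
  commutative ring of scalars, so we drop that requirement.  The fields \<^const>\<open>monoid.mult\<close> and
  \<^const>\<open>one\<close>, which a module record inherits from the ring record, carry no meaning and are
  left unspecified in the constructions below.  The library's locale \<^locale>\<open>submodule\<close> does not
  mention commutativity and is used as it stands.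
\<close>

locale left_module = R?: ring R + M?: abelian_group M
  for R :: "('a, 'c) ring_scheme" (structure) and M :: "('a, 'm) module" (structure) +
  assumes smult_closed: "\<lbrakk>a \<in> carrier R; x \<in> carrier M\<rbrakk> \<Longrightarrow> a \<odot>\<^bsub>M\<^esub> x \<in> carrier M"
    and smult_l_distr: "\<lbrakk>a \<in> carrier R; b \<in> carrier R; x \<in> carrier M\<rbrakk> \<Longrightarrow>
      (a \<oplus>\<^bsub>R\<^esub> b) \<odot>\<^bsub>M\<^esub> x = a \<odot>\<^bsub>M\<^esub> x \<oplus>\<^bsub>M\<^esub> b \<odot>\<^bsub>M\<^esub> x"
    and smult_r_distr: "\<lbrakk>a \<in> carrier R; x \<in> carrier M; y \<in> carrier M\<rbrakk> \<Longrightarrow>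
      a \<odot>\<^bsub>M\<^esub> (x \<oplus>\<^bsub>M\<^esub> y) = a \<odot>\<^bsub>M\<^esub> x \<oplus>\<^bsub>M\<^esub> a \<odot>\<^bsub>M\<^esub> y"
    and smult_assoc: "\<lbrakk>a \<in> carrier R; b \<in> carrier R; x \<in> carrier M\<rbrakk> \<Longrightarrow>
      (a \<otimes>\<^bsub>R\<^esub> b) \<odot>\<^bsub>M\<^esub> x = a \<odot>\<^bsub>M\<^esub> (b \<odot>\<^bsub>M\<^esub> x)"
    and smult_one: "x \<in> carrier M \<Longrightarrow> \<one>\<^bsub>R\<^esub> \<odot>\<^bsub>M\<^esub> x = x"

definition fg_module :: "('a, 'c) ring_scheme \<Rightarrow> ('a, 'm) module \<Rightarrow> bool" where
  "fg_module R M \<longleftrightarrow> left_module R M \<and>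
     (\<exists>S. finite S \<and> S \<subseteq> carrier M \<and> (\<forall>N. submodule N R M \<and> S \<subseteq> N \<longrightarrow> N = carrier M))"

text \<open>
  Every finitely generated left module over a ring with elements in \<open>'a\<close> is isomorphic to a
  quotient of some \<open>R\<^sup>n\<close>, whose elements are cosets, i.e. sets of functions from \<open>nat\<close> to \<open>'a\<close>.
  Hence quantifying over the finitely generated modules of the following type amounts to
  quantifying over all finitely generated modules.
\<close>

type_synonym 'a umod = "('a, (nat \<Rightarrow> 'a) set) module"

definition zero_module :: "('a, 'm) module \<Rightarrow> bool" where
  "zero_module M \<longleftrightarrow> carrier M = {\<zero>\<^bsub>M\<^esub>}"

text \<open>Homomorphisms are extensional functions, so that \<open>lin R M N\<close> really is the set Hom(M,N).\<close>

definition lin :: "('a, 'c) ring_scheme \<Rightarrow> ('a, 'm) module \<Rightarrow> ('a, 'n) module \<Rightarrow> ('m \<Rightarrow> 'n) set" where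
  "lin R M N = {f \<in> carrier M \<rightarrow>\<^sub>E carrier N.
     (\<forall>x\<in>carrier M. \<forall>y\<in>carrier M. f (x \<oplus>\<^bsub>M\<^esub> y) = f x \<oplus>\<^bsub>N\<^esub> f y) \<and>
     (\<forall>a\<in>carrier R. \<forall>x\<in>carrier M. f (a \<odot>\<^bsub>M\<^esub> x) = a \<odot>\<^bsub>N\<^esub> f x)}"

definition lin_add :: "('a, 'm) module \<Rightarrow> ('a, 'n) module \<Rightarrow> ('m \<Rightarrow> 'n) \<Rightarrow> ('m \<Rightarrow> 'n) \<Rightarrow> 'm \<Rightarrow> 'n" where
  "lin_add M N f g = (\<lambda>x\<in>carrier M. f x \<oplus>\<^bsub>N\<^esub> g x)"

definition lin_zero :: "('a, 'm) module \<Rightarrow> ('a, 'n) module \<Rightarrow> 'm \<Rightarrow> 'n" where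
  "lin_zero M N = (\<lambda>x\<in>carrier M. \<zero>\<^bsub>N\<^esub>)"

definition mod_iso :: "('a, 'c) ring_scheme \<Rightarrow> ('a, 'm) module \<Rightarrow> ('a, 'n) module \<Rightarrow> bool" where
  "mod_iso R M N \<longleftrightarrow> (\<exists>f\<in>lin R M N. bij_betw f (carrier M) (carrier N))"

definition mod_epi ::
  "('a, 'c) ring_scheme \<Rightarrow> ('a, 'm) module \<Rightarrow> ('a, 'n) module \<Rightarrow> ('m \<Rightarrow> 'n) \<Rightarrow> bool" where
  "mod_epi R M N f \<longleftrightarrow> f \<in> lin R M N \<and> f ` carrier M = carrier N"

definition mod_mono ::
  "('a, 'c) ring_scheme \<Rightarrow> ('a, 'm) module \<Rightarrow> ('a, 'n) module \<Rightarrow> ('m \<Rightarrow> 'n) \<Rightarrow> bool" where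
  "mod_mono R M N f \<longleftrightarrow> f \<in> lin R M N \<and> inj_on f (carrier M)"

section \<open>Basic constructions\<close>

definition regular :: "('a, 'c) ring_scheme \<Rightarrow> ('a, 'a) module" where
  "regular R = \<lparr>carrier = carrier R, monoid.mult = monoid.mult R, one = one R,
     ring.zero = ring.zero R, add = add R,
     smult = monoid.mult R\<rparr>"

definition opp :: "('a, 'c) ring_scheme \<Rightarrow> ('a, 'c) ring_scheme" where
  "opp R = R\<lparr>monoid.mult := (\<lambda>a b. b \<otimes>\<^bsub>R\<^esub> a)\<rparr>"

definition restrict_scalars :: "('k \<Rightarrow> 'a) \<Rightarrow> ('a, 'm) module \<Rightarrow> ('k, 'm) module" where
  "restrict_scalars \<eta> M = \<lparr>carrier = carrier M, monoid.mult = undefined, one = undefined,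
     ring.zero = ring.zero M, add = add M, smult = (\<lambda>c x. \<eta> c \<odot>\<^bsub>M\<^esub> x)\<rparr>"

definition quot_module :: "('a, 'm) module \<Rightarrow> 'm set \<Rightarrow> ('a, 'm set) module" where
  "quot_module M N = \<lparr>carrier = a_rcosets\<^bsub>M\<^esub> N, monoid.mult = undefined, one = undefined,
     ring.zero = N, add = set_add M, smult = (\<lambda>a X. \<Union>x\<in>X. N +>\<^bsub>M\<^esub> (a \<odot>\<^bsub>M\<^esub> x))\<rparr>"

definition dsum :: "nat \<Rightarrow> (nat \<Rightarrow> ('a, 'm) module) \<Rightarrow> ('a, nat \<Rightarrow> 'm) module" where
  "dsum n M = \<lparr>carrier = (\<Pi>\<^sub>E i\<in>{..<n}. carrier (M i)), monoid.mult = undefined, one = undefined,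
     ring.zero = (\<lambda>i\<in>{..<n}. \<zero>\<^bsub>M i\<^esub>), add = (\<lambda>x y. \<lambda>i\<in>{..<n}. x i \<oplus>\<^bsub>M i\<^esub> y i),
     smult = (\<lambda>a x. \<lambda>i\<in>{..<n}. a \<odot>\<^bsub>M i\<^esub> x i)\<rparr>"

abbreviation mpow :: "('a, 'm) module \<Rightarrow> nat \<Rightarrow> ('a, nat \<Rightarrow> 'm) module" where
  "mpow M n \<equiv> dsum n (\<lambda>_. M)"

definition End_ring :: "('a, 'c) ring_scheme \<Rightarrow> ('a, 'm) module \<Rightarrow> ('m \<Rightarrow> 'm) ring" where
  "End_ring R M = \<lparr>carrier = lin R M M, monoid.mult = compose (carrier M), one = (\<lambda>x\<in>carrier M. x),
     ring.zero = lin_zero M M, add = lin_add M M\<rparr>"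

section \<open>Direct summands\<close>

definition complementary ::
  "('a, 'c) ring_scheme \<Rightarrow> ('a, 'm) module \<Rightarrow> 'm set \<Rightarrow> 'm set \<Rightarrow> bool" where
  "complementary R M A B \<longleftrightarrow> submodule A R M \<and> submodule B R M \<and>
     A \<inter> B = {\<zero>\<^bsub>M\<^esub>} \<and> A <+>\<^bsub>M\<^esub> B = carrier M"

definition indecomposable :: "('a, 'c) ring_scheme \<Rightarrow> ('a, 'm) module \<Rightarrow> bool" where
  "indecomposable R M \<longleftrightarrow> \<not> zero_module M \<and>
     (\<forall>A B. complementary R M A B \<longrightarrow> A = {\<zero>\<^bsub>M\<^esub>} \<or> B = {\<zero>\<^bsub>M\<^esub>})"

definition in_add :: "('a, 'c) ring_scheme \<Rightarrow> ('a, 'm) module \<Rightarrow> ('a, 'n) module \<Rightarrow> bool" where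
  "in_add R T M \<longleftrightarrow>
     (\<exists>n A B. complementary R (mpow T n) A B \<and> mod_iso R M ((mpow T n)\<lparr>carrier := A\<rparr>))"

definition basic :: "('a, 'c) ring_scheme \<Rightarrow> ('a, 'm) module \<Rightarrow> bool" where
  "basic R M \<longleftrightarrow> (\<exists>n (N :: nat \<Rightarrow> 'a umod).
     (\<forall>i<n. fg_module R (N i) \<and> indecomposable R (N i)) \<and>
     (\<forall>i<n. \<forall>j<n. i \<noteq> j \<longrightarrow> \<not> mod_iso R (N i) (N j)) \<and>
     mod_iso R M (dsum n N))"

section \<open>Projective and injective modules, resolutions and dimensions\<close>

text \<open>Projectivity and injectivity are taken in the category of finitely generated modules.\<close>

definition projective :: "('a, 'c) ring_scheme \<Rightarrow> ('a, 'm) module \<Rightarrow> bool" where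
  "projective R P \<longleftrightarrow> fg_module R P \<and>
     (\<forall>(X :: 'a umod) (Y :: 'a umod) p f. fg_module R X \<and> fg_module R Y \<and> mod_epi R X Y p \<and>
        f \<in> lin R P Y \<longrightarrow> (\<exists>h\<in>lin R P X. \<forall>x\<in>carrier P. p (h x) = f x))"

definition injective :: "('a, 'c) ring_scheme \<Rightarrow> ('a, 'm) module \<Rightarrow> bool" where
  "injective R I \<longleftrightarrow> fg_module R I \<and>
     (\<forall>(X :: 'a umod) (Y :: 'a umod) u f. fg_module R X \<and> fg_module R Y \<and> mod_mono R X Y u \<and>
        f \<in> lin R X I \<longrightarrow> (\<exists>h\<in>lin R Y I. \<forall>x\<in>carrier X. h (u x) = f x))"

text \<open>A resolution is \<open>\<dots> \<rightarrow> P 1 \<rightarrow> P 0 \<rightarrow> M \<rightarrow> 0\<close> with differentials \<open>d n : P (n+1) \<rightarrow> P n\<close> and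
  augmentation \<open>e : P 0 \<rightarrow> M\<close>.\<close>

definition projective_resolution ::
  "('a, 'c) ring_scheme \<Rightarrow> ('a, 'm) module \<Rightarrow> (nat \<Rightarrow> ('a, 'p) module) \<Rightarrow> (nat \<Rightarrow> 'p \<Rightarrow> 'p) \<Rightarrow>
   ('p \<Rightarrow> 'm) \<Rightarrow> bool" where
  "projective_resolution R M P d e \<longleftrightarrow>
     (\<forall>n. projective R (P n)) \<and> (\<forall>n. d n \<in> lin R (P (Suc n)) (P n)) \<and> mod_epi R (P 0) M e \<and>
     d 0 ` carrier (P 1) = a_kernel (P 0) M e \<and>
     (\<forall>n. d (Suc n) ` carrier (P (Suc (Suc n))) = a_kernel (P (Suc n)) (P n) (d n))"

definition projdim :: "('a, 'c) ring_scheme \<Rightarrow> ('a, 'm) module \<Rightarrow> enat" where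
  "projdim R M = Inf {enat n | n. \<exists>(P :: nat \<Rightarrow> 'a umod) d e.
     projective_resolution R M P d e \<and> (\<forall>i>n. zero_module (P i))}"

definition gldim :: "('a, 'c) ring_scheme \<Rightarrow> enat" where
  "gldim R = Sup {projdim R M | M :: 'a umod. fg_module R M}"

text \<open>Ext is the cohomology of \<open>Hom(P, N)\<close> for a projective resolution \<open>P\<close> of \<open>M\<close>.\<close>

definition cocycles ::
  "('a, 'c) ring_scheme \<Rightarrow> (nat \<Rightarrow> ('a, 'p) module) \<Rightarrow> (nat \<Rightarrow> 'p \<Rightarrow> 'p) \<Rightarrow> ('a, 'n) module \<Rightarrow> nat \<Rightarrow>
   ('p \<Rightarrow> 'n) set" where
  "cocycles R P d N n = {f \<in> lin R (P n) N. \<forall>x\<in>carrier (P (Suc n)). f (d n x) = \<zero>\<^bsub>N\<^esub>}"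

definition coboundaries ::
  "('a, 'c) ring_scheme \<Rightarrow> (nat \<Rightarrow> ('a, 'p) module) \<Rightarrow> (nat \<Rightarrow> 'p \<Rightarrow> 'p) \<Rightarrow> ('a, 'n) module \<Rightarrow> nat \<Rightarrow>
   ('p \<Rightarrow> 'n) set" where
  "coboundaries R P d N n = (case n of
      0 \<Rightarrow> {lin_zero (P 0) N}
    | Suc m \<Rightarrow> {compose (carrier (P (Suc m))) g (d m) | g. g \<in> lin R (P m) N})"

definition Ext :: "nat \<Rightarrow> ('a, 'c) ring_scheme \<Rightarrow> ('a, 'm) module \<Rightarrow> ('a, 'n) module \<Rightarrow>
    ((nat \<Rightarrow> 'a) set \<Rightarrow> 'n) set monoid" where
  "Ext n R M N =
     (let (P, d) = (SOME (P :: nat \<Rightarrow> 'a umod, d). \<exists>e. projective_resolution R M P d e)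
      in \<lparr>carrier = cocycles R P d N n, monoid.mult = lin_add (P n) N, one = lin_zero (P n) N\<rparr>
           Mod coboundaries R P d N n)"

definition essential :: "('a, 'c) ring_scheme \<Rightarrow> ('a, 'm) module \<Rightarrow> 'm set \<Rightarrow> bool" where
  "essential R M A \<longleftrightarrow> submodule A R M \<and>
     (\<forall>N. submodule N R M \<and> N \<inter> A = {\<zero>\<^bsub>M\<^esub>} \<longrightarrow> N = {\<zero>\<^bsub>M\<^esub>})"

definition superfluous :: "('a, 'c) ring_scheme \<Rightarrow> ('a, 'm) module \<Rightarrow> 'm set \<Rightarrow> bool" where
  "superfluous R M A \<longleftrightarrow> submodule A R M \<and>
     (\<forall>N. submodule N R M \<and> N <+>\<^bsub>M\<^esub> A = carrier M \<longrightarrow> N = carrier M)"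

definition injective_envelope ::
  "('a, 'c) ring_scheme \<Rightarrow> ('a, 'm) module \<Rightarrow> ('a, 'i) module \<Rightarrow> ('m \<Rightarrow> 'i) \<Rightarrow> bool" where
  "injective_envelope R M I e \<longleftrightarrow>
     injective R I \<and> mod_mono R M I e \<and> essential R I (e ` carrier M)"

definition projective_cover ::
  "('a, 'c) ring_scheme \<Rightarrow> ('a, 'm) module \<Rightarrow> ('a, 'p) module \<Rightarrow> ('p \<Rightarrow> 'm) \<Rightarrow> bool" where
  "projective_cover R M P e \<longleftrightarrow>
     projective R P \<and> mod_epi R P M e \<and> superfluous R P (a_kernel P M e)"

text \<open>\<open>0 \<rightarrow> M \<rightarrow> I 0 \<rightarrow> I 1 \<rightarrow> \<dots>\<close> is exact, and each term is an injective envelope of the image of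
  the map into it.\<close>

definition min_injective_resolution ::
  "('a, 'c) ring_scheme \<Rightarrow> ('a, 'm) module \<Rightarrow> (nat \<Rightarrow> ('a, 'i) module) \<Rightarrow> (nat \<Rightarrow> 'i \<Rightarrow> 'i) \<Rightarrow>
   ('m \<Rightarrow> 'i) \<Rightarrow> bool" where
  "min_injective_resolution R M I d e \<longleftrightarrow>
     injective_envelope R M (I 0) e \<and>
     (\<forall>n. injective R (I n) \<and> d n \<in> lin R (I n) (I (Suc n)) \<and>
          essential R (I (Suc n)) (d n ` carrier (I n))) \<and>
     e ` carrier M = a_kernel (I 0) (I 1) (d 0) \<and>
     (\<forall>n. d n ` carrier (I n) = a_kernel (I (Suc n)) (I (Suc (Suc n))) (d (Suc n)))"

text \<open>Minimal injective resolutions are unique up to isomorphism, so it does not matter which one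
  is used.\<close>

definition domdim :: "('a, 'c) ring_scheme \<Rightarrow> enat" where
  "domdim R = Sup {enat k | k. \<exists>(I :: nat \<Rightarrow> 'a umod) d e.
     min_injective_resolution R (regular R) I d e \<and> (\<forall>i<k. projective R (I i))}"

section \<open>Artin algebras and the Auslander-Reiten translation\<close>

definition artinian_ring :: "('k, 'c) ring_scheme \<Rightarrow> bool" where
  "artinian_ring k \<longleftrightarrow> cring k \<and>
     (\<forall>I. (\<forall>n. ideal (I n) k \<and> I (Suc n) \<subseteq> I n) \<longrightarrow> (\<exists>N. \<forall>n\<ge>N. I n = I (N :: nat)))"

text \<open>\<open>\<eta>\<close> is the structure map of the algebra \<open>R\<close> over the commutative artinian ring \<open>k\<close>.\<close>

definition artin_algebra ::
  "('k, 'd) ring_scheme \<Rightarrow> ('k \<Rightarrow> 'a) \<Rightarrow> ('a, 'c) ring_scheme \<Rightarrow> bool" where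
  "artin_algebra k \<eta> R \<longleftrightarrow> artinian_ring k \<and> ring R \<and> \<eta> \<in> ring_hom k R \<and>
     (\<forall>c\<in>carrier k. \<forall>a\<in>carrier R. \<eta> c \<otimes>\<^bsub>R\<^esub> a = a \<otimes>\<^bsub>R\<^esub> \<eta> c) \<and>
     fg_module k (restrict_scalars \<eta> (regular R))"

definition jacobson_radical :: "('k, 'd) ring_scheme \<Rightarrow> 'k set" where
  "jacobson_radical k = carrier k \<inter> \<Inter>{I. maximalideal I k}"

definition dualizing :: "('k, 'd) ring_scheme \<Rightarrow> 'k umod" where
  "dualizing k =
     (SOME J. \<exists>e. injective_envelope k (quot_module (regular k) (jacobson_radical k)) J e)"

text \<open>The duality \<open>D = Hom\<^sub>k(-, J)\<close>, where \<open>J\<close> is the injective envelope of \<open>k / rad k\<close>.  It turns a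
  left module over \<open>opp R\<close> into a left module over \<open>R\<close>.\<close>

definition dual ::
  "('k, 'd) ring_scheme \<Rightarrow> ('k \<Rightarrow> 'a) \<Rightarrow> ('a, 'm) module \<Rightarrow> ('a, 'm \<Rightarrow> (nat \<Rightarrow> 'k) set) module" where
  "dual k \<eta> X = (let X\<^sub>k = restrict_scalars \<eta> X; J = dualizing k in
     \<lparr>carrier = lin k X\<^sub>k J, monoid.mult = undefined, one = undefined,
      ring.zero = lin_zero X\<^sub>k J, add = lin_add X\<^sub>k J,
      smult = (\<lambda>a f. \<lambda>x\<in>carrier X. f (a \<odot>\<^bsub>X\<^esub> x))\<rparr>)"

text \<open>\<open>Hom\<^sub>R(M, R)\<close> is a right \<open>R\<close>-module, that is, a left module over \<open>opp R\<close>.\<close>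

definition ring_dual :: "('a, 'c) ring_scheme \<Rightarrow> ('a, 'm) module \<Rightarrow> ('a, 'm \<Rightarrow> 'a) module" where
  "ring_dual R M =
     \<lparr>carrier = lin R M (regular R), monoid.mult = undefined, one = undefined,
      ring.zero = lin_zero M (regular R), add = lin_add M (regular R),
      smult = (\<lambda>a f. \<lambda>x\<in>carrier M. f x \<otimes>\<^bsub>R\<^esub> a)\<rparr>"

definition min_projective_presentation ::
  "('a, 'c) ring_scheme \<Rightarrow> ('a, 'm) module \<Rightarrow> ('a, 'p) module \<Rightarrow> ('a, 'q) module \<Rightarrow>
   ('p \<Rightarrow> 'q) \<Rightarrow> ('q \<Rightarrow> 'm) \<Rightarrow> bool" where
  "min_projective_presentation R M P\<^sub>1 P\<^sub>0 d e \<longleftrightarrow> projective_cover R M P\<^sub>0 e \<and>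
     projective_cover R (P\<^sub>0\<lparr>carrier := a_kernel P\<^sub>0 M e\<rparr>) P\<^sub>1 d"

text \<open>The transpose is the cokernel of \<open>Hom\<^sub>R(P\<^sub>0, R) \<rightarrow> Hom\<^sub>R(P\<^sub>1, R)\<close> for a minimal projective
  presentation \<open>P\<^sub>1 \<rightarrow> P\<^sub>0 \<rightarrow> M \<rightarrow> 0\<close>; it is a left module over \<open>opp R\<close>.\<close>

definition Tr :: "('a, 'c) ring_scheme \<Rightarrow> ('a, 'm) module \<Rightarrow>
    ('a, ((nat \<Rightarrow> 'a) set \<Rightarrow> 'a) set) module" where
  "Tr R M =
     (let (P\<^sub>1, P\<^sub>0, d) =
        (SOME (P\<^sub>1 :: 'a umod, P\<^sub>0 :: 'a umod, d). \<exists>e. min_projective_presentation R M P\<^sub>1 P\<^sub>0 d e)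
      in quot_module (ring_dual R P\<^sub>1)
           {compose (carrier P\<^sub>1) f d | f. f \<in> lin R P\<^sub>0 (regular R)})"

definition AR_translate :: "('k, 'd) ring_scheme \<Rightarrow> ('k \<Rightarrow> 'a) \<Rightarrow> ('a, 'c) ring_scheme \<Rightarrow>
    ('a, 'm) module \<Rightarrow> ('a, ((nat \<Rightarrow> 'a) set \<Rightarrow> 'a) set \<Rightarrow> (nat \<Rightarrow> 'k) set) module" where
  "AR_translate k \<eta> R M = dual k \<eta> (Tr R M)"

section \<open>Tilting modules generated and cogenerated by projective-injectives\<close>

definition tilting :: "('a, 'c) ring_scheme \<Rightarrow> ('a, 'm) module \<Rightarrow> bool" where
  "tilting R T \<longleftrightarrow> fg_module R T \<and> basic R T \<and>
     projdim R T \<le> 1 \<and>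
     trivial_group (Ext 1 R T T) \<and>
     (\<exists>(T\<^sub>0 :: 'a umod) (T\<^sub>1 :: 'a umod) f g.
        fg_module R T\<^sub>0 \<and> fg_module R T\<^sub>1 \<and> in_add R T T\<^sub>0 \<and> in_add R T T\<^sub>1 \<and>
        mod_mono R (regular R) T\<^sub>0 f \<and> mod_epi R T\<^sub>0 T\<^sub>1 g \<and>
        f ` carrier (regular R) = a_kernel T\<^sub>0 T\<^sub>1 g)"

definition is_proj_inj_sum ::
  "('a, 'c) ring_scheme \<Rightarrow> ('a, nat \<Rightarrow> (nat \<Rightarrow> 'a) set) module \<Rightarrow> bool" where
  "is_proj_inj_sum R Q \<longleftrightarrow> (\<exists>n (E :: nat \<Rightarrow> 'a umod).
     (\<forall>i<n. indecomposable R (E i) \<and> projective R (E i) \<and> injective R (E i)) \<and>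
     (\<forall>i<n. \<forall>j<n. i \<noteq> j \<longrightarrow> \<not> mod_iso R (E i) (E j)) \<and>
     (\<forall>M :: 'a umod. indecomposable R M \<and> projective R M \<and> injective R M \<longrightarrow>
        (\<exists>i<n. mod_iso R M (E i))) \<and>
     Q = dsum n E)"

definition in_Gen :: "('a, 'c) ring_scheme \<Rightarrow> ('a, 'q) module \<Rightarrow> ('a, 'm) module \<Rightarrow> bool" where
  "in_Gen R Q M \<longleftrightarrow> (\<exists>m p. mod_epi R (mpow Q m) M p)"

definition in_Cogen :: "('a, 'c) ring_scheme \<Rightarrow> ('a, 'q) module \<Rightarrow> ('a, 'm) module \<Rightarrow> bool" where
  "in_Cogen R Q M \<longleftrightarrow> (\<exists>m u. mod_mono R M (mpow Q m) u)"

text \<open>Membership in the subcategory \<open>C\<^sub>R\<close>; the sum of representatives \<open>Q\<close> is unique up to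
  isomorphism.\<close>

definition in_C :: "('a, 'c) ring_scheme \<Rightarrow> ('a, 'm) module \<Rightarrow> bool" where
  "in_C R M \<longleftrightarrow> fg_module R M \<and> (\<exists>Q. is_proj_inj_sum R Q \<and> in_Gen R Q M \<and> in_Cogen R Q M)"

end

theory Submission
  imports Defs
begin

text \<open>
  Write \<open>d = gldim \<Gamma>\<close> and call a module torsion if it is a quotient of a projective-injective module.
  With a minimal presentation \<open>0 \<rightarrow> P1 \<rightarrow> P0 \<rightarrow> T \<rightarrow> 0\<close>, where \<open>P0\<close> is injective, \<open>M\<close> is torsion iff every
  map \<open>P1 \<rightarrow> M\<close> extends to \<open>P0\<close>, so torsion modules behave as if \<open>Ext\<^sup>1(T, -)\<close> vanished on them.
  The functor \<open>F = Hom(T, -)\<close> then lowers projective dimension by one: for torsion \<open>M\<close>,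
  \<open>pd M \<le> n + 1\<close> iff \<open>pd (F M) \<le> n\<close>, both directions by approximating \<open>M\<close> by powers of \<open>T\<close> with
  torsion kernel.

  The translate satisfies \<open>Hom(T, \<tau>T) = 0\<close> and cogenerates all \<open>K\<close> with \<open>Hom(T, K) = 0\<close>.  Suppose
  \<open>pd \<tau>T \<le> d - 1\<close>; then \<open>pd K \<le> d - 1\<close> for all such \<open>K\<close>.  Each \<open>B\<close>-module \<open>N\<close> has a presentation
  \<open>0 \<rightarrow> F M \<rightarrow> B\<^sup>n \<rightarrow> N \<rightarrow> 0\<close> with \<open>M\<close> torsion and \<open>M \<rightarrow> T\<^sup>n\<close> having such a kernel, while its image embeds in
  a projective module.  Hence \<open>pd M \<le> d - 1\<close>, \<open>pd (F M) \<le> d - 2\<close> and \<open>pd N \<le> d - 1\<close>.  Conversely,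
  a universal extension \<open>0 \<rightarrow> \<tau>T \<rightarrow> M \<rightarrow> T\<^sup>n \<rightarrow> 0\<close> with \<open>M\<close> torsion embeds \<open>F M\<close> in \<open>B\<^sup>n\<close>, so
  \<open>gldim B \<le> d - 1\<close> gives \<open>pd (F M) \<le> d - 2\<close>, \<open>pd M \<le> d - 1\<close> and finally \<open>pd \<tau>T \<le> d - 1\<close>.
  The case \<open>d = 1\<close> does not occur, as then the coresolution of \<open>\<Gamma>\<close> by \<open>add T\<close> splits and \<open>\<Gamma>\<close> is
  self-injective.

  The duality that defines \<open>\<tau>\<close> needs the injective envelope \<open>J\<close> of the semisimple quotient of \<open>k\<close>: by the
  Hopkins theorem \<open>k\<close> has finite length, which bounds the length of essential extensions, and one of
  maximal length is injective.
\<close>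

section \<open>Homomorphisms and submodules\<close>

text \<open>One mechanism yields the bounds. If all modules have projective dimension at most
  \<open>d\<close> and \<open>V\<close> has at most \<open>d - 1\<close>, then so has each submodule
  \<open>K\<close> of \<open>V\<close>, because \<open>V / K\<close> has at most \<open>d\<close>.
  It is therefore enough to embed a module into one that is already controlled: a projective module,
  a free \<open>B\<close>-module, or a sum of copies of \<open>\<tau>T\<close>. The shift by one
  between \<open>M\<close> and \<open>F M\<close> stems from \<open>T\<close>, which has projective
  dimension at most one but becomes projective under \<open>F\<close>. No derived functors occur:
  vanishing of \<open>Ext\<close> is replaced by extending maps along
  \<open>P1 \<rightarrow> P0\<close>, and \<open>F\<close> is applied only to sequences with torsion
  kernel, where it is exact. A constraint that shapes many statements is the element type.
  Projectivity, resolutions and global dimension quantify over \<open>umod\<close>, while pairs,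
  modules of homomorphisms and \<open>\<tau>T\<close> live over other types. Hence the isomorphic
  copies made by \<open>ex_umod\<close>, and the inductions whose step is a separate lemma with free
  element types.\<close>

context left_module
begin

declare smult_closed [simp, intro] smult_one [simp]

lemma neg_zero [simp]: "\<ominus>\<^bsub>M\<^esub> \<zero>\<^bsub>M\<^esub> = \<zero>\<^bsub>M\<^esub>"
  by (rule M.minus_equality) auto

lemma diff_self [simp]: "x \<in> carrier M \<Longrightarrow> x \<ominus>\<^bsub>M\<^esub> x = \<zero>\<^bsub>M\<^esub>"
  by (simp add: a_minus_def M.r_neg)

lemma diff_zero [simp]: "x \<in> carrier M \<Longrightarrow> x \<ominus>\<^bsub>M\<^esub> \<zero>\<^bsub>M\<^esub> = x"
  by (simp add: a_minus_def)

lemma zero_diff [simp]: "x \<in> carrier M \<Longrightarrow> \<zero>\<^bsub>M\<^esub> \<ominus>\<^bsub>M\<^esub> x = \<ominus>\<^bsub>M\<^esub> x"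
  by (simp add: a_minus_def)

lemma diff_add_cancel [simp]: "x \<in> carrier M \<Longrightarrow> y \<in> carrier M \<Longrightarrow> (x \<ominus>\<^bsub>M\<^esub> y) \<oplus>\<^bsub>M\<^esub> y = x"
  by (simp add: a_minus_def M.a_assoc M.l_neg)

lemma add_diff_cancel [simp]: "x \<in> carrier M \<Longrightarrow> y \<in> carrier M \<Longrightarrow> y \<oplus>\<^bsub>M\<^esub> (x \<ominus>\<^bsub>M\<^esub> y) = x"
  by (subst M.a_comm) auto

lemma add_diff_cancel_right [simp]: "x \<in> carrier M \<Longrightarrow> y \<in> carrier M \<Longrightarrow> (x \<oplus>\<^bsub>M\<^esub> y) \<ominus>\<^bsub>M\<^esub> y = x"
  by (simp add: a_minus_def M.a_assoc M.r_neg)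

lemma diff_eq_zero_iff [simp]: "x \<in> carrier M \<Longrightarrow> y \<in> carrier M \<Longrightarrow> x \<ominus>\<^bsub>M\<^esub> y = \<zero>\<^bsub>M\<^esub> \<longleftrightarrow> x = y"
  by (metis diff_add_cancel diff_self M.l_zero)

lemma smult_r_null [simp]: "a \<in> carrier R \<Longrightarrow> a \<odot>\<^bsub>M\<^esub> \<zero>\<^bsub>M\<^esub> = \<zero>\<^bsub>M\<^esub>"
  using smult_r_distr[of a "\<zero>\<^bsub>M\<^esub>" "\<zero>\<^bsub>M\<^esub>"] M.add.r_cancel_one'[of "a \<odot>\<^bsub>M\<^esub> \<zero>\<^bsub>M\<^esub>" "a \<odot>\<^bsub>M\<^esub> \<zero>\<^bsub>M\<^esub>"]
  by simp

lemma smult_l_null [simp]: "x \<in> carrier M \<Longrightarrow> \<zero>\<^bsub>R\<^esub> \<odot>\<^bsub>M\<^esub> x = \<zero>\<^bsub>M\<^esub>"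
  using smult_l_distr[of "\<zero>\<^bsub>R\<^esub>" "\<zero>\<^bsub>R\<^esub>" x] M.add.r_cancel_one'[of "\<zero>\<^bsub>R\<^esub> \<odot>\<^bsub>M\<^esub> x" "\<zero>\<^bsub>R\<^esub> \<odot>\<^bsub>M\<^esub> x"]
  by simp

lemma smult_l_minus: "a \<in> carrier R \<Longrightarrow> x \<in> carrier M \<Longrightarrow> (\<ominus>\<^bsub>R\<^esub> a) \<odot>\<^bsub>M\<^esub> x = \<ominus>\<^bsub>M\<^esub> (a \<odot>\<^bsub>M\<^esub> x)"
  using smult_l_distr[of "\<ominus>\<^bsub>R\<^esub> a" a x] by (simp add: R.l_neg M.minus_equality)

lemma smult_r_minus: "a \<in> carrier R \<Longrightarrow> x \<in> carrier M \<Longrightarrow> a \<odot>\<^bsub>M\<^esub> (\<ominus>\<^bsub>M\<^esub> x) = \<ominus>\<^bsub>M\<^esub> (a \<odot>\<^bsub>M\<^esub> x)"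
  using smult_r_distr[of a "\<ominus>\<^bsub>M\<^esub> x" x] by (simp add: M.l_neg M.minus_equality)

text \<open>Negatives come for free: they are multiples by minus one, so only zero, sums and scalar
  multiples need checking.\<close>

lemma submodule_iff:
  "submodule N R M \<longleftrightarrow> N \<subseteq> carrier M \<and> \<zero>\<^bsub>M\<^esub> \<in> N \<and> (\<forall>x\<in>N. \<forall>y\<in>N. x \<oplus>\<^bsub>M\<^esub> y \<in> N) \<and>
     (\<forall>a\<in>carrier R. \<forall>x\<in>N. a \<odot>\<^bsub>M\<^esub> x \<in> N)" (is "?l \<longleftrightarrow> ?r")
proof
  assume ?l
  then interpret N: submodule N R M .
  show ?r using N.subset N.one_closed N.m_closed N.smult_closed by auto
next
  assume r: ?r
  have "\<ominus>\<^bsub>M\<^esub> x \<in> N" if "x \<in> N" for x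
    using r that smult_l_minus[of "\<one>\<^bsub>R\<^esub>" x] by (metis R.add.inv_closed R.one_closed smult_one subsetD)
  then have "subgroup N (add_monoid M)" using r M.add.subgroupI[of N] by blast
  with r show ?l by (simp add: submodule_def submodule_axioms_def)
qed

end

lemma submoduleI':
  assumes "left_module R M" "N \<subseteq> carrier M" "\<zero>\<^bsub>M\<^esub> \<in> N"
    "\<And>x y. x \<in> N \<Longrightarrow> y \<in> N \<Longrightarrow> x \<oplus>\<^bsub>M\<^esub> y \<in> N"
    "\<And>a x. a \<in> carrier R \<Longrightarrow> x \<in> N \<Longrightarrow> a \<odot>\<^bsub>M\<^esub> x \<in> N"
  shows "submodule N R M"
  unfolding left_module.submodule_iff[OF assms(1)] by (intro conjI ballI) (use assms in simp_all)

lemma submodule_subset: "submodule N R M \<Longrightarrow> N \<subseteq> carrier M"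
  using subgroup.subset[of N "add_monoid M"] by (simp add: submodule_def)

lemma submodule_carrierD: "submodule N R M \<Longrightarrow> x \<in> N \<Longrightarrow> x \<in> carrier M"
  using submodule_subset by blast

lemma submodule_zero: "submodule N R M \<Longrightarrow> \<zero>\<^bsub>M\<^esub> \<in> N"
  using subgroup.one_closed[of N "add_monoid M"] by (simp add: submodule_def)

lemma submodule_add: "submodule N R M \<Longrightarrow> x \<in> N \<Longrightarrow> y \<in> N \<Longrightarrow> x \<oplus>\<^bsub>M\<^esub> y \<in> N"
  using subgroup.m_closed[of N "add_monoid M"] by (simp add: submodule_def)

lemma submodule_smult: "submodule N R M \<Longrightarrow> a \<in> carrier R \<Longrightarrow> x \<in> N \<Longrightarrow> a \<odot>\<^bsub>M\<^esub> x \<in> N"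
  by (rule submodule.smult_closed)

lemma submodule_neg: "submodule N R M \<Longrightarrow> x \<in> N \<Longrightarrow> \<ominus>\<^bsub>M\<^esub> x \<in> N"
  using subgroup.m_inv_closed[of N "add_monoid M"] by (simp add: submodule_def a_inv_def)

lemma submodule_minus: "submodule N R M \<Longrightarrow> x \<in> N \<Longrightarrow> y \<in> N \<Longrightarrow> x \<ominus>\<^bsub>M\<^esub> y \<in> N"
  by (simp add: a_minus_def submodule_add submodule_neg)

lemma submodule_carrier: "left_module R M \<Longrightarrow> submodule (carrier M) R M"
  by (intro submoduleI') (auto simp: left_module_def intro: left_module.smult_closed abelian_monoid.a_closed
    abelian_group.axioms abelian_monoid.zero_closed)

lemma submodule_trivial: "left_module R M \<Longrightarrow> submodule {\<zero>\<^bsub>M\<^esub>} R M"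
proof -
  assume "left_module R M"
  then interpret left_module R M .
  show ?thesis by (intro submoduleI'[OF left_module_axioms]) auto
qed

lemma submodule_Int:
  assumes "left_module R M" "submodule N R M" "submodule L R M"
  shows "submodule (N \<inter> L) R M"
  using assms by (intro submoduleI')
    (auto simp: submodule_zero submodule_add submodule_smult submodule_carrierD)

lemma submodule_Inter:
  assumes "left_module R M" "\<And>N. N \<in> F \<Longrightarrow> submodule N R M" "F \<noteq> {}"
  shows "submodule (\<Inter>F) R M"
  using assms submodule_subset[OF assms(2)] by (intro submoduleI')
    (auto intro!: submodule_zero[OF assms(2)] submodule_add[OF assms(2)] submodule_smult[OF assms(2)])

lemma left_moduleI':
  assumes "ring R"
    "\<And>x y. x \<in> carrier M \<Longrightarrow> y \<in> carrier M \<Longrightarrow> x \<oplus>\<^bsub>M\<^esub> y \<in> carrier M" "\<zero>\<^bsub>M\<^esub> \<in> carrier M"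
    "\<And>x y z. x \<in> carrier M \<Longrightarrow> y \<in> carrier M \<Longrightarrow> z \<in> carrier M \<Longrightarrow> (x \<oplus>\<^bsub>M\<^esub> y) \<oplus>\<^bsub>M\<^esub> z = x \<oplus>\<^bsub>M\<^esub> (y \<oplus>\<^bsub>M\<^esub> z)"
    "\<And>x y. x \<in> carrier M \<Longrightarrow> y \<in> carrier M \<Longrightarrow> x \<oplus>\<^bsub>M\<^esub> y = y \<oplus>\<^bsub>M\<^esub> x"
    "\<And>x. x \<in> carrier M \<Longrightarrow> \<zero>\<^bsub>M\<^esub> \<oplus>\<^bsub>M\<^esub> x = x"
    "\<And>x. x \<in> carrier M \<Longrightarrow> \<exists>y\<in>carrier M. y \<oplus>\<^bsub>M\<^esub> x = \<zero>\<^bsub>M\<^esub>"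
    "\<And>a x. a \<in> carrier R \<Longrightarrow> x \<in> carrier M \<Longrightarrow> a \<odot>\<^bsub>M\<^esub> x \<in> carrier M"
    "\<And>a b x. a \<in> carrier R \<Longrightarrow> b \<in> carrier R \<Longrightarrow> x \<in> carrier M \<Longrightarrow>
      (a \<oplus>\<^bsub>R\<^esub> b) \<odot>\<^bsub>M\<^esub> x = a \<odot>\<^bsub>M\<^esub> x \<oplus>\<^bsub>M\<^esub> b \<odot>\<^bsub>M\<^esub> x"
    "\<And>a x y. a \<in> carrier R \<Longrightarrow> x \<in> carrier M \<Longrightarrow> y \<in> carrier M \<Longrightarrow>
      a \<odot>\<^bsub>M\<^esub> (x \<oplus>\<^bsub>M\<^esub> y) = a \<odot>\<^bsub>M\<^esub> x \<oplus>\<^bsub>M\<^esub> a \<odot>\<^bsub>M\<^esub> y"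
    "\<And>a b x. a \<in> carrier R \<Longrightarrow> b \<in> carrier R \<Longrightarrow> x \<in> carrier M \<Longrightarrow>
      (a \<otimes>\<^bsub>R\<^esub> b) \<odot>\<^bsub>M\<^esub> x = a \<odot>\<^bsub>M\<^esub> (b \<odot>\<^bsub>M\<^esub> x)"
    "\<And>x. x \<in> carrier M \<Longrightarrow> \<one>\<^bsub>R\<^esub> \<odot>\<^bsub>M\<^esub> x = x"
  shows "left_module R M"
proof -
  interpret R: ring R by fact
  have "abelian_group M" by (rule abelian_groupI) (fact assms(2-7))+
  then show ?thesis using assms by (intro left_module.intro left_module_axioms.intro) (auto simp: R.ring_axioms)
qed

lemma left_module_regular: "ring R \<Longrightarrow> left_module R (regular R)"
proof -
  assume "ring R"
  then interpret ring R .
  show ?thesis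
    by (rule left_moduleI')
      (auto simp: regular_def ring_axioms m_assoc l_distr r_distr a_ac intro: bexI[of _ "\<ominus>\<^bsub>R\<^esub> x" for x] l_neg r_neg)
qed

text \<open>Zero, sum and action stay those of \<open>M\<close>. So kernels keep the element type of
  the ambient module, inclusions are the identity map, and a submodule of a submodule collapses to a
  single update.\<close>

abbreviation subm :: "('a, 'm) module \<Rightarrow> 'm set \<Rightarrow> ('a, 'm) module" where
  "subm M N \<equiv> M\<lparr>carrier := N\<rparr>"

lemma left_module_subm:
  assumes "left_module R M" "submodule N R M"
  shows "left_module R (subm M N)"
proof -
  interpret left_module R M by fact
  note [simp] = submodule_subset[OF assms(2), THEN subsetD] submodule_zero[OF assms(2)]
    submodule_add[OF assms(2)] submodule_smult[OF assms(2)] submodule_neg[OF assms(2)]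
  show ?thesis
  proof (rule left_moduleI')
    show "\<exists>y\<in>carrier (subm M N). y \<oplus>\<^bsub>subm M N\<^esub> x = \<zero>\<^bsub>subm M N\<^esub>" if "x \<in> carrier (subm M N)" for x
      using that by (intro bexI[of _ "\<ominus>\<^bsub>M\<^esub> x"]) (auto simp: M.l_neg)
  qed (auto simp: M.a_ac smult_l_distr smult_r_distr smult_assoc R.ring_axioms)
qed

lemma submodule_subm:
  assumes "left_module R M" "submodule L R M" "N \<subseteq> L"
  shows "submodule N R (subm M L) \<longleftrightarrow> submodule N R M"
  using left_module.submodule_iff[OF assms(1)] left_module.submodule_iff[OF left_module_subm[OF assms(1,2)]]
    submodule_subset[OF assms(2)] assms(3) by auto

text \<open>Elements of \<open>lin\<close> must be extensional, which composites and pointwise sums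
  are only after restriction. Here values outside the carrier are ignored; \<open>lin_mhom\<close>
  and \<open>lin_restrict\<close> pass between the two notions, so extensionality matters only at
  the definitions and where a set of homomorphisms is itself a module.\<close>

definition mhom ::
  "('a, 'c) ring_scheme \<Rightarrow> ('a, 'm) module \<Rightarrow> ('a, 'n) module \<Rightarrow> ('m \<Rightarrow> 'n) \<Rightarrow> bool" where
  "mhom R M N f \<longleftrightarrow> (\<forall>x\<in>carrier M. f x \<in> carrier N) \<and>
     (\<forall>x\<in>carrier M. \<forall>y\<in>carrier M. f (x \<oplus>\<^bsub>M\<^esub> y) = f x \<oplus>\<^bsub>N\<^esub> f y) \<and>
     (\<forall>a\<in>carrier R. \<forall>x\<in>carrier M. f (a \<odot>\<^bsub>M\<^esub> x) = a \<odot>\<^bsub>N\<^esub> f x)"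

lemma mhomI:
  assumes "\<And>x. x \<in> carrier M \<Longrightarrow> f x \<in> carrier N"
    "\<And>x y. x \<in> carrier M \<Longrightarrow> y \<in> carrier M \<Longrightarrow> f (x \<oplus>\<^bsub>M\<^esub> y) = f x \<oplus>\<^bsub>N\<^esub> f y"
    "\<And>a x. a \<in> carrier R \<Longrightarrow> x \<in> carrier M \<Longrightarrow> f (a \<odot>\<^bsub>M\<^esub> x) = a \<odot>\<^bsub>N\<^esub> f x"
  shows "mhom R M N f"
  using assms by (auto simp: mhom_def)

lemma mhom_closed: "mhom R M N f \<Longrightarrow> x \<in> carrier M \<Longrightarrow> f x \<in> carrier N"
  and mhom_add: "mhom R M N f \<Longrightarrow> x \<in> carrier M \<Longrightarrow> y \<in> carrier M \<Longrightarrow> f (x \<oplus>\<^bsub>M\<^esub> y) = f x \<oplus>\<^bsub>N\<^esub> f y"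
  and mhom_smult: "mhom R M N f \<Longrightarrow> a \<in> carrier R \<Longrightarrow> x \<in> carrier M \<Longrightarrow> f (a \<odot>\<^bsub>M\<^esub> x) = a \<odot>\<^bsub>N\<^esub> f x"
  by (auto simp: mhom_def)

lemma mhom_zero:
  assumes "left_module R M" "left_module R N" "mhom R M N f"
  shows "f \<zero>\<^bsub>M\<^esub> = \<zero>\<^bsub>N\<^esub>"
proof -
  interpret M: left_module R M by fact
  interpret N: left_module R N by fact
  have "f \<zero>\<^bsub>M\<^esub> \<oplus>\<^bsub>N\<^esub> f \<zero>\<^bsub>M\<^esub> = f \<zero>\<^bsub>M\<^esub>" using mhom_add[OF assms(3), of "\<zero>\<^bsub>M\<^esub>" "\<zero>\<^bsub>M\<^esub>"] by simp
  then show ?thesis using mhom_closed[OF assms(3), of "\<zero>\<^bsub>M\<^esub>"] N.M.add.r_cancel_one' by (metis M.M.zero_closed)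
qed

lemma mhom_neg:
  assumes "left_module R M" "left_module R N" "mhom R M N f" "x \<in> carrier M"
  shows "f (\<ominus>\<^bsub>M\<^esub> x) = \<ominus>\<^bsub>N\<^esub> f x"
proof -
  interpret M: left_module R M by fact
  interpret N: left_module R N by fact
  have "f (\<ominus>\<^bsub>M\<^esub> x) \<oplus>\<^bsub>N\<^esub> f x = \<zero>\<^bsub>N\<^esub>"
    using mhom_add[OF assms(3), of "\<ominus>\<^bsub>M\<^esub> x" x] mhom_zero[OF assms(1-3)] assms(4) by (simp add: M.M.l_neg)
  then show ?thesis using mhom_closed[OF assms(3)] assms(4) N.M.minus_equality by (metis M.M.a_inv_closed)
qed

lemma mhom_minus:
  assumes "left_module R M" "left_module R N" "mhom R M N f" "x \<in> carrier M" "y \<in> carrier M"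
  shows "f (x \<ominus>\<^bsub>M\<^esub> y) = f x \<ominus>\<^bsub>N\<^esub> f y"
proof -
  interpret M: left_module R M by fact
  show ?thesis using assms mhom_neg[OF assms(1-3,5)] mhom_add[OF assms(3), of x "\<ominus>\<^bsub>M\<^esub> y"]
    by (simp add: a_minus_def)
qed

lemma mhom_comp: "mhom R M N f \<Longrightarrow> mhom R N L g \<Longrightarrow> mhom R M L (\<lambda>x. g (f x))"
  by (auto simp: mhom_def)

lemma mhom_id: "mhom R M M (\<lambda>x. x)"
  by (auto simp: mhom_def)

lemma mhom_cong: "mhom R M N f \<Longrightarrow> left_module R M \<Longrightarrow> (\<And>x. x \<in> carrier M \<Longrightarrow> f x = g x) \<Longrightarrow> mhom R M N g"
  unfolding mhom_def left_module_def
  by (auto simp: abelian_monoid.a_closed abelian_group.axioms left_module_axioms_def)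

lemma mhom_const_zero: "left_module R N \<Longrightarrow> mhom R M N (\<lambda>x. \<zero>\<^bsub>N\<^esub>)"
proof -
  assume "left_module R N"
  then interpret left_module R N .
  show ?thesis by (auto simp: mhom_def)
qed

lemma mhom_plus:
  assumes "left_module R N" "mhom R M N f" "mhom R M N g"
  shows "mhom R M N (\<lambda>x. f x \<oplus>\<^bsub>N\<^esub> g x)"
proof -
  interpret N: left_module R N by fact
  show ?thesis using assms(2,3)
    by (intro mhomI) (auto simp: mhom_closed mhom_add mhom_smult N.smult_r_distr N.M.a_ac)
qed

lemma mhom_uminus:
  assumes "left_module R N" "mhom R M N f"
  shows "mhom R M N (\<lambda>x. \<ominus>\<^bsub>N\<^esub> f x)"
proof -
  interpret N: left_module R N by fact
  show ?thesis using assms(2)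
    by (intro mhomI) (auto simp: mhom_closed mhom_add mhom_smult N.smult_r_minus N.M.minus_add)
qed

lemma mhom_diff:
  assumes "left_module R N" "mhom R M N f" "mhom R M N g"
  shows "mhom R M N (\<lambda>x. f x \<ominus>\<^bsub>N\<^esub> g x)"
  using mhom_plus[OF assms(1,2) mhom_uminus[OF assms(1,3)]] by (simp add: a_minus_def)

lemma mhom_subm_incl: "submodule N R M \<Longrightarrow> mhom R (subm M N) M (\<lambda>x. x)"
  by (auto simp: mhom_def submodule_carrierD)

lemma mhom_restrict_dom: "mhom R M X f \<Longrightarrow> submodule N R M \<Longrightarrow> mhom R (subm M N) X f"
  by (auto simp: mhom_def submodule_carrierD)

lemma mhom_to_subm: "mhom R X M f \<Longrightarrow> (\<And>x. x \<in> carrier X \<Longrightarrow> f x \<in> N) \<Longrightarrow> mhom R X (subm M N) f"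
  by (auto simp: mhom_def)

lemma mhom_from_subm: "mhom R X (subm M N) f \<Longrightarrow> submodule N R M \<Longrightarrow> mhom R X M f"
  by (auto simp: mhom_def submodule_carrierD)

lemma mhom_regular:
  assumes "left_module R M" "x \<in> carrier M"
  shows "mhom R (regular R) M (\<lambda>a. a \<odot>\<^bsub>M\<^esub> x)"
proof -
  interpret left_module R M by fact
  show ?thesis using assms(2) by (auto simp: mhom_def regular_def smult_l_distr smult_assoc)
qed

section \<open>Kernels, images and factorisation of homomorphisms\<close>

definition ker :: "('a, 'm) module \<Rightarrow> ('a, 'n) module \<Rightarrow> ('m \<Rightarrow> 'n) \<Rightarrow> 'm set" where
  "ker M N f = {x \<in> carrier M. f x = \<zero>\<^bsub>N\<^esub>}"

lemma a_kernel_ker: "a_kernel M N f = ker M N f"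
  by (simp add: a_kernel_def kernel_def ker_def)

lemma submodule_vimage:
  assumes "left_module R M" "left_module R N" "mhom R M N f" "submodule L R N"
  shows "submodule {x \<in> carrier M. f x \<in> L} R M"
proof -
  interpret M: left_module R M by fact
  show ?thesis
    using assms mhom_zero[OF assms(1-3)]
    by (intro submoduleI') (auto simp: mhom_add mhom_smult submodule_zero submodule_add submodule_smult)
qed

lemma submodule_ker:
  assumes "left_module R M" "left_module R N" "mhom R M N f"
  shows "submodule (ker M N f) R M"
  using submodule_vimage[OF assms submodule_trivial[OF assms(2)]] by (simp add: ker_def)

lemma submodule_image:
  assumes "left_module R M" "left_module R N" "mhom R M N f" "submodule L R M"
  shows "submodule (f ` L) R N"
proof (rule submoduleI')
  note sub = submodule_subset[OF assms(4)]
  show "f ` L \<subseteq> carrier N" using sub mhom_closed[OF assms(3)] by auto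
  show "\<zero>\<^bsub>N\<^esub> \<in> f ` L" using mhom_zero[OF assms(1-3)] submodule_zero[OF assms(4)] by (metis imageI)
  show "x \<oplus>\<^bsub>N\<^esub> y \<in> f ` L" if "x \<in> f ` L" "y \<in> f ` L" for x y
    using that sub by (auto simp: mhom_add[OF assms(3), symmetric] subset_iff intro!: imageI submodule_add[OF assms(4)])
  show "a \<odot>\<^bsub>N\<^esub> x \<in> f ` L" if "a \<in> carrier R" "x \<in> f ` L" for a x
    using that sub by (auto simp: mhom_smult[OF assms(3), symmetric] subset_iff intro!: imageI submodule_smult[OF assms(4)])
qed fact

lemma submodule_range:
  assumes "left_module R M" "left_module R N" "mhom R M N f"
  shows "submodule (f ` carrier M) R N"
  by (rule submodule_image[OF assms submodule_carrier[OF assms(1)]])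

lemma mhom_inj_iff:
  assumes "left_module R M" "left_module R N" "mhom R M N f"
  shows "inj_on f (carrier M) \<longleftrightarrow> (\<forall>x\<in>carrier M. f x = \<zero>\<^bsub>N\<^esub> \<longrightarrow> x = \<zero>\<^bsub>M\<^esub>)"
proof -
  interpret M: left_module R M by fact
  interpret N: left_module R N by fact
  have "x = y" if "\<forall>x\<in>carrier M. f x = \<zero>\<^bsub>N\<^esub> \<longrightarrow> x = \<zero>\<^bsub>M\<^esub>" "x \<in> carrier M" "y \<in> carrier M" "f x = f y" for x y
  proof -
    have "f (x \<ominus>\<^bsub>M\<^esub> y) = \<zero>\<^bsub>N\<^esub>" using that mhom_minus[OF assms] mhom_closed[OF assms(3)]
      by (simp add: a_minus_def N.M.r_neg)
    then have "x \<ominus>\<^bsub>M\<^esub> y = \<zero>\<^bsub>M\<^esub>" using that by simp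
    then show ?thesis using that(2,3) by simp
  qed
  then show ?thesis using mhom_zero[OF assms] M.M.zero_closed by (fastforce simp: inj_on_def)
qed

lemma lin_iff: "f \<in> lin R M N \<longleftrightarrow> mhom R M N f \<and> f \<in> extensional (carrier M)"
  by (auto simp: lin_def mhom_def PiE_def)

lemma lin_mhom: "f \<in> lin R M N \<Longrightarrow> mhom R M N f"
  by (simp add: lin_iff)

lemma lin_restrict: "left_module R M \<Longrightarrow> mhom R M N f \<Longrightarrow> restrict f (carrier M) \<in> lin R M N"
  by (auto simp: lin_iff intro: mhom_cong)

lemma lin_eqI: "f \<in> lin R M N \<Longrightarrow> g \<in> lin R M N \<Longrightarrow> (\<And>x. x \<in> carrier M \<Longrightarrow> f x = g x) \<Longrightarrow> f = g"
  by (auto simp: lin_iff intro: extensionalityI)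

lemma mhom_inverse:
  assumes "left_module R M" "mhom R M N f" "inj_on f (carrier M)" "f ` carrier M = carrier N"
  shows "mhom R N M (inv_into (carrier M) f)"
proof -
  interpret M: left_module R M by fact
  let ?g = "inv_into (carrier M) f"
  have g: "?g y \<in> carrier M" "f (?g y) = y" if "y \<in> carrier N" for y
    using that assms(4) by (auto simp: inv_into_into f_inv_into_f)
  show ?thesis
  proof (rule mhomI)
    fix x y assume *: "x \<in> carrier N" "y \<in> carrier N"
    have "f (?g x \<oplus>\<^bsub>M\<^esub> ?g y) = x \<oplus>\<^bsub>N\<^esub> y" using * g by (simp add: mhom_add[OF assms(2)])
    then show "?g (x \<oplus>\<^bsub>N\<^esub> y) = ?g x \<oplus>\<^bsub>M\<^esub> ?g y"
      using * g inv_into_f_f[OF assms(3), of "?g x \<oplus>\<^bsub>M\<^esub> ?g y"] by simp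
  next
    fix a x assume *: "a \<in> carrier R" "x \<in> carrier N"
    have "f (a \<odot>\<^bsub>M\<^esub> ?g x) = a \<odot>\<^bsub>N\<^esub> x" using * g by (simp add: mhom_smult[OF assms(2)])
    then show "?g (a \<odot>\<^bsub>N\<^esub> x) = a \<odot>\<^bsub>M\<^esub> ?g x"
      using * g inv_into_f_f[OF assms(3), of "a \<odot>\<^bsub>M\<^esub> ?g x"] by simp
  qed (use g in auto)
qed

text \<open>Two points in one fibre of \<open>p\<close> differ by an element of its kernel, so
  \<open>f\<close> takes a single value on each fibre and any choice of preimages defines
  \<open>h\<close>.\<close>

lemma factor_through:
  assumes "left_module R M" "left_module R N" "left_module R X" "mhom R M N p" "p ` carrier M = carrier N"
    "mhom R M X f" "\<And>x. x \<in> carrier M \<Longrightarrow> p x = \<zero>\<^bsub>N\<^esub> \<Longrightarrow> f x = \<zero>\<^bsub>X\<^esub>"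
  obtains h where "mhom R N X h" "\<And>x. x \<in> carrier M \<Longrightarrow> h (p x) = f x"
proof -
  interpret M: left_module R M by fact
  interpret N: left_module R N by fact
  interpret X: left_module R X by fact
  let ?g = "\<lambda>y. f (inv_into (carrier M) p y)"
  have *: "f x = f y" if "x \<in> carrier M" "y \<in> carrier M" "p x = p y" for x y
  proof -
    have "p (x \<ominus>\<^bsub>M\<^esub> y) = \<zero>\<^bsub>N\<^esub>" using that
      by (simp add: mhom_minus[OF assms(1,2,4)] mhom_closed[OF assms(4)])
    then have "f x \<ominus>\<^bsub>X\<^esub> f y = \<zero>\<^bsub>X\<^esub>" using assms(7)[of "x \<ominus>\<^bsub>M\<^esub> y"] that by (simp add: mhom_minus[OF assms(1,3,6)])
    then show ?thesis using that mhom_closed[OF assms(6)] by simp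
  qed
  have g: "?g (p x) = f x" if "x \<in> carrier M" for x
    using that assms(5) by (intro *) (auto simp: inv_into_into f_inv_into_f)
  have "mhom R N X ?g"
  proof (rule mhomI)
    fix x y assume "x \<in> carrier N" "y \<in> carrier N"
    then obtain x' y' where "x = p x'" "y = p y'" "x' \<in> carrier M" "y' \<in> carrier M" using assms(5) by blast
    then show "?g (x \<oplus>\<^bsub>N\<^esub> y) = ?g x \<oplus>\<^bsub>X\<^esub> ?g y"
      by (simp add: g mhom_add[OF assms(4), symmetric] mhom_add[OF assms(6)])
  next
    fix a x assume "a \<in> carrier R" "x \<in> carrier N"
    moreover then obtain x' where "x = p x'" "x' \<in> carrier M" using assms(5) by blast
    ultimately show "?g (a \<odot>\<^bsub>N\<^esub> x) = a \<odot>\<^bsub>X\<^esub> ?g x"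
      by (simp add: g mhom_smult[OF assms(4), symmetric] mhom_smult[OF assms(6)])
  next
    fix x assume "x \<in> carrier N"
    then obtain x' where "x = p x'" "x' \<in> carrier M" using assms(5) by blast
    then show "?g x \<in> carrier X" by (simp add: g mhom_closed[OF assms(6)])
  qed
  then show ?thesis using g that by blast
qed

text \<open>On its image \<open>u\<close> is invertible, so \<open>f\<close> is corestricted to that
  image and followed by the inverse.\<close>

lemma factor_through_mono:
  assumes "left_module R N" "left_module R X" "mhom R N M u" "inj_on u (carrier N)" "mhom R X M f"
    "\<And>x. x \<in> carrier X \<Longrightarrow> f x \<in> u ` carrier N"
  obtains h where "mhom R X N h" "\<And>x. x \<in> carrier X \<Longrightarrow> u (h x) = f x"
proof -
  let ?L = "u ` carrier N"
  have 1: "mhom R N (subm M ?L) u" using mhom_to_subm[OF assms(3)] by blast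
  have 2: "mhom R (subm M ?L) N (inv_into (carrier N) u)"
    using mhom_inverse[OF assms(1) 1 assms(4)] by simp
  have 3: "mhom R X (subm M ?L) f" using mhom_to_subm[OF assms(5)] assms(6) by blast
  show ?thesis
    using that[OF mhom_comp[OF 3 2]] assms(6) by (simp add: f_inv_into_f)
qed

section \<open>Quotients and direct sums\<close>

text \<open>These four facts present the quotient as an epimorphism with kernel \<open>N\<close>.
  The one point about cosets is that the union in the scalar action runs over equal sets: two
  members of a coset differ by an element of \<open>N\<close>, and so do their multiples.\<close>

lemma quot_module:
  assumes "left_module R M" "submodule N R M"
  shows left_module_quot: "left_module R (quot_module M N)"
    and mhom_quot: "mhom R M (quot_module M N) (\<lambda>x. N +>\<^bsub>M\<^esub> x)"
    and quot_surj: "(\<lambda>x. N +>\<^bsub>M\<^esub> x) ` carrier M = carrier (quot_module M N)"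
    and quot_zero_iff: "x \<in> carrier M \<Longrightarrow> N +>\<^bsub>M\<^esub> x = \<zero>\<^bsub>quot_module M N\<^esub> \<longleftrightarrow> x \<in> N"
proof -
  interpret M: left_module R M by fact
  interpret N: abelian_subgroup N M
    using assms(2) by (intro abelian_subgroupI3 additive_subgroup.intro) (auto simp: submodule_def M.M.abelian_group_axioms)
  let ?Q = "quot_module M N" and ?p = "\<lambda>x. N +>\<^bsub>M\<^esub> x"
  show surj: "?p ` carrier M = carrier ?Q"
    by (auto simp: quot_module_def A_RCOSETS_def')
  have Nc: "x \<in> carrier M" if "x \<in> N" for x using that submodule_carrierD[OF assms(2)] by simp
  have eq: "?p x = ?p y \<longleftrightarrow> x \<ominus>\<^bsub>M\<^esub> y \<in> N" if "x \<in> carrier M" "y \<in> carrier M" for x y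
  proof
    assume "?p x = ?p y"
    then have "x \<in> ?p y" using N.a_rcos_self[OF that(1)] by simp
    then show "x \<ominus>\<^bsub>M\<^esub> y \<in> N" using N.a_rcos_module[OF that(2,1)] by (simp add: a_minus_def)
  next
    assume h: "x \<ominus>\<^bsub>M\<^esub> y \<in> N"
    then have "x \<in> ?p y" using N.a_rcos_module[OF that(2,1)] by (simp add: a_minus_def)
    then show "?p x = ?p y" using N.a_repr_independence'[OF _ that(2)] by simp
  qed
  have add: "?p x \<oplus>\<^bsub>?Q\<^esub> ?p y = ?p (x \<oplus>\<^bsub>M\<^esub> y)" if "x \<in> carrier M" "y \<in> carrier M" for x y
    using N.a_rcos_sum[OF that] by (simp add: quot_module_def)
  have smult: "a \<odot>\<^bsub>?Q\<^esub> ?p x = ?p (a \<odot>\<^bsub>M\<^esub> x)" if "a \<in> carrier R" "x \<in> carrier M" for a x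
  proof -
    have "?p (a \<odot>\<^bsub>M\<^esub> y) = ?p (a \<odot>\<^bsub>M\<^esub> x)" if y: "y \<in> ?p x" for y
    proof -
      from y obtain h where h: "h \<in> N" "y = h \<oplus>\<^bsub>M\<^esub> x" by (auto simp: a_r_coset_def')
      have "a \<odot>\<^bsub>M\<^esub> y \<ominus>\<^bsub>M\<^esub> a \<odot>\<^bsub>M\<^esub> x = a \<odot>\<^bsub>M\<^esub> h"
        using h Nc \<open>a \<in> carrier R\<close> \<open>x \<in> carrier M\<close> by (simp add: M.smult_r_distr)
      then show ?thesis using h Nc that \<open>a \<in> carrier R\<close> \<open>x \<in> carrier M\<close>
        by (subst eq) (auto intro: submodule_smult[OF assms(2)])
    qed
    moreover have "x \<in> ?p x" using that N.a_rcos_self by simp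
    ultimately have "(\<Union>y\<in>?p x. ?p (a \<odot>\<^bsub>M\<^esub> y)) = ?p (a \<odot>\<^bsub>M\<^esub> x)" by blast
    then show ?thesis by (simp add: quot_module_def)
  qed
  have zero: "\<zero>\<^bsub>?Q\<^esub> = ?p \<zero>\<^bsub>M\<^esub>"
    using N.a_rcos_self M.M.a_coset_add_zero[of N] submodule_subset[OF assms(2)] by (simp add: quot_module_def)
  have pc: "?p x \<in> carrier ?Q" if "x \<in> carrier M" for x using that surj by blast
  have ex: "\<exists>x\<in>carrier M. X = ?p x" if "X \<in> carrier ?Q" for X using that surj by blast
  show "left_module R ?Q"
  proof (rule left_moduleI')
    show "ring R" by (rule M.R.ring_axioms)
  next
    fix X assume "X \<in> carrier ?Q"
    then obtain x where x: "X = ?p x" "x \<in> carrier M" using ex by blast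
    have "?p (\<ominus>\<^bsub>M\<^esub> x) \<oplus>\<^bsub>?Q\<^esub> X = \<zero>\<^bsub>?Q\<^esub>" using x by (simp add: add zero M.M.l_neg)
    then show "\<exists>Y\<in>carrier ?Q. Y \<oplus>\<^bsub>?Q\<^esub> X = \<zero>\<^bsub>?Q\<^esub>" using x pc by blast
  qed (auto dest!: ex simp: add smult zero pc M.M.a_ac M.smult_l_distr M.smult_r_distr M.smult_assoc)
  show "mhom R M ?Q ?p" by (rule mhomI) (auto simp: add smult pc)
  show "?p x = \<zero>\<^bsub>?Q\<^esub> \<longleftrightarrow> x \<in> N" if "x \<in> carrier M"
    using eq[OF that M.M.zero_closed] that by (simp add: zero a_minus_def)
qed

text \<open>Pairs allow summands over different element types, which \<open>dsum\<close> does
  not.\<close>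

definition pmod :: "('a, 'm) module \<Rightarrow> ('a, 'n) module \<Rightarrow> ('a, 'm \<times> 'n) module" where
  "pmod A C = \<lparr>carrier = carrier A \<times> carrier C, monoid.mult = undefined, one = undefined,
     ring.zero = (\<zero>\<^bsub>A\<^esub>, \<zero>\<^bsub>C\<^esub>), add = (\<lambda>x y. (fst x \<oplus>\<^bsub>A\<^esub> fst y, snd x \<oplus>\<^bsub>C\<^esub> snd y)),
     smult = (\<lambda>a x. (a \<odot>\<^bsub>A\<^esub> fst x, a \<odot>\<^bsub>C\<^esub> snd x))\<rparr>"

text \<open>Described by equations alone, so that the same lemmas serve pairs, the last summand of a
  \<open>dsum\<close>, split sequences, and the images of biproducts under the additive functor
  \<open>F\<close>.\<close>

definition biprod :: "('a, 'c) ring_scheme \<Rightarrow> ('a, 'm) module \<Rightarrow> ('a, 'n) module \<Rightarrow> ('a, 'u) module \<Rightarrow>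
    ('m \<Rightarrow> 'u) \<Rightarrow> ('n \<Rightarrow> 'u) \<Rightarrow> ('u \<Rightarrow> 'm) \<Rightarrow> ('u \<Rightarrow> 'n) \<Rightarrow> bool" where
  "biprod R A C U i j p q \<longleftrightarrow> left_module R A \<and> left_module R C \<and> left_module R U \<and>
     mhom R A U i \<and> mhom R C U j \<and> mhom R U A p \<and> mhom R U C q \<and>
     (\<forall>a\<in>carrier A. p (i a) = a) \<and> (\<forall>a\<in>carrier A. q (i a) = \<zero>\<^bsub>C\<^esub>) \<and>
     (\<forall>c\<in>carrier C. p (j c) = \<zero>\<^bsub>A\<^esub>) \<and> (\<forall>c\<in>carrier C. q (j c) = c) \<and>
     (\<forall>u\<in>carrier U. i (p u) \<oplus>\<^bsub>U\<^esub> j (q u) = u)"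

lemma left_module_pmod:
  assumes "left_module R A" "left_module R C"
  shows "left_module R (pmod A C)"
proof -
  interpret A: left_module R A by fact
  interpret C: left_module R C by fact
  show ?thesis
  proof (rule left_moduleI')
    fix x assume "x \<in> carrier (pmod A C)"
    then show "\<exists>y\<in>carrier (pmod A C). y \<oplus>\<^bsub>pmod A C\<^esub> x = \<zero>\<^bsub>pmod A C\<^esub>"
      by (intro bexI[of _ "(\<ominus>\<^bsub>A\<^esub> fst x, \<ominus>\<^bsub>C\<^esub> snd x)"]) (auto simp: pmod_def A.M.l_neg C.M.l_neg)
  qed (auto simp: pmod_def A.R.ring_axioms A.M.a_ac C.M.a_ac A.smult_l_distr A.smult_r_distr A.smult_assoc
      C.smult_l_distr C.smult_r_distr C.smult_assoc)
qed

lemma biprod_pmod: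
  assumes "left_module R A" "left_module R C"
  shows "biprod R A C (pmod A C) (\<lambda>a. (a, \<zero>\<^bsub>C\<^esub>)) (\<lambda>c. (\<zero>\<^bsub>A\<^esub>, c)) fst snd"
proof -
  interpret A: left_module R A by fact
  interpret C: left_module R C by fact
  show ?thesis using left_module_pmod[OF assms] assms
    by (auto simp: biprod_def pmod_def mhom_def)
qed

lemma biprodD:
  assumes "biprod R A C U i j p q"
  shows "left_module R A" "left_module R C" "left_module R U"
    "mhom R A U i" "mhom R C U j" "mhom R U A p" "mhom R U C q"
    "a \<in> carrier A \<Longrightarrow> p (i a) = a" "a \<in> carrier A \<Longrightarrow> q (i a) = \<zero>\<^bsub>C\<^esub>"
    "c \<in> carrier C \<Longrightarrow> p (j c) = \<zero>\<^bsub>A\<^esub>" "c \<in> carrier C \<Longrightarrow> q (j c) = c"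
    "u \<in> carrier U \<Longrightarrow> i (p u) \<oplus>\<^bsub>U\<^esub> j (q u) = u"
  using assms by (auto simp: biprod_def)

lemma biprod_copair:
  assumes "biprod R A C U i j p q" "left_module R X" "mhom R A X f" "mhom R C X g"
  obtains h where "mhom R U X h" "\<And>a. a \<in> carrier A \<Longrightarrow> h (i a) = f a" "\<And>c. c \<in> carrier C \<Longrightarrow> h (j c) = g c"
    "\<And>u. u \<in> carrier U \<Longrightarrow> h u = f (p u) \<oplus>\<^bsub>X\<^esub> g (q u)"
proof
  interpret X: left_module R X by fact
  note b = biprodD[OF assms(1)]
  let ?h = "\<lambda>u. f (p u) \<oplus>\<^bsub>X\<^esub> g (q u)"
  show "mhom R U X ?h" by (intro mhom_plus assms(2) mhom_comp[OF b(6) assms(3)] mhom_comp[OF b(7) assms(4)])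
  show "?h (i a) = f a" if "a \<in> carrier A" for a
    using that by (simp add: b(8,9) mhom_zero[OF b(2) assms(2,4)] mhom_closed[OF assms(3)])
  show "?h (j c) = g c" if "c \<in> carrier C" for c
    using that by (simp add: b(10,11) mhom_zero[OF b(1) assms(2,3)] mhom_closed[OF assms(4)])
qed simp

lemma biprod_pair:
  assumes "biprod R A C U i j p q" "mhom R X A f" "mhom R X C g"
  obtains h where "mhom R X U h" "\<And>x. x \<in> carrier X \<Longrightarrow> p (h x) = f x" "\<And>x. x \<in> carrier X \<Longrightarrow> q (h x) = g x"
    "\<And>x. x \<in> carrier X \<Longrightarrow> h x = i (f x) \<oplus>\<^bsub>U\<^esub> j (g x)"
proof
  note b = biprodD[OF assms(1)]
  interpret A: left_module R A by (rule b(1))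
  interpret C: left_module R C by (rule b(2))
  let ?h = "\<lambda>x. i (f x) \<oplus>\<^bsub>U\<^esub> j (g x)"
  show "mhom R X U ?h" by (intro mhom_plus b(3) mhom_comp[OF assms(2) b(4)] mhom_comp[OF assms(3) b(5)])
  note c = mhom_closed[OF assms(2)] mhom_closed[OF assms(3)] mhom_closed[OF b(4)] mhom_closed[OF b(5)]
  show "p (?h x) = f x" "q (?h x) = g x" if "x \<in> carrier X" for x
    using that c by (simp_all add: mhom_add[OF b(6)] mhom_add[OF b(7)] b(8-11))
qed simp

lemma biprod_eqI:
  assumes "biprod R A C U i j p q" "u \<in> carrier U" "v \<in> carrier U" "p u = p v" "q u = q v"
  shows "u = v"
  using biprodD(12)[OF assms(1)] assms(2-) by metis

section \<open>Finite direct sums and powers\<close>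

lemma dsum_carrier: "x \<in> carrier (dsum n M) \<longleftrightarrow> x \<in> extensional {..<n} \<and> (\<forall>i<n. x i \<in> carrier (M i))"
  by (auto simp: dsum_def PiE_iff)

lemma dsum_nth:
  "i < n \<Longrightarrow> (x \<oplus>\<^bsub>dsum n M\<^esub> y) i = x i \<oplus>\<^bsub>M i\<^esub> y i"
  "i < n \<Longrightarrow> (a \<odot>\<^bsub>dsum n M\<^esub> x) i = a \<odot>\<^bsub>M i\<^esub> x i"
  "i < n \<Longrightarrow> \<zero>\<^bsub>dsum n M\<^esub> i = \<zero>\<^bsub>M i\<^esub>"
  "x \<oplus>\<^bsub>dsum n M\<^esub> y \<in> extensional {..<n}"
  "a \<odot>\<^bsub>dsum n M\<^esub> x \<in> extensional {..<n}"
  "\<zero>\<^bsub>dsum n M\<^esub> \<in> extensional {..<n}"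
  by (auto simp: dsum_def)

lemma dsum_eqI:
  fixes x y :: "nat \<Rightarrow> 'm"
  shows "x \<in> extensional {..<n} \<Longrightarrow> y \<in> extensional {..<n} \<Longrightarrow> (\<And>i. i < n \<Longrightarrow> x i = y i) \<Longrightarrow> x = y"
  by (rule extensionalityI[of _ "{..<n}"]) auto

lemma left_module_dsum:
  assumes "ring R" "\<And>i. i < n \<Longrightarrow> left_module R (M i)"
  shows "left_module R (dsum n M)"
proof -
  have ab: "abelian_group (M i)" if "i < n" for i
    using assms(2)[OF that] by (auto simp: left_module_def)
  have ab': "abelian_monoid (M i)" if "i < n" for i
    using ab[OF that] by (auto simp: abelian_group_def)
  note [simp] = abelian_monoid.a_closed[OF ab'] abelian_monoid.zero_closed[OF ab'] abelian_monoid.l_zero[OF ab']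
    abelian_group.l_neg[OF ab] left_module.smult_closed[OF assms(2)] left_module.smult_l_distr[OF assms(2)]
    left_module.smult_r_distr[OF assms(2)] left_module.smult_assoc[OF assms(2)] left_module.smult_one[OF assms(2)]
    abelian_group.a_inv_closed[OF ab] abelian_monoid.a_assoc[OF ab'] dsum_nth dsum_carrier
  show ?thesis
  proof (rule left_moduleI')
    fix x assume x: "x \<in> carrier (dsum n M)"
    have "(\<lambda>i\<in>{..<n}. \<ominus>\<^bsub>M i\<^esub> x i) \<oplus>\<^bsub>dsum n M\<^esub> x = \<zero>\<^bsub>dsum n M\<^esub>"
      by (rule dsum_eqI[of _ n]) (use x in auto)
    then show "\<exists>y\<in>carrier (dsum n M). y \<oplus>\<^bsub>dsum n M\<^esub> x = \<zero>\<^bsub>dsum n M\<^esub>"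
      using x by (intro bexI[of _ "\<lambda>i\<in>{..<n}. \<ominus>\<^bsub>M i\<^esub> x i"]) auto
  next
    fix x y assume "x \<in> carrier (dsum n M)" "y \<in> carrier (dsum n M)"
    then show "x \<oplus>\<^bsub>dsum n M\<^esub> y = y \<oplus>\<^bsub>dsum n M\<^esub> x"
      by (intro dsum_eqI[of _ n]) (auto intro: abelian_monoid.a_comm[OF ab'])
  qed (use assms(1) in \<open>auto intro!: dsum_eqI[of _ n]\<close>)
qed

text \<open>Inductions over the number of summands run through this splitting off of the last
  one.\<close>

lemma biprod_dsum_Suc:
  assumes "ring R" "\<And>i. i \<le> n \<Longrightarrow> left_module R (M i)"
  shows "biprod R (dsum n M) (M n) (dsum (Suc n) M)
    (\<lambda>x. \<lambda>i\<in>{..<Suc n}. if i < n then x i else \<zero>\<^bsub>M n\<^esub>)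
    (\<lambda>y. \<lambda>i\<in>{..<Suc n}. if i < n then \<zero>\<^bsub>M i\<^esub> else y)
    (\<lambda>x. restrict x {..<n}) (\<lambda>x. x n)"
proof -
  have ab: "abelian_monoid (M i)" if "i \<le> n" for i
    using assms(2)[OF that] by (auto simp: left_module_def abelian_group_def)
  have le: "i \<le> n" if "i < Suc n" "\<not> i < n" for i using that by simp
  have eq: "i = n" if "i < Suc n" "\<not> i < n" for i using that by simp
  have lt: "i \<le> n" if "i < n" for i using that by simp
  note [simp] = abelian_monoid.a_closed[OF ab] abelian_monoid.zero_closed[OF ab] abelian_monoid.l_zero[OF ab]
    abelian_monoid.r_zero[OF ab] left_module.smult_closed[OF assms(2)] left_module.smult_r_null[OF assms(2)]
    dsum_nth dsum_carrier
  show ?thesis unfolding biprod_def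
  proof (intro conjI ballI)
    show "left_module R (dsum n M)" "left_module R (dsum (Suc n) M)" "left_module R (M n)"
      using assms by (auto intro: left_module_dsum)
    show "mhom R (dsum n M) (dsum (Suc n) M) (\<lambda>x. \<lambda>i\<in>{..<Suc n}. if i < n then x i else \<zero>\<^bsub>M n\<^esub>)"
      "mhom R (M n) (dsum (Suc n) M) (\<lambda>y. \<lambda>i\<in>{..<Suc n}. if i < n then \<zero>\<^bsub>M i\<^esub> else y)"
      by (auto intro!: dsum_eqI[of _ "Suc n"] mhomI simp: less_Suc_eq)
    show "mhom R (dsum (Suc n) M) (dsum n M) (\<lambda>x. restrict x {..<n})"
      by (auto intro!: dsum_eqI[of _ n] mhomI)
    fix u assume "u \<in> carrier (dsum (Suc n) M)"
    then show "(\<lambda>i\<in>{..<Suc n}. if i < n then restrict u {..<n} i else \<zero>\<^bsub>M n\<^esub>) \<oplus>\<^bsub>dsum (Suc n) M\<^esub>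
       (\<lambda>i\<in>{..<Suc n}. if i < n then \<zero>\<^bsub>M i\<^esub> else u n) = u"
      by (auto intro!: dsum_eqI[of _ "Suc n"] dest: eq)
  qed (auto intro!: dsum_eqI[of _ n] mhomI)
qed

lemma biprod_split:
  assumes "biprod R A C U i j p q" "submodule N R U" "\<And>a. a \<in> carrier A \<Longrightarrow> i a \<in> N" "\<And>c. c \<in> carrier C \<Longrightarrow> j c \<in> N"
  shows "N = carrier U"
proof -
  note b = biprodD[OF assms(1)]
  have "u \<in> N" if "u \<in> carrier U" for u
    using b(12)[OF that] submodule_add[OF assms(2) assms(3,4)] mhom_closed[OF b(6) that] mhom_closed[OF b(7) that]
    by metis
  then show ?thesis using submodule_subset[OF assms(2)] by blast
qed

lemma mpow_mhom:
  assumes "left_module R M" "left_module R N" "mhom R M N f"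
  shows "mhom R (mpow M n) (mpow N n) (\<lambda>x. \<lambda>i\<in>{..<n}. f (x i))"
  using assms(3) by (auto simp: mhom_def dsum_def PiE_iff intro!: restrict_ext)

lemma mpow_inj:
  assumes "inj_on f (carrier M)"
  shows "inj_on (\<lambda>x. \<lambda>i\<in>{..<n}. f (x i)) (carrier (mpow M n))"
proof (rule inj_onI)
  fix x y assume *: "x \<in> carrier (mpow M n)" "y \<in> carrier (mpow M n)" "(\<lambda>i\<in>{..<n}. f (x i)) = (\<lambda>i\<in>{..<n}. f (y i))"
  have "x i = y i" if "i < n" for i
    using fun_cong[OF *(3), of i] *(1,2) that inj_onD[OF assms, of "x i" "y i"] by (auto simp: dsum_def)
  then show "x = y" using *(1,2) by (intro dsum_eqI[of _ n]) (auto simp: dsum_carrier)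
qed

section \<open>Modules of bounded length\<close>

text \<open>A strictly monotone rank function bounded by \<open>n\<close> exists iff all chains of submodules have at
  most \<open>n\<close> steps; it makes both extremal choices of submodules and length estimates immediate.\<close>

definition len_le :: "('a, 'c) ring_scheme \<Rightarrow> ('a, 'm) module \<Rightarrow> nat \<Rightarrow> bool" where
  "len_le R M n \<longleftrightarrow> (\<exists>\<rho>. (\<forall>N. submodule N R M \<longrightarrow> \<rho> N \<le> n) \<and>
     (\<forall>N N'. submodule N R M \<and> submodule N' R M \<and> N \<subset> N' \<longrightarrow> \<rho> N < (\<rho> N' :: nat)))"

lemma len_leI:
  assumes "\<And>N. submodule N R M \<Longrightarrow> \<rho> N \<le> n"
    "\<And>N N'. submodule N R M \<Longrightarrow> submodule N' R M \<Longrightarrow> N \<subset> N' \<Longrightarrow> \<rho> N < (\<rho> N' :: nat)"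
  shows "len_le R M n"
  using assms unfolding len_le_def by blast

lemma len_leE:
  assumes "len_le R M n"
  obtains \<rho> where "\<And>N. submodule N R M \<Longrightarrow> \<rho> N \<le> n"
    "\<And>N N'. submodule N R M \<Longrightarrow> submodule N' R M \<Longrightarrow> N \<subset> N' \<Longrightarrow> \<rho> N < (\<rho> N' :: nat)"
    "\<And>N N'. submodule N R M \<Longrightarrow> submodule N' R M \<Longrightarrow> N \<subseteq> N' \<Longrightarrow> \<rho> N \<le> \<rho> N'"
proof -
  obtain \<rho> where \<rho>: "\<forall>N. submodule N R M \<longrightarrow> \<rho> N \<le> n"
    "\<forall>N N'. submodule N R M \<and> submodule N' R M \<and> N \<subset> N' \<longrightarrow> \<rho> N < (\<rho> N' :: nat)"
    using assms unfolding len_le_def by blast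
  then have "\<rho> N \<le> \<rho> N'" if "submodule N R M" "submodule N' R M" "N \<subseteq> N'" for N N'
    using that \<rho>(2)[rule_format, of N N'] by (cases "N = N'") (simp, metis psubsetI less_imp_le)
  then show ?thesis by (intro that[of \<rho>] \<rho>(1,2)[rule_format] conjI)
qed

text \<open>Among the submodules with \<open>P\<close> one of greatest rank is taken; a strictly
  larger one would have greater rank.\<close>

lemma len_max:
  assumes "len_le R M n" "submodule N\<^sub>0 R M" "P N\<^sub>0"
  obtains N where "submodule N R M" "P N" "\<And>N'. submodule N' R M \<Longrightarrow> P N' \<Longrightarrow> N \<subseteq> N' \<Longrightarrow> N' = N"
proof -
  obtain \<rho> where \<rho>: "\<And>N. submodule N R M \<Longrightarrow> \<rho> N \<le> n"
    "\<And>N N'. submodule N R M \<Longrightarrow> submodule N' R M \<Longrightarrow> N \<subset> N' \<Longrightarrow> \<rho> N < (\<rho> N' :: nat)"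
    using assms(1) by (rule len_leE) blast
  have "\<exists>N. (submodule N R M \<and> P N) \<and> (\<forall>N'. submodule N' R M \<and> P N' \<longrightarrow> \<rho> N' \<le> \<rho> N)"
    using assms(2,3) \<rho>(1) by (intro ex_has_greatest_nat[of _ N\<^sub>0 _ "Suc n"]) (auto simp: less_Suc_eq_le)
  then obtain N where N: "submodule N R M" "P N" "\<And>N'. submodule N' R M \<Longrightarrow> P N' \<Longrightarrow> \<rho> N' \<le> \<rho> N"
    by blast
  then show ?thesis using \<rho>(2) that by (metis psubsetI leD)
qed

lemma len_min:
  assumes "len_le R M n" "submodule N\<^sub>0 R M" "P N\<^sub>0"
  obtains N where "submodule N R M" "P N" "\<And>N'. submodule N' R M \<Longrightarrow> P N' \<Longrightarrow> N' \<subseteq> N \<Longrightarrow> N' = N"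
proof -
  obtain \<rho> where \<rho>: "\<And>N. submodule N R M \<Longrightarrow> \<rho> N \<le> n"
    "\<And>N N'. submodule N R M \<Longrightarrow> submodule N' R M \<Longrightarrow> N \<subset> N' \<Longrightarrow> \<rho> N < (\<rho> N' :: nat)"
    using assms(1) by (rule len_leE) blast
  have "\<exists>N. (submodule N R M \<and> P N) \<and> (\<forall>N'. submodule N' R M \<and> P N' \<longrightarrow> \<rho> N \<le> \<rho> N')"
    using assms(2,3) by (intro ex_has_least_nat[of _ N\<^sub>0]) auto
  then obtain N where N: "submodule N R M" "P N" "\<And>N'. submodule N' R M \<Longrightarrow> P N' \<Longrightarrow> \<rho> N \<le> \<rho> N'"
    by blast
  then show ?thesis using \<rho>(2) that by (metis psubsetI leD)
qed

text \<open>A comparison of two rings of scalars: an algebra has fewer submodules than its base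
  ring, so a bound found over the base carries over.\<close>

lemma len_le_weaken:
  assumes "len_le k M n" "\<And>N. submodule N R M' \<Longrightarrow> submodule N k M"
  shows "len_le R M' n"
proof -
  obtain \<rho> where "\<And>N. submodule N k M \<Longrightarrow> \<rho> N \<le> n"
    "\<And>N N'. submodule N k M \<Longrightarrow> submodule N' k M \<Longrightarrow> N \<subset> N' \<Longrightarrow> \<rho> N < (\<rho> N' :: nat)"
    using assms(1) by (rule len_leE) blast
  then show ?thesis using assms(2) by (intro len_leI[of _ _ \<rho>]) auto
qed

lemma len_le_inj:
  assumes "left_module R M" "left_module R N" "mhom R M N u" "inj_on u (carrier M)" "len_le R N n"
  shows "len_le R M n"
proof -
  obtain \<rho> where \<rho>: "\<And>L. submodule L R N \<Longrightarrow> \<rho> L \<le> n"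
    "\<And>L L'. submodule L R N \<Longrightarrow> submodule L' R N \<Longrightarrow> L \<subset> L' \<Longrightarrow> \<rho> L < (\<rho> L' :: nat)"
    using assms(5) by (rule len_leE) blast
  have im: "submodule (u ` L) R N" if "submodule L R M" for L by (rule submodule_image[OF assms(1-3) that])
  show ?thesis
  proof (rule len_leI[of _ _ "\<lambda>L. \<rho> (u ` L)"])
    fix L L' assume "submodule L R M" "submodule L' R M" "L \<subset> L'"
    then show "\<rho> (u ` L) < \<rho> (u ` L')"
      using submodule_subset[of L' R M] inj_on_image_eq_iff[OF assms(4), of L L'] by (intro \<rho>(2) im) auto
  qed (rule \<rho>(1)[OF im])
qed

lemma len_le_subm: "left_module R M \<Longrightarrow> len_le R M n \<Longrightarrow> submodule N R M \<Longrightarrow> len_le R (subm M N) n"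
  by (rule len_le_inj[where u = "\<lambda>x. x"]) (auto intro: left_module_subm mhom_subm_incl)

lemma len_le_surj:
  assumes "left_module R M" "left_module R N" "mhom R M N p" "p ` carrier M = carrier N" "len_le R M n"
  shows "len_le R N n"
proof -
  obtain \<rho> where \<rho>: "\<And>L. submodule L R M \<Longrightarrow> \<rho> L \<le> n"
    "\<And>L L'. submodule L R M \<Longrightarrow> submodule L' R M \<Longrightarrow> L \<subset> L' \<Longrightarrow> \<rho> L < (\<rho> L' :: nat)"
    using assms(5) by (rule len_leE) blast
  let ?v = "\<lambda>L. {x \<in> carrier M. p x \<in> L}"
  have im: "submodule (?v L) R M" if "submodule L R N" for L by (rule submodule_vimage[OF assms(1-3) that])
  show ?thesis
  proof (rule len_leI[of _ _ "\<lambda>L. \<rho> (?v L)"])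
    fix L L' assume *: "submodule L R N" "submodule L' R N" "L \<subset> L'"
    then obtain y where y: "y \<in> L'" "y \<notin> L" by blast
    then obtain x where "x \<in> carrier M" "p x = y" using submodule_carrierD[OF *(2) y(1)] assms(4) by (metis imageE)
    then have "?v L \<subset> ?v L'" using * y by blast
    then show "\<rho> (?v L) < \<rho> (?v L')" using * by (intro \<rho>(2) im)
  qed (rule \<rho>(1)[OF im])
qed

text \<open>The rank of \<open>N\<close> is the rank of its intersection with the kernel plus the
  rank of its image. If \<open>N\<close> and a larger \<open>N'\<close> have the same image, an
  element of \<open>N'\<close> outside \<open>N\<close> can be moved by an element of
  \<open>N\<close> into the kernel, so the intersections differ.\<close>

lemma len_le_ext:
  assumes "left_module R B" "left_module R C" "mhom R B C p" "len_le R C m" "len_le R (subm B (ker B C p)) n"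
  shows "len_le R B (n + m)"
proof -
  interpret B: left_module R B by fact
  interpret C: left_module R C by fact
  let ?K = "ker B C p"
  have K: "submodule ?K R B" by (rule submodule_ker[OF assms(1-3)])
  obtain \<rho> where \<rho>: "\<And>L. submodule L R C \<Longrightarrow> \<rho> L \<le> m"
    "\<And>L L'. submodule L R C \<Longrightarrow> submodule L' R C \<Longrightarrow> L \<subset> L' \<Longrightarrow> \<rho> L < (\<rho> L' :: nat)"
    "\<And>L L'. submodule L R C \<Longrightarrow> submodule L' R C \<Longrightarrow> L \<subseteq> L' \<Longrightarrow> \<rho> L \<le> \<rho> L'"
    using assms(4) by (rule len_leE) blast
  obtain \<sigma> where \<sigma>: "\<And>L. submodule L R (subm B ?K) \<Longrightarrow> \<sigma> L \<le> n"
    "\<And>L L'. submodule L R (subm B ?K) \<Longrightarrow> submodule L' R (subm B ?K) \<Longrightarrow> L \<subset> L' \<Longrightarrow> \<sigma> L < (\<sigma> L' :: nat)"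
    "\<And>L L'. submodule L R (subm B ?K) \<Longrightarrow> submodule L' R (subm B ?K) \<Longrightarrow> L \<subseteq> L' \<Longrightarrow> \<sigma> L \<le> \<sigma> L'"
    using assms(5) by (rule len_leE) blast
  have 1: "submodule (N \<inter> ?K) R (subm B ?K)" if "submodule N R B" for N
    using submodule_Int[OF assms(1) that K] submodule_subm[OF assms(1) K, of "N \<inter> ?K"] by simp
  have 2: "submodule (p ` N) R C" if "submodule N R B" for N by (rule submodule_image[OF assms(1-3) that])
  show ?thesis
  proof (rule len_leI[of _ _ "\<lambda>N. \<sigma> (N \<inter> ?K) + \<rho> (p ` N)"])
    fix N assume "submodule N R B"
    then show "\<sigma> (N \<inter> ?K) + \<rho> (p ` N) \<le> n + m" using \<sigma>(1) \<rho>(1) 1 2 by (simp add: add_mono)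
  next
    fix N N' assume *: "submodule N R B" "submodule N' R B" "N \<subset> N'"
    show "\<sigma> (N \<inter> ?K) + \<rho> (p ` N) < \<sigma> (N' \<inter> ?K) + \<rho> (p ` N')"
    proof (cases "p ` N = p ` N'")
      case False
      then have "p ` N \<subset> p ` N'" using * by blast
      then have "\<rho> (p ` N) < \<rho> (p ` N')" using * \<rho>(2) 2 by blast
      moreover have "\<sigma> (N \<inter> ?K) \<le> \<sigma> (N' \<inter> ?K)" using * \<sigma>(3)[OF 1 1] by blast
      ultimately show ?thesis by linarith
    next
      case True
      obtain x where x: "x \<in> N'" "x \<notin> N" using * by blast
      then obtain y where y: "y \<in> N" "p y = p x" using True by (metis imageE imageI)
      have c: "x \<in> carrier B" "y \<in> carrier B" "y \<in> N'"
        using x y * submodule_carrierD[OF *(1)] submodule_carrierD[OF *(2)] by auto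
      have "x \<ominus>\<^bsub>B\<^esub> y \<in> N' \<inter> ?K"
        using c x y submodule_minus[OF *(2), of x y] mhom_closed[OF assms(3)]
        by (simp add: ker_def mhom_minus[OF assms(1-3)])
      moreover have "x \<ominus>\<^bsub>B\<^esub> y \<notin> N" using x y c submodule_add[OF *(1), of "x \<ominus>\<^bsub>B\<^esub> y" y] by auto
      ultimately have "N \<inter> ?K \<subset> N' \<inter> ?K" using * by blast
      then have "\<sigma> (N \<inter> ?K) < \<sigma> (N' \<inter> ?K)" using * \<sigma>(2) 1 by blast
      then show ?thesis using True by simp
    qed
  qed
qed

lemma len_le_zero: "left_module R M \<Longrightarrow> carrier M = {\<zero>\<^bsub>M\<^esub>} \<Longrightarrow> len_le R M 0"
  using submodule_subset[of _ R M] submodule_zero[of _ R M]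
  by (intro len_leI[of _ _ "\<lambda>_. 0"]) (simp, metis psubset_subset_trans singletonD subset_singletonD psubset_eq not_psubset_empty empty_iff)

lemma len_le_biprod:
  assumes "biprod R A C U i j p q" "len_le R A n" "len_le R C m"
  shows "len_le R U (n + m)"
proof -
  note b = biprodD[OF assms(1)]
  interpret C: left_module R C by (rule b(2))
  interpret U: left_module R U by (rule b(3))
  have K: "submodule (ker U C q) R U" by (rule submodule_ker[OF b(3,2,7)])
  have "mhom R A (subm U (ker U C q)) i"
    by (rule mhom_to_subm[OF b(4)]) (simp add: ker_def b(9) mhom_closed[OF b(4)])
  moreover have "x \<in> i ` carrier A" if "x \<in> ker U C q" for x
  proof -
    have x: "x \<in> carrier U" "q x = \<zero>\<^bsub>C\<^esub>" using that by (auto simp: ker_def)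
    then have "i (p x) = x" using b(12)[OF x(1)] mhom_zero[OF b(2,3,5)] mhom_closed[OF b(4) mhom_closed[OF b(6) x(1)]] by simp
    then show ?thesis using mhom_closed[OF b(6) x(1)] by (metis imageI)
  qed
  then have "i ` carrier A = ker U C q" using b(9) mhom_closed[OF b(4)] by (auto simp: ker_def)
  ultimately have "len_le R (subm U (ker U C q)) n"
    using len_le_surj[OF b(1) left_module_subm[OF b(3) K]] assms(2) by auto
  then show ?thesis using len_le_ext[OF b(3,2,7) assms(3)] by simp
qed

lemma len_le_dsum:
  assumes "ring R" "\<And>i. i < n \<Longrightarrow> left_module R (M i) \<and> (\<exists>m. len_le R (M i) m)"
  shows "\<exists>m. len_le R (dsum n M) m"
  using assms(2)
proof (induction n)
  case 0
  have "carrier (dsum 0 M) = {\<zero>\<^bsub>dsum 0 M\<^esub>}" by (auto simp: dsum_def)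
  then show ?case using len_le_zero[OF left_module_dsum[OF assms(1), of 0 M]] by auto
next
  case (Suc n)
  then obtain m m' where "len_le R (dsum n M) m" "len_le R (M n) m'" by (metis less_Suc_eq)
  then show ?case using len_le_biprod[OF biprod_dsum_Suc[OF assms(1)]] Suc.prems by (metis less_Suc_eq_le)
qed

section \<open>Finitely generated modules\<close>

definition span :: "('a, 'c) ring_scheme \<Rightarrow> ('a, 'm) module \<Rightarrow> 'm set \<Rightarrow> 'm set" where
  "span R M S = \<Inter>{N. submodule N R M \<and> S \<subseteq> N}"

lemma submodule_span: "left_module R M \<Longrightarrow> S \<subseteq> carrier M \<Longrightarrow> submodule (span R M S) R M"
  unfolding span_def by (rule submodule_Inter) (auto intro: submodule_carrier)

lemma span_superset: "S \<subseteq> span R M S"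
  by (auto simp: span_def)

lemma span_least: "submodule N R M \<Longrightarrow> S \<subseteq> N \<Longrightarrow> span R M S \<subseteq> N"
  by (auto simp: span_def)

lemma fg_iff_span: "fg_module R M \<longleftrightarrow> left_module R M \<and> (\<exists>S. finite S \<and> S \<subseteq> carrier M \<and> span R M S = carrier M)"
proof -
  have "(\<forall>N. submodule N R M \<and> S \<subseteq> N \<longrightarrow> N = carrier M) \<longleftrightarrow> span R M S = carrier M"
    if "left_module R M" "S \<subseteq> carrier M" for S
    using submodule_span[OF that] span_superset[of S R M] span_least[of _ R M S] submodule_subset[of _ R M] that(2)
    by (metis subset_antisym)
  then show ?thesis unfolding fg_module_def by metis
qed

lemma fg_left_module: "fg_module R M \<Longrightarrow> left_module R M"
  by (simp add: fg_module_def)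

lemma fg_gens:
  assumes "fg_module R M"
  obtains S where "finite S" "S \<subseteq> carrier M" "\<And>L. submodule L R M \<Longrightarrow> S \<subseteq> L \<Longrightarrow> L = carrier M"
proof -
  have "\<exists>S. finite S \<and> S \<subseteq> carrier M \<and> (\<forall>N. submodule N R M \<and> S \<subseteq> N \<longrightarrow> N = carrier M)"
    using assms by (simp add: fg_module_def)
  then obtain S where "finite S" "S \<subseteq> carrier M" and S: "\<forall>N. submodule N R M \<and> S \<subseteq> N \<longrightarrow> N = carrier M"
    by (elim exE conjE)
  moreover have "L = carrier M" if "submodule L R M" "S \<subseteq> L" for L using S that by simp
  ultimately show ?thesis by (intro that[of S])
qed

lemma fg_regular: "ring R \<Longrightarrow> fg_module R (regular R)"
proof -
  assume R: "ring R"
  then interpret ring R .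
  have "N = carrier (regular R)" if "submodule N R (regular R)" "\<one>\<^bsub>R\<^esub> \<in> N" for N
    using submodule_smult[OF that(1) _ that(2)] submodule_subset[OF that(1)] by (auto simp: regular_def)
  then show ?thesis unfolding fg_module_def using left_module_regular[OF R]
    by (intro conjI exI[of _ "{\<one>\<^bsub>R\<^esub>}"]) (auto simp: regular_def)
qed

lemma fg_surj:
  assumes "fg_module R M" "left_module R N" "mhom R M N p" "p ` carrier M = carrier N"
  shows "fg_module R N"
proof -
  have M: "left_module R M" using assms(1) fg_left_module by auto
  obtain S where S: "finite S" "S \<subseteq> carrier M" "\<And>L. submodule L R M \<Longrightarrow> S \<subseteq> L \<Longrightarrow> L = carrier M"
    using fg_gens[OF assms(1)] by metis
  have "L = carrier N" if "submodule L R N" "p ` S \<subseteq> L" for L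
  proof -
    have "{x \<in> carrier M. p x \<in> L} = carrier M"
      using that S by (intro S(3) submodule_vimage[OF M assms(2,3)]) auto
    then have "p x \<in> L" if "x \<in> carrier M" for x using that by blast
    then have "p ` carrier M \<subseteq> L" by blast
    then have "carrier N \<subseteq> L" using assms(4) by simp
    then show ?thesis using submodule_subset[OF that(1)] by simp
  qed
  then show ?thesis unfolding fg_module_def using assms S by (intro conjI exI[of _ "p ` S"]) auto
qed

lemma free_cover:
  assumes "left_module R M" "finite S" "S \<subseteq> carrier M"
  shows "\<exists>n h. mhom R (mpow (regular R) n) M h \<and> S \<subseteq> h ` carrier (mpow (regular R) n)"
  using assms(2,3)
proof (induction S)
  case empty
  then show ?case using mhom_const_zero[OF assms(1)] by blast
next
  case (insert s S)
  interpret M: left_module R M by fact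
  note R = M.R.ring_axioms and reg = left_module_regular[OF M.R.ring_axioms]
  from insert obtain n h where h: "mhom R (mpow (regular R) n) M h" "S \<subseteq> h ` carrier (mpow (regular R) n)" by auto
  note bp = biprod_dsum_Suc[OF R, of n "\<lambda>_. regular R", OF reg]
  obtain h' where h': "mhom R (mpow (regular R) (Suc n)) M h'"
    "\<And>a. a \<in> carrier (mpow (regular R) n) \<Longrightarrow> h' (\<lambda>i\<in>{..<Suc n}. if i < n then a i else \<zero>\<^bsub>regular R\<^esub>) = h a"
    "\<And>c. c \<in> carrier (regular R) \<Longrightarrow> h' (\<lambda>i\<in>{..<Suc n}. if i < n then \<zero>\<^bsub>regular R\<^esub> else c) = c \<odot>\<^bsub>M\<^esub> s"
    by (rule biprod_copair[OF bp assms(1) h(1) mhom_regular[OF assms(1), of s]]) (use insert.prems in auto)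
  have "h' (\<lambda>i\<in>{..<Suc n}. if i < n then \<zero>\<^bsub>regular R\<^esub> else \<one>\<^bsub>R\<^esub>) = s"
    using h'(3)[of "\<one>\<^bsub>R\<^esub>"] insert.prems by (simp add: regular_def)
  moreover have "(\<lambda>i\<in>{..<Suc n}. if i < n then \<zero>\<^bsub>regular R\<^esub> else \<one>\<^bsub>R\<^esub>) \<in> carrier (mpow (regular R) (Suc n))"
    by (rule mhom_closed[OF biprodD(5)[OF bp]]) (simp add: regular_def)
  moreover have "h a \<in> h' ` carrier (mpow (regular R) (Suc n))" if "a \<in> carrier (mpow (regular R) n)" for a
    using h'(2)[OF that] mhom_closed[OF biprodD(4)[OF bp] that] by (rule rev_image_eqI[rotated, OF sym])
  ultimately have "insert s S \<subseteq> h' ` carrier (mpow (regular R) (Suc n))" using h(2) by (auto intro: rev_image_eqI)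
  with h'(1) show ?case by blast
qed

lemma fg_free_cover:
  assumes "fg_module R M"
  obtains n h where "mhom R (mpow (regular R) n) M h" "h ` carrier (mpow (regular R) n) = carrier M"
proof -
  have M: "left_module R M" using assms fg_left_module by auto
  then interpret M: left_module R M .
  obtain S where S: "finite S" "S \<subseteq> carrier M" "\<And>L. submodule L R M \<Longrightarrow> S \<subseteq> L \<Longrightarrow> L = carrier M"
    using fg_gens[OF assms] by metis
  obtain n h where h: "mhom R (mpow (regular R) n) M h" "S \<subseteq> h ` carrier (mpow (regular R) n)"
    using free_cover[OF M S(1,2)] by blast
  have "left_module R (mpow (regular R) n)"
    by (intro left_module_dsum left_module_regular) (rule M.R.ring_axioms)+
  then show ?thesis using that[OF h(1)] S(3)[OF submodule_range[OF _ M h(1)] h(2)] by blast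
qed

section \<open>Isomorphisms, and copies of modules over the type \<open>umod\<close>\<close>

definition miso ::
  "('a, 'c) ring_scheme \<Rightarrow> ('a, 'm) module \<Rightarrow> ('a, 'n) module \<Rightarrow> ('m \<Rightarrow> 'n) \<Rightarrow> ('n \<Rightarrow> 'm) \<Rightarrow> bool" where
  "miso R M N f g \<longleftrightarrow> mhom R M N f \<and> mhom R N M g \<and>
     (\<forall>x\<in>carrier M. g (f x) = x) \<and> (\<forall>y\<in>carrier N. f (g y) = y)"

lemma misoD:
  assumes "miso R M N f g"
  shows "mhom R M N f" "mhom R N M g" "x \<in> carrier M \<Longrightarrow> g (f x) = x" "y \<in> carrier N \<Longrightarrow> f (g y) = y"
    "inj_on f (carrier M)" "inj_on g (carrier N)" "f ` carrier M = carrier N" "g ` carrier N = carrier M"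
proof -
  show 1: "mhom R M N f" "mhom R N M g" and 2: "x \<in> carrier M \<Longrightarrow> g (f x) = x" "y \<in> carrier N \<Longrightarrow> f (g y) = y" for x y
    using assms by (auto simp: miso_def)
  show "inj_on f (carrier M)" "inj_on g (carrier N)" using 2 by (metis inj_onI)+
  show "f ` carrier M = carrier N" "g ` carrier N = carrier M"
    using 2 mhom_closed[OF 1(1)] mhom_closed[OF 1(2)] by force+
qed

lemma miso_sym: "miso R M N f g \<Longrightarrow> miso R N M g f"
  by (auto simp: miso_def)

lemma misoI_bij:
  assumes "left_module R M" "mhom R M N f" "inj_on f (carrier M)" "f ` carrier M = carrier N"
  shows "miso R M N f (inv_into (carrier M) f)"
  using mhom_inverse[OF assms] assms(2-4) by (auto simp: miso_def f_inv_into_f)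

text \<open>The quotient of a free module by the kernel of a cover has exactly the required element
  type. Through such copies pairs, submodules and modules of homomorphisms come under definitions
  that quantify over \<open>umod\<close> only.\<close>

lemma ex_umod:
  fixes M :: "('a, 'm) module"
  assumes "fg_module R M"
  obtains U :: "'a umod" and f g where "fg_module R U" "miso R M U f g"
proof -
  have M: "left_module R M" using assms fg_left_module by auto
  then interpret M: left_module R M .
  obtain n h where h: "mhom R (mpow (regular R) n) M h" "h ` carrier (mpow (regular R) n) = carrier M"
    using fg_free_cover[OF assms] by blast
  let ?F = "mpow (regular R) n"
  have F: "left_module R ?F"
    by (intro left_module_dsum left_module_regular) (rule M.R.ring_axioms)+
  have K: "submodule (ker ?F M h) R ?F" by (rule submodule_ker[OF F M h(1)])
  let ?U = "quot_module ?F (ker ?F M h)" and ?p = "\<lambda>x. ker ?F M h +>\<^bsub>?F\<^esub> x"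
  note U = left_module_quot[OF F K] and p = mhom_quot[OF F K] quot_surj[OF F K] quot_zero_iff[OF F K]
  obtain f where f: "mhom R ?U M f" "\<And>x. x \<in> carrier ?F \<Longrightarrow> f (?p x) = h x"
    by (rule factor_through[OF F U M p(1,2) h(1)]) (unfold p(3), simp_all add: ker_def)
  obtain g where g: "mhom R M ?U g" "\<And>x. x \<in> carrier ?F \<Longrightarrow> g (h x) = ?p x"
    by (rule factor_through[OF F M U h p(1)]) (simp_all add: p(3), simp add: ker_def)
  have 1: "f (g x) = x" if "x \<in> carrier M" for x
  proof -
    from that h(2) obtain y where "y \<in> carrier ?F" "x = h y" by blast
    then show ?thesis by (simp add: f(2) g(2))
  qed
  have 2: "g (f x) = x" if "x \<in> carrier ?U" for x
  proof -
    from that p(2) obtain y where "y \<in> carrier ?F" "x = ?p y" by blast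
    then show ?thesis by (simp add: f(2) g(2))
  qed
  have i: "miso R M ?U g f" using 1 2 f(1) g(1) by (simp add: miso_def)
  show ?thesis using that[OF fg_surj[OF assms U g(1) misoD(7)[OF i]] i] .
qed

section \<open>Rings of finite length\<close>

text \<open>A length bound on the ring makes finite generation and finite length equivalent
  (\<open>fg_len\<close>, \<open>len_fg\<close>). So submodules of finitely generated modules are
  finitely generated, and extremal submodules exist. The base ring, the algebra and the opposite
  endomorphism ring are all instances.\<close>

locale finite_length_ring = R?: ring R for R :: "('a, 'c) ring_scheme" (structure) +
  assumes len_regular: "\<exists>n. len_le R (regular R) n"
begin

lemma fg_len:
  fixes M :: "('a, 'm) module"
  assumes "fg_module R M"
  obtains n where "len_le R M n"
proof -
  obtain n h where h: "mhom R (mpow (regular R) n) M h" "h ` carrier (mpow (regular R) n) = carrier M"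
    using fg_free_cover[OF assms] by blast
  have reg: "left_module R (regular R)" by (rule left_module_regular[OF ring_axioms])
  have "\<exists>m. len_le R (mpow (regular R) n) m"
    using reg len_regular by (intro len_le_dsum[OF ring_axioms]) auto
  then show ?thesis
    using that len_le_surj[OF left_module_dsum[OF ring_axioms] fg_left_module[OF assms] h] reg by auto
qed

text \<open>A submodule that is maximal among the finitely generated ones absorbs every further
  element, since adjoining one element keeps it finitely generated.\<close>

lemma len_fg:
  fixes M :: "('a, 'm) module"
  assumes "left_module R M" "len_le R M n"
  shows "fg_module R M"
proof -
  let ?P = "\<lambda>N. \<exists>S. finite S \<and> S \<subseteq> carrier M \<and> N = span R M S"
  have "?P (span R M {})" by blast
  then obtain N where N: "submodule N R M" "?P N" "\<And>N'. submodule N' R M \<Longrightarrow> ?P N' \<Longrightarrow> N \<subseteq> N' \<Longrightarrow> N' = N"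
    using len_max[OF assms(2), of "span R M {}" ?P] submodule_span[OF assms(1), of "{}"] by blast
  then obtain S where S: "finite S" "S \<subseteq> carrier M" "N = span R M S" by blast
  have "x \<in> N" if x: "x \<in> carrier M" for x
  proof -
    let ?N = "span R M (insert x S)"
    have "submodule ?N R M" using S x by (intro submodule_span[OF assms(1)]) auto
    moreover have "?P ?N" using S x by blast
    moreover have "N \<subseteq> ?N" unfolding S(3) by (rule span_least) (use calculation span_superset[of "insert x S" R M] in auto)
    ultimately have "?N = N" using N(3) by blast
    then show ?thesis using span_superset[of "insert x S" R M] by blast
  qed
  then have "span R M S = carrier M" using S(3) submodule_subset[OF N(1)] by blast
  then show ?thesis unfolding fg_iff_span using S assms(1) by blast
qed

lemma fg_subm:
  fixes M :: "('a, 'm) module"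
  assumes "fg_module R M" "submodule N R M"
  shows "fg_module R (subm M N)"
proof -
  obtain n where "len_le R M n" using fg_len[OF assms(1)] by blast
  then show ?thesis
    using len_fg len_le_subm left_module_subm assms fg_left_module by metis
qed

lemma fg_biprod:
  assumes "biprod R A C U i j p q" "fg_module R A" "fg_module R C"
  shows "fg_module R U"
  using assms len_le_biprod[OF assms(1)] biprodD(3)[OF assms(1)] by (metis fg_len len_fg)

lemma fg_dsum:
  assumes "\<And>i. i < n \<Longrightarrow> fg_module R (M i)"
  shows "fg_module R (dsum n M)"
proof -
  have "\<exists>m. len_le R (M i) m" if "i < n" for i using fg_len[OF assms[OF that]] by blast
  then have "\<exists>m. len_le R (dsum n M) m" using assms fg_left_module by (intro len_le_dsum ring_axioms) auto
  then show ?thesis using len_fg left_module_dsum[OF ring_axioms] assms fg_left_module by blast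
qed

lemma fg_inj:
  assumes "fg_module R N" "left_module R M" "mhom R M N u" "inj_on u (carrier M)"
  shows "fg_module R M"
  using assms fg_left_module len_le_inj len_fg fg_len by metis

lemma ex_biprod:
  fixes A :: "('a, 'm) module" and C :: "('a, 'n) module"
  assumes "fg_module R A" "fg_module R C"
  obtains U :: "'a umod" and i j p q where "biprod R A C U i j p q" "fg_module R U"
proof -
  have l: "left_module R A" "left_module R C" using assms fg_left_module by auto
  note b = biprod_pmod[OF l]
  obtain U :: "'a umod" and f g where U: "fg_module R U" "miso R (pmod A C) U f g"
    using ex_umod[OF fg_biprod[OF b assms]] by blast
  note d = misoD[OF U(2)] and b' = biprodD[OF b]
  have "biprod R A C U (\<lambda>a. f (a, \<zero>\<^bsub>C\<^esub>)) (\<lambda>c. f (\<zero>\<^bsub>A\<^esub>, c)) (\<lambda>u. fst (g u)) (\<lambda>u. snd (g u))"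
    unfolding biprod_def
  proof (intro conjI ballI)
    fix u assume u: "u \<in> carrier U"
    have g: "g u \<in> carrier (pmod A C)" by (rule mhom_closed[OF d(2) u])
    have "f (fst (g u), \<zero>\<^bsub>C\<^esub>) \<oplus>\<^bsub>U\<^esub> f (\<zero>\<^bsub>A\<^esub>, snd (g u)) =
        f ((fst (g u), \<zero>\<^bsub>C\<^esub>) \<oplus>\<^bsub>pmod A C\<^esub> (\<zero>\<^bsub>A\<^esub>, snd (g u)))"
      by (rule mhom_add[OF d(1), symmetric])
        (rule mhom_closed[OF b'(4)] mhom_closed[OF b'(5)], rule mhom_closed[OF b'(6) g] mhom_closed[OF b'(7) g])+
    also have "\<dots> = u" using b'(12)[OF g] d(4)[OF u] by simp
    finally show "f (fst (g u), \<zero>\<^bsub>C\<^esub>) \<oplus>\<^bsub>U\<^esub> f (\<zero>\<^bsub>A\<^esub>, snd (g u)) = u" .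
  qed (use l fg_left_module[OF U(1)] mhom_comp[OF b'(4) d(1)] mhom_comp[OF b'(5) d(1)] mhom_comp[OF d(2) b'(6)]
      mhom_comp[OF d(2) b'(7)] d(3) b'(8-11) mhom_closed[OF b'(4)] mhom_closed[OF b'(5)] in auto)
  then show ?thesis using that U(1) by blast
qed

lemma ex_quot:
  fixes M :: "('a, 'm) module"
  assumes "fg_module R M" "submodule N R M"
  obtains U :: "'a umod" and p where "fg_module R U" "mhom R M U p" "p ` carrier M = carrier U"
    "\<And>x. x \<in> carrier M \<Longrightarrow> p x = \<zero>\<^bsub>U\<^esub> \<longleftrightarrow> x \<in> N"
proof -
  have M: "left_module R M" using assms fg_left_module by auto
  let ?Q = "quot_module M N"
  note Q = left_module_quot[OF M assms(2)] mhom_quot[OF M assms(2)] quot_surj[OF M assms(2)] quot_zero_iff[OF M assms(2)]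
  obtain U :: "'a umod" and f g where U: "fg_module R U" "miso R ?Q U f g"
    using ex_umod[OF fg_surj[OF assms(1) Q(1-3)]] by blast
  note d = misoD[OF U(2)]
  have U': "left_module R U" using U(1) fg_left_module by auto
  have "f (N +>\<^bsub>M\<^esub> x) = \<zero>\<^bsub>U\<^esub> \<longleftrightarrow> x \<in> N" if "x \<in> carrier M" for x
    using Q(4)[OF that] d(5) mhom_inj_iff[OF Q(1) U' d(1)] mhom_zero[OF Q(1) U' d(1)] mhom_closed[OF Q(2) that] by metis
  then show ?thesis
    using that[OF U(1) mhom_comp[OF Q(2) d(1)]] Q(3) d(7) by (simp add: image_image[symmetric])
qed

end

section \<open>Projective and injective modules\<close>

lemma projective_fg: "projective R P \<Longrightarrow> fg_module R P"
  by (simp add: projective_def)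

lemma injective_fg: "injective R I \<Longrightarrow> fg_module R I"
  by (simp add: injective_def)

lemma projectiveI:
  fixes P :: "('a, 'm) module"
  assumes "fg_module R P"
    "\<And>(X :: 'a umod) (Y :: 'a umod) p f. fg_module R X \<Longrightarrow> fg_module R Y \<Longrightarrow> mhom R X Y p \<Longrightarrow>
      p ` carrier X = carrier Y \<Longrightarrow> mhom R P Y f \<Longrightarrow> \<exists>h. mhom R P X h \<and> (\<forall>x\<in>carrier P. p (h x) = f x)"
  shows "projective R P"
  unfolding projective_def
proof (intro conjI allI impI)
  fix X Y :: "'a umod" and p f
  assume *: "fg_module R X \<and> fg_module R Y \<and> mod_epi R X Y p \<and> f \<in> lin R P Y"
  then obtain h where h: "mhom R P X h" "\<forall>x\<in>carrier P. p (h x) = f x"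
    using assms(2)[of X Y p f] by (auto simp: mod_epi_def lin_iff)
  then show "\<exists>h\<in>lin R P X. \<forall>x\<in>carrier P. p (h x) = f x"
    using lin_restrict[OF fg_left_module[OF assms(1)] h(1)] by (intro bexI[of _ "restrict h (carrier P)"]) auto
qed fact

lemma injectiveI:
  fixes I :: "('a, 'm) module"
  assumes "fg_module R I"
    "\<And>(X :: 'a umod) (Y :: 'a umod) u f. fg_module R X \<Longrightarrow> fg_module R Y \<Longrightarrow> mhom R X Y u \<Longrightarrow>
      inj_on u (carrier X) \<Longrightarrow> mhom R X I f \<Longrightarrow> \<exists>h. mhom R Y I h \<and> (\<forall>x\<in>carrier X. h (u x) = f x)"
  shows "injective R I"
  unfolding injective_def
proof (intro conjI allI impI)
  fix X Y :: "'a umod" and u f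
  assume *: "fg_module R X \<and> fg_module R Y \<and> mod_mono R X Y u \<and> f \<in> lin R X I"
  then obtain h where h: "mhom R Y I h" "\<forall>x\<in>carrier X. h (u x) = f x"
    using assms(2)[of X Y u f] by (auto simp: mod_mono_def lin_iff)
  have Y: "left_module R Y" and u: "mhom R X Y u" using * fg_left_module by (auto simp: mod_mono_def lin_iff)
  show "\<exists>h\<in>lin R Y I. \<forall>x\<in>carrier X. h (u x) = f x"
    using lin_restrict[OF Y h(1)] h(2) mhom_closed[OF u] by (intro bexI[of _ "restrict h (carrier Y)"]) auto
qed fact

text \<open>The definition tests projectivity against modules of type \<open>umod\<close> only.
  Conjugating with isomorphisms to such copies gives lifting against epimorphisms between modules of
  any element types.\<close>

lemma proj_lift:
  fixes P :: "('a, 'm) module" and X :: "('a, 'x) module" and Y :: "('a, 'y) module"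
  assumes "projective R P" "fg_module R X" "mhom R X Y p" "p ` carrier X = carrier Y" "left_module R Y" "mhom R P Y f"
  obtains h where "mhom R P X h" "\<And>x. x \<in> carrier P \<Longrightarrow> p (h x) = f x"
proof -
  have Y: "fg_module R Y" by (rule fg_surj[OF assms(2,5,3,4)])
  have P: "left_module R P" using projective_fg[OF assms(1)] fg_left_module by auto
  obtain X' :: "'a umod" and a b where X': "fg_module R X'" "miso R X X' a b" using ex_umod[OF assms(2)] by blast
  obtain Y' :: "'a umod" and c d where Y': "fg_module R Y'" "miso R Y Y' c d" using ex_umod[OF Y] by blast
  note x = misoD[OF X'(2)] and y = misoD[OF Y'(2)]
  have X'l: "left_module R X'" using X'(1) by (rule fg_left_module)
  let ?p = "restrict (\<lambda>x. c (p (b x))) (carrier X')"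
  have p: "mhom R X' Y' (\<lambda>x. c (p (b x)))" by (rule mhom_comp[OF x(2) mhom_comp[OF assms(3) y(1)]])
  have "(\<lambda>x. c (p (b x))) ` carrier X' = carrier Y'"
    using x(8) y(7) assms(4) image_image[of p b "carrier X'"] image_image[of c "\<lambda>x. p (b x)" "carrier X'"] by simp
  then have p: "mod_epi R X' Y' ?p" using lin_restrict[OF X'l p] by (auto simp: mod_epi_def)
  have f: "restrict (\<lambda>x. c (f x)) (carrier P) \<in> lin R P Y'" by (rule lin_restrict[OF P mhom_comp[OF assms(6) y(1)]])
  obtain h where h: "h \<in> lin R P X'" "\<forall>x\<in>carrier P. ?p (h x) = restrict (\<lambda>x. c (f x)) (carrier P) x"
    using assms(1) X'(1) Y'(1) p f unfolding projective_def by meson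
  have h': "mhom R P X' h" using h(1) by (simp add: lin_iff)
  have "p (b (h x)) = f x" if "x \<in> carrier P" for x
  proof -
    have "c (p (b (h x))) = c (f x)" using h(2) that mhom_closed[OF h' that] by auto
    then show ?thesis
      using y(3) mhom_closed[OF assms(6) that] mhom_closed[OF assms(3) mhom_closed[OF x(2) mhom_closed[OF h' that]]] by metis
  qed
  then show ?thesis using that mhom_comp[OF h' x(2)] by blast
qed

text \<open>As for \<open>proj_lift\<close>: both ends of the monomorphism move to copies, while
  \<open>I\<close> stays, since it occurs only as a codomain.\<close>

lemma inj_extend:
  fixes I :: "('a, 'm) module" and X :: "('a, 'x) module" and Y :: "('a, 'y) module"
  assumes "injective R I" "fg_module R X" "fg_module R Y" "mhom R X Y u" "inj_on u (carrier X)" "mhom R X I f"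
  obtains h where "mhom R Y I h" "\<And>x. x \<in> carrier X \<Longrightarrow> h (u x) = f x"
proof -
  obtain X' :: "'a umod" and a b where X': "fg_module R X'" "miso R X X' a b" using ex_umod[OF assms(2)] by blast
  obtain Y' :: "'a umod" and c d where Y': "fg_module R Y'" "miso R Y Y' c d" using ex_umod[OF assms(3)] by blast
  note x = misoD[OF X'(2)] and y = misoD[OF Y'(2)]
  have X'l: "left_module R X'" using X'(1) by (rule fg_left_module)
  let ?u = "restrict (\<lambda>x. c (u (b x))) (carrier X')"
  have u: "mhom R X' Y' (\<lambda>x. c (u (b x)))" by (rule mhom_comp[OF x(2) mhom_comp[OF assms(4) y(1)]])
  have "inj_on (\<lambda>x. c (u (b x))) (carrier X')"
  proof (rule inj_onI)
    fix z w assume *: "z \<in> carrier X'" "w \<in> carrier X'" "c (u (b z)) = c (u (b w))"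
    then have "u (b z) = u (b w)" using y(3) mhom_closed[OF assms(4)] mhom_closed[OF x(2)] by metis
    then have "b z = b w" using * assms(5) mhom_closed[OF x(2)] by (auto dest: inj_onD)
    then show "z = w" using * x(4) by metis
  qed
  then have u: "mod_mono R X' Y' ?u" using lin_restrict[OF X'l u] by (auto simp: mod_mono_def inj_on_def)
  have f: "restrict (\<lambda>x. f (b x)) (carrier X') \<in> lin R X' I" by (rule lin_restrict[OF X'l mhom_comp[OF x(2) assms(6)]])
  obtain h where h: "h \<in> lin R Y' I" "\<forall>x\<in>carrier X'. h (?u x) = restrict (\<lambda>x. f (b x)) (carrier X') x"
    using assms(1) X'(1) Y'(1) u f unfolding injective_def by meson
  have h': "mhom R Y' I h" using h(1) by (simp add: lin_iff)
  have "h (c (u x)) = f x" if "x \<in> carrier X" for x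
    using h(2)[rule_format, of "a x"] mhom_closed[OF x(1) that] x(3)[OF that] by simp
  then show ?thesis using that mhom_comp[OF y(1) h'] by blast
qed

lemma projective_retract:
  assumes "projective R P" "left_module R A" "mhom R A P i" "mhom R P A r" "\<And>x. x \<in> carrier A \<Longrightarrow> r (i x) = x"
  shows "projective R A"
proof (rule projectiveI)
  have "r ` carrier P = carrier A" using assms(5) mhom_closed[OF assms(3)] mhom_closed[OF assms(4)] by force
  then show "fg_module R A" using fg_surj[OF projective_fg[OF assms(1)] assms(2,4)] by simp
  fix X Y :: "'a umod" and p f
  assume *: "fg_module R X" "fg_module R Y" "mhom R X Y p" "p ` carrier X = carrier Y" "mhom R A Y f"
  obtain h where "mhom R P X h" "\<And>x. x \<in> carrier P \<Longrightarrow> p (h x) = f (r x)"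
    using proj_lift[OF assms(1) *(1,3,4) fg_left_module[OF *(2)] mhom_comp[OF assms(4) *(5)]] by blast
  then show "\<exists>h. mhom R A X h \<and> (\<forall>x\<in>carrier A. p (h x) = f x)"
    using assms(5) mhom_closed[OF assms(3)] by (intro exI[of _ "\<lambda>x. h (i x)"]) (auto intro: mhom_comp[OF assms(3)])
qed

lemma injective_retract:
  assumes "injective R I" "left_module R A" "mhom R A I i" "mhom R I A r" "\<And>x. x \<in> carrier A \<Longrightarrow> r (i x) = x"
  shows "injective R A"
proof (rule injectiveI)
  have "r ` carrier I = carrier A" using assms(5) mhom_closed[OF assms(3)] mhom_closed[OF assms(4)] by force
  then show "fg_module R A" using fg_surj[OF injective_fg[OF assms(1)] assms(2,4)] by simp
  fix X Y :: "'a umod" and u f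
  assume *: "fg_module R X" "fg_module R Y" "mhom R X Y u" "inj_on u (carrier X)" "mhom R X A f"
  obtain h where "mhom R Y I h" "\<And>x. x \<in> carrier X \<Longrightarrow> h (u x) = i (f x)"
    using inj_extend[OF assms(1) *(1-4) mhom_comp[OF *(5) assms(3)]] by blast
  then show "\<exists>h. mhom R Y A h \<and> (\<forall>x\<in>carrier X. h (u x) = f x)"
    using assms(5) mhom_closed[OF *(5)] by (intro exI[of _ "\<lambda>x. r (h x)"]) (auto intro: mhom_comp[OF _ assms(4)])
qed

lemma projective_regular: "ring R \<Longrightarrow> projective R (regular R)"
proof -
  assume R: "ring R"
  then interpret R: ring R .
  show ?thesis
  proof (rule projectiveI[OF fg_regular[OF R]])
    fix X Y :: "'a umod" and p f
    assume *: "fg_module R X" "fg_module R Y" "mhom R X Y p" "p ` carrier X = carrier Y" "mhom R (regular R) Y f"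
    have "f \<one>\<^bsub>R\<^esub> \<in> carrier Y" using mhom_closed[OF *(5), of "\<one>\<^bsub>R\<^esub>"] by (simp add: regular_def)
    then obtain x where x: "x \<in> carrier X" "p x = f \<one>\<^bsub>R\<^esub>" using *(4) by (metis imageE)
    have "p (a \<odot>\<^bsub>X\<^esub> x) = f a" if "a \<in> carrier (regular R)" for a
      using mhom_smult[OF *(3), of a x] mhom_smult[OF *(5), of a "\<one>\<^bsub>R\<^esub>"] that x by (simp add: regular_def)
    then show "\<exists>h. mhom R (regular R) X h \<and> (\<forall>x\<in>carrier (regular R). p (h x) = f x)"
      using mhom_regular[OF fg_left_module[OF *(1)] x(1)] by blast
  qed
qed

section \<open>Short exact sequences and their splittings\<close>

definition ses :: "('a, 'c) ring_scheme \<Rightarrow> ('a, 'm) module \<Rightarrow> ('a, 'n) module \<Rightarrow> ('a, 'u) module \<Rightarrow>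
    ('m \<Rightarrow> 'n) \<Rightarrow> ('n \<Rightarrow> 'u) \<Rightarrow> bool" where
  "ses R A B C i p \<longleftrightarrow> left_module R A \<and> left_module R B \<and> left_module R C \<and> mhom R A B i \<and> mhom R B C p \<and>
     inj_on i (carrier A) \<and> p ` carrier B = carrier C \<and> i ` carrier A = ker B C p"

lemma sesD:
  assumes "ses R A B C i p"
  shows "left_module R A" "left_module R B" "left_module R C" "mhom R A B i" "mhom R B C p"
    "inj_on i (carrier A)" "p ` carrier B = carrier C" "i ` carrier A = ker B C p"
    "a \<in> carrier A \<Longrightarrow> p (i a) = \<zero>\<^bsub>C\<^esub>"
    "b \<in> carrier B \<Longrightarrow> p b = \<zero>\<^bsub>C\<^esub> \<Longrightarrow> b \<in> i ` carrier A"
  using assms by (auto simp: ses_def ker_def)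

lemma sesI:
  assumes "left_module R A" "left_module R B" "left_module R C" "mhom R A B i" "mhom R B C p"
    "inj_on i (carrier A)" "p ` carrier B = carrier C" "\<And>a. a \<in> carrier A \<Longrightarrow> p (i a) = \<zero>\<^bsub>C\<^esub>"
    "\<And>b. b \<in> carrier B \<Longrightarrow> p b = \<zero>\<^bsub>C\<^esub> \<Longrightarrow> b \<in> i ` carrier A"
  shows "ses R A B C i p"
  using assms mhom_closed[OF assms(4)] by (auto simp: ses_def ker_def)

lemma ses_ker:
  assumes "left_module R B" "left_module R C" "mhom R B C p" "p ` carrier B = carrier C"
  shows "ses R (subm B (ker B C p)) B C (\<lambda>x. x) p"
  using assms submodule_ker[OF assms(1-3)]
  by (intro sesI left_module_subm mhom_subm_incl) (auto simp: ker_def)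

lemma ses_sub_quot:
  assumes "left_module R B" "left_module R C" "mhom R B C p" "p ` carrier B = carrier C"
    "submodule N R B" "\<And>x. x \<in> carrier B \<Longrightarrow> p x = \<zero>\<^bsub>C\<^esub> \<longleftrightarrow> x \<in> N"
  shows "ses R (subm B N) B C (\<lambda>x. x) p"
proof -
  have "ker B C p = N" using assms(6) submodule_subset[OF assms(5)] by (auto simp: ker_def)
  then show ?thesis using ses_ker[OF assms(1-4)] by simp
qed

lemma ses_biprod:
  assumes "biprod R A C U i j p q"
  shows "ses R A U C i q"
proof (rule sesI)
  note b = biprodD[OF assms]
  show "left_module R A" "left_module R U" "left_module R C" "mhom R A U i" "mhom R U C q" by (fact b)+
  show "inj_on i (carrier A)" using b(8) by (metis inj_onI)
  show "q ` carrier U = carrier C" using b(11) mhom_closed[OF b(5)] mhom_closed[OF b(7)] by force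
  show "q (i a) = \<zero>\<^bsub>C\<^esub>" if "a \<in> carrier A" for a by (rule b(9)[OF that])
  fix u assume u: "u \<in> carrier U" "q u = \<zero>\<^bsub>C\<^esub>"
  interpret U: left_module R U by (rule b(3))
  have "i (p u) = u" using b(12)[OF u(1)] u mhom_zero[OF b(2,3,5)] mhom_closed[OF b(4) mhom_closed[OF b(6) u(1)]] by simp
  then show "u \<in> i ` carrier A" using mhom_closed[OF b(6) u(1)] by (metis imageI)
qed

lemma biprod_swap: "biprod R A C U i j p q \<Longrightarrow> biprod R C A U j i q p"
proof -
  assume a: "biprod R A C U i j p q"
  note b = biprodD[OF a]
  interpret U: left_module R U by (rule b(3))
  have "j (q u) \<oplus>\<^bsub>U\<^esub> i (p u) = u" if "u \<in> carrier U" for u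
    using b(12)[OF that] mhom_closed[OF b(5) mhom_closed[OF b(7) that]] mhom_closed[OF b(4) mhom_closed[OF b(6) that]]
    by (simp add: U.M.a_comm)
  then show ?thesis using b by (simp add: biprod_def)
qed

text \<open>The map that subtracts \<open>s (p x)\<close> from \<open>x\<close> lands in the kernel
  of \<open>p\<close>; its factor through \<open>i\<close> is the retraction.\<close>

lemma ses_section:
  assumes "ses R A B C i p" "mhom R C B s" "\<And>x. x \<in> carrier C \<Longrightarrow> p (s x) = x"
  obtains r where "biprod R A C B i s r p"
proof -
  note s = sesD[OF assms(1)]
  interpret A: left_module R A by (rule s(1))
  interpret B: left_module R B by (rule s(2))
  interpret C: left_module R C by (rule s(3))
  let ?f = "\<lambda>x. x \<ominus>\<^bsub>B\<^esub> s (p x)"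
  have f: "mhom R B B ?f" by (rule mhom_diff[OF s(2) mhom_id mhom_comp[OF s(5) assms(2)]])
  have sp: "s (p x) \<in> carrier B" "p x \<in> carrier C" if "x \<in> carrier B" for x
    using that mhom_closed[OF assms(2)] mhom_closed[OF s(5)] by auto
  have "p (?f x) = \<zero>\<^bsub>C\<^esub>" if "x \<in> carrier B" for x
    using that sp by (simp add: mhom_minus[OF s(2,3,5)] assms(3))
  then have "?f x \<in> i ` carrier A" if "x \<in> carrier B" for x
    using that mhom_closed[OF f] s(10) by blast
  then obtain r where r: "mhom R B A r" "\<And>x. x \<in> carrier B \<Longrightarrow> i (r x) = ?f x"
    using factor_through_mono[OF s(1,2,4,6) f] by metis
  have inj: "x = y" if "x \<in> carrier A" "y \<in> carrier A" "i x = i y" for x y using inj_onD[OF s(6) that(3)] that by simp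
  have z: "s \<zero>\<^bsub>C\<^esub> = \<zero>\<^bsub>B\<^esub>" "i \<zero>\<^bsub>A\<^esub> = \<zero>\<^bsub>B\<^esub>" by (rule mhom_zero[OF s(3,2) assms(2)], rule mhom_zero[OF s(1,2,4)])
  have "r (i a) = a" if "a \<in> carrier A" for a
    using that mhom_closed[OF s(4) that] mhom_closed[OF r(1)]
    by (intro inj) (auto simp: r(2) s(9) z)
  moreover have "r (s c) = \<zero>\<^bsub>A\<^esub>" if "c \<in> carrier C" for c
    using that mhom_closed[OF assms(2) that] mhom_closed[OF r(1)] by (intro inj) (auto simp: r(2) assms(3) z)
  ultimately have "biprod R A C B i s r p"
    unfolding biprod_def using s assms(2,3) r sp by auto
  then show ?thesis by (rule that)
qed

text \<open>The map that subtracts \<open>i (r x)\<close> from \<open>x\<close> vanishes on the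
  image of \<open>i\<close>; its factor through \<open>p\<close> is a section killed by
  \<open>r\<close>.\<close>

lemma ses_retraction:
  assumes "ses R A B C i p" "mhom R B A r" "\<And>x. x \<in> carrier A \<Longrightarrow> r (i x) = x"
  obtains s where "biprod R A C B i s r p"
proof -
  note s = sesD[OF assms(1)]
  interpret A: left_module R A by (rule s(1))
  interpret B: left_module R B by (rule s(2))
  interpret C: left_module R C by (rule s(3))
  let ?f = "\<lambda>x. x \<ominus>\<^bsub>B\<^esub> i (r x)"
  have f: "mhom R B B ?f" by (rule mhom_diff[OF s(2) mhom_id mhom_comp[OF assms(2) s(4)]])
  have ir: "i (r x) \<in> carrier B" "r x \<in> carrier A" if "x \<in> carrier B" for x
    using that mhom_closed[OF assms(2)] mhom_closed[OF s(4)] by auto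
  have "?f x = \<zero>\<^bsub>B\<^esub>" if x: "x \<in> carrier B" "p x = \<zero>\<^bsub>C\<^esub>" for x
  proof -
    from s(10)[OF that] obtain a where "a \<in> carrier A" "x = i a" by blast
    then show ?thesis using assms(3) mhom_closed[OF s(4)] by simp
  qed
  then obtain g where g: "mhom R C B g" "\<And>x. x \<in> carrier B \<Longrightarrow> g (p x) = ?f x"
    using factor_through[OF s(2,3,2,5,7) f] by metis
  have pg: "p (g c) = c" "r (g c) = \<zero>\<^bsub>A\<^esub>" if c: "c \<in> carrier C" for c
  proof -
    from c s(7) obtain b where b: "b \<in> carrier B" "c = p b" by (metis imageE)
    interpret C: left_module R C by (rule s(3))
    show "p (g c) = c" using b ir mhom_closed[OF s(5)]
      by (simp add: g(2) mhom_minus[OF s(2,3,5)] s(9))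
    show "r (g c) = \<zero>\<^bsub>A\<^esub>" using b ir mhom_closed[OF assms(2)]
      by (simp add: g(2) mhom_minus[OF s(2,1) assms(2)] assms(3))
  qed
  have "biprod R A C B i g r p"
    unfolding biprod_def using s assms(2,3) g ir pg by auto
  then show ?thesis by (rule that)
qed

lemma ses_projective_split:
  assumes "ses R A B C i p" "projective R C" "fg_module R B"
  obtains s r where "biprod R A C B i s r p"
proof -
  note s = sesD[OF assms(1)]
  obtain h where "mhom R C B h" "\<And>x. x \<in> carrier C \<Longrightarrow> p (h x) = x"
    using proj_lift[OF assms(2,3) s(5,7,3) mhom_id] by blast
  then show ?thesis using ses_section[OF assms(1)] that by blast
qed

lemma ses_injective_split:
  assumes "ses R A B C i p" "injective R A" "fg_module R B"
  obtains s r where "biprod R A C B i s r p"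
proof -
  note s = sesD[OF assms(1)]
  obtain h where "mhom R B A h" "\<And>x. x \<in> carrier A \<Longrightarrow> h (i x) = x"
    using inj_extend[OF assms(2) injective_fg[OF assms(2)] assms(3) s(4,6) mhom_id] by blast
  then show ?thesis using ses_retraction[OF assms(1)] that by blast
qed

context finite_length_ring
begin

lemma projective_biprod:
  assumes "biprod R A C U i j p q" "projective R A" "projective R C"
  shows "projective R U"
proof (rule projectiveI)
  note b = biprodD[OF assms(1)]
  show "fg_module R U" by (rule fg_biprod[OF assms(1) projective_fg[OF assms(2)] projective_fg[OF assms(3)]])
  fix X Y :: "'a umod" and e f
  assume *: "fg_module R X" "fg_module R Y" "mhom R X Y e" "e ` carrier X = carrier Y" "mhom R U Y f"
  note X = fg_left_module[OF *(1)] and Y = fg_left_module[OF *(2)]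
  obtain g where g: "mhom R A X g" "\<And>x. x \<in> carrier A \<Longrightarrow> e (g x) = f (i x)"
    using proj_lift[OF assms(2) *(1,3,4) Y mhom_comp[OF b(4) *(5)]] by blast
  obtain h where h: "mhom R C X h" "\<And>x. x \<in> carrier C \<Longrightarrow> e (h x) = f (j x)"
    using proj_lift[OF assms(3) *(1,3,4) Y mhom_comp[OF b(5) *(5)]] by blast
  obtain k where k: "mhom R U X k" "\<And>u. u \<in> carrier U \<Longrightarrow> k u = g (p u) \<oplus>\<^bsub>X\<^esub> h (q u)"
    using biprod_copair[OF assms(1) X g(1) h(1)] by metis
  have "e (k u) = f u" if "u \<in> carrier U" for u
  proof -
    note c = mhom_closed[OF b(6) that] mhom_closed[OF b(7) that]
    have "e (k u) = f (i (p u)) \<oplus>\<^bsub>Y\<^esub> f (j (q u))"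
      using c by (simp add: k(2)[OF that] mhom_add[OF *(3)] mhom_closed[OF g(1)] mhom_closed[OF h(1)] g(2) h(2))
    also have "\<dots> = f u" using c mhom_closed[OF b(4)] mhom_closed[OF b(5)] b(12)[OF that]
      by (simp add: mhom_add[OF *(5), symmetric])
    finally show ?thesis .
  qed
  with k(1) show "\<exists>h. mhom R U X h \<and> (\<forall>x\<in>carrier U. e (h x) = f x)" by blast
qed

lemma injective_biprod:
  assumes "biprod R A C U i j p q" "injective R A" "injective R C"
  shows "injective R U"
proof (rule injectiveI)
  note b = biprodD[OF assms(1)]
  show "fg_module R U" by (rule fg_biprod[OF assms(1) injective_fg[OF assms(2)] injective_fg[OF assms(3)]])
  fix X Y :: "'a umod" and u f
  assume *: "fg_module R X" "fg_module R Y" "mhom R X Y u" "inj_on u (carrier X)" "mhom R X U f"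
  obtain g where g: "mhom R Y A g" "\<And>x. x \<in> carrier X \<Longrightarrow> g (u x) = p (f x)"
    using inj_extend[OF assms(2) *(1-4) mhom_comp[OF *(5) b(6)]] by blast
  obtain h where h: "mhom R Y C h" "\<And>x. x \<in> carrier X \<Longrightarrow> h (u x) = q (f x)"
    using inj_extend[OF assms(3) *(1-4) mhom_comp[OF *(5) b(7)]] by blast
  obtain k where k: "mhom R Y U k" "\<And>y. y \<in> carrier Y \<Longrightarrow> k y = i (g y) \<oplus>\<^bsub>U\<^esub> j (h y)"
    using biprod_pair[OF assms(1) g(1) h(1)] by metis
  have "k (u x) = f x" if "x \<in> carrier X" for x
    using that mhom_closed[OF *(3)] mhom_closed[OF *(5)] by (simp add: k(2) g(2) h(2) b(12))
  with k(1) show "\<exists>h. mhom R Y U h \<and> (\<forall>x\<in>carrier X. h (u x) = f x)" by blast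
qed

lemma zero_dsum: "left_module R (dsum 0 M)" "carrier (dsum 0 M) = {\<zero>\<^bsub>dsum 0 M\<^esub>}"
  using left_module_dsum[OF ring_axioms, of 0 M] by (auto simp: dsum_def)

lemma projective_zero:
  fixes Z :: "('a, 'm) module"
  assumes "left_module R Z" "carrier Z = {\<zero>\<^bsub>Z\<^esub>}"
  shows "projective R Z"
proof (rule projectiveI)
  show "fg_module R Z" using len_fg len_le_zero assms by blast
  fix X Y :: "'a umod" and e f
  assume *: "fg_module R X" "fg_module R Y" "mhom R X Y e" "e ` carrier X = carrier Y" "mhom R Z Y f"
  note X = fg_left_module[OF *(1)] and Y = fg_left_module[OF *(2)]
  show "\<exists>h. mhom R Z X h \<and> (\<forall>x\<in>carrier Z. e (h x) = f x)"
    using mhom_const_zero[OF X] mhom_zero[OF X Y *(3)] mhom_zero[OF assms(1) Y *(5)]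
    by (intro exI[of _ "\<lambda>_. \<zero>\<^bsub>X\<^esub>"]) (simp add: assms(2))
qed

lemma injective_zero:
  fixes Z :: "('a, 'm) module"
  assumes "left_module R Z" "carrier Z = {\<zero>\<^bsub>Z\<^esub>}"
  shows "injective R Z"
proof (rule injectiveI)
  show "fg_module R Z" using len_fg len_le_zero assms by blast
  fix X Y :: "'a umod" and u f
  assume *: "fg_module R X" "fg_module R Y" "mhom R X Y u" "inj_on u (carrier X)" "mhom R X Z f"
  show "\<exists>h. mhom R Y Z h \<and> (\<forall>x\<in>carrier X. h (u x) = f x)"
    using mhom_const_zero[OF assms(1)] mhom_closed[OF *(5)] assms(2)
    by (intro exI[of _ "\<lambda>_. \<zero>\<^bsub>Z\<^esub>"]) auto
qed

lemma projective_dsum: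
  assumes "\<And>i. i < n \<Longrightarrow> projective R (M i)"
  shows "projective R (dsum n M)"
  using assms
proof (induction n)
  case 0
  show ?case by (rule projective_zero[OF zero_dsum])
next
  case (Suc n)
  have "left_module R (M i)" if "i \<le> n" for i
    using Suc.prems[of i] that by (auto dest!: projective_fg fg_left_module)
  then show ?case using projective_biprod[OF biprod_dsum_Suc[OF ring_axioms]] Suc by auto
qed

lemma injective_dsum:
  assumes "\<And>i. i < n \<Longrightarrow> injective R (M i)"
  shows "injective R (dsum n M)"
  using assms
proof (induction n)
  case 0
  show ?case by (rule injective_zero[OF zero_dsum])
next
  case (Suc n)
  have "left_module R (M i)" if "i \<le> n" for i
    using Suc.prems[of i] that by (auto dest!: injective_fg fg_left_module)
  then show ?case using injective_biprod[OF biprod_dsum_Suc[OF ring_axioms]] Suc by auto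
qed

lemma projective_miso: "projective R P \<Longrightarrow> left_module R Q \<Longrightarrow> miso R P Q f g \<Longrightarrow> projective R Q"
  by (rule projective_retract[where i = g and r = f]) (auto simp: miso_def)

lemma injective_miso: "injective R P \<Longrightarrow> left_module R Q \<Longrightarrow> miso R P Q f g \<Longrightarrow> injective R Q"
  by (rule injective_retract[where i = g and r = f]) (auto simp: miso_def)

text \<open>No minimality is claimed: this is a free cover moved to \<open>umod\<close>. Minimal
  covers come from \<open>ex_min_projective_cover\<close>.\<close>

lemma ex_projective_cover:
  fixes M :: "('a, 'm) module"
  assumes "fg_module R M"
  obtains P :: "'a umod" and e where "projective R P" "mhom R P M e" "e ` carrier P = carrier M"
proof -
  obtain n h where h: "mhom R (mpow (regular R) n) M h" "h ` carrier (mpow (regular R) n) = carrier M"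
    using fg_free_cover[OF assms] by blast
  have P: "projective R (mpow (regular R) n)" by (intro projective_dsum projective_regular ring_axioms)
  obtain U :: "'a umod" and f g where U: "fg_module R U" "miso R (mpow (regular R) n) U f g"
    using ex_umod[OF projective_fg[OF P]] by blast
  have "(\<lambda>x. h (g x)) ` carrier U = carrier M" using misoD(8)[OF U(2)] h(2) by (simp add: image_image[symmetric])
  then show ?thesis
    using that[OF projective_miso[OF P fg_left_module[OF U(1)] U(2)] mhom_comp[OF misoD(2)[OF U(2)] h(1)]] by simp
qed

section \<open>Pushouts along a monomorphism\<close>

lemma ex_pushout:
  fixes A :: "('a, 'm) module" and B :: "('a, 'n) module" and C :: "('a, 'u) module"
  assumes "left_module R A" "fg_module R B" "fg_module R C" "mhom R A B u" "inj_on u (carrier A)" "mhom R A C f"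
  obtains W :: "'a umod" and j v where "fg_module R W" "mhom R C W j" "inj_on j (carrier C)" "mhom R B W v"
    "\<And>a. a \<in> carrier A \<Longrightarrow> v (u a) = j (f a)"
    "\<And>w. w \<in> carrier W \<Longrightarrow> \<exists>c\<in>carrier C. \<exists>b\<in>carrier B. w = j c \<oplus>\<^bsub>W\<^esub> v b"
    "\<And>c b. c \<in> carrier C \<Longrightarrow> b \<in> carrier B \<Longrightarrow> j c \<oplus>\<^bsub>W\<^esub> v b = \<zero>\<^bsub>W\<^esub> \<Longrightarrow>
      \<exists>a\<in>carrier A. b = u a \<and> c = \<ominus>\<^bsub>C\<^esub> f a"
proof -
  note B = fg_left_module[OF assms(2)] and C = fg_left_module[OF assms(3)]
  interpret A: left_module R A by fact
  interpret B: left_module R B by fact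
  interpret C: left_module R C by fact
  obtain D :: "'a umod" and i k p q where D: "biprod R C B D i k p q" "fg_module R D"
    using ex_biprod[OF assms(3,2)] by blast
  note b = biprodD[OF D(1)]
  interpret D: left_module R D by (rule b(3))
  \<comment> \<open>The antidiagonal copy of \<open>A\<close>, which is divided out of the sum of
    \<open>C\<close> and \<open>B\<close>.\<close>
  let ?g = "\<lambda>a. k (u a) \<ominus>\<^bsub>D\<^esub> i (f a)"
  have g: "mhom R A D ?g" by (rule mhom_diff[OF b(3) mhom_comp[OF assms(4) b(5)] mhom_comp[OF assms(6) b(4)]])
  have N: "submodule (?g ` carrier A) R D" by (rule submodule_range[OF assms(1) b(3) g])
  obtain W :: "'a umod" and \<pi> where W: "fg_module R W" "mhom R D W \<pi>" "\<pi> ` carrier D = carrier W"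
    "\<And>x. x \<in> carrier D \<Longrightarrow> \<pi> x = \<zero>\<^bsub>W\<^esub> \<longleftrightarrow> x \<in> ?g ` carrier A"
    using ex_quot[OF D(2) N] by blast
  note Wl = fg_left_module[OF W(1)]
  interpret W: left_module R W by (rule Wl)
  note c = mhom_closed[OF assms(4)] mhom_closed[OF assms(6)] mhom_closed[OF b(4)] mhom_closed[OF b(5)]
    mhom_closed[OF b(6)] mhom_closed[OF b(7)] mhom_closed[OF W(2)]
  have rel: "\<exists>a\<in>carrier A. y = u a \<and> x = \<ominus>\<^bsub>C\<^esub> f a"
    if xy: "x \<in> carrier C" "y \<in> carrier B" "\<pi> (i x) \<oplus>\<^bsub>W\<^esub> \<pi> (k y) = \<zero>\<^bsub>W\<^esub>" for x y
  proof -
    have "\<pi> (i x \<oplus>\<^bsub>D\<^esub> k y) = \<zero>\<^bsub>W\<^esub>" using xy c by (simp add: mhom_add[OF W(2)])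
    then obtain a where a: "a \<in> carrier A" "i x \<oplus>\<^bsub>D\<^esub> k y = ?g a" using W(4)[of "i x \<oplus>\<^bsub>D\<^esub> k y"] xy c by auto
    have "q (i x \<oplus>\<^bsub>D\<^esub> k y) = y" "p (i x \<oplus>\<^bsub>D\<^esub> k y) = x" "q (?g a) = u a" "p (?g a) = \<ominus>\<^bsub>C\<^esub> f a"
      using xy a(1) c
      by (simp_all add: mhom_add[OF b(7)] mhom_add[OF b(6)] mhom_minus[OF b(3,2,7)] mhom_minus[OF b(3,1,6)] b(8-11))
    then have "y = u a" "x = \<ominus>\<^bsub>C\<^esub> f a" using a(2) by simp_all
    with a show ?thesis by blast
  qed
  show ?thesis
  proof (rule that[OF W(1) mhom_comp[OF b(4) W(2)] _ mhom_comp[OF b(5) W(2)]])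
    show "inj_on (\<lambda>x. \<pi> (i x)) (carrier C)"
    proof (subst mhom_inj_iff[OF C Wl mhom_comp[OF b(4) W(2)]], intro ballI impI)
      fix x assume x: "x \<in> carrier C" "\<pi> (i x) = \<zero>\<^bsub>W\<^esub>"
      have "\<pi> (k \<zero>\<^bsub>B\<^esub>) = \<zero>\<^bsub>W\<^esub>" using mhom_zero[OF b(2,3,5)] mhom_zero[OF b(3) Wl W(2)] by simp
      then obtain a where a: "a \<in> carrier A" "\<zero>\<^bsub>B\<^esub> = u a" "x = \<ominus>\<^bsub>C\<^esub> f a" using rel[OF x(1) B.M.zero_closed] x by auto
      then have "a = \<zero>\<^bsub>A\<^esub>" using mhom_inj_iff[OF assms(1) B assms(4)] assms(5) by auto
      then show "x = \<zero>\<^bsub>C\<^esub>" using a mhom_zero[OF assms(1) C assms(6)] by simp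
    qed
    show "\<pi> (k (u a)) = \<pi> (i (f a))" if a: "a \<in> carrier A" for a
    proof -
      have "\<pi> (?g a) = \<zero>\<^bsub>W\<^esub>" using W(4)[of "?g a"] a mhom_closed[OF g a] by simp
      then show ?thesis using a c by (simp add: mhom_minus[OF b(3) Wl W(2)])
    qed
    fix w assume "w \<in> carrier W"
    then obtain x where x: "x \<in> carrier D" "w = \<pi> x" using W(3) by (metis imageE)
    then have "w = \<pi> (i (p x)) \<oplus>\<^bsub>W\<^esub> \<pi> (k (q x))"
      using c by (simp add: mhom_add[OF W(2), symmetric] b(12))
    then show "\<exists>c\<in>carrier C. \<exists>b\<in>carrier B. w = \<pi> (i c) \<oplus>\<^bsub>W\<^esub> \<pi> (k b)" using x c by blast
  qed (use rel in blast)
qed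

text \<open>The assumptions on sums and relations say that \<open>C\<close> plus \<open>B\<close>
  maps onto \<open>W\<close> with kernel coming from \<open>A\<close>. The pair of
  \<open>\<gamma>\<close> and \<open>\<beta>\<close> kills that kernel and hence factors, whatever
  the construction of \<open>W\<close> was.\<close>

lemma pushout_universal:
  assumes "left_module R X" "left_module R A" "left_module R B" "left_module R C" "left_module R W"
    "mhom R A B u" "mhom R A C f" "mhom R C W j" "mhom R B W v"
    "\<And>w. w \<in> carrier W \<Longrightarrow> \<exists>c\<in>carrier C. \<exists>b\<in>carrier B. w = j c \<oplus>\<^bsub>W\<^esub> v b"
    "\<And>c b. c \<in> carrier C \<Longrightarrow> b \<in> carrier B \<Longrightarrow> j c \<oplus>\<^bsub>W\<^esub> v b = \<zero>\<^bsub>W\<^esub> \<Longrightarrow>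
      \<exists>a\<in>carrier A. b = u a \<and> c = \<ominus>\<^bsub>C\<^esub> f a"
    "mhom R C X \<gamma>" "mhom R B X \<beta>" "\<And>a. a \<in> carrier A \<Longrightarrow> \<beta> (u a) = \<gamma> (f a)"
  obtains h where "mhom R W X h" "\<And>b. b \<in> carrier B \<Longrightarrow> h (v b) = \<beta> b" "\<And>c. c \<in> carrier C \<Longrightarrow> h (j c) = \<gamma> c"
proof -
  interpret B: left_module R B by fact
  interpret X: left_module R X by fact
  interpret C: left_module R C by fact
  interpret W: left_module R W by fact
  note b = biprod_pmod[OF assms(4,3)]
  let ?D = "pmod C B"
  obtain g where g: "mhom R ?D W g" "\<And>c. c \<in> carrier C \<Longrightarrow> g (c, \<zero>\<^bsub>B\<^esub>) = j c" "\<And>b. b \<in> carrier B \<Longrightarrow> g (\<zero>\<^bsub>C\<^esub>, b) = v b"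
    "\<And>x. x \<in> carrier ?D \<Longrightarrow> g x = j (fst x) \<oplus>\<^bsub>W\<^esub> v (snd x)"
    using biprod_copair[OF b assms(5,8,9)] by metis
  obtain g' where g': "mhom R ?D X g'" "\<And>c. c \<in> carrier C \<Longrightarrow> g' (c, \<zero>\<^bsub>B\<^esub>) = \<gamma> c" "\<And>b. b \<in> carrier B \<Longrightarrow> g' (\<zero>\<^bsub>C\<^esub>, b) = \<beta> b"
    "\<And>x. x \<in> carrier ?D \<Longrightarrow> g' x = \<gamma> (fst x) \<oplus>\<^bsub>X\<^esub> \<beta> (snd x)"
    using biprod_copair[OF b assms(1,12,13)] by metis
  have D: "c \<in> carrier C \<Longrightarrow> b \<in> carrier B \<Longrightarrow> (c, b) \<in> carrier ?D" for c b by (simp add: pmod_def)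
  have D': "fst x \<in> carrier C" "snd x \<in> carrier B" if "x \<in> carrier ?D" for x using that by (auto simp: pmod_def)
  have surj: "g ` carrier ?D = carrier W"
  proof
    show "carrier W \<subseteq> g ` carrier ?D"
    proof
      fix w assume "w \<in> carrier W"
      then obtain c b where "c \<in> carrier C" "b \<in> carrier B" "w = j c \<oplus>\<^bsub>W\<^esub> v b" using assms(10) by blast
      then have "w = g (c, b)" "(c, b) \<in> carrier ?D" using g(4) D by auto
      then show "w \<in> g ` carrier ?D" by blast
    qed
  qed (use mhom_closed[OF g(1)] in blast)
  have k: "g' x = \<zero>\<^bsub>X\<^esub>" if x: "x \<in> carrier ?D" "g x = \<zero>\<^bsub>W\<^esub>" for x
  proof -
    obtain a where a: "a \<in> carrier A" "snd x = u a" "fst x = \<ominus>\<^bsub>C\<^esub> f a"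
      using assms(11)[OF D'[OF x(1)]] x g(4)[OF x(1)] by auto
    then have "g' x = \<ominus>\<^bsub>X\<^esub> \<gamma> (f a) \<oplus>\<^bsub>X\<^esub> \<gamma> (f a)"
      using g'(4)[OF x(1)] assms(14)[OF a(1)] mhom_neg[OF assms(4,1,12) mhom_closed[OF assms(7) a(1)]] by simp
    then show ?thesis using mhom_closed[OF assms(12) mhom_closed[OF assms(7) a(1)]] by (simp add: X.M.l_neg)
  qed
  obtain h where h: "mhom R W X h" "\<And>x. x \<in> carrier ?D \<Longrightarrow> h (g x) = g' x"
    using factor_through[OF biprodD(3)[OF b] assms(5,1) g(1) surj g'(1)] k by metis
  have "h (v y) = \<beta> y" if "y \<in> carrier B" for y using that h(2)[OF D[OF C.M.zero_closed that]] g(3)[OF that] g'(3)[OF that] by simp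
  moreover have "h (j y) = \<gamma> y" if "y \<in> carrier C" for y
    using that h(2)[OF D[OF that B.M.zero_closed]] g(2)[OF that] g'(2)[OF that] by simp
  ultimately show ?thesis using that h(1) by blast
qed

text \<open>Pushing an extension of \<open>X\<close> out along \<open>f\<close> gives an extension
  of \<open>X\<close> by \<open>C\<close>. The map to \<open>X\<close> is zero on \<open>C\<close>
  and \<open>\<pi>\<close> on \<open>B\<close>; if it kills the sum of \<open>j c\<close> and
  \<open>v b\<close>, then \<open>b\<close> comes from some \<open>a\<close> in \<open>A\<close>,
  and the sum is the image of \<open>c\<close> plus \<open>f a\<close>.\<close>

lemma pushout_cokernel:
  assumes "ses R A B X u \<pi>" "left_module R C" "left_module R W" "mhom R A C f" "mhom R C W j" "inj_on j (carrier C)" "mhom R B W v"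
    "\<And>a. a \<in> carrier A \<Longrightarrow> v (u a) = j (f a)"
    "\<And>w. w \<in> carrier W \<Longrightarrow> \<exists>c\<in>carrier C. \<exists>b\<in>carrier B. w = j c \<oplus>\<^bsub>W\<^esub> v b"
    "\<And>c b. c \<in> carrier C \<Longrightarrow> b \<in> carrier B \<Longrightarrow> j c \<oplus>\<^bsub>W\<^esub> v b = \<zero>\<^bsub>W\<^esub> \<Longrightarrow>
      \<exists>a\<in>carrier A. b = u a \<and> c = \<ominus>\<^bsub>C\<^esub> f a"
  obtains h where "ses R C W X j h" "\<And>b. b \<in> carrier B \<Longrightarrow> h (v b) = \<pi> b"
proof -
  note s = sesD[OF assms(1)]
  interpret C: left_module R C by fact
  interpret X: left_module R X by (rule s(3))
  obtain h where h: "mhom R W X h" and hv: "\<And>b. b \<in> carrier B \<Longrightarrow> h (v b) = \<pi> b" and hj: "\<And>c. c \<in> carrier C \<Longrightarrow> h (j c) = \<zero>\<^bsub>X\<^esub>"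
    by (rule pushout_universal[OF s(3,1,2) assms(2,3) s(4) assms(4,5,7,9,10) mhom_const_zero[OF s(3)] s(5) s(9)]) (assumption+, rule that)
  have "ses R C W X j h"
  proof (rule sesI[OF assms(2,3) s(3) assms(5) h assms(6)])
    show "h ` carrier W = carrier X"
    proof
      show "carrier X \<subseteq> h ` carrier W"
      proof
        fix x assume "x \<in> carrier X"
        then obtain y where "y \<in> carrier B" "x = \<pi> y" using s(7) by (metis imageE)
        then show "x \<in> h ` carrier W" using hv mhom_closed[OF assms(7)] by (metis imageI)
      qed
    qed (use mhom_closed[OF h] in blast)
    fix w assume w: "w \<in> carrier W" "h w = \<zero>\<^bsub>X\<^esub>"
    then obtain c b where cb: "c \<in> carrier C" "b \<in> carrier B" "w = j c \<oplus>\<^bsub>W\<^esub> v b" using assms(9) by blast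
    then have "\<pi> b = \<zero>\<^bsub>X\<^esub>" using w hv hj mhom_closed[OF assms(5)] mhom_closed[OF assms(7)] mhom_closed[OF s(5)]
      by (simp add: mhom_add[OF h])
    then obtain a where a: "a \<in> carrier A" "b = u a" using s(10)[OF cb(2)] by blast
    then have "w = j (c \<oplus>\<^bsub>C\<^esub> f a)" using cb by (simp add: assms(8) mhom_add[OF assms(5)] mhom_closed[OF assms(4)])
    then show "w \<in> j ` carrier C" using cb a mhom_closed[OF assms(4)] by simp
  qed (rule hj)
  then show ?thesis using that hv by blast
qed

end

section \<open>Projective dimension\<close>

text \<open>Some chain of syzygies has to end in a projective module. That the kernel of any other
  projective cover would serve as well follows from \<open>pd_le_sub\<close>.\<close>

primrec pdu :: "('a, 'c) ring_scheme \<Rightarrow> nat \<Rightarrow> 'a umod \<Rightarrow> bool" where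
  "pdu R 0 M \<longleftrightarrow> projective R M"
| "pdu R (Suc n) M \<longleftrightarrow> (\<exists>P e. projective R P \<and> mhom R P M e \<and> e ` carrier P = carrier M \<and>
     pdu R n (subm P (ker P M e)))"

text \<open>The recursion runs through kernels, which stay in the type \<open>'a umod\<close>; only the first step
  starts from a module over another type.\<close>

definition pd_le :: "('a, 'c) ring_scheme \<Rightarrow> nat \<Rightarrow> ('a, 'm) module \<Rightarrow> bool" where
  "pd_le R n M \<longleftrightarrow> fg_module R M \<and> (case n of 0 \<Rightarrow> projective R M | Suc m \<Rightarrow>
     (\<exists>(P :: 'a umod) e. projective R P \<and> mhom R P M e \<and> e ` carrier P = carrier M \<and>
        pdu R m (subm P (ker P M e))))"

context finite_length_ring
begin

lemma pd_le_fg: "pd_le R n M \<Longrightarrow> fg_module R M"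
  by (simp add: pd_le_def)

lemma pd_le_0: "pd_le R 0 M \<longleftrightarrow> projective R M"
  by (auto simp: pd_le_def projective_fg)

lemma pdu_iff: "fg_module R M \<Longrightarrow> pdu R n M \<longleftrightarrow> pd_le R n M"
  by (cases n) (auto simp: pd_le_def)

lemma fg_ker:
  assumes "fg_module R P" "left_module R M" "mhom R P M e"
  shows "fg_module R (subm P (ker P M e))"
  by (rule fg_subm[OF assms(1) submodule_ker[OF fg_left_module[OF assms(1)] assms(2,3)]])

lemma pd_le_SucI:
  fixes P :: "'a umod"
  assumes "projective R P" "mhom R P M e" "e ` carrier P = carrier M" "left_module R M" "pd_le R n (subm P (ker P M e))"
  shows "pd_le R (Suc n) M"
  unfolding pd_le_def[of R "Suc n"]
  using assms fg_surj[OF projective_fg[OF assms(1)] assms(4,2,3)] pdu_iff[OF pd_le_fg[OF assms(5)]]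
  by (auto intro!: exI[of _ P] exI[of _ e])

lemma pd_le_SucE:
  fixes M :: "('a, 'm) module"
  assumes "pd_le R (Suc n) M"
  obtains P :: "'a umod" and e where "projective R P" "mhom R P M e" "e ` carrier P = carrier M"
    "pd_le R n (subm P (ker P M e))"
proof -
  have M: "left_module R M" using pd_le_fg[OF assms] by (rule fg_left_module)
  obtain P :: "'a umod" and e where P: "projective R P" "mhom R P M e" "e ` carrier P = carrier M"
    "pdu R n (subm P (ker P M e))"
    using assms by (auto simp: pd_le_def)
  show ?thesis using that[OF P(1-3)] P(4) pdu_iff[OF fg_ker[OF projective_fg[OF P(1)] M P(2)]] by simp
qed

lemma pd_le_miso:
  fixes M :: "('a, 'm) module" and N :: "('a, 'n) module"
  assumes "miso R M N f g" "left_module R N" "pd_le R n M"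
  shows "pd_le R n N"
proof (cases n)
  case 0
  then show ?thesis using assms projective_miso[OF _ assms(2,1)] by (simp add: pd_le_0)
next
  case (Suc m)
  note d = misoD[OF assms(1)]
  have M: "left_module R M" using pd_le_fg[OF assms(3)] by (rule fg_left_module)
  obtain P :: "'a umod" and e where P: "projective R P" "mhom R P M e" "e ` carrier P = carrier M"
    "pd_le R m (subm P (ker P M e))"
    using assms(3) pd_le_SucE Suc by blast
  have "ker P N (\<lambda>x. f (e x)) = ker P M e"
    using mhom_inj_iff[OF M assms(2) d(1)] d(5) mhom_zero[OF M assms(2) d(1)] mhom_closed[OF P(2)]
    by (auto simp: ker_def)
  moreover have "(\<lambda>x. f (e x)) ` carrier P = carrier N" using P(3) d(7) image_image[of f e] by metis
  ultimately show ?thesis unfolding Suc using pd_le_SucI[OF P(1) mhom_comp[OF P(2) d(1)] _ assms(2)] P(4) by simp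
qed

text \<open>The cover of \<open>C\<close> lifts to a map \<open>t\<close> into \<open>B\<close>;
  together with \<open>f\<close> followed by \<open>i\<close> it covers \<open>B\<close> by the sum
  of \<open>PA\<close> and \<open>PC\<close>, and the kernels then form an exact sequence.\<close>

lemma horseshoe:
  fixes A :: "('a, 'm) module" and B :: "('a, 'n) module" and C :: "('a, 'u) module"
    and PA PC :: "'a umod"
  assumes "ses R A B C i p" "fg_module R B" "projective R PA" "projective R PC"
    "mhom R PA A f" "f ` carrier PA = carrier A" "mhom R PC C g" "g ` carrier PC = carrier C"
  obtains PB :: "'a umod" and h i' p' where "projective R PB" "mhom R PB B h" "h ` carrier PB = carrier B"
    "ses R (subm PA (ker PA A f)) (subm PB (ker PB B h)) (subm PC (ker PC C g)) i' p'"
proof -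
  note s = sesD[OF assms(1)]
  interpret A: left_module R A by (rule s(1))
  interpret B: left_module R B by (rule s(2))
  interpret C: left_module R C by (rule s(3))
  have PAl: "left_module R PA" and PCl: "left_module R PC"
    using assms(3,4) projective_fg fg_left_module by blast+
  interpret PA: left_module R PA by (rule PAl)
  obtain t where t: "mhom R PC B t" "\<And>x. x \<in> carrier PC \<Longrightarrow> p (t x) = g x"
    using proj_lift[OF assms(4,2) s(5,7,3) assms(7)] by blast
  obtain PB :: "'a umod" and j k a b where D: "biprod R PA PC PB j k a b" "fg_module R PB"
    using ex_biprod[OF projective_fg[OF assms(3)] projective_fg[OF assms(4)]] by blast
  note d = biprodD[OF D(1)]
  interpret PB: left_module R PB by (rule d(3))
  obtain h where h: "mhom R PB B h" "\<And>x. x \<in> carrier PA \<Longrightarrow> h (j x) = i (f x)" "\<And>x. x \<in> carrier PC \<Longrightarrow> h (k x) = t x"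
    "\<And>u. u \<in> carrier PB \<Longrightarrow> h u = i (f (a u)) \<oplus>\<^bsub>B\<^esub> t (b u)"
    using biprod_copair[OF D(1) s(2) mhom_comp[OF assms(5) s(4)] t(1)] by metis
  note c = mhom_closed[OF assms(5)] mhom_closed[OF assms(7)] mhom_closed[OF s(4)] mhom_closed[OF s(5)]
    mhom_closed[OF d(4)] mhom_closed[OF d(5)] mhom_closed[OF d(6)] mhom_closed[OF d(7)] mhom_closed[OF t(1)] mhom_closed[OF h(1)]
  have ph: "p (h u) = g (b u)" if "u \<in> carrier PB" for u
    using that c by (simp add: h(4) mhom_add[OF s(5)] s(9) t(2))
  \<comment> \<open>This serves twice: with arbitrary \<open>y\<close> it shows that
    \<open>h\<close> is onto, and with \<open>y\<close> zero that the kernel of \<open>h\<close>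
    maps onto the kernel of \<open>g\<close>.\<close>
  have lift: "\<exists>u\<in>carrier PB. h u = y \<and> b u = z" if y: "y \<in> carrier B" "z \<in> carrier PC" "p y = g z" for y z
  proof -
    have "p (y \<ominus>\<^bsub>B\<^esub> t z) = \<zero>\<^bsub>C\<^esub>" using y c by (simp add: mhom_minus[OF s(2,3,5)] t(2))
    then obtain x where x: "x \<in> carrier A" "y \<ominus>\<^bsub>B\<^esub> t z = i x" using s(10)[of "y \<ominus>\<^bsub>B\<^esub> t z"] y c by auto
    then obtain w where w: "w \<in> carrier PA" "x = f w" using assms(6) by (metis imageE)
    have "h (j w \<oplus>\<^bsub>PB\<^esub> k z) = i x \<oplus>\<^bsub>B\<^esub> t z" using w y c by (simp add: mhom_add[OF h(1)] h(2,3))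
    also have "\<dots> = y" using x(2)[symmetric] y c by simp
    finally have "h (j w \<oplus>\<^bsub>PB\<^esub> k z) = y" .
    moreover have "b (j w \<oplus>\<^bsub>PB\<^esub> k z) = z" using w y c PCl by (simp add: mhom_add[OF d(7)] d(9,11) left_module.axioms abelian_monoid.l_zero[OF abelian_group.axioms(1)[OF left_module.axioms(2)[OF PCl]]])
    ultimately show ?thesis using w y c by (intro bexI[of _ "j w \<oplus>\<^bsub>PB\<^esub> k z"]) auto
  qed
  have surj: "h ` carrier PB = carrier B"
  proof
    show "carrier B \<subseteq> h ` carrier PB"
    proof
      fix y assume y: "y \<in> carrier B"
      then obtain z where "z \<in> carrier PC" "p y = g z" using assms(8) c by (metis imageE)
      then show "y \<in> h ` carrier PB" using lift[OF y] by blast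
    qed
  qed (use mhom_closed[OF h(1)] in auto)
  let ?KA = "ker PA A f" and ?KB = "ker PB B h" and ?KC = "ker PC C g"
  have K: "submodule ?KA R PA" "submodule ?KB R PB" "submodule ?KC R PC"
    using submodule_ker[OF PAl s(1) assms(5)] submodule_ker[OF d(3) s(2) h(1)] submodule_ker[OF PCl s(3) assms(7)] by auto
  have "ses R (subm PA ?KA) (subm PB ?KB) (subm PC ?KC) j b"
  proof (rule sesI)
    show "left_module R (subm PA ?KA)" "left_module R (subm PB ?KB)" "left_module R (subm PC ?KC)"
      using left_module_subm PAl PCl d(3) K by blast+
    have iz: "i \<zero>\<^bsub>A\<^esub> = \<zero>\<^bsub>B\<^esub>" by (rule mhom_zero[OF s(1,2,4)])
    show "mhom R (subm PA ?KA) (subm PB ?KB) j"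
      by (rule mhom_to_subm[OF mhom_restrict_dom[OF d(4) K(1)]]) (auto simp: ker_def c h(2) iz)
    have gz: "g (b u) = \<zero>\<^bsub>C\<^esub>" if "u \<in> ?KB" for u
      using that ph[of u] mhom_zero[OF s(2,3,5)] by (auto simp: ker_def)
    show "mhom R (subm PB ?KB) (subm PC ?KC) b"
      by (rule mhom_to_subm[OF mhom_restrict_dom[OF d(7) K(2)]]) (use gz c in \<open>auto simp: ker_def\<close>)
    show "inj_on j (carrier (subm PA ?KA))"
      using sesD(6)[OF ses_biprod[OF D(1)]] by (rule inj_on_subset) (auto simp: ker_def)
    show "b ` carrier (subm PB ?KB) = carrier (subm PC ?KC)"
    proof
      show "b ` carrier (subm PB ?KB) \<subseteq> carrier (subm PC ?KC)" using gz c by (auto simp: ker_def)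
      show "carrier (subm PC ?KC) \<subseteq> b ` carrier (subm PB ?KB)"
      proof
        fix z assume "z \<in> carrier (subm PC ?KC)"
        then have z: "z \<in> carrier PC" "g z = \<zero>\<^bsub>C\<^esub>" by (auto simp: ker_def)
        then obtain u where "u \<in> carrier PB" "h u = \<zero>\<^bsub>B\<^esub>" "b u = z"
          using lift[OF B.M.zero_closed z(1)] mhom_zero[OF s(2,3,5)] by auto
        then show "z \<in> b ` carrier (subm PB ?KB)" by (auto simp: ker_def)
      qed
    qed
    show "b (j x) = \<zero>\<^bsub>subm PC ?KC\<^esub>" if "x \<in> carrier (subm PA ?KA)" for x
      using that d(9) by (auto simp: ker_def)
    fix u assume "u \<in> carrier (subm PB ?KB)" "b u = \<zero>\<^bsub>subm PC ?KC\<^esub>"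
    then have u: "u \<in> carrier PB" "h u = \<zero>\<^bsub>B\<^esub>" "b u = \<zero>\<^bsub>PC\<^esub>" by (auto simp: ker_def)
    then obtain x where x: "x \<in> carrier PA" "u = j x" using sesD(10)[OF ses_biprod[OF D(1)]] by blast
    then have "i (f x) = \<zero>\<^bsub>B\<^esub>" using u h(2) by simp
    then have "f x = \<zero>\<^bsub>A\<^esub>" using mhom_inj_iff[OF s(1,2,4)] s(6) x c by blast
    then show "u \<in> j ` carrier (subm PA ?KA)" using x by (auto simp: ker_def)
  qed
  then show ?thesis using that[OF projective_biprod[OF D(1) assms(3,4)] h(1) surj] by blast
qed

text \<open>The inductive step stands apart from the induction because of types: syzygies are always
  of type \<open>umod\<close>, so the induction runs there, while the outermost step may start from
  any element types.\<close>

lemma pd_le_ext_step: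
  fixes A :: "('a, 'm) module" and B :: "('a, 'n) module" and C :: "('a, 'u) module"
  assumes IH: "\<And>(A :: 'a umod) (B :: 'a umod) (C :: 'a umod) i p. ses R A B C i p \<Longrightarrow> fg_module R B \<Longrightarrow>
      pd_le R n A \<Longrightarrow> pd_le R n C \<Longrightarrow> pd_le R n B"
    and "ses R A B C i p" "fg_module R B" "pd_le R (Suc n) A" "pd_le R (Suc n) C"
  shows "pd_le R (Suc n) B"
proof -
  obtain PA :: "'a umod" and f where a: "projective R PA" "mhom R PA A f" "f ` carrier PA = carrier A"
    "pd_le R n (subm PA (ker PA A f))" using pd_le_SucE[OF assms(4)] by blast
  obtain PC :: "'a umod" and g where c: "projective R PC" "mhom R PC C g" "g ` carrier PC = carrier C"
    "pd_le R n (subm PC (ker PC C g))" using pd_le_SucE[OF assms(5)] by blast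
  obtain PB :: "'a umod" and h i' p' where b: "projective R PB" "mhom R PB B h" "h ` carrier PB = carrier B"
    "ses R (subm PA (ker PA A f)) (subm PB (ker PB B h)) (subm PC (ker PC C g)) i' p'"
    using horseshoe[OF assms(2,3) a(1) c(1) a(2,3) c(2,3)] by blast
  note B = fg_left_module[OF assms(3)]
  show ?thesis
    by (rule pd_le_SucI[OF b(1-3) B IH[OF b(4) fg_ker[OF projective_fg[OF b(1)] B b(2)] a(4) c(4)]])
qed

lemma pd_le_ext_0:
  assumes "ses R A B C i p" "fg_module R B" "pd_le R 0 A" "pd_le R 0 C"
  shows "pd_le R 0 B"
proof -
  obtain s r where "biprod R A C B i s r p"
    using ses_projective_split[OF assms(1) _ assms(2)] assms(4) pd_le_0 by blast
  then show ?thesis using projective_biprod assms(3,4) by (auto simp: pd_le_0)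
qed

lemma pd_le_ext_umod:
  fixes A B C :: "'a umod"
  assumes "ses R A B C i p" "fg_module R B" "pd_le R n A" "pd_le R n C"
  shows "pd_le R n B"
  using assms
proof (induction n arbitrary: A B C i p)
  case 0
  then show ?case by (rule pd_le_ext_0)
next
  case (Suc n)
  show ?case by (rule pd_le_ext_step[OF Suc.IH Suc.prems])
qed

lemma pd_le_ext:
  fixes A :: "('a, 'm) module" and B :: "('a, 'n) module" and C :: "('a, 'u) module"
  assumes "ses R A B C i p" "fg_module R B" "pd_le R n A" "pd_le R n C"
  shows "pd_le R n B"
proof (cases n)
  case 0
  then show ?thesis using pd_le_ext_0[OF assms(1,2)] assms(3,4) by simp
next
  case (Suc m)
  show ?thesis unfolding Suc
    by (rule pd_le_ext_step[OF _ assms(1,2)], erule (3) pd_le_ext_umod) (use assms(3,4) Suc in auto)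
qed

text \<open>A cover of a projective module splits, so its kernel is a summand of a projective
  module.\<close>

lemma pd_le_Suc_mono_0:
  assumes "pd_le R 0 M"
  shows "pd_le R (Suc 0) M"
proof -
  have M: "projective R M" "fg_module R M" using assms pd_le_fg[OF assms] by (auto simp: pd_le_0)
  note Ml = fg_left_module[OF M(2)]
  obtain P :: "'a umod" and e where P: "projective R P" "mhom R P M e" "e ` carrier P = carrier M"
    using ex_projective_cover[OF M(2)] by blast
  note Pl = fg_left_module[OF projective_fg[OF P(1)]]
  obtain s r where b: "biprod R (subm P (ker P M e)) M P (\<lambda>x. x) s r e"
    using ses_projective_split[OF ses_ker[OF Pl Ml P(2,3)] M(1) projective_fg[OF P(1)]] by blast
  note d = biprodD[OF b]
  have "projective R (subm P (ker P M e))"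
    by (rule projective_retract[OF P(1) d(1,4,6,8)])
  then show ?thesis by (intro pd_le_SucI[OF P Ml]) (simp add: pd_le_0)
qed

lemma pd_le_Suc_mono_umod:
  fixes M :: "'a umod"
  shows "pd_le R n M \<Longrightarrow> pd_le R (Suc n) M"
proof (induction n arbitrary: M)
  case 0
  then show ?case by (rule pd_le_Suc_mono_0)
next
  case (Suc n)
  then show ?case by (metis pd_le_SucE pd_le_SucI pd_le_fg fg_left_module)
qed

lemma pd_le_Suc_mono:
  fixes M :: "('a, 'm) module"
  assumes "pd_le R n M"
  shows "pd_le R (Suc n) M"
proof -
  obtain U :: "'a umod" and f g where U: "fg_module R U" "miso R M U f g" using ex_umod[OF pd_le_fg[OF assms]] by blast
  have "pd_le R (Suc n) U"
    by (rule pd_le_Suc_mono_umod[OF pd_le_miso[OF U(2) fg_left_module[OF U(1)] assms]])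
  then show ?thesis
    by (rule pd_le_miso[OF miso_sym[OF U(2)] fg_left_module[OF pd_le_fg[OF assms]]])
qed

lemma pd_le_mono: "n \<le> m \<Longrightarrow> pd_le R n M \<Longrightarrow> pd_le R m M"
  by (induction rule: dec_induct) (auto intro: pd_le_Suc_mono)

lemma pd_le_projective: "projective R M \<Longrightarrow> pd_le R n M"
  using pd_le_mono[of 0 n M] by (simp add: pd_le_0)

text \<open>A cover of \<open>B\<close> also covers \<open>C\<close>. Its kernel over
  \<open>C\<close> is an extension of \<open>A\<close> by its kernel over \<open>B\<close>, and both
  of these have dimension at most \<open>n\<close>.\<close>

lemma pd_le_quotient:
  fixes A :: "('a, 'm) module" and B :: "('a, 'n) module" and C :: "('a, 'u) module"
  assumes "ses R A B C i p" "pd_le R n A" "pd_le R (Suc n) B"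
  shows "pd_le R (Suc n) C"
proof -
  note s = sesD[OF assms(1)]
  obtain P :: "'a umod" and e where P: "projective R P" "mhom R P B e" "e ` carrier P = carrier B"
    "pd_le R n (subm P (ker P B e))" using pd_le_SucE[OF assms(3)] by blast
  note Pl = fg_left_module[OF projective_fg[OF P(1)]]
  let ?q = "\<lambda>x. p (e x)"
  have q: "mhom R P C ?q" by (rule mhom_comp[OF P(2) s(5)])
  have surj: "?q ` carrier P = carrier C" using P(3) s(7) image_image[of p e] by metis
  let ?K = "ker P B e" and ?L = "ker P C ?q"
  have K: "submodule ?K R P" and L: "submodule ?L R P"
    using submodule_ker[OF Pl s(2) P(2)] submodule_ker[OF Pl s(3) q] by auto
  have KL: "?K \<subseteq> ?L" using mhom_zero[OF s(2,3,5)] by (auto simp: ker_def)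
  have e: "mhom R (subm P ?L) B e" by (rule mhom_restrict_dom[OF P(2) L])
  have "e x \<in> i ` carrier A" if "x \<in> carrier (subm P ?L)" for x
    using that s(10)[of "e x"] mhom_closed[OF P(2)] by (auto simp: ker_def)
  then obtain f where f: "mhom R (subm P ?L) A f" "\<And>x. x \<in> ?L \<Longrightarrow> i (f x) = e x"
    using factor_through_mono[OF s(1) left_module_subm[OF Pl L] s(4,6) e] by auto
  have iz: "a = \<zero>\<^bsub>A\<^esub>" if "a \<in> carrier A" "i a = \<zero>\<^bsub>B\<^esub>" for a
    using mhom_inj_iff[OF s(1,2,4)] s(6) that by blast
  have "ses R (subm P ?K) (subm P ?L) A (\<lambda>x. x) f"
  proof (rule sesI)
    show "left_module R (subm P ?K)" "left_module R (subm P ?L)" "left_module R A"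
      by (intro left_module_subm Pl K L s(1))+
    show "mhom R (subm P ?K) (subm P ?L) (\<lambda>x. x)"
      by (rule mhom_to_subm[OF mhom_subm_incl[OF K]]) (use KL in auto)
    show "f ` carrier (subm P ?L) = carrier A"
    proof
      show "carrier A \<subseteq> f ` carrier (subm P ?L)"
      proof
        fix a assume a: "a \<in> carrier A"
        then obtain x where x: "x \<in> carrier P" "e x = i a" using P(3) mhom_closed[OF s(4)] by (metis imageE)
        then have "x \<in> ?L" using s(9)[OF a] by (simp add: ker_def)
        then have "f x = a" using f(2)[of x] x inj_onD[OF s(6), of "f x" a] a mhom_closed[OF f(1), of x] by simp
        then show "a \<in> f ` carrier (subm P ?L)" using \<open>x \<in> ?L\<close> by auto
      qed
    qed (use mhom_closed[OF f(1)] in blast)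
    fix x assume x: "x \<in> carrier (subm P ?K)"
    then have "i (f x) = \<zero>\<^bsub>B\<^esub>" using f(2)[of x] KL by (auto simp: ker_def)
    then show "f x = \<zero>\<^bsub>A\<^esub>" using iz mhom_closed[OF f(1), of x] x KL by auto
  next
    fix x assume "x \<in> carrier (subm P ?L)" "f x = \<zero>\<^bsub>A\<^esub>"
    then have "x \<in> ?L" "e x = \<zero>\<^bsub>B\<^esub>" using f(2)[of x] mhom_zero[OF s(1,2,4)] by auto
    then show "x \<in> (\<lambda>x. x) ` carrier (subm P ?K)" by (auto simp: ker_def)
  qed (use f in auto)
  then have "pd_le R n (subm P ?L)"
    by (rule pd_le_ext) (use fg_ker[OF projective_fg[OF P(1)] s(3) q] P(4) assms(2) in auto)
  then show ?thesis by (rule pd_le_SucI[OF P(1) q surj s(3)])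
qed

text \<open>A projective cover \<open>P\<close> of \<open>C\<close> lifts to \<open>B\<close>, so
  the pullback of \<open>B\<close> and \<open>P\<close> over \<open>C\<close> is the sum of
  \<open>A\<close> and \<open>P\<close>. It maps onto \<open>B\<close> with kernel the syzygy of
  \<open>C\<close>, hence has dimension at most \<open>n\<close>, and \<open>A\<close> inherits
  this: as a retract for \<open>n = 0\<close>, otherwise as the quotient by
  \<open>P\<close>.\<close>

lemma pd_le_sub:
  fixes A :: "('a, 'm) module" and B :: "('a, 'n) module" and C :: "('a, 'u) module"
  assumes "ses R A B C i p" "pd_le R n B" "pd_le R (Suc n) C"
  shows "pd_le R n A"
proof -
  note s = sesD[OF assms(1)]
  interpret A: left_module R A by (rule s(1))
  interpret B: left_module R B by (rule s(2))
  interpret C: left_module R C by (rule s(3))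
  note Bf = pd_le_fg[OF assms(2)]
  have Af: "fg_module R A" by (rule fg_inj[OF Bf s(1,4,6)])
  obtain P :: "'a umod" and e where P: "projective R P" "mhom R P C e" "e ` carrier P = carrier C"
    "pd_le R n (subm P (ker P C e))" using pd_le_SucE[OF assms(3)] by blast
  note Pf = projective_fg[OF P(1)] note Pl = fg_left_module[OF Pf]
  obtain t where t: "mhom R P B t" "\<And>x. x \<in> carrier P \<Longrightarrow> p (t x) = e x"
    using proj_lift[OF P(1) Bf s(5,7,3) P(2)] by blast
  obtain U :: "'a umod" and j k a b where D: "biprod R A P U j k a b" "fg_module R U"
    using ex_biprod[OF Af Pf] by blast
  note d = biprodD[OF D(1)]
  interpret U: left_module R U by (rule d(3))
  obtain h where h: "mhom R U B h" "\<And>x. x \<in> carrier A \<Longrightarrow> h (j x) = i x" "\<And>x. x \<in> carrier P \<Longrightarrow> h (k x) = t x"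
    "\<And>u. u \<in> carrier U \<Longrightarrow> h u = i (a u) \<oplus>\<^bsub>B\<^esub> t (b u)"
    using biprod_copair[OF D(1) s(2) s(4) t(1)] by metis
  note c = mhom_closed[OF s(4)] mhom_closed[OF s(5)] mhom_closed[OF P(2)]
    mhom_closed[OF d(4)] mhom_closed[OF d(5)] mhom_closed[OF d(6)] mhom_closed[OF d(7)] mhom_closed[OF t(1)] mhom_closed[OF h(1)]
  let ?K = "ker P C e"
  have K: "submodule ?K R P" by (rule submodule_ker[OF Pl s(3) P(2)])
  have Kc: "x \<in> carrier P" "e x = \<zero>\<^bsub>C\<^esub>" if "x \<in> ?K" for x using that by (auto simp: ker_def)
  have "\<ominus>\<^bsub>B\<^esub> t x \<in> i ` carrier A" if "x \<in> carrier (subm P ?K)" for x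
    using that Kc[of x] c by (intro s(10)) (auto simp: mhom_neg[OF s(2,3,5)] t(2))
  then obtain f where f: "mhom R (subm P ?K) A f" "\<And>x. x \<in> ?K \<Longrightarrow> i (f x) = \<ominus>\<^bsub>B\<^esub> t x"
    using factor_through_mono[OF s(1) left_module_subm[OF Pl K] s(4,6) mhom_uminus[OF s(2) mhom_restrict_dom[OF t(1) K]]]
    by auto
  \<comment> \<open>\<open>v x\<close> is the pair of \<open>f x\<close> and \<open>x\<close>; the
    minus sign in the choice of \<open>f\<close> makes \<open>h\<close> kill it.\<close>
  obtain v where v: "mhom R (subm P ?K) U v" "\<And>x. x \<in> carrier (subm P ?K) \<Longrightarrow> a (v x) = f x"
    "\<And>x. x \<in> carrier (subm P ?K) \<Longrightarrow> b (v x) = x"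
    using biprod_pair[OF D(1) f(1) mhom_subm_incl[OF K]] by metis
  note v = v(1) v(2,3)[simplified]
  have vc: "v x \<in> carrier U" "f x \<in> carrier A" if "x \<in> ?K" for x
    using that mhom_closed[OF v(1), of x] mhom_closed[OF f(1), of x] by auto
  have "ses R (subm P ?K) U B v h"
  proof (rule sesI[OF left_module_subm[OF Pl K] d(3) s(2) v(1) h(1)])
    show "inj_on v (carrier (subm P ?K))" using v(3) by (intro inj_on_inverseI[of _ b]) simp
    show "h ` carrier U = carrier B"
    proof
      show "carrier B \<subseteq> h ` carrier U"
      proof
        fix y assume y: "y \<in> carrier B"
        then obtain x where x: "x \<in> carrier P" "e x = p y" using P(3) c by (metis imageE)
        have "p (y \<ominus>\<^bsub>B\<^esub> t x) = \<zero>\<^bsub>C\<^esub>" using x y c by (simp add: mhom_minus[OF s(2,3,5)] t(2))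
        then obtain z where z: "z \<in> carrier A" "y \<ominus>\<^bsub>B\<^esub> t x = i z" using s(10)[of "y \<ominus>\<^bsub>B\<^esub> t x"] x y c by auto
        have "h (j z \<oplus>\<^bsub>U\<^esub> k x) = i z \<oplus>\<^bsub>B\<^esub> t x" using x z c by (simp add: mhom_add[OF h(1)] h(2,3))
        also have "\<dots> = y" using z(2)[symmetric] x y c by simp
        finally show "y \<in> h ` carrier U" using x z c by (intro image_eqI[of _ _ "j z \<oplus>\<^bsub>U\<^esub> k x"]) auto
      qed
    qed (use mhom_closed[OF h(1)] in auto)
    show "h (v x) = \<zero>\<^bsub>B\<^esub>" if "x \<in> carrier (subm P ?K)" for x
      using that vc[of x] Kc[of x] c by (simp add: h(4) v(2,3) f(2) B.M.l_neg)
    fix u assume u: "u \<in> carrier U" "h u = \<zero>\<^bsub>B\<^esub>"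
    have "p (h u) = e (b u)" using u(1) c by (simp add: h(4) mhom_add[OF s(5)] s(9) t(2))
    then have bu: "b u \<in> ?K" using u c mhom_zero[OF s(2,3,5)] by (simp add: ker_def)
    have "i (a u) = \<ominus>\<^bsub>B\<^esub> t (b u)" using h(4)[OF u(1)] u(2) B.M.minus_equality[of "i (a u)" "t (b u)"] u(1) c by simp
    then have "i (a u) = i (f (b u))" using f(2)[OF bu] by simp
    then have "a u = f (b u)" by (rule inj_onD[OF s(6) _ mhom_closed[OF d(6) u(1)] vc(2)[OF bu]])
    then have "a u = a (v (b u))" "b u = b (v (b u))" using v(2,3)[OF bu] by simp_all
    then have "u = v (b u)" by (rule biprod_eqI[OF D(1) u(1) vc(1)[OF bu]])
    then show "u \<in> v ` carrier (subm P ?K)" using bu by auto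
  qed
  then have U: "pd_le R n U" by (rule pd_le_ext[OF _ D(2) P(4) assms(2)])
  show ?thesis
  proof (cases n)
    case 0
    then show ?thesis using U projective_retract[OF _ d(1,4,6,8)] by (simp add: pd_le_0)
  next
    case (Suc m)
    have "ses R P U A k a" by (rule ses_biprod[OF biprod_swap[OF D(1)]])
    then show ?thesis using pd_le_quotient pd_le_projective[OF P(1)] U Suc by blast
  qed
qed

text \<open>If \<open>P\<close> covers \<open>A\<close> and \<open>Q\<close> covers
  \<open>M\<close>, then \<open>P\<close> plus \<open>Q\<close> covers \<open>M\<close>, and the
  syzygy of \<open>A\<close> is a retract of this syzygy of \<open>M\<close>. The retraction adds to
  the first component the image of the second under a lift \<open>t\<close> of \<open>q\<close>
  followed by \<open>r\<close>.\<close>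

lemma pd_le_retract_step:
  fixes A :: "('a, 'm) module" and M :: "('a, 'n) module"
  assumes IH: "\<And>(A :: 'a umod) (M :: 'a umod) i r. pd_le R n M \<Longrightarrow> left_module R A \<Longrightarrow> mhom R A M i \<Longrightarrow> mhom R M A r \<Longrightarrow>
      (\<And>x. x \<in> carrier A \<Longrightarrow> r (i x) = x) \<Longrightarrow> pd_le R n A"
    and "pd_le R (Suc n) M" "left_module R A" "mhom R A M i" "mhom R M A r" "\<And>x. x \<in> carrier A \<Longrightarrow> r (i x) = x"
  shows "pd_le R (Suc n) A"
proof -
  note Mf = pd_le_fg[OF assms(2)] note Ml = fg_left_module[OF Mf]
  interpret A: left_module R A by fact
  interpret M: left_module R M by (rule Ml)
  have "r ` carrier M = carrier A" using assms(6) mhom_closed[OF assms(4)] mhom_closed[OF assms(5)] by force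
  then have Af: "fg_module R A" using fg_surj[OF Mf assms(3,5)] by simp
  obtain P :: "'a umod" and p where P: "projective R P" "mhom R P A p" "p ` carrier P = carrier A"
    using ex_projective_cover[OF Af] by blast
  obtain Q :: "'a umod" and q where Q: "projective R Q" "mhom R Q M q" "q ` carrier Q = carrier M"
    using ex_projective_cover[OF Mf] by blast
  note Pl = fg_left_module[OF projective_fg[OF P(1)]] and Ql = fg_left_module[OF projective_fg[OF Q(1)]]
  interpret P: left_module R P by (rule Pl)
  interpret Q: left_module R Q by (rule Ql)
  obtain U :: "'a umod" and j k a b where D: "biprod R P Q U j k a b" "fg_module R U"
    using ex_biprod[OF projective_fg[OF P(1)] projective_fg[OF Q(1)]] by blast
  note d = biprodD[OF D(1)]
  obtain h where h: "mhom R U M h" "\<And>x. x \<in> carrier P \<Longrightarrow> h (j x) = i (p x)" "\<And>x. x \<in> carrier Q \<Longrightarrow> h (k x) = q x"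
    "\<And>u. u \<in> carrier U \<Longrightarrow> h u = i (p (a u)) \<oplus>\<^bsub>M\<^esub> q (b u)"
    using biprod_copair[OF D(1) Ml mhom_comp[OF P(2) assms(4)] Q(2)] by metis
  note c = mhom_closed[OF assms(4)] mhom_closed[OF assms(5)] mhom_closed[OF P(2)] mhom_closed[OF Q(2)]
    mhom_closed[OF d(4)] mhom_closed[OF d(5)] mhom_closed[OF d(6)] mhom_closed[OF d(7)] mhom_closed[OF h(1)]
  have surj: "h ` carrier U = carrier M"
  proof
    show "carrier M \<subseteq> h ` carrier U"
    proof
      fix y assume "y \<in> carrier M"
      then obtain x where "x \<in> carrier Q" "y = q x" using Q(3) by (metis imageE)
      then show "y \<in> h ` carrier U" using h(3) c by (metis imageI)
    qed
  qed (use mhom_closed[OF h(1)] in auto)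
  let ?L = "ker P A p" and ?N = "ker U M h"
  have L: "submodule ?L R P" and N: "submodule ?N R U"
    using submodule_ker[OF Pl assms(3) P(2)] submodule_ker[OF d(3) Ml h(1)] by auto
  have pdN: "pd_le R n (subm U ?N)"
    by (rule pd_le_sub[OF ses_ker[OF d(3) Ml h(1) surj] pd_le_projective assms(2)])
      (rule projective_biprod[OF D(1) P(1) Q(1)])
  obtain t where t: "mhom R Q P t" "\<And>x. x \<in> carrier Q \<Longrightarrow> p (t x) = r (q x)"
    using proj_lift[OF Q(1) projective_fg[OF P(1)] P(2,3) assms(3) mhom_comp[OF Q(2) assms(5)]] by blast
  let ?r = "\<lambda>u. a u \<oplus>\<^bsub>P\<^esub> t (b u)"
  have "mhom R (subm P ?L) (subm U ?N) j"
    by (rule mhom_to_subm[OF mhom_restrict_dom[OF d(4) L]])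
      (auto simp: ker_def c h(2) mhom_zero[OF assms(3) Ml assms(4)])
  moreover have "mhom R (subm U ?N) (subm P ?L) ?r"
  proof (rule mhom_to_subm[OF mhom_restrict_dom[OF _ N]])
    show "mhom R U P ?r" by (rule mhom_plus[OF Pl d(6) mhom_comp[OF d(7) t(1)]])
    fix u assume "u \<in> carrier (subm U ?N)"
    then have u: "u \<in> carrier U" "h u = \<zero>\<^bsub>M\<^esub>" by (auto simp: ker_def)
    have "p (?r u) = r (h u)" using u(1) c mhom_closed[OF t(1)]
      by (simp add: mhom_add[OF P(2)] t(2) h(4) mhom_add[OF assms(5)] assms(6))
    then show "?r u \<in> ?L" using u c mhom_closed[OF t(1)] mhom_zero[OF Ml assms(3,5)] by (simp add: ker_def)
  qed
  moreover have "?r (j x) = x" if "x \<in> carrier (subm P ?L)" for x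
    using that mhom_zero[OF Ql Pl t(1)] by (simp add: ker_def d(8,9))
  ultimately have "pd_le R n (subm P ?L)"
    using IH[OF pdN left_module_subm[OF Pl L]] by blast
  then show ?thesis by (rule pd_le_SucI[OF P assms(3)])
qed

lemma pd_le_retract_umod:
  fixes A M :: "'a umod"
  assumes "pd_le R n M" "left_module R A" "mhom R A M i" "mhom R M A r" "\<And>x. x \<in> carrier A \<Longrightarrow> r (i x) = x"
  shows "pd_le R n A"
  using assms
proof (induction n arbitrary: A M i r)
  case 0
  then show ?case using projective_retract[of R M A i r] by (simp add: pd_le_0)
next
  case (Suc n)
  show ?case by (rule pd_le_retract_step[OF Suc.IH Suc.prems])
qed

lemma pd_le_retract:
  fixes A :: "('a, 'm) module" and M :: "('a, 'n) module"
  assumes "pd_le R n M" "left_module R A" "mhom R A M i" "mhom R M A r" "\<And>x. x \<in> carrier A \<Longrightarrow> r (i x) = x"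
  shows "pd_le R n A"
proof (cases n)
  case 0
  then show ?thesis using assms projective_retract[of R M A i r] by (simp add: pd_le_0)
next
  case (Suc m)
  show ?thesis unfolding Suc
    by (rule pd_le_retract_step[OF _ _ assms(2-5)], erule (3) pd_le_retract_umod) (use assms(1) Suc in auto)
qed

lemma pd_le_dsum:
  assumes "\<And>i. i < n \<Longrightarrow> pd_le R m (M i)"
  shows "pd_le R m (dsum n M)"
  using assms
proof (induction n)
  case 0
  show ?case by (rule pd_le_projective[OF projective_zero[OF zero_dsum]])
next
  case (Suc n)
  have l: "left_module R (M i)" if "i \<le> n" for i
    using Suc.prems[of i] that by (auto dest!: pd_le_fg fg_left_module)
  have f: "fg_module R (dsum (Suc n) M)" using Suc.prems by (intro fg_dsum) (auto dest: pd_le_fg)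
  show ?case by (rule pd_le_ext[OF ses_biprod[OF biprod_dsum_Suc[OF ring_axioms l]] f]) (use Suc in auto)
qed

subsection \<open>Comparison with resolutions\<close>

lemma resolution_zero:
  fixes M :: "('a, 'm) module" and P :: "nat \<Rightarrow> 'a umod"
  assumes "left_module R M" "projective_resolution R M P d e" "\<forall>i>0. zero_module (P i)"
  shows "pd_le R 0 M"
proof -
  have P: "projective R (P 0)" "projective R (P 1)" and e: "mhom R (P 0) M e" "e ` carrier (P 0) = carrier M"
    and d: "mhom R (P 1) (P 0) (d 0)" and k: "d 0 ` carrier (P 1) = ker (P 0) M e"
    using assms(2) by (auto simp: projective_resolution_def mod_epi_def lin_iff a_kernel_ker)
  note P0 = fg_left_module[OF projective_fg[OF P(1)]]
  have "ker (P 0) M e = {\<zero>\<^bsub>P 0\<^esub>}"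
    using k assms(3) mhom_zero[OF fg_left_module[OF projective_fg[OF P(2)]] P0 d] by (simp add: zero_module_def)
  then have "inj_on e (carrier (P 0))" using mhom_inj_iff[OF P0 assms(1) e(1)] by (auto simp: ker_def)
  then show ?thesis
    using projective_miso[OF P(1) assms(1) misoI_bij[OF P0 e(1) _ e(2)]] by (simp add: pd_le_0)
qed

text \<open>The first differential becomes the augmentation of the tail; corestricting it to its
  image does not change its kernel.\<close>

lemma resolution_shift:
  fixes M :: "('a, 'm) module" and P :: "nat \<Rightarrow> 'a umod"
  assumes "projective_resolution R M P d e"
  shows "projective_resolution R (subm (P 0) (ker (P 0) M e)) (\<lambda>n. P (Suc n)) (\<lambda>n. d (Suc n)) (d 0)"
proof -
  have d0: "d 0 \<in> lin R (P (Suc 0)) (P 0)" and k: "d 0 ` carrier (P (Suc 0)) = ker (P 0) M e"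
    and d1: "d (Suc 0) ` carrier (P (Suc (Suc 0))) = ker (P (Suc 0)) (P 0) (d 0)"
    using assms by (auto simp: projective_resolution_def a_kernel_ker)
  have "d 0 \<in> lin R (P (Suc 0)) (subm (P 0) (ker (P 0) M e))"
    unfolding lin_iff k[symmetric] using d0 by (auto simp: lin_iff intro!: mhom_to_subm)
  moreover have "ker (P (Suc 0)) (subm (P 0) (ker (P 0) M e)) (d 0) = ker (P (Suc 0)) (P 0) (d 0)"
    by (simp add: ker_def)
  ultimately show ?thesis
    using assms d1 k by (simp add: projective_resolution_def mod_epi_def a_kernel_ker)
qed

lemma resolution_pd_le_umod:
  fixes M :: "'a umod" and P :: "nat \<Rightarrow> 'a umod"
  assumes "left_module R M" "projective_resolution R M P d e" "\<forall>i>n. zero_module (P i)"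
  shows "pd_le R n M"
  using assms
proof (induction n arbitrary: M P d e)
  case 0
  then show ?case by (rule resolution_zero)
next
  case (Suc n)
  have P: "projective R (P 0)" and e: "mhom R (P 0) M e" "e ` carrier (P 0) = carrier M"
    using Suc.prems(2) by (auto simp: projective_resolution_def mod_epi_def lin_iff)
  note P0 = fg_left_module[OF projective_fg[OF P]]
  have "pd_le R n (subm (P 0) (ker (P 0) M e))"
    by (rule Suc.IH[OF left_module_subm[OF P0 submodule_ker[OF P0 Suc.prems(1) e(1)]] resolution_shift[OF Suc.prems(2)]])
      (use Suc.prems(3) in auto)
  then show ?case by (rule pd_le_SucI[OF P e Suc.prems(1)])
qed

lemma resolution_pd_le:
  fixes M :: "('a, 'm) module" and P :: "nat \<Rightarrow> 'a umod"
  assumes "left_module R M" "projective_resolution R M P d e" "\<forall>i>n. zero_module (P i)"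
  shows "pd_le R n M"
proof (cases n)
  case 0
  then show ?thesis using resolution_zero[OF assms(1,2)] assms(3) by simp
next
  case (Suc m)
  have P: "projective R (P 0)" and e: "mhom R (P 0) M e" "e ` carrier (P 0) = carrier M"
    using assms(2) by (auto simp: projective_resolution_def mod_epi_def lin_iff)
  note P0 = fg_left_module[OF projective_fg[OF P]]
  have "pd_le R m (subm (P 0) (ker (P 0) M e))"
    by (rule resolution_pd_le_umod[OF left_module_subm[OF P0 submodule_ker[OF P0 assms(1) e(1)]] resolution_shift[OF assms(2)]])
      (use assms(3) Suc in auto)
  then show ?thesis unfolding Suc by (rule pd_le_SucI[OF P e assms(1)])
qed

lemma ex_zero_umod: "\<exists>Z :: 'a umod. left_module R Z \<and> zero_module Z \<and> projective R Z"
proof -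
  obtain Z :: "'a umod" and f g where Z: "fg_module R Z" "miso R (dsum 0 (\<lambda>_. regular R)) Z f g"
    using ex_umod[OF projective_fg[OF projective_zero[OF zero_dsum(1,2)]]] by blast
  note l = fg_left_module[OF Z(1)]
  have "carrier Z = {\<zero>\<^bsub>Z\<^esub>}" using misoD(7)[OF Z(2)] zero_dsum(2) mhom_zero[OF zero_dsum(1) l misoD(1)[OF Z(2)]] by (metis image_empty image_insert)
  then show ?thesis using l projective_zero by (auto simp: zero_module_def)
qed

lemma pd_le_resolution_0:
  fixes M :: "('a, 'm) module"
  assumes "pd_le R 0 M"
  shows "\<exists>(P :: nat \<Rightarrow> 'a umod) d e. projective_resolution R M P d e \<and> (\<forall>i>0. zero_module (P i))"
proof -
  have M: "projective R M" using assms by (simp add: pd_le_0)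
  note Mf = projective_fg[OF M] note Ml = fg_left_module[OF Mf]
  obtain U :: "'a umod" and f g where U: "fg_module R U" "miso R M U f g" using ex_umod[OF Mf] by blast
  note Ul = fg_left_module[OF U(1)] and d = misoD[OF U(2)]
  have PU: "projective R U" by (rule projective_miso[OF M Ul U(2)])
  obtain Z :: "'a umod" where Z: "left_module R Z" "zero_module Z" "projective R Z" using ex_zero_umod by blast
  let ?P = "\<lambda>n::nat. if n = 0 then U else Z"
  let ?d = "\<lambda>n. lin_zero (?P (Suc n)) (?P n)"
  have dl: "?d n \<in> lin R (?P (Suc n)) (?P n)" for n
    using lin_restrict[OF Z(1) mhom_const_zero[OF Ul]] lin_restrict[OF Z(1) mhom_const_zero[OF Z(1)]] by (simp add: lin_zero_def)
  have "ker U M (restrict g (carrier U)) = {\<zero>\<^bsub>U\<^esub>}"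
  proof -
    have "{x \<in> carrier U. g x = \<zero>\<^bsub>M\<^esub>} \<subseteq> {\<zero>\<^bsub>U\<^esub>}"
      using iffD1[OF mhom_inj_iff[OF Ul Ml d(2)] d(6)] by blast
    moreover have "ker U M (restrict g (carrier U)) = {x \<in> carrier U. g x = \<zero>\<^bsub>M\<^esub>}" by (auto simp: ker_def)
    ultimately show ?thesis using mhom_zero[OF Ul Ml d(2)] submodule_zero[OF submodule_carrier[OF Ul]] by auto
  qed
  moreover have "restrict g (carrier U) ` carrier U = carrier M" using d(8) by simp
  ultimately have "projective_resolution R M ?P ?d (restrict g (carrier U))"
    using PU Z dl lin_restrict[OF Ul d(2)]
    by (auto simp: projective_resolution_def mod_epi_def a_kernel_ker lin_zero_def zero_module_def ker_def)
  then show ?thesis using Z(2) by (intro exI[of _ ?P] exI) auto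
qed

lemma resolution_Cons:
  fixes M :: "('a, 'm) module" and P :: "nat \<Rightarrow> 'a umod" and P0 :: "'a umod"
  assumes "projective R P0" "mhom R P0 M e" "e ` carrier P0 = carrier M" "left_module R M"
    "projective_resolution R (subm P0 (ker P0 M e)) P d e'"
  shows "projective_resolution R M (case_nat P0 P) (case_nat e' d) (restrict e (carrier P0))"
proof -
  note P0 = fg_left_module[OF projective_fg[OF assms(1)]]
  have K: "submodule (ker P0 M e) R P0" by (rule submodule_ker[OF P0 assms(4,2)])
  have e': "e' \<in> lin R (P 0) P0" "e' ` carrier (P 0) = ker P0 M e"
    using assms(5) mhom_from_subm[OF _ K] by (auto simp: projective_resolution_def mod_epi_def lin_iff)
  have "restrict e (carrier P0) \<in> lin R P0 M" by (rule lin_restrict[OF P0 assms(2)])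
  moreover have "ker P0 M (restrict e (carrier P0)) = ker P0 M e" by (auto simp: ker_def)
  moreover have "ker (P 0) P0 e' = ker (P 0) (subm P0 (ker P0 M e)) e'" by (simp add: ker_def)
  ultimately show ?thesis
    using assms(1,3,5) e'
    by (auto simp: projective_resolution_def mod_epi_def a_kernel_ker split: nat.splits)
qed

lemma pd_le_resolution_umod:
  fixes M :: "'a umod"
  assumes "pd_le R n M"
  shows "\<exists>(P :: nat \<Rightarrow> 'a umod) d e. projective_resolution R M P d e \<and> (\<forall>i>n. zero_module (P i))"
  using assms
proof (induction n arbitrary: M)
  case 0
  then show ?case by (rule pd_le_resolution_0)
next
  case (Suc n)
  note M = fg_left_module[OF pd_le_fg[OF Suc.prems]]
  obtain P0 :: "'a umod" and e where P0: "projective R P0" "mhom R P0 M e" "e ` carrier P0 = carrier M"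
    "pd_le R n (subm P0 (ker P0 M e))" using pd_le_SucE[OF Suc.prems] by blast
  obtain P :: "nat \<Rightarrow> 'a umod" and d e' where P: "projective_resolution R (subm P0 (ker P0 M e)) P d e'"
    "\<forall>i>n. zero_module (P i)" using Suc.IH[OF P0(4)] by blast
  show ?case using resolution_Cons[OF P0(1-3) M P(1)] P(2) by (intro exI conjI) (auto split: nat.splits)
qed

lemma pd_le_resolution:
  fixes M :: "('a, 'm) module"
  assumes "pd_le R n M"
  shows "\<exists>(P :: nat \<Rightarrow> 'a umod) d e. projective_resolution R M P d e \<and> (\<forall>i>n. zero_module (P i))"
proof (cases n)
  case 0
  then show ?thesis using pd_le_resolution_0 assms by simp
next
  case (Suc m)
  note M = fg_left_module[OF pd_le_fg[OF assms]]
  obtain P0 :: "'a umod" and e where P0: "projective R P0" "mhom R P0 M e" "e ` carrier P0 = carrier M"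
    "pd_le R m (subm P0 (ker P0 M e))" using pd_le_SucE assms Suc by blast
  obtain P :: "nat \<Rightarrow> 'a umod" and d e' where P: "projective_resolution R (subm P0 (ker P0 M e)) P d e'"
    "\<forall>i>m. zero_module (P i)" using pd_le_resolution_umod[OF P0(4)] by blast
  show ?thesis using resolution_Cons[OF P0(1-3) M P(1)] P(2) Suc by (intro exI conjI) (auto split: nat.splits)
qed

text \<open>The infimum is attained because a finite bound excludes the empty set of lengths, whose
  infimum would be infinite.\<close>

lemma projdim_le_iff:
  fixes M :: "('a, 'm) module"
  assumes "left_module R M"
  shows "projdim R M \<le> enat n \<longleftrightarrow> pd_le R n M"
proof
  let ?S = "{enat n | n. \<exists>(P :: nat \<Rightarrow> 'a umod) d e. projective_resolution R M P d e \<and> (\<forall>i>n. zero_module (P i))}"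
  assume "pd_le R n M"
  then have "enat n \<in> ?S" using pd_le_resolution by blast
  then show "projdim R M \<le> enat n" unfolding projdim_def by (rule Inf_lower)
next
  let ?S = "{enat n | n. \<exists>(P :: nat \<Rightarrow> 'a umod) d e. projective_resolution R M P d e \<and> (\<forall>i>n. zero_module (P i))}"
  assume le: "projdim R M \<le> enat n"
  have "?S \<noteq> {}"
  proof
    assume "?S = {}"
    then have "projdim R M = \<infinity>" unfolding projdim_def by (simp add: Inf_enat_def)
    then show False using le by simp
  qed
  then have "projdim R M \<in> ?S" unfolding projdim_def Inf_enat_def by (metis (no_types, lifting) LeastI ex_in_conv)
  then obtain m P d e where m: "projdim R M = enat m" "projective_resolution R M (P :: nat \<Rightarrow> 'a umod) d e" "\<forall>i>m. zero_module (P i)"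
    by blast
  have "pd_le R m M" by (rule resolution_pd_le[OF assms m(2,3)])
  then show "pd_le R n M" by (rule pd_le_mono[rotated]) (use le m(1) in auto)
qed

lemma gldim_le_iff: "gldim R \<le> enat n \<longleftrightarrow> (\<forall>M :: 'a umod. fg_module R M \<longrightarrow> pd_le R n M)"
  unfolding gldim_def using projdim_le_iff fg_left_module by (force simp: Sup_le_iff)

lemma gldim_le_pd_le:
  fixes M :: "('a, 'm) module"
  assumes "gldim R \<le> enat n" "fg_module R M"
  shows "pd_le R n M"
proof -
  obtain U :: "'a umod" and f g where U: "fg_module R U" "miso R M U f g" using ex_umod[OF assms(2)] by blast
  then show ?thesis using pd_le_miso[OF miso_sym[OF U(2)] fg_left_module[OF assms(2)]] assms(1) by (simp add: gldim_le_iff)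
qed

end

section \<open>Commutative artinian rings\<close>

definition adjoin :: "('a, 'c) ring_scheme \<Rightarrow> ('a, 'm) module \<Rightarrow> 'm set \<Rightarrow> 'm \<Rightarrow> 'm set" where
  "adjoin R M N x = {u \<oplus>\<^bsub>M\<^esub> b \<odot>\<^bsub>M\<^esub> x | u b. u \<in> N \<and> b \<in> carrier R}"

lemma adjoin:
  assumes "left_module R M" "submodule N R M" "x \<in> carrier M"
  shows submodule_adjoin: "submodule (adjoin R M N x) R M"
    and adjoin_superset: "N \<subseteq> adjoin R M N x"
    and adjoin_mem: "x \<in> adjoin R M N x"
proof -
  interpret M: left_module R M by fact
  note N = submodule_carrierD[OF assms(2)] submodule_zero[OF assms(2)] submodule_add[OF assms(2)] submodule_smult[OF assms(2)]
  have I: "u \<oplus>\<^bsub>M\<^esub> b \<odot>\<^bsub>M\<^esub> x \<in> adjoin R M N x" if "u \<in> N" "b \<in> carrier R" for u b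
    using that by (auto simp: adjoin_def)
  have D: "\<exists>u b. u \<in> N \<and> b \<in> carrier R \<and> y = u \<oplus>\<^bsub>M\<^esub> b \<odot>\<^bsub>M\<^esub> x" if "y \<in> adjoin R M N x" for y
    using that by (auto simp: adjoin_def)
  show sup: "N \<subseteq> adjoin R M N x"
  proof
    fix u assume "u \<in> N"
    then show "u \<in> adjoin R M N x" using I[of u "\<zero>\<^bsub>R\<^esub>"] N(1) assms(3) by simp
  qed
  show "x \<in> adjoin R M N x" using I[OF N(2) M.R.one_closed] assms(3) by simp
  show "submodule (adjoin R M N x) R M"
  proof (rule submoduleI'[OF assms(1)])
    show "adjoin R M N x \<subseteq> carrier M" using N(1) assms(3) by (auto simp: adjoin_def)
    show "\<zero>\<^bsub>M\<^esub> \<in> adjoin R M N x" using sup N(2) by blast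
  next
    fix y z assume "y \<in> adjoin R M N x" "z \<in> adjoin R M N x"
    then obtain u b v c where *: "u \<in> N" "b \<in> carrier R" "y = u \<oplus>\<^bsub>M\<^esub> b \<odot>\<^bsub>M\<^esub> x"
      "v \<in> N" "c \<in> carrier R" "z = v \<oplus>\<^bsub>M\<^esub> c \<odot>\<^bsub>M\<^esub> x" using D by meson
    have "y \<oplus>\<^bsub>M\<^esub> z = (u \<oplus>\<^bsub>M\<^esub> v) \<oplus>\<^bsub>M\<^esub> (b \<oplus>\<^bsub>R\<^esub> c) \<odot>\<^bsub>M\<^esub> x"
      using * N(1) assms(3) by (simp add: M.smult_l_distr M.M.a_ac)
    then show "y \<oplus>\<^bsub>M\<^esub> z \<in> adjoin R M N x" using I * N(3) by simp
  next
    fix a y assume a: "a \<in> carrier R" and "y \<in> adjoin R M N x"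
    then obtain u b where *: "u \<in> N" "b \<in> carrier R" "y = u \<oplus>\<^bsub>M\<^esub> b \<odot>\<^bsub>M\<^esub> x" using D by meson
    have "a \<odot>\<^bsub>M\<^esub> y = a \<odot>\<^bsub>M\<^esub> u \<oplus>\<^bsub>M\<^esub> (a \<otimes>\<^bsub>R\<^esub> b) \<odot>\<^bsub>M\<^esub> x"
      using * a N(1) assms(3) by (simp add: M.smult_r_distr M.smult_assoc)
    then show "a \<odot>\<^bsub>M\<^esub> y \<in> adjoin R M N x" using I * N(4) a by simp
  qed
qed

text \<open>The quotient by \<open>N\<close> has no submodules besides zero and itself, so a rank
  with values 0 and 1 bounds its length by one.\<close>

lemma len_le_maximal:
  assumes "left_module R M" "submodule N R M" "len_le R (subm M N) n"
    "\<And>L. submodule L R M \<Longrightarrow> N \<subseteq> L \<Longrightarrow> L = N \<or> L = carrier M"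
  shows "len_le R M (n + 1)"
proof -
  interpret M: left_module R M by fact
  let ?Q = "quot_module M N" and ?p = "\<lambda>x. N +>\<^bsub>M\<^esub> x"
  note Q = left_module_quot[OF assms(1,2)] mhom_quot[OF assms(1,2)] quot_surj[OF assms(1,2)] quot_zero_iff[OF assms(1,2)]
  interpret Q: left_module R ?Q by (rule Q(1))
  have triv: "L = {\<zero>\<^bsub>?Q\<^esub>} \<or> L = carrier ?Q" if L: "submodule L R ?Q" for L
  proof -
    let ?L = "{x \<in> carrier M. ?p x \<in> L}"
    have im: "?p ` ?L = L"
    proof
      show "L \<subseteq> ?p ` ?L"
      proof
        fix y assume y: "y \<in> L"
        then have "y \<in> carrier ?Q" by (rule submodule_carrierD[OF L])
        then obtain x where "x \<in> carrier M" "y = ?p x" using Q(3) by (metis imageE)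
        then show "y \<in> ?p ` ?L" using y by blast
      qed
    qed auto
    have "submodule ?L R M" by (rule submodule_vimage[OF assms(1) Q(1,2) L])
    moreover have "N \<subseteq> ?L"
      using submodule_carrierD[OF assms(2)] Q(4) submodule_zero[OF L] by (metis (mono_tags, lifting) mem_Collect_eq subsetI)
    ultimately consider "?L = N" | "?L = carrier M" using assms(4) by blast
    then show ?thesis
    proof cases
      case 1
      have "?p x = \<zero>\<^bsub>?Q\<^esub>" if "x \<in> N" for x using that Q(4)[OF submodule_carrierD[OF assms(2) that]] by simp
      then have "?p ` N \<subseteq> {\<zero>\<^bsub>?Q\<^esub>}" by auto
      then have "L \<subseteq> {\<zero>\<^bsub>?Q\<^esub>}" using im 1 by simp
      then show ?thesis using submodule_zero[OF L] by blast
    next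
      case 2
      then show ?thesis using im Q(3) by simp
    qed
  qed
  have "len_le R ?Q 1"
  proof (rule len_leI[of _ _ "\<lambda>L. if L = {\<zero>\<^bsub>?Q\<^esub>} then 0 else 1"])
    fix L L' assume *: "submodule L R ?Q" "submodule L' R ?Q" "L \<subset> L'"
    then have "L = {\<zero>\<^bsub>?Q\<^esub>}" using triv[OF *(1)] submodule_subset[OF *(2)] by blast
    then show "(if L = {\<zero>\<^bsub>?Q\<^esub>} then 0 else 1) < (if L' = {\<zero>\<^bsub>?Q\<^esub>} then 0 else 1 :: nat)"
      using *(3) by auto
  qed simp
  moreover have "ker M ?Q ?p = N" using Q(4) submodule_carrierD[OF assms(2)] by (auto simp: ker_def)
  ultimately show ?thesis using len_le_ext[OF assms(1) Q(1,2), of 1 n] assms(3) by simp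
qed

locale comm_ring_reg = R?: cring R for R :: "('a, 'c) ring_scheme" (structure)
begin

lemma reg_simps [simp]:
  "carrier (regular R) = carrier R" "\<zero>\<^bsub>regular R\<^esub> = \<zero>" "x \<oplus>\<^bsub>regular R\<^esub> y = x \<oplus> y" "a \<odot>\<^bsub>regular R\<^esub> x = a \<otimes> x"
  by (auto simp: regular_def)

lemma reg_minus: "x \<ominus>\<^bsub>regular R\<^esub> y = x \<ominus> y"
  by (simp add: a_minus_def a_inv_def m_inv_def regular_def)

lemma reg: "left_module R (regular R)"
  by (rule left_module_regular[OF ring_axioms])

text \<open>Makes the lemmas on length and on extremal submodules available for ideals.\<close>

lemma submodule_reg_iff: "submodule I R (regular R) \<longleftrightarrow> ideal I R"
proof
  assume I: "submodule I R (regular R)"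
  have "\<ominus> x \<in> I" if "x \<in> I" for x
    using submodule_smult[OF I, of "\<ominus> \<one>" x] submodule_carrierD[OF I that] that by (simp add: l_minus)
  then have "subgroup I (add_monoid R)"
    using submodule_subset[OF I] submodule_zero[OF I] submodule_add[OF I] by (intro add.subgroupI) auto
  moreover have l: "x \<otimes> a \<in> I" if "a \<in> I" "x \<in> carrier R" for a x
    using submodule_smult[OF I that(2,1)] by simp
  moreover have "a \<otimes> x \<in> I" if "a \<in> I" "x \<in> carrier R" for a x
    using l[OF that] m_comm[OF _ that(2), of a] submodule_carrierD[OF I that(1)] by simp
  ultimately show "ideal I R" by (intro idealI ring_axioms)
next
  assume "ideal I R"
  then interpret I: ideal I R .
  show "submodule I R (regular R)" by (rule submoduleI'[OF reg]) (auto simp: I.I_l_closed)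
qed

text \<open>Being maximal among ideals without the unit is the form in which \<open>len_max\<close>
  delivers such ideals.\<close>

lemma maximalideal_iff:
  "maximalideal I R \<longleftrightarrow> submodule I R (regular R) \<and> \<one> \<notin> I \<and>
     (\<forall>J. submodule J R (regular R) \<and> I \<subseteq> J \<and> \<one> \<notin> J \<longrightarrow> J = I)"
proof -
  have one: "\<one> \<in> J \<longleftrightarrow> J = carrier R" if "ideal J R" for J
    using ideal.one_imp_carrier[OF that] by auto
  have sub: "J \<subseteq> carrier R" if "ideal J R" for J using submodule_subset[of J R "regular R"] that submodule_reg_iff by auto
  show ?thesis
    unfolding submodule_reg_iff maximalideal_def maximalideal_axioms_def using one sub by blast
qed

lemma maximal_add:
  assumes "maximalideal m R" "a \<in> carrier R" "a \<notin> m"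
  obtains u b where "u \<in> m" "b \<in> carrier R" "\<one> = u \<oplus> b \<otimes> a"
proof -
  have m: "submodule m R (regular R)" using assms(1) maximalideal_iff by blast
  note ad = adjoin[OF reg m, of a]
  have "\<one> \<in> adjoin R (regular R) m a"
    using assms ad maximalideal_iff[of m] by auto
  then show ?thesis using that by (auto simp: adjoin_def)
qed

lemma mult_mhom:
  assumes "left_module R X" "b \<in> carrier R"
  shows "mhom R X X (\<lambda>x. b \<odot>\<^bsub>X\<^esub> x)"
proof -
  interpret X: left_module R X by fact
  show ?thesis using assms(2) by (intro mhomI) (auto simp: X.smult_r_distr X.smult_assoc[symmetric] m_comm)
qed

end

locale artinian = comm_ring_reg R for R :: "('a, 'c) ring_scheme" (structure) +
  assumes artinian: "artinian_ring R"
begin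

text \<open>Without a minimal element, dependent choice would produce a strictly descending sequence
  of ideals.\<close>

lemma ideal_min:
  assumes "submodule I\<^sub>0 R (regular R)" "P I\<^sub>0"
  obtains I where "submodule I R (regular R)" "P I" "\<And>J. submodule J R (regular R) \<Longrightarrow> P J \<Longrightarrow> J \<subseteq> I \<Longrightarrow> J = I"
proof -
  let ?Q = "\<lambda>I. submodule I R (regular R) \<and> P I"
  have "\<exists>I. ?Q I \<and> (\<forall>J. ?Q J \<and> J \<subseteq> I \<longrightarrow> J = I)"
  proof (rule ccontr)
    assume "\<not> ?thesis"
    then have ex: "\<exists>J. ?Q J \<and> J \<subset> I" if "?Q I" for I using that by blast
    obtain f where f: "\<And>n. ?Q (f n)" "\<And>n. f (Suc n) \<subset> f n"
      using dependent_nat_choice[of "\<lambda>_ I. ?Q I" "\<lambda>_ I J. J \<subset> I"] assms ex by metis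
    have "\<forall>n. ideal (f n) R \<and> f (Suc n) \<subseteq> f n" using f submodule_reg_iff by blast
    then obtain N where N: "\<forall>n\<ge>N. f n = f N" using artinian unfolding artinian_ring_def by blast
    have "f (Suc N) = f N" by (rule N[rule_format]) simp
    then show False using f(2)[of N] by simp
  qed
  then show ?thesis using that by blast
qed

text \<open>Hopkins' theorem by a minimal counterexample \<open>A\<close>, an ideal minimal among
  those of infinite length. Ring elements act on \<open>A\<close> by zero or invertibly, so
  \<open>A\<close> behaves like a vector space over a field; it then has a maximal subideal, which
  has finite length by minimality, and so does \<open>A\<close>.\<close>

lemma finite_length: "\<exists>n. len_le R (regular R) n"
proof (rule ccontr)
  assume no: "\<nexists>n. len_le R (regular R) n"
  let ?fl = "\<lambda>I. \<exists>n. len_le R (subm (regular R) I) n"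
  have nfl: "\<not> ?fl (carrier R)" using no by (simp add: regular_def)
  have car: "submodule (carrier R) R (regular R)" using submodule_carrier[OF reg] by simp
  obtain A where A: "submodule A R (regular R)" "\<not> ?fl A"
    "\<And>J. submodule J R (regular R) \<Longrightarrow> \<not> ?fl J \<Longrightarrow> J \<subseteq> A \<Longrightarrow> J = A"
    by (rule ideal_min[where P = "\<lambda>I. \<not> ?fl I", OF car nfl]) (rule that)
  let ?A = "subm (regular R) A"
  have Al: "left_module R ?A" by (rule left_module_subm[OF reg A(1)])
  note Ac = submodule_carrierD[OF A(1), simplified]
  have flP: "?fl J" if "submodule J R (regular R)" "J \<subset> A" for J using A(3)[OF that(1)] that(2) by blast
  \<comment> \<open>Otherwise the image and the kernel of multiplication by \<open>r\<close> are
    both proper in \<open>A\<close>, hence of finite length, and \<open>A\<close> is an extension of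
    the one by the other.\<close>
  have dich: "(\<lambda>x. r \<otimes> x) ` A = A \<or> (\<forall>x\<in>A. r \<otimes> x = \<zero>)" if r: "r \<in> carrier R" for r
  proof (rule ccontr)
    assume n: "\<not> ?thesis"
    have mu: "mhom R ?A ?A (\<lambda>x. r \<otimes> x)"
      using mult_mhom[OF Al r] by simp
    have "submodule ((\<lambda>x. r \<otimes> x) ` A) R ?A" using submodule_range[OF Al Al mu] by simp
    moreover have sub: "(\<lambda>x. r \<otimes> x) ` A \<subseteq> A" using mhom_closed[OF mu] by auto
    ultimately have im: "submodule ((\<lambda>x. r \<otimes> x) ` A) R (regular R)" using submodule_subm[OF reg A(1)] by blast
    obtain n1 where n1: "len_le R (subm (regular R) ((\<lambda>x. r \<otimes> x) ` A)) n1"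
      using flP[OF im] n sub by blast
    let ?I = "(\<lambda>x. r \<otimes> x) ` A" and ?K = "{x \<in> A. r \<otimes> x = \<zero>}"
    have mu': "mhom R ?A (subm (regular R) ?I) (\<lambda>x. r \<otimes> x)"
      using mu by (auto simp: mhom_def)
    note Il = left_module_subm[OF reg im]
    have k: "ker ?A (subm (regular R) ?I) (\<lambda>x. r \<otimes> x) = ?K" by (auto simp: ker_def)
    have "submodule ?K R ?A" using submodule_ker[OF Al Il mu'] k by simp
    then have "submodule ?K R (regular R)" using submodule_subm[OF reg A(1), of ?K] by auto
    moreover have "?K \<subset> A" using n by blast
    ultimately obtain n2 where "len_le R (subm (regular R) ?K) n2" using flP by blast
    then have "len_le R ?A (n2 + n1)" using len_le_ext[OF Al Il mu' n1] k by simp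
    then show False using A(2) by blast
  qed
  \<comment> \<open>The ideals generated by the powers of \<open>r\<close> become stationary, so
    some power \<open>N\<close> of \<open>r\<close> is \<open>s\<close> times the next power. Every
    element of \<open>A\<close> is divisible by that power, so \<open>s\<close> inverts
    \<open>r\<close> on \<open>A\<close>.\<close>
  have inv: "\<exists>s\<in>carrier R. \<forall>x\<in>A. s \<otimes> (r \<otimes> x) = x" if r: "r \<in> carrier R" "\<not> (\<forall>x\<in>A. r \<otimes> x = \<zero>)" for r
  proof -
    have rA: "(\<lambda>x. r \<otimes> x) ` A = A" using dich r by blast
    have rnA: "\<forall>x\<in>A. \<exists>y\<in>A. x = (r [^] n) \<otimes> y" for n :: nat
    proof (induction n)
      case 0
      then show ?case using Ac by auto
    next
      case (Suc n)
      show ?case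
      proof
        fix x assume "x \<in> A"
        then obtain y where y: "y \<in> A" "x = (r [^] n) \<otimes> y" using Suc by blast
        then obtain z where "z \<in> A" "y = r \<otimes> z" using rA by (metis imageE)
        then show "\<exists>y\<in>A. x = (r [^] Suc n) \<otimes> y" using y r Ac by (intro bexI[of _ z]) (auto simp: m_assoc)
      qed
    qed
    let ?I = "\<lambda>n::nat. (\<lambda>c. c \<otimes> (r [^] n)) ` carrier R"
    have I: "submodule (?I n) R (regular R)" for n
      using submodule_range[OF reg reg mhom_regular[OF reg, of "r [^] n"]] r by simp
    have ex: "\<exists>n. ?I 0 = ?I n" by blast
    obtain J where J: "submodule J R (regular R)" "\<exists>n. J = ?I n"
      "\<And>J'. submodule J' R (regular R) \<Longrightarrow> \<exists>n. J' = ?I n \<Longrightarrow> J' \<subseteq> J \<Longrightarrow> J' = J"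
      by (rule ideal_min[where P = "\<lambda>J. \<exists>n. J = ?I n", OF I[of 0] ex]) (rule that)
    then obtain N where N: "J = ?I N" by blast
    have "?I (Suc N) \<subseteq> J"
    proof
      fix x assume "x \<in> ?I (Suc N)"
      then obtain c where "c \<in> carrier R" "x = c \<otimes> (r [^] Suc N)" by blast
      then have "x = (c \<otimes> r) \<otimes> (r [^] N)" "c \<otimes> r \<in> carrier R" using r by (auto simp: m_ac)
      then show "x \<in> J" unfolding N by blast
    qed
    then have "?I (Suc N) = ?I N" using J(3)[OF I] N by blast
    moreover have "r [^] N \<in> ?I N" using r by (intro image_eqI[of _ _ "\<one>"]) auto
    ultimately obtain s where s: "s \<in> carrier R" "r [^] N = s \<otimes> (r [^] Suc N)" by blast
    have "s \<otimes> (r \<otimes> x) = x" if "x \<in> A" for x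
    proof -
      obtain y where y: "y \<in> A" "x = (r [^] N) \<otimes> y" using rnA \<open>x \<in> A\<close> by blast
      have "s \<otimes> (r \<otimes> x) = (s \<otimes> (r [^] Suc N)) \<otimes> y" using y r s(1) Ac by (simp add: m_ac)
      then show ?thesis by (simp only: s(2)[symmetric] y(2)[symmetric])
    qed
    then show ?thesis using s(1) by blast
  qed
  have "A \<noteq> {\<zero>}" using A(2) len_le_zero[OF Al] by auto
  then obtain a where a: "a \<in> A" "a \<noteq> \<zero>" using submodule_zero[OF A(1)] by auto
  let ?\<N> = "{N. submodule N R (regular R) \<and> N \<subseteq> A \<and> a \<notin> N}"
  \<comment> \<open>Zorn's lemma, because no bound on ascending chains is available yet: that is
    what is being proved.\<close>
  have "\<exists>N\<in>?\<N>. \<forall>X\<in>?\<N>. N \<subseteq> X \<longrightarrow> X = N"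
  proof (rule subset_Zorn_nonempty)
    have "{\<zero>} \<in> ?\<N>" using submodule_trivial[OF reg] submodule_zero[OF A(1)] a by auto
    then show "?\<N> \<noteq> {}" by blast
  next
    fix \<C> assume C: "\<C> \<noteq> {}" "subset.chain ?\<N> \<C>"
    have mem: "submodule N R (regular R)" "N \<subseteq> A" "a \<notin> N" if "N \<in> \<C>" for N
      using C(2) that by (auto simp: subset.chain_def)
    have lin: "N \<subseteq> N' \<or> N' \<subseteq> N" if "N \<in> \<C>" "N' \<in> \<C>" for N N'
      using C(2) that by (auto simp: subset.chain_def)
    have "submodule (\<Union>\<C>) R (regular R)"
    proof (rule submoduleI'[OF reg])
      show "\<Union>\<C> \<subseteq> carrier (regular R)" using mem(1) submodule_subset[of _ R "regular R"] by blast
      show "\<zero>\<^bsub>regular R\<^esub> \<in> \<Union>\<C>" using C(1) mem(1) submodule_zero[of _ R "regular R"] by blast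
      fix x y assume "x \<in> \<Union>\<C>" "y \<in> \<Union>\<C>"
      then obtain N N' where N: "N \<in> \<C>" "x \<in> N" "N' \<in> \<C>" "y \<in> N'" by blast
      obtain L where "L \<in> \<C>" "x \<in> L" "y \<in> L" using lin[OF N(1,3)] N by blast
      then show "x \<oplus>\<^bsub>regular R\<^esub> y \<in> \<Union>\<C>" using submodule_add[OF mem(1)] by blast
    next
      fix b x assume b: "b \<in> carrier R" and "x \<in> \<Union>\<C>"
      then obtain L where "L \<in> \<C>" "x \<in> L" by blast
      then show "b \<odot>\<^bsub>regular R\<^esub> x \<in> \<Union>\<C>" using submodule_smult[OF mem(1) b] by blast
    qed
    then show "\<Union>\<C> \<in> ?\<N>" using mem(2,3) by auto
  qed
  then obtain N where N: "submodule N R (regular R)" "N \<subseteq> A" "a \<notin> N"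
    and Nmax: "\<And>X. submodule X R (regular R) \<Longrightarrow> X \<subseteq> A \<Longrightarrow> a \<notin> X \<Longrightarrow> N \<subseteq> X \<Longrightarrow> X = N" by auto
  note Nc = submodule_carrierD[OF N(1), simplified]
  have max: "L = N \<or> L = carrier ?A" if L: "submodule L R ?A" "N \<subseteq> L" for L
  proof (rule disjCI)
    assume "L \<noteq> carrier ?A"
    then have nA: "L \<noteq> A" by simp
    have LA: "L \<subseteq> A" using submodule_subset[OF L(1)] by simp
    then have L': "submodule L R (regular R)" using submodule_subm[OF reg A(1)] L(1) by blast
    have "a \<notin> L"
    proof
      assume aL: "a \<in> L"
      have "v \<in> L" if v: "v \<in> A" for v
      proof (cases "v \<in> N")
        case False
        note ad = adjoin[OF reg N(1), of v]
        have vc: "v \<in> carrier R" using Ac v by blast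
        have "adjoin R (regular R) N v \<subseteq> A"
          using submodule_add[OF A(1)] submodule_smult[OF A(1) _ v] N(2) by (auto simp: adjoin_def)
        then have "a \<in> adjoin R (regular R) N v" using Nmax[of "adjoin R (regular R) N v"] ad vc False by auto
        then obtain u b where ub: "u \<in> N" "b \<in> carrier R" "a = u \<oplus> b \<otimes> v" by (auto simp: adjoin_def)
        \<comment> \<open>\<open>b\<close> does not act by zero on \<open>A\<close>, hence acts
          invertibly. So \<open>a = u \<oplus> b \<otimes> v\<close> can be solved for
          \<open>v\<close>, which lies in \<open>L\<close> together with \<open>a\<close> and
          \<open>u\<close>.\<close>
        have "b \<otimes> v \<noteq> \<zero>" using ub N(3) Nc[OF ub(1)] by auto
        then have "\<not> (\<forall>x\<in>A. b \<otimes> x = \<zero>)" using v by blast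
        then obtain s where s: "s \<in> carrier R" "\<And>x. x \<in> A \<Longrightarrow> s \<otimes> (b \<otimes> x) = x" using inv[OF ub(2)] by blast
        have "b \<otimes> v = a \<ominus> u"
        proof -
          have "u \<in> carrier R" "b \<otimes> v \<in> carrier R" using Nc ub vc by auto
          then show ?thesis unfolding ub(3) by (simp add: a_minus_def a_ac r_neg1 r_neg2 r_neg)
        qed
        moreover have "a \<ominus> u \<in> L" using submodule_minus[OF L' aL, of u] ub(1) L(2) reg_minus by auto
        ultimately have "s \<otimes> (b \<otimes> v) \<in> L" using submodule_smult[OF L' s(1)] by simp
        then show ?thesis using s(2)[OF v] by simp
      qed (use L(2) in blast)
      then show False using nA LA by blast
    qed
    then show "L = N" using Nmax[OF L' LA _ L(2)] by blast
  qed
  obtain n where "len_le R (subm (regular R) N) n" using flP[OF N(1)] N(2,3) a(1) by blast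
  then have "len_le R ?A (n + 1)"
    using len_le_maximal[OF Al _ _ max] submodule_subm[OF reg A(1) N(2)] N(1) by simp
  then show False using A(2) by blast
qed

end

sublocale artinian \<subseteq> finite_length_ring R
  by unfold_locales (rule finite_length)

section \<open>The injective envelope of the semisimple quotient\<close>

context artinian
begin

abbreviation rad :: "'a set" where "rad \<equiv> jacobson_radical R"

lemma ex_maximalideal:
  assumes "submodule I R (regular R)" "\<one> \<notin> I"
  obtains m where "maximalideal m R" "I \<subseteq> m"
proof -
  obtain n where n: "len_le R (regular R) n" using len_regular by blast
  obtain m where m: "submodule m R (regular R)" "I \<subseteq> m \<and> \<one> \<notin> m"
    "\<And>J. submodule J R (regular R) \<Longrightarrow> I \<subseteq> J \<and> \<one> \<notin> J \<Longrightarrow> m \<subseteq> J \<Longrightarrow> J = m"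
    by (rule len_max[where P = "\<lambda>J. I \<subseteq> J \<and> \<one> \<notin> J", OF n assms(1)]) (use assms(2) in simp, rule that)
  then have "maximalideal m R" unfolding maximalideal_iff by blast
  then show ?thesis using that m(2) by blast
qed

lemma maximalideal_submodule: "maximalideal m R \<Longrightarrow> submodule m R (regular R)"
  and maximalideal_one: "maximalideal m R \<Longrightarrow> \<one> \<notin> m"
  by (simp_all add: maximalideal_iff)

lemma submodule_rad: "submodule rad R (regular R)"
proof (rule submoduleI'[OF reg])
  show "rad \<subseteq> carrier (regular R)" by (auto simp: jacobson_radical_def)
  show "\<zero>\<^bsub>regular R\<^esub> \<in> rad" using submodule_zero[OF maximalideal_submodule] by (auto simp: jacobson_radical_def)
  show "x \<oplus>\<^bsub>regular R\<^esub> y \<in> rad" if "x \<in> rad" "y \<in> rad" for x y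
    using that submodule_add[OF maximalideal_submodule, of _ x y] by (auto simp: jacobson_radical_def)
  show "a \<odot>\<^bsub>regular R\<^esub> x \<in> rad" if "a \<in> carrier R" "x \<in> rad" for a x
    using that submodule_smult[OF maximalideal_submodule, of _ a x] by (auto simp: jacobson_radical_def)
qed

lemma rad_subset: "maximalideal m R \<Longrightarrow> rad \<subseteq> m"
  by (auto simp: jacobson_radical_def)

text \<open>The residue field of every maximal ideal embeds in the quotient by the radical.\<close>

lemma ex_socle_elem:
  assumes m: "maximalideal m R"
  obtains y where "y \<in> carrier R" "y \<notin> m" "\<And>a. a \<in> m \<Longrightarrow> a \<otimes> y \<in> rad"
proof -
  have car: "submodule (carrier R) R (regular R)" using submodule_carrier[OF reg] by simp
  have nm: "\<not> carrier R \<subseteq> m" using maximalideal_one[OF m] by blast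
  obtain I where I: "submodule I R (regular R)" "\<not> I \<subseteq> m"
    "\<And>J. submodule J R (regular R) \<Longrightarrow> \<not> J \<subseteq> m \<Longrightarrow> J \<subseteq> I \<Longrightarrow> J = I"
    by (rule ideal_min[where P = "\<lambda>I. \<not> I \<subseteq> m", OF car nm]) (rule that)
  note Ic = submodule_carrierD[OF I(1), simplified]
  \<comment> \<open>As \<open>m\<close> is prime, the intersection of \<open>I\<close> with another
    maximal ideal is still not inside \<open>m\<close>, and minimality of \<open>I\<close> makes it
    all of \<open>I\<close>.\<close>
  have sub: "I \<subseteq> m'" if m': "maximalideal m' R" "m' \<noteq> m" for m'
  proof -
    note s = maximalideal_submodule[OF m] maximalideal_submodule[OF m'(1)]
    have "\<not> m' \<subseteq> m" using m' m maximalideal_iff by blast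
    then obtain b where b: "b \<in> m'" "b \<notin> m" by blast
    obtain a where a: "a \<in> I" "a \<notin> m" using I(2) by blast
    have c: "a \<in> carrier R" "b \<in> carrier R" using submodule_carrierD[OF s(2) b(1)] Ic[OF a(1)] by auto
    have "a \<otimes> b \<notin> m" using primeideal.I_prime[OF maximalideal_prime[OF m]] a b c by blast
    moreover have "a \<otimes> b \<in> I" using submodule_smult[OF I(1) c(2) a(1)] c by (simp add: m_comm)
    moreover have "a \<otimes> b \<in> m'" using submodule_smult[OF s(2) c(1) b(1)] by simp
    ultimately have "I \<inter> m' = I" by (intro I(3) submodule_Int reg I(1) s(2)) auto
    then show ?thesis by blast
  qed
  obtain y where y: "y \<in> I" "y \<notin> m" using I(2) by blast
  have "a \<otimes> y \<in> rad" if a: "a \<in> m" for a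
  proof -
    have c: "a \<in> carrier R" "y \<in> carrier R"
      using submodule_carrierD[OF maximalideal_submodule[OF m] a] Ic[OF y(1)] by auto
    have "a \<otimes> y \<in> m'" if m': "maximalideal m' R" for m'
    proof (cases "m' = m")
      case True
      then show ?thesis using submodule_smult[OF maximalideal_submodule[OF m] c(2) a] c by (simp add: m_comm)
    next
      case False
      then have "y \<in> m'" using sub[OF m'] y by blast
      then show ?thesis using submodule_smult[OF maximalideal_submodule[OF m'] c(1)] by simp
    qed
    then show ?thesis using c by (auto simp: jacobson_radical_def)
  qed
  then show ?thesis using that y Ic by blast
qed

abbreviation top :: "('a, 'a set) module" where "top \<equiv> quot_module (regular R) rad"

lemmas top = left_module_quot[OF reg submodule_rad] mhom_quot[OF reg submodule_rad]
  quot_surj[OF reg submodule_rad] quot_zero_iff[OF reg submodule_rad]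

lemma fg_top: "fg_module R top"
  by (rule fg_surj[OF fg_regular[OF ring_axioms] top(1-3)])

text \<open>An essential submodule contains the socle. If \<open>x\<close> were outside
  \<open>E\<close>, some multiple \<open>z\<close> of it outside \<open>E\<close> would be killed by
  a maximal ideal. The submodule generated by \<open>z\<close> is then simple, and since it meets
  \<open>E\<close>, it lies in \<open>E\<close>.\<close>

lemma essential_annihilator:
  assumes X: "left_module R X" and E: "essential R X E" and x: "x \<in> carrier X" "\<And>a. a \<in> rad \<Longrightarrow> a \<odot>\<^bsub>X\<^esub> x = \<zero>\<^bsub>X\<^esub>"
  shows "x \<in> E"
proof -
  interpret X: left_module R X by fact
  have E': "submodule E R X" and ess: "\<And>N. submodule N R X \<Longrightarrow> N \<inter> E = {\<zero>\<^bsub>X\<^esub>} \<Longrightarrow> N = {\<zero>\<^bsub>X\<^esub>}"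
    using E by (auto simp: essential_def)
  let ?I = "{c \<in> carrier R. c \<odot>\<^bsub>X\<^esub> x \<in> E}"
  have I: "submodule ?I R (regular R)"
    using submodule_vimage[OF reg X mhom_regular[OF X x(1)] E'] by simp
  have "\<one> \<in> ?I"
  proof (rule ccontr)
    assume "\<one> \<notin> ?I"
    then obtain m where m: "maximalideal m R" "?I \<subseteq> m" using ex_maximalideal[OF I] by blast
    note ms = maximalideal_submodule[OF m(1)]
    obtain y where y: "y \<in> carrier R" "y \<notin> m" "\<And>a. a \<in> m \<Longrightarrow> a \<otimes> y \<in> rad" using ex_socle_elem[OF m(1)] by blast
    let ?z = "y \<odot>\<^bsub>X\<^esub> x"
    have z: "?z \<in> carrier X" using y x by simp
    have mz: "a \<odot>\<^bsub>X\<^esub> ?z = \<zero>\<^bsub>X\<^esub>" if "a \<in> m" for a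
      using x(2)[OF y(3)[OF that]] submodule_carrierD[OF ms that] y(1) x(1) by (simp add: X.smult_assoc)
    have zE: "?z \<notin> E" using y m(2) by blast
    then have z0: "?z \<noteq> \<zero>\<^bsub>X\<^esub>" using submodule_zero[OF E'] by auto
    let ?N = "(\<lambda>a. a \<odot>\<^bsub>X\<^esub> ?z) ` carrier R"
    have N: "submodule ?N R X" using submodule_range[OF reg X mhom_regular[OF X z]] by simp
    have "?z \<in> ?N" using z by (intro image_eqI[of _ _ "\<one>"]) auto
    then have "?N \<inter> E \<noteq> {\<zero>\<^bsub>X\<^esub>}" using ess[OF N] z0 by blast
    moreover have "\<zero>\<^bsub>X\<^esub> \<in> ?N \<inter> E" using submodule_zero[OF N] submodule_zero[OF E'] by blast
    ultimately obtain a where a: "a \<in> carrier R" "a \<odot>\<^bsub>X\<^esub> ?z \<in> E" "a \<odot>\<^bsub>X\<^esub> ?z \<noteq> \<zero>\<^bsub>X\<^esub>" by blast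
    then have "a \<notin> m" using mz by blast
    then obtain u b where ub: "u \<in> m" "b \<in> carrier R" "\<one> = u \<oplus> b \<otimes> a" using maximal_add[OF m(1) a(1)] by blast
    have uc: "u \<in> carrier R" using submodule_carrierD[OF ms ub(1)] by simp
    have "?z = (u \<oplus> b \<otimes> a) \<odot>\<^bsub>X\<^esub> ?z" using z ub(3)[symmetric] by simp
    also have "\<dots> = b \<odot>\<^bsub>X\<^esub> (a \<odot>\<^bsub>X\<^esub> ?z)" using uc ub(2) a(1) z mz[OF ub(1)] by (simp add: X.smult_l_distr X.smult_assoc)
    also have "\<dots> \<in> E" by (rule submodule_smult[OF E' ub(2) a(2)])
    finally show False using zE by simp
  qed
  then show ?thesis using x(1) by simp
qed

section \<open>Essential extensions of the quotient by the radical\<close>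

definition ess_ext :: "'a umod \<Rightarrow> ('a set \<Rightarrow> (nat \<Rightarrow> 'a) set) \<Rightarrow> bool" where
  "ess_ext X e \<longleftrightarrow> fg_module R X \<and> mhom R top X e \<and> inj_on e (carrier top) \<and> essential R X (e ` carrier top)"

text \<open>Decreasing in \<open>I\<close>: it is zero for the whole ring and all of
  \<open>X\<close> for the zero ideal, so a chain of ideals filters \<open>X\<close>.\<close>

definition ann :: "'a umod \<Rightarrow> 'a set \<Rightarrow> (nat \<Rightarrow> 'a) set set" where
  "ann X I = {x \<in> carrier X. \<forall>a\<in>I. a \<odot>\<^bsub>X\<^esub> x = \<zero>\<^bsub>X\<^esub>}"

lemma submodule_ann:
  assumes "left_module R X" "I \<subseteq> carrier R"
  shows "submodule (ann X I) R X"
proof (rule submoduleI'[OF assms(1)])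
  interpret X: left_module R X by fact
  note I = subsetD[OF assms(2)]
  show "ann X I \<subseteq> carrier X" "\<zero>\<^bsub>X\<^esub> \<in> ann X I" using I by (auto simp: ann_def)
  show "x \<oplus>\<^bsub>X\<^esub> y \<in> ann X I" if "x \<in> ann X I" "y \<in> ann X I" for x y
    using that I by (auto simp: ann_def X.smult_r_distr)
  show "c \<odot>\<^bsub>X\<^esub> x \<in> ann X I" if "c \<in> carrier R" "x \<in> ann X I" for c x
  proof -
    have "a \<odot>\<^bsub>X\<^esub> (c \<odot>\<^bsub>X\<^esub> x) = c \<odot>\<^bsub>X\<^esub> (a \<odot>\<^bsub>X\<^esub> x)" if "a \<in> I" for a
    proof -
      have "x \<in> carrier X" using \<open>x \<in> ann X I\<close> by (simp add: ann_def)
      then show ?thesis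
        using X.smult_assoc[of a c x] X.smult_assoc[of c a x] m_comm[of a c] I[OF that] \<open>c \<in> carrier R\<close> by simp
    qed
    then show ?thesis using that by (auto simp: ann_def)
  qed
qed

text \<open>Climbing a composition series of the ring bounds the length of every essential extension.\<close>

lemma ess_ext_bound: "\<exists>n. \<forall>X e. ess_ext X e \<longrightarrow> len_le R X n"
proof -
  let ?B = "\<lambda>I. \<exists>n. \<forall>X e. ess_ext X e \<longrightarrow> len_le R (subm X (ann X I)) n"
  obtain ns where ns: "len_le R top ns" using fg_len[OF fg_top] by blast
  obtain nr where nr: "len_le R (regular R) nr" using len_regular by blast
  \<comment> \<open>The bound has to hold for all extensions at once. Hence the extremal choice is
    made among ideals: \<open>I\<close> is maximal without a uniform bound, and adjoining one
    element to \<open>I\<close> leads to a contradiction.\<close>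
  have "?B {\<zero>}"
  proof (rule ccontr)
    assume "\<not> ?B {\<zero>}"
    moreover have "submodule {\<zero>} R (regular R)" using submodule_trivial[OF reg] by simp
    ultimately obtain I where I: "submodule I R (regular R)" "\<not> ?B I"
      "\<And>J. submodule J R (regular R) \<Longrightarrow> \<not> ?B J \<Longrightarrow> I \<subseteq> J \<Longrightarrow> J = I"
      using len_max[where P = "\<lambda>I. \<not> ?B I", OF nr, of "{\<zero>}"] by metis
    note Ic = submodule_carrierD[OF I(1), simplified]
    have "\<one> \<notin> I"
    proof
      assume one: "\<one> \<in> I"
      have "len_le R (subm X (ann X I)) 0" if X: "ess_ext X e" for X e
      proof -
        have Xl: "left_module R X" using X by (auto simp: ess_ext_def intro: fg_left_module)
        then interpret X: left_module R X .
        have "ann X I = {\<zero>\<^bsub>X\<^esub>}"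
          using one submodule_zero[OF submodule_ann[OF Xl]] submodule_subset[OF I(1)] by (auto simp: ann_def)
        then show ?thesis
          using left_module_subm[OF Xl submodule_ann[OF Xl, of I]] submodule_subset[OF I(1)] by (intro len_le_zero) auto
      qed
      then show False using I(2) by blast
    qed
    let ?P = "\<lambda>J. I \<subset> J"
    have car: "submodule (carrier R) R (regular R)" using submodule_carrier[OF reg] by simp
    have lt: "I \<subset> carrier R" using Ic \<open>\<one> \<notin> I\<close> by blast
    obtain I' where I': "submodule I' R (regular R)" "I \<subset> I'"
      "\<And>J. submodule J R (regular R) \<Longrightarrow> I \<subset> J \<Longrightarrow> J \<subseteq> I' \<Longrightarrow> J = I'"
      by (rule len_min[where P = ?P, OF nr car lt]) (rule that)
    obtain b where b: "b \<in> I'" "b \<notin> I" using I'(2) by blast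
    have bc: "b \<in> carrier R" using submodule_carrierD[OF I'(1) b(1)] by simp
    let ?J = "{c \<in> carrier R. c \<otimes> b \<in> I}"
    have J: "submodule ?J R (regular R)"
      using submodule_vimage[OF reg reg mhom_regular[OF reg, of b] I(1)] bc by simp
    have "\<one> \<notin> ?J" using b bc by simp
    then obtain m where m: "maximalideal m R" "?J \<subseteq> m" using ex_maximalideal[OF J] by blast
    note ms = maximalideal_submodule[OF m(1)]
    \<comment> \<open>\<open>I'\<close> is minimal above \<open>I\<close>. So
      \<open>a \<otimes> b\<close> outside \<open>I\<close> would generate \<open>b\<close> modulo
      \<open>I\<close>, say with coefficient \<open>c\<close>; then
      \<open>\<one> \<ominus> c \<otimes> a\<close> multiplies \<open>b\<close> into
      \<open>I\<close> and lies in \<open>m\<close>, as does \<open>c \<otimes> a\<close>, and their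
      sum is the unit.\<close>
    have mb: "a \<otimes> b \<in> I" if a: "a \<in> m" for a
    proof (rule ccontr)
      assume nI: "a \<otimes> b \<notin> I"
      have ac: "a \<in> carrier R" using submodule_carrierD[OF ms a] by simp
      note ad = adjoin[OF reg I(1), of "a \<otimes> b"]
      have "adjoin R (regular R) I (a \<otimes> b) \<subseteq> I'"
        using submodule_add[OF I'(1)] submodule_smult[OF I'(1) _ submodule_smult[OF I'(1) ac b(1)]] I'(2)
        by (auto simp: adjoin_def)
      then have "adjoin R (regular R) I (a \<otimes> b) = I'" using ad nI ac bc by (intro I'(3)) auto
      then obtain i c where ic: "i \<in> I" "c \<in> carrier R" "b = i \<oplus> c \<otimes> (a \<otimes> b)" using b(1) by (auto simp: adjoin_def)
      have "(\<one> \<ominus> c \<otimes> a) \<otimes> b = b \<ominus> c \<otimes> (a \<otimes> b)" using ic(2) ac bc by (simp add: a_minus_def l_distr l_minus m_assoc)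
      also have "\<dots> = i"
      proof -
        have "i \<in> carrier R" "c \<otimes> (a \<otimes> b) \<in> carrier R" using Ic ic ac bc by auto
        then have "(i \<oplus> c \<otimes> (a \<otimes> b)) \<ominus> c \<otimes> (a \<otimes> b) = i" by (simp add: a_minus_def a_assoc r_neg)
        then show ?thesis using ic(3) by simp
      qed
      finally have "\<one> \<ominus> c \<otimes> a \<in> ?J" using ic ac by simp
      then have "\<one> \<ominus> c \<otimes> a \<in> m" using m(2) by blast
      moreover have "c \<otimes> a \<in> m" using submodule_smult[OF ms ic(2) a] by simp
      ultimately have "(\<one> \<ominus> c \<otimes> a) \<oplus> c \<otimes> a \<in> m" using submodule_add[OF ms] by simp
      then show False using maximalideal_one[OF m(1)] ic ac by (simp add: a_minus_def a_assoc l_neg)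
    qed
    let ?I2 = "adjoin R (regular R) I b"
    note ad = adjoin[OF reg I(1), of b]
    have I2: "submodule ?I2 R (regular R)" "I \<subset> ?I2" using ad bc b by auto
    then have "?B ?I2" using I(3) by blast
    then obtain n2 where n2: "\<And>X e. ess_ext X e \<Longrightarrow> len_le R (subm X (ann X ?I2)) n2" by blast
    have "len_le R (subm X (ann X I)) (n2 + ns)" if X: "ess_ext X e" for X e
    proof -
      have Xl: "left_module R X" and e: "mhom R top X e" and ess: "essential R X (e ` carrier top)"
        using X by (auto simp: ess_ext_def intro: fg_left_module)
      interpret X: left_module R X by (rule Xl)
      let ?A = "ann X I" and ?E = "e ` carrier top"
      have A: "submodule ?A R X" by (rule submodule_ann[OF Xl]) (use Ic in auto)
      have E: "submodule ?E R X" using ess by (simp add: essential_def)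
      have Ac: "x \<in> carrier X" if "x \<in> ?A" for x using that by (simp add: ann_def)
      \<comment> \<open>The radical multiplies \<open>b\<close> into \<open>I\<close>, so it kills
        the product of \<open>b\<close> with \<open>x\<close>, which therefore lies in the copy of
        \<open>top\<close>. Multiplication by \<open>b\<close> thus maps \<open>ann X I\<close> into
        a module of length at most \<open>ns\<close>, with kernel the annihilator of the larger
        ideal.\<close>
      have "b \<odot>\<^bsub>X\<^esub> x \<in> ?E" if x: "x \<in> ?A" for x
      proof (rule essential_annihilator[OF Xl ess])
        show "b \<odot>\<^bsub>X\<^esub> x \<in> carrier X" using bc Ac[OF x] by simp
        fix a assume a: "a \<in> rad"
        then have "a \<otimes> b \<in> I" using mb rad_subset[OF m(1)] by blast
        then have "(a \<otimes> b) \<odot>\<^bsub>X\<^esub> x = \<zero>\<^bsub>X\<^esub>" using x by (simp add: ann_def)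
        then show "a \<odot>\<^bsub>X\<^esub> (b \<odot>\<^bsub>X\<^esub> x) = \<zero>\<^bsub>X\<^esub>"
          using submodule_carrierD[OF submodule_rad a] bc Ac[OF x] by (simp add: X.smult_assoc)
      qed
      then have f: "mhom R (subm X ?A) (subm X ?E) (\<lambda>x. b \<odot>\<^bsub>X\<^esub> x)"
        using mhom_to_subm[OF mhom_restrict_dom[OF mult_mhom[OF Xl bc] A]] by auto
      have lE: "len_le R (subm X ?E) ns"
        using len_le_surj[OF top(1) left_module_subm[OF Xl E] mhom_to_subm[OF e] _ ns] by auto
      have k: "ker (subm X ?A) (subm X ?E) (\<lambda>x. b \<odot>\<^bsub>X\<^esub> x) = ann X ?I2"
      proof
        show "ann X ?I2 \<subseteq> ker (subm X ?A) (subm X ?E) (\<lambda>x. b \<odot>\<^bsub>X\<^esub> x)"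
          using ad bc by (auto simp: ker_def ann_def)
        have "a \<odot>\<^bsub>X\<^esub> x = \<zero>\<^bsub>X\<^esub>" if x: "x \<in> ?A" "b \<odot>\<^bsub>X\<^esub> x = \<zero>\<^bsub>X\<^esub>" and a: "a \<in> ?I2" for a x
        proof -
          obtain i c where ic: "i \<in> I" "c \<in> carrier R" "a = i \<oplus> c \<otimes> b" using a by (auto simp: adjoin_def)
          then have "a \<odot>\<^bsub>X\<^esub> x = i \<odot>\<^bsub>X\<^esub> x \<oplus>\<^bsub>X\<^esub> c \<odot>\<^bsub>X\<^esub> (b \<odot>\<^bsub>X\<^esub> x)"
            using Ic Ac[OF x(1)] bc by (simp add: X.smult_l_distr X.smult_assoc)
          then show ?thesis using x ic by (simp add: ann_def)
        qed
        then show "ker (subm X ?A) (subm X ?E) (\<lambda>x. b \<odot>\<^bsub>X\<^esub> x) \<subseteq> ann X ?I2"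
          by (auto simp: ker_def ann_def)
      qed
      have "len_le R (subm (subm X ?A) (ann X ?I2)) n2" using n2[OF X] by simp
      then show ?thesis
        using len_le_ext[OF left_module_subm[OF Xl A] left_module_subm[OF Xl E] f lE] k by simp
    qed
    then show False using I(2) by blast
  qed
  then obtain n where n: "\<And>X e. ess_ext X e \<Longrightarrow> len_le R (subm X (ann X {\<zero>})) n" by blast
  have "len_le R X n" if X: "ess_ext X e" for X e
  proof -
    have "left_module R X" using X by (auto simp: ess_ext_def intro: fg_left_module)
    then interpret X: left_module R X .
    have "ann X {\<zero>} = carrier X" by (auto simp: ann_def)
    then show ?thesis using n[OF X] by simp
  qed
  then show ?thesis by blast
qed

text \<open>The image of \<open>X\<close> leaves room for one more step, so ranks of images of
  submodules stay below \<open>n\<close>.\<close>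

lemma len_le_proper:
  fixes X :: "('a, 'm) module" and X' :: "('a, 'n) module"
  assumes "left_module R X" "left_module R X'" "mhom R X X' j" "inj_on j (carrier X)" "j ` carrier X \<noteq> carrier X'"
    "len_le R X' n"
  shows "n > 0 \<and> len_le R X (n - 1)"
proof -
  obtain \<rho> where \<rho>: "\<And>L. submodule L R X' \<Longrightarrow> \<rho> L \<le> n"
    "\<And>L L'. submodule L R X' \<Longrightarrow> submodule L' R X' \<Longrightarrow> L \<subset> L' \<Longrightarrow> \<rho> L < (\<rho> L' :: nat)"
    "\<And>L L'. submodule L R X' \<Longrightarrow> submodule L' R X' \<Longrightarrow> L \<subseteq> L' \<Longrightarrow> \<rho> L \<le> \<rho> L'"
    using assms(6) by (rule len_leE) blast
  have im: "submodule (j ` L) R X'" if "submodule L R X" for L by (rule submodule_image[OF assms(1-3) that])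
  have top: "submodule (carrier X') R X'" "submodule (carrier X) R X" by (intro submodule_carrier assms)+
  have "j ` carrier X \<subset> carrier X'" using submodule_subset[OF im[OF top(2)]] assms(5) by blast
  then have lt: "\<rho> (j ` carrier X) < \<rho> (carrier X')" by (rule \<rho>(2)[OF im[OF top(2)] top(1)])
  then have n: "n > 0" using \<rho>(1)[OF top(1)] by linarith
  have "len_le R X (n - 1)"
  proof (rule len_leI[of _ _ "\<lambda>L. \<rho> (j ` L)"])
    fix L assume L: "submodule L R X"
    have "\<rho> (j ` L) \<le> \<rho> (j ` carrier X)"
      by (rule \<rho>(3)[OF im[OF L] im[OF top(2)]]) (use submodule_subset[OF L] in blast)
    then show "\<rho> (j ` L) \<le> n - 1" using lt \<rho>(1)[OF top(1)] by linarith
  next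
    fix L L' assume *: "submodule L R X" "submodule L' R X" "L \<subset> L'"
    then have "j ` L \<subset> j ` L'"
      using submodule_subset[OF *(2)] submodule_subset[OF *(1)] inj_on_image_eq_iff[OF assms(4), of L L'] by blast
    then show "\<rho> (j ` L) < \<rho> (j ` L')" by (rule \<rho>(2)[OF im[OF *(1)] im[OF *(2)]])
  qed
  with n show ?thesis by simp
qed

lemma essential_trans:
  assumes "left_module R X" "left_module R X'" "mhom R X X' j" "inj_on j (carrier X)"
    "essential R X E" "essential R X' (j ` carrier X)"
  shows "essential R X' (j ` E)"
proof -
  have E: "submodule E R X" and ess: "\<And>N. submodule N R X \<Longrightarrow> N \<inter> E = {\<zero>\<^bsub>X\<^esub>} \<Longrightarrow> N = {\<zero>\<^bsub>X\<^esub>}"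
    using assms(5) by (auto simp: essential_def)
  have ess': "\<And>N. submodule N R X' \<Longrightarrow> N \<inter> j ` carrier X = {\<zero>\<^bsub>X'\<^esub>} \<Longrightarrow> N = {\<zero>\<^bsub>X'\<^esub>}"
    using assms(6) by (auto simp: essential_def)
  note Ec = submodule_carrierD[OF E]
  have z: "j \<zero>\<^bsub>X\<^esub> = \<zero>\<^bsub>X'\<^esub>" by (rule mhom_zero[OF assms(1-3)])
  have zc: "\<zero>\<^bsub>X\<^esub> \<in> carrier X" using submodule_zero[OF submodule_carrier[OF assms(1)]] .
  have iz: "x = \<zero>\<^bsub>X\<^esub>" if "x \<in> carrier X" "j x = \<zero>\<^bsub>X'\<^esub>" for x
    by (rule inj_onD[OF assms(4) _ that(1) zc]) (simp add: that(2) z)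
  have "N = {\<zero>\<^bsub>X'\<^esub>}" if N: "submodule N R X'" "N \<inter> j ` E = {\<zero>\<^bsub>X'\<^esub>}" for N
  proof (rule ess'[OF N(1)])
    let ?V = "{x \<in> carrier X. j x \<in> N}"
    have V: "submodule ?V R X" by (rule submodule_vimage[OF assms(1-3) N(1)])
    have "x = \<zero>\<^bsub>X\<^esub>" if "x \<in> ?V \<inter> E" for x
    proof -
      have "j x \<in> N \<inter> j ` E" using that by blast
      then have "j x = \<zero>\<^bsub>X'\<^esub>" using N(2) by blast
      then show ?thesis using iz that by blast
    qed
    then have "?V \<inter> E = {\<zero>\<^bsub>X\<^esub>}" using submodule_zero[OF V] submodule_zero[OF E] by blast
    then have V0: "?V = {\<zero>\<^bsub>X\<^esub>}" by (rule ess[OF V])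
    have "y = \<zero>\<^bsub>X'\<^esub>" if "y \<in> N \<inter> j ` carrier X" for y
    proof -
      from that obtain x where x: "x \<in> carrier X" "y = j x" "j x \<in> N" by blast
      then have "x \<in> ?V" by simp
      then show ?thesis using V0 z x by auto
    qed
    then show "N \<inter> j ` carrier X = {\<zero>\<^bsub>X'\<^esub>}" using submodule_zero[OF N(1)] z zc by (auto intro: image_eqI[OF sym])
  qed
  then show ?thesis unfolding essential_def using submodule_image[OF assms(1-3) E] by blast
qed

text \<open>An essential extension of maximal length is injective: a pushout along a monomorphism splits
  because a complement of it yields another essential extension.\<close>

lemma ex_injective_envelope: "\<exists>J e. injective_envelope R top (J :: 'a umod) e"
proof -
  obtain b where b: "\<And>X e. ess_ext X e \<Longrightarrow> len_le R X b" using ess_ext_bound by blast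
  \<comment> \<open>\<open>len_le\<close> only bounds the length from above; the least bound can be
    maximised over all extensions.\<close>
  let ?l = "\<lambda>X. LEAST n. len_le R X n"
  have lX: "len_le R X (?l X)" "\<And>n. len_le R X n \<Longrightarrow> ?l X \<le> n" if "ess_ext X e" for X :: "'a umod" and e
    using LeastI[of "\<lambda>n. len_le R X n" b] Least_le[of "\<lambda>n. len_le R X n"] b[OF that] by auto
  obtain U :: "'a umod" and f g where U: "fg_module R U" "miso R top U f g" using ex_umod[OF fg_top] by blast
  note d = misoD[OF U(2)]
  have "ess_ext U f"
    using U d submodule_carrier[OF fg_left_module[OF U(1)]] submodule_subset[of _ R U]
    by (auto simp: ess_ext_def essential_def Int_absorb2)
  then have "\<exists>p. case_prod ess_ext p" by (intro exI[of _ "(U, f)"]) simp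
  then obtain p\<^sub>0 where "case_prod ess_ext p\<^sub>0" by blast
  \<comment> \<open>Extension and embedding are maximised as a pair. The bound is
    \<open>Suc b\<close> because the maximum principle asks for a strict one.\<close>
  then obtain p where "case_prod ess_ext p" "\<And>p'. case_prod ess_ext p' \<Longrightarrow> ?l (fst p') \<le> ?l (fst p)"
    using ex_has_greatest_nat[of "case_prod ess_ext" p\<^sub>0 "\<lambda>p. ?l (fst p)" "Suc b"] lX(2)[OF _ b]
    by (metis (no_types, lifting) case_prodE fst_conv less_Suc_eq_le)
  then obtain X e where X: "ess_ext X e" "\<And>X' e'. ess_ext X' e' \<Longrightarrow> ?l X' \<le> ?l X"
    by (cases p) force
  have Xf: "fg_module R X" and e: "mhom R top X e" "inj_on e (carrier top)" and ess: "essential R X (e ` carrier top)"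
    using X(1) by (auto simp: ess_ext_def)
  note Xl = fg_left_module[OF Xf]
  interpret X: left_module R X by (rule Xl)
  \<comment> \<open>A proper essential extension of \<open>X\<close> would be a longer essential
    extension of \<open>top\<close>.\<close>
  have surj: "j ` carrier X = carrier X'"
    if j: "fg_module R X'" "mhom R X X' j" "inj_on j (carrier X)" "essential R X' (j ` carrier X)" for X' :: "'a umod" and j
  proof (rule ccontr)
    assume ne: "j ` carrier X \<noteq> carrier X'"
    note X'l = fg_left_module[OF j(1)]
    have "inj_on (\<lambda>x. j (e x)) (carrier top)"
      using comp_inj_on[OF e(2) inj_on_subset[OF j(3)]] mhom_closed[OF e(1)] by (auto simp: comp_def)
    then have X': "ess_ext X' (\<lambda>x. j (e x))"
      using j(1) mhom_comp[OF e(1) j(2)] essential_trans[OF Xl X'l j(2,3) ess j(4)]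
      by (simp add: ess_ext_def image_image)
    have l: "?l X' > 0 \<and> len_le R X (?l X' - 1)" by (rule len_le_proper[OF Xl X'l j(2,3) ne lX(1)[OF X']])
    have "?l X \<le> ?l X' - 1" by (rule lX(2)[OF X(1)]) (use l in simp)
    then have "?l X < ?l X'" using l by linarith
    then show False using X(2)[OF X'] by simp
  qed
  have "injective R X"
  proof (rule injectiveI[OF Xf])
    fix A B :: "'a umod" and u f
    assume *: "fg_module R A" "fg_module R B" "mhom R A B u" "inj_on u (carrier A)" "mhom R A X f"
    obtain W :: "'a umod" and j v where W: "fg_module R W" "mhom R X W j" "inj_on j (carrier X)" "mhom R B W v"
      "\<And>a. a \<in> carrier A \<Longrightarrow> v (u a) = j (f a)"
      by (rule ex_pushout[OF fg_left_module[OF *(1)] *(2) Xf *(3,4,5)]) (rule that)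
    note Wl = fg_left_module[OF W(1)]
    interpret W: left_module R W by (rule Wl)
    let ?C = "j ` carrier X"
    have C: "submodule ?C R W" by (rule submodule_range[OF Xl Wl W(2)])
    obtain n where n: "len_le R W n" using fg_len[OF W(1)] by blast
    have z: "{\<zero>\<^bsub>W\<^esub>} \<inter> ?C = {\<zero>\<^bsub>W\<^esub>}" using submodule_zero[OF C] by blast
    \<comment> \<open>Modulo a submodule \<open>N\<close> that is maximal with trivial intersection,
      the copy of \<open>X\<close> in \<open>W\<close> becomes essential and hence everything. So
      \<open>W\<close> modulo \<open>N\<close> is isomorphic to \<open>X\<close>, which gives the
      required extension of \<open>f\<close>.\<close>
    obtain N where N: "submodule N R W" "N \<inter> ?C = {\<zero>\<^bsub>W\<^esub>}"
      "\<And>N'. submodule N' R W \<Longrightarrow> N' \<inter> ?C = {\<zero>\<^bsub>W\<^esub>} \<Longrightarrow> N \<subseteq> N' \<Longrightarrow> N' = N"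
      by (rule len_max[where P = "\<lambda>N. N \<inter> ?C = {\<zero>\<^bsub>W\<^esub>}", OF n submodule_trivial[OF Wl] z]) (rule that)
    obtain X' :: "'a umod" and \<pi> where X': "fg_module R X'" "mhom R W X' \<pi>" "\<pi> ` carrier W = carrier X'"
      "\<And>w. w \<in> carrier W \<Longrightarrow> \<pi> w = \<zero>\<^bsub>X'\<^esub> \<longleftrightarrow> w \<in> N" using ex_quot[OF W(1) N(1)] by blast
    note X'l = fg_left_module[OF X'(1)]
    let ?j = "\<lambda>x. \<pi> (j x)"
    have j: "mhom R X X' ?j" by (rule mhom_comp[OF W(2) X'(2)])
    have jz: "j x = \<zero>\<^bsub>W\<^esub> \<longleftrightarrow> x = \<zero>\<^bsub>X\<^esub>" if "x \<in> carrier X" for x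
      using inj_onD[OF W(3) _ that X.M.zero_closed] mhom_zero[OF Xl Wl W(2)] by auto
    have inj: "inj_on ?j (carrier X)"
    proof (subst mhom_inj_iff[OF Xl X'l j], intro ballI impI)
      fix x assume x: "x \<in> carrier X" "\<pi> (j x) = \<zero>\<^bsub>X'\<^esub>"
      then have "j x \<in> N" using X'(4) mhom_closed[OF W(2) x(1)] by simp
      then have "j x \<in> N \<inter> ?C" using x(1) by simp
      then have "j x = \<zero>\<^bsub>W\<^esub>" unfolding N(2) by simp
      then show "x = \<zero>\<^bsub>X\<^esub>" using jz[OF x(1)] by simp
    qed
    have "L = {\<zero>\<^bsub>X'\<^esub>}" if L: "submodule L R X'" "L \<inter> ?j ` carrier X = {\<zero>\<^bsub>X'\<^esub>}" for L
    proof -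
      let ?V = "{w \<in> carrier W. \<pi> w \<in> L}"
      have V: "submodule ?V R W" by (rule submodule_vimage[OF Wl X'l X'(2) L(1)])
      have NV: "N \<subseteq> ?V"
        using X'(4) submodule_zero[OF L(1)] submodule_carrierD[OF N(1)] by (metis (mono_tags, lifting) mem_Collect_eq subsetI)
      have "w = \<zero>\<^bsub>W\<^esub>" if "w \<in> ?V \<inter> ?C" for w
      proof -
        from that obtain x where x: "x \<in> carrier X" "w = j x" "\<pi> (j x) \<in> L" by blast
        then have "\<pi> (j x) \<in> L \<inter> ?j ` carrier X" by simp
        then have "\<pi> (j x) = \<zero>\<^bsub>X'\<^esub>" unfolding L(2) by simp
        then have "w \<in> N" using x X'(4)[of w] mhom_closed[OF W(2) x(1)] by simp
        then have "w \<in> N \<inter> ?C" using x by simp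
        then show ?thesis unfolding N(2) by simp
      qed
      then have "?V \<inter> ?C = {\<zero>\<^bsub>W\<^esub>}" using submodule_zero[OF V] submodule_zero[OF C] by blast
      then have VN: "?V = N" using N(3)[OF V] NV by blast
      have "y = \<zero>\<^bsub>X'\<^esub>" if y: "y \<in> L" for y
      proof -
        obtain w where w: "w \<in> carrier W" "y = \<pi> w" using X'(3) submodule_carrierD[OF L(1) y] by (metis imageE)
        then have "w \<in> N" using VN y by blast
        then show ?thesis using X'(4) w by blast
      qed
      then show ?thesis using submodule_zero[OF L(1)] by blast
    qed
    then have "essential R X' (?j ` carrier X)"
      unfolding essential_def using submodule_range[OF Xl X'l j] by blast
    then have sj: "?j ` carrier X = carrier X'" by (rule surj[OF X'(1) j inj])
    have "miso R X X' ?j (inv_into (carrier X) ?j)" by (rule misoI_bij[OF Xl j inj sj])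
    note m = misoD[OF this]
    have "inv_into (carrier X) ?j (\<pi> (v (u a))) = f a" if "a \<in> carrier A" for a
      using m(3)[OF mhom_closed[OF *(5) that]] W(5)[OF that] by simp
    then show "\<exists>h. mhom R B X h \<and> (\<forall>a\<in>carrier A. h (u a) = f a)"
      using mhom_comp[OF W(4) mhom_comp[OF X'(2) m(2)]] by blast
  qed
  then have "injective_envelope R top X (restrict e (carrier top))"
    using lin_restrict[OF top(1) e(1)] e(2) ess by (auto simp: injective_envelope_def mod_mono_def inj_on_def)
  then show ?thesis by blast
qed

text \<open>For the cogenerator property, the annihilator of \<open>x\<close> lies in a maximal
  ideal \<open>m\<close>, and \<open>ex_socle_elem\<close> gives a nonzero element of
  \<open>top\<close> killed by \<open>m\<close>. Sending \<open>x\<close> to it is well defined on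
  the submodule generated by \<open>x\<close>, and injectivity extends the composite into the
  envelope to all of \<open>X\<close>.\<close>

lemma dualizing_injective: "injective R (dualizing R)"
  and dualizing_cogenerator:
    "fg_module R X \<Longrightarrow> x \<in> carrier X \<Longrightarrow> x \<noteq> \<zero>\<^bsub>X\<^esub> \<Longrightarrow> \<exists>\<phi>. mhom R X (dualizing R) \<phi> \<and> \<phi> x \<noteq> \<zero>\<^bsub>dualizing R\<^esub>"
proof -
  have "\<exists>e. injective_envelope R top (dualizing R) e"
    unfolding dualizing_def using ex_injective_envelope by (rule someI_ex)
  then obtain e where J: "injective R (dualizing R)" and e: "mhom R top (dualizing R) e" "inj_on e (carrier top)"
    by (auto simp: injective_envelope_def mod_mono_def lin_iff)
  show "injective R (dualizing R)" by (rule J)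
  note Jl = fg_left_module[OF injective_fg[OF J]]
  assume X: "fg_module R X" and x: "x \<in> carrier X" "x \<noteq> \<zero>\<^bsub>X\<^esub>"
  note Xl = fg_left_module[OF X]
  interpret X: left_module R X by (rule Xl)
  interpret S: left_module R top by (rule top(1))
  let ?A = "{a \<in> carrier R. a \<odot>\<^bsub>X\<^esub> x = \<zero>\<^bsub>X\<^esub>}"
  have A: "submodule ?A R (regular R)"
    using submodule_ker[OF reg Xl mhom_regular[OF Xl x(1)]] by (simp add: ker_def)
  have "\<one> \<notin> ?A" using x by simp
  then obtain m where m: "maximalideal m R" "?A \<subseteq> m" using ex_maximalideal[OF A] by blast
  obtain y where y: "y \<in> carrier R" "y \<notin> m" "\<And>a. a \<in> m \<Longrightarrow> a \<otimes> y \<in> rad" using ex_socle_elem[OF m(1)] by blast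
  let ?s = "rad +>\<^bsub>regular R\<^esub> y"
  have s: "?s \<in> carrier top" "?s \<noteq> \<zero>\<^bsub>top\<^esub>"
    using mhom_closed[OF top(2)] top(4)[of y] y rad_subset[OF m(1)] by auto
  let ?N = "(\<lambda>a. a \<odot>\<^bsub>X\<^esub> x) ` carrier R"
  have N: "submodule ?N R X" using submodule_range[OF reg Xl mhom_regular[OF Xl x(1)]] by simp
  have p: "mhom R (regular R) (subm X ?N) (\<lambda>a. a \<odot>\<^bsub>X\<^esub> x)" by (rule mhom_to_subm[OF mhom_regular[OF Xl x(1)]]) simp
  have "a \<odot>\<^bsub>top\<^esub> ?s = \<zero>\<^bsub>top\<^esub>" if a: "a \<in> carrier R" "a \<odot>\<^bsub>X\<^esub> x = \<zero>\<^bsub>X\<^esub>" for a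
  proof -
    have "a \<otimes> y \<in> rad" using a m(2) y(3) by blast
    then show ?thesis using mhom_smult[OF top(2), of a y] top(4)[of "a \<otimes> y"] a y by simp
  qed
  then obtain h where h: "mhom R (subm X ?N) top h" "\<And>a. a \<in> carrier R \<Longrightarrow> h (a \<odot>\<^bsub>X\<^esub> x) = a \<odot>\<^bsub>top\<^esub> ?s"
    using factor_through[OF reg left_module_subm[OF Xl N] top(1) p _ mhom_regular[OF top(1) s(1)]] by auto
  obtain \<phi> where \<phi>: "mhom R X (dualizing R) \<phi>" "\<And>z. z \<in> ?N \<Longrightarrow> \<phi> z = e (h z)"
    using inj_extend[OF J fg_subm[OF X N] X mhom_subm_incl[OF N] _ mhom_comp[OF h(1) e(1)]] by auto
  have "x \<in> ?N" using x by (intro image_eqI[of _ _ "\<one>"]) auto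
  then have "\<phi> x = e ?s" using \<phi>(2)[of x] h(2)[of \<one>] x s by simp
  moreover have "e ?s \<noteq> \<zero>\<^bsub>dualizing R\<^esub>"
    using inj_onD[OF e(2) _ s(1) S.M.zero_closed] s(2) mhom_zero[OF top(1) Jl e(1)] by auto
  ultimately show "\<exists>\<phi>. mhom R X (dualizing R) \<phi> \<and> \<phi> x \<noteq> \<zero>\<^bsub>dualizing R\<^esub>" using \<phi>(1) by auto
qed

end

section \<open>Modules of homomorphisms\<close>

lemma lin_add_nth: "x \<in> carrier X \<Longrightarrow> lin_add X Y f g x = f x \<oplus>\<^bsub>Y\<^esub> g x"
  by (simp add: lin_add_def)

lemma lin_zero_nth: "x \<in> carrier X \<Longrightarrow> lin_zero X Y x = \<zero>\<^bsub>Y\<^esub>"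
  by (simp add: lin_zero_def)

lemma lin_add_closed:
  assumes "left_module R X" "left_module R Y" "f \<in> lin R X Y" "g \<in> lin R X Y"
  shows "lin_add X Y f g \<in> lin R X Y"
  unfolding lin_add_def using assms by (intro lin_restrict mhom_plus) (auto simp: lin_iff)

lemma lin_zero_closed: "left_module R X \<Longrightarrow> left_module R Y \<Longrightarrow> lin_zero X Y \<in> lin R X Y"
  unfolding lin_zero_def by (intro lin_restrict mhom_const_zero)

lemma lin_group:
  assumes "left_module R X" "left_module R Y" "f \<in> lin R X Y" "g \<in> lin R X Y" "h \<in> lin R X Y"
  shows "lin_add X Y (lin_add X Y f g) h = lin_add X Y f (lin_add X Y g h)"
    "lin_add X Y f g = lin_add X Y g f" "lin_add X Y (lin_zero X Y) f = f"
    "\<exists>f'\<in>lin R X Y. lin_add X Y f' f = lin_zero X Y"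
proof -
  interpret Y: left_module R Y by fact
  note c = mhom_closed[OF lin_mhom[OF assms(3)]] mhom_closed[OF lin_mhom[OF assms(4)]] mhom_closed[OF lin_mhom[OF assms(5)]]
  note cl = lin_add_closed[OF assms(1,2)] lin_zero_closed[OF assms(1,2)]
  show "lin_add X Y (lin_add X Y f g) h = lin_add X Y f (lin_add X Y g h)"
    by (rule lin_eqI[OF cl(1)[OF cl(1)] cl(1)[OF _ cl(1)]]) (auto simp: assms lin_add_nth c Y.M.a_assoc)
  show "lin_add X Y f g = lin_add X Y g f"
    by (rule lin_eqI[OF cl(1) cl(1)]) (auto simp: assms lin_add_nth c Y.M.a_comm)
  show "lin_add X Y (lin_zero X Y) f = f"
    by (rule lin_eqI[OF cl(1)[OF cl(2)]]) (auto simp: assms lin_add_nth lin_zero_nth c)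
  let ?f = "restrict (\<lambda>x. \<ominus>\<^bsub>Y\<^esub> f x) (carrier X)"
  have f: "?f \<in> lin R X Y" by (rule lin_restrict[OF assms(1) mhom_uminus[OF assms(2) lin_mhom[OF assms(3)]]])
  have "lin_add X Y ?f f = lin_zero X Y"
    by (rule lin_eqI[OF cl(1)[OF f assms(3)] cl(2)]) (auto simp: lin_add_nth lin_zero_nth c Y.M.l_neg)
  then show "\<exists>f'\<in>lin R X Y. lin_add X Y f' f = lin_zero X Y" using f by blast
qed

text \<open>One verification for \<open>homk\<close>, \<open>dual\<close>, \<open>ring_dual\<close>
  and \<open>hom_mod\<close>: they share zero and sum and differ in the acting ring and in the
  argument through which it acts. The laws need checking only pointwise.\<close>

lemma left_module_lin:
  assumes "left_module R X" "left_module R Y" "ring S"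
    "carrier H = lin R X Y" "ring.zero H = lin_zero X Y" "add H = lin_add X Y"
    "\<And>a f. a \<in> carrier S \<Longrightarrow> f \<in> lin R X Y \<Longrightarrow> a \<odot>\<^bsub>H\<^esub> f \<in> lin R X Y"
    "\<And>a b f x. a \<in> carrier S \<Longrightarrow> b \<in> carrier S \<Longrightarrow> f \<in> lin R X Y \<Longrightarrow> x \<in> carrier X \<Longrightarrow>
      ((a \<oplus>\<^bsub>S\<^esub> b) \<odot>\<^bsub>H\<^esub> f) x = (a \<odot>\<^bsub>H\<^esub> f) x \<oplus>\<^bsub>Y\<^esub> (b \<odot>\<^bsub>H\<^esub> f) x"
    "\<And>a f g x. a \<in> carrier S \<Longrightarrow> f \<in> lin R X Y \<Longrightarrow> g \<in> lin R X Y \<Longrightarrow> x \<in> carrier X \<Longrightarrow>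
      (a \<odot>\<^bsub>H\<^esub> lin_add X Y f g) x = (a \<odot>\<^bsub>H\<^esub> f) x \<oplus>\<^bsub>Y\<^esub> (a \<odot>\<^bsub>H\<^esub> g) x"
    "\<And>a b f x. a \<in> carrier S \<Longrightarrow> b \<in> carrier S \<Longrightarrow> f \<in> lin R X Y \<Longrightarrow> x \<in> carrier X \<Longrightarrow>
      ((a \<otimes>\<^bsub>S\<^esub> b) \<odot>\<^bsub>H\<^esub> f) x = (a \<odot>\<^bsub>H\<^esub> (b \<odot>\<^bsub>H\<^esub> f)) x"
    "\<And>f x. f \<in> lin R X Y \<Longrightarrow> x \<in> carrier X \<Longrightarrow> (\<one>\<^bsub>S\<^esub> \<odot>\<^bsub>H\<^esub> f) x = f x"
  shows "left_module S H"
proof -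
  interpret S: ring S by fact
  note cl = lin_add_closed[OF assms(1,2)] lin_zero_closed[OF assms(1,2)] assms(7)
  note g = lin_group[OF assms(1,2)]
  show ?thesis
  proof (rule left_moduleI'[OF assms(3)])
    fix a b f assume *: "a \<in> carrier S" "b \<in> carrier S" "f \<in> carrier H"
    then show "(a \<oplus>\<^bsub>S\<^esub> b) \<odot>\<^bsub>H\<^esub> f = a \<odot>\<^bsub>H\<^esub> f \<oplus>\<^bsub>H\<^esub> b \<odot>\<^bsub>H\<^esub> f"
      unfolding assms(4,6) by (intro lin_eqI[of _ R X Y] cl) (auto simp: assms(8) lin_add_nth)
    show "(a \<otimes>\<^bsub>S\<^esub> b) \<odot>\<^bsub>H\<^esub> f = a \<odot>\<^bsub>H\<^esub> (b \<odot>\<^bsub>H\<^esub> f)"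
      using * unfolding assms(4) by (intro lin_eqI[of _ R X Y] cl) (auto simp: assms(10))
  next
    fix a f g assume "a \<in> carrier S" "f \<in> carrier H" "g \<in> carrier H"
    then show "a \<odot>\<^bsub>H\<^esub> (f \<oplus>\<^bsub>H\<^esub> g) = a \<odot>\<^bsub>H\<^esub> f \<oplus>\<^bsub>H\<^esub> a \<odot>\<^bsub>H\<^esub> g"
      unfolding assms(4,6) by (intro lin_eqI[of _ R X Y] cl) (auto simp: assms(9) lin_add_nth)
  next
    fix f assume "f \<in> carrier H"
    then show "\<one>\<^bsub>S\<^esub> \<odot>\<^bsub>H\<^esub> f = f"
      unfolding assms(4) by (intro lin_eqI[of _ R X Y] cl) (auto simp: assms(11))
  qed (use cl g in \<open>simp_all add: assms(4-6)\<close>)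
qed

text \<open>Over a noncommutative \<open>R\<close> the homomorphisms form no \<open>R\<close>-module
  in general, but the central scalars from \<open>k\<close> act. Lengths over \<open>k\<close> then
  bound lengths over the endomorphism ring and the finiteness of duals.\<close>

definition homk :: "('k \<Rightarrow> 'a) \<Rightarrow> ('a, 'c) ring_scheme \<Rightarrow> ('a, 'm) module \<Rightarrow> ('a, 'n) module \<Rightarrow> ('k, 'm \<Rightarrow> 'n) module" where
  "homk \<eta> R X Y = \<lparr>carrier = lin R X Y, monoid.mult = undefined, one = undefined,
     ring.zero = lin_zero X Y, add = lin_add X Y, smult = (\<lambda>c f. \<lambda>x\<in>carrier X. \<eta> c \<odot>\<^bsub>Y\<^esub> f x)\<rparr>"

lemma restrict_scalars_simps [simp]:
  "carrier (restrict_scalars \<eta> M) = carrier M" "\<zero>\<^bsub>restrict_scalars \<eta> M\<^esub> = \<zero>\<^bsub>M\<^esub>"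
  "x \<oplus>\<^bsub>restrict_scalars \<eta> M\<^esub> y = x \<oplus>\<^bsub>M\<^esub> y" "c \<odot>\<^bsub>restrict_scalars \<eta> M\<^esub> x = \<eta> c \<odot>\<^bsub>M\<^esub> x"
  by (simp_all add: restrict_scalars_def)

lemma left_module_restrict_scalars:
  assumes "ring k" "\<eta> \<in> ring_hom k R" "left_module R M"
  shows "left_module k (restrict_scalars \<eta> M)"
proof -
  interpret k: ring k by fact
  interpret M: left_module R M by fact
  note h = ring_hom_closed[OF assms(2)] ring_hom_mult[OF assms(2)] ring_hom_add[OF assms(2)] ring_hom_one[OF assms(2)]
  show ?thesis
  proof (rule left_moduleI')
    show "\<exists>y\<in>carrier (restrict_scalars \<eta> M). y \<oplus>\<^bsub>restrict_scalars \<eta> M\<^esub> x = \<zero>\<^bsub>restrict_scalars \<eta> M\<^esub>"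
      if "x \<in> carrier (restrict_scalars \<eta> M)" for x
      using that by (intro bexI[of _ "\<ominus>\<^bsub>M\<^esub> x"]) (auto simp: M.M.l_neg)
  qed (auto simp: assms(1) h M.M.a_ac M.smult_l_distr M.smult_r_distr M.smult_assoc)
qed

section \<open>Artin algebras\<close>

locale artin_alg =
  fixes k :: "('k, 'd) ring_scheme" and \<eta> :: "'k \<Rightarrow> 'a" and R :: "('a, 'c) ring_scheme" (structure)
  assumes artin: "artin_algebra k \<eta> R"

sublocale artin_alg \<subseteq> k: artinian k
  using artin by (simp add: artin_algebra_def artinian_ring_def artinian_def artinian_axioms_def comm_ring_reg_def)

context artin_alg
begin

lemma ring_R: "ring R"
  and eta_hom: "\<eta> \<in> ring_hom k R"
  and eta_central: "c \<in> carrier k \<Longrightarrow> a \<in> carrier R \<Longrightarrow> \<eta> c \<otimes>\<^bsub>R\<^esub> a = a \<otimes>\<^bsub>R\<^esub> \<eta> c"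
  and fg_regular_k: "fg_module k (restrict_scalars \<eta> (regular R))"
  using artin by (auto simp: artin_algebra_def)

lemma eta [simp]:
  "c \<in> carrier k \<Longrightarrow> \<eta> c \<in> carrier R"
  "b \<in> carrier k \<Longrightarrow> c \<in> carrier k \<Longrightarrow> \<eta> (b \<oplus>\<^bsub>k\<^esub> c) = \<eta> b \<oplus>\<^bsub>R\<^esub> \<eta> c"
  "b \<in> carrier k \<Longrightarrow> c \<in> carrier k \<Longrightarrow> \<eta> (b \<otimes>\<^bsub>k\<^esub> c) = \<eta> b \<otimes>\<^bsub>R\<^esub> \<eta> c"
  "\<eta> \<one>\<^bsub>k\<^esub> = \<one>\<^bsub>R\<^esub>"
  using eta_hom by (auto simp: ring_hom_def)

lemma smult_commute:
  assumes "left_module R M" "c \<in> carrier k" "a \<in> carrier R" "x \<in> carrier M"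
  shows "\<eta> c \<odot>\<^bsub>M\<^esub> (a \<odot>\<^bsub>M\<^esub> x) = a \<odot>\<^bsub>M\<^esub> (\<eta> c \<odot>\<^bsub>M\<^esub> x)"
  using assms eta_central[OF assms(2,3)] left_module.smult_assoc[OF assms(1), of "\<eta> c" a x]
    left_module.smult_assoc[OF assms(1), of a "\<eta> c" x] by simp

lemma left_module_restrict: "left_module R M \<Longrightarrow> left_module k (restrict_scalars \<eta> M)"
  by (rule left_module_restrict_scalars[OF k.ring_axioms eta_hom])

lemma mhom_restrict: "mhom R M N f \<Longrightarrow> mhom k (restrict_scalars \<eta> M) (restrict_scalars \<eta> N) f"
  by (auto simp: mhom_def)

lemma submodule_restrict:
  assumes "left_module R M" "submodule N R M"
  shows "submodule N k (restrict_scalars \<eta> M)"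
  using submodule_subset[OF assms(2)] submodule_zero[OF assms(2)] submodule_add[OF assms(2)] submodule_smult[OF assms(2)]
  by (intro submoduleI' left_module_restrict[OF assms(1)]) auto

lemma restrict_dsum: "restrict_scalars \<eta> (dsum n M) = dsum n (\<lambda>i. restrict_scalars \<eta> (M i))"
  by (simp add: restrict_scalars_def dsum_def)

lemma len_restrict: "left_module R M \<Longrightarrow> len_le k (restrict_scalars \<eta> M) n \<Longrightarrow> len_le R M n"
  unfolding len_le_def using submodule_restrict by meson

text \<open>Left ideals are \<open>k\<close>-submodules, so a length bound over \<open>k\<close>
  bounds the chains of left ideals.\<close>

lemma finite_length_ring: "finite_length_ring R"
proof -
  obtain n where "len_le k (restrict_scalars \<eta> (regular R)) n" using k.fg_len[OF fg_regular_k] by blast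
  then show ?thesis
    using len_restrict[OF left_module_regular[OF ring_R]] ring_R
    by (auto simp: finite_length_ring_def finite_length_ring_axioms_def)
qed

end

sublocale artin_alg \<subseteq> finite_length_ring R
  by (rule finite_length_ring)

context artin_alg
begin

lemma fg_restrict:
  fixes M :: "('a, 'm) module"
  assumes "fg_module R M"
  shows "fg_module k (restrict_scalars \<eta> M)"
proof -
  obtain n h where h: "mhom R (mpow (regular R) n) M h" "h ` carrier (mpow (regular R) n) = carrier M"
    using fg_free_cover[OF assms] by blast
  have "fg_module k (restrict_scalars \<eta> (mpow (regular R) n))"
    unfolding restrict_dsum by (rule k.fg_dsum[OF fg_regular_k])
  then show ?thesis
    using left_module_restrict[OF fg_left_module[OF assms]] mhom_restrict[OF h(1)] h(2)
    by (elim fg_surj) simp_all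
qed

lemma fg_unrestrict:
  fixes M :: "('a, 'm) module"
  assumes "left_module R M" "fg_module k (restrict_scalars \<eta> M)"
  shows "fg_module R M"
  using k.fg_len[OF assms(2)] len_restrict[OF assms(1)] len_fg[OF assms(1)] by metis

lemma homk_simps [simp]:
  "carrier (homk \<eta> R X Y) = lin R X Y" "\<zero>\<^bsub>homk \<eta> R X Y\<^esub> = lin_zero X Y" "add (homk \<eta> R X Y) = lin_add X Y"
  "x \<in> carrier X \<Longrightarrow> (c \<odot>\<^bsub>homk \<eta> R X Y\<^esub> f) x = \<eta> c \<odot>\<^bsub>Y\<^esub> f x"
  by (simp_all add: homk_def)

lemma mhom_eta: "left_module R M \<Longrightarrow> c \<in> carrier k \<Longrightarrow> mhom R M M (\<lambda>x. \<eta> c \<odot>\<^bsub>M\<^esub> x)"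
  by (intro mhomI) (auto simp: smult_commute left_module.smult_r_distr left_module.smult_closed)

lemma left_module_homk:
  assumes "left_module R X" "left_module R Y"
  shows "left_module k (homk \<eta> R X Y)"
proof -
  interpret Y: left_module R Y by fact
  have cl: "c \<odot>\<^bsub>homk \<eta> R X Y\<^esub> f \<in> lin R X Y" if "c \<in> carrier k" "f \<in> lin R X Y" for c f
    unfolding homk_def using lin_restrict[OF assms(1) mhom_comp[OF lin_mhom[OF that(2)] mhom_eta[OF assms(2) that(1)]]] by simp
  show ?thesis
  proof (rule left_module_lin[OF assms k.ring_axioms])
  qed (use cl in \<open>auto simp: lin_add_nth Y.smult_l_distr Y.smult_r_distr Y.smult_assoc dest!: lin_mhom mhom_closed\<close>)
qed

text \<open>The generators of \<open>X\<close> are treated one by one. Among the maps vanishing at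
  some of them, evaluation at the next one goes to \<open>Y\<close>, of finite length over
  \<open>k\<close>, and its kernel consists of the maps vanishing there too. After all generators
  only the zero map is left.\<close>

lemma fg_homk:
  fixes X :: "('a, 'm) module" and Y :: "('a, 'n) module"
  assumes "fg_module R X" "fg_module R Y"
  shows "fg_module k (homk \<eta> R X Y)"
proof -
  note Xl = fg_left_module[OF assms(1)] and Yl = fg_left_module[OF assms(2)]
  note Hl = left_module_homk[OF Xl Yl]
  let ?H = "homk \<eta> R X Y"
  interpret X: left_module R X by (rule Xl)
  interpret Y: left_module R Y by (rule Yl)
  obtain S where S: "finite S" "S \<subseteq> carrier X" "\<And>L. submodule L R X \<Longrightarrow> S \<subseteq> L \<Longrightarrow> L = carrier X"
    using fg_gens[OF assms(1)] by metis
  obtain n where n: "len_le k (restrict_scalars \<eta> Y) n" using k.fg_len[OF fg_restrict[OF assms(2)]] by blast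
  have ev: "mhom k ?H (restrict_scalars \<eta> Y) (\<lambda>f. f x)" if "x \<in> carrier X" for x
    using that by (intro mhomI) (auto simp: lin_add_nth dest: lin_mhom mhom_closed)
  note Ykl = left_module_restrict[OF Yl]
  let ?K = "\<lambda>S. {f \<in> lin R X Y. \<forall>x\<in>S. f x = \<zero>\<^bsub>Y\<^esub>}"
  have K: "submodule (?K S') k ?H" if "S' \<subseteq> carrier X" for S'
    using that submodule_zero[OF submodule_ker[OF Hl Ykl ev]] submodule_add[OF submodule_ker[OF Hl Ykl ev]]
      submodule_smult[OF submodule_ker[OF Hl Ykl ev]] submodule_zero[OF submodule_carrier[OF Hl]]
      submodule_add[OF submodule_carrier[OF Hl]] submodule_smult[OF submodule_carrier[OF Hl]]
    by (intro submoduleI'[OF Hl]) (auto simp: subset_iff lin_zero_nth lin_add_nth)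
  have "\<exists>m. \<forall>l. len_le k (subm ?H (?K S')) l \<longrightarrow> len_le k (subm ?H (?K {})) (l + m)" if "S' \<subseteq> S" for S'
    using finite_subset[OF that S(1)] that
  proof (induction S')
    case empty
    then show ?case by (intro exI[of _ 0]) simp
  next
    case (insert x S')
    then obtain m where m: "\<And>l. len_le k (subm ?H (?K S')) l \<Longrightarrow> len_le k (subm ?H (?K {})) (l + m)" by blast
    have x: "x \<in> carrier X" "S' \<subseteq> carrier X" using insert.prems S(2) by auto
    note KS = K[OF x(2)]
    have "mhom k (subm ?H (?K S')) (restrict_scalars \<eta> Y) (\<lambda>f. f x)" by (rule mhom_restrict_dom[OF ev[OF x(1)] KS])
    moreover have "ker (subm ?H (?K S')) (restrict_scalars \<eta> Y) (\<lambda>f. f x) = ?K (insert x S')" by (auto simp: ker_def)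
    ultimately have *: "len_le k (subm ?H (?K S')) (l + n)" if "len_le k (subm ?H (?K (insert x S'))) l" for l
      using len_le_ext[OF left_module_subm[OF Hl KS] Ykl _ n, of "\<lambda>f. f x" l] that by simp
    show ?case
    proof (intro exI[of _ "n + m"] allI impI)
      fix l assume "len_le k (subm ?H (?K (insert x S'))) l"
      then show "len_le k (subm ?H (?K {})) (l + (n + m))" using m[OF *] by (simp only: add.assoc)
    qed
  qed
  then obtain m where m: "\<And>l. len_le k (subm ?H (?K S)) l \<Longrightarrow> len_le k (subm ?H (?K {})) (l + m)" by blast
  have "?K S = {lin_zero X Y}"
  proof
    show "?K S \<subseteq> {lin_zero X Y}"
    proof
      fix f assume f: "f \<in> ?K S"
      then have fm: "mhom R X Y f" by (auto dest: lin_mhom)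
      have "ker X Y f = carrier X"
        by (rule S(3)[OF submodule_ker[OF Xl Yl fm]]) (use f S(2) in \<open>auto simp: ker_def\<close>)
      then have "f x = \<zero>\<^bsub>Y\<^esub>" if "x \<in> carrier X" for x using that by (auto simp: ker_def)
      then show "f \<in> {lin_zero X Y}"
        using f lin_eqI[OF _ lin_zero_closed[OF Xl Yl], of f] by (auto simp: lin_zero_nth)
    qed
    show "{lin_zero X Y} \<subseteq> ?K S" using lin_zero_closed[OF Xl Yl] S(2) by (auto simp: lin_zero_nth)
  qed
  then have "len_le k (subm ?H (?K S)) 0"
    using left_module_subm[OF Hl K[OF S(2)]] by (intro len_le_zero) auto
  then have "len_le k (subm ?H (lin R X Y)) (0 + m)" using m[of 0] by simp
  moreover have "subm ?H (lin R X Y) = ?H" by (simp add: homk_def)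
  ultimately show ?thesis using k.len_fg[OF Hl] by simp
qed

lemma opp_simps [simp]:
  "carrier (opp R) = carrier R" "\<zero>\<^bsub>opp R\<^esub> = \<zero>\<^bsub>R\<^esub>" "\<one>\<^bsub>opp R\<^esub> = \<one>\<^bsub>R\<^esub>" "a \<oplus>\<^bsub>opp R\<^esub> b = a \<oplus>\<^bsub>R\<^esub> b" "a \<otimes>\<^bsub>opp R\<^esub> b = b \<otimes>\<^bsub>R\<^esub> a"
  by (simp_all add: opp_def)

end

lemma ring_opp: "ring R \<Longrightarrow> ring (opp R)"
proof -
  assume "ring R"
  then interpret ring R .
  show ?thesis
  proof (rule ringI)
    show "abelian_group (opp R)"
    proof (rule abelian_groupI)
      show "\<exists>y\<in>carrier (opp R). y \<oplus>\<^bsub>opp R\<^esub> x = \<zero>\<^bsub>opp R\<^esub>" if "x \<in> carrier (opp R)" for x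
        using that by (intro bexI[of _ "\<ominus>\<^bsub>R\<^esub> x"]) (auto simp: opp_def l_neg)
    qed (auto simp: opp_def a_ac)
    show "Group.monoid (opp R)" by (rule monoidI) (auto simp: opp_def m_assoc)
  qed (auto simp: opp_def l_distr r_distr)
qed

context artin_alg
begin

lemma artin_alg_opp: "artin_alg k \<eta> (opp R)"
proof -
  have h: "\<eta> \<in> ring_hom k (opp R)"
  proof (rule ring_hom_memI)
    show "\<eta> (b \<otimes>\<^bsub>k\<^esub> c) = \<eta> b \<otimes>\<^bsub>opp R\<^esub> \<eta> c" if "b \<in> carrier k" "c \<in> carrier k" for b c
      using that eta_central[of b "\<eta> c"] by simp
  qed simp_all
  have "fg_module k (restrict_scalars \<eta> (regular (opp R)))"
  proof (rule fg_surj[OF fg_regular_k])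
    show "mhom k (restrict_scalars \<eta> (regular R)) (restrict_scalars \<eta> (regular (opp R))) (\<lambda>x. x)"
      by (intro mhomI) (simp_all add: regular_def, subst eta_central, simp_all)
    show "left_module k (restrict_scalars \<eta> (regular (opp R)))"
      by (rule left_module_restrict_scalars[OF k.ring_axioms h left_module_regular[OF ring_opp[OF ring_R]]])
  qed (auto simp: regular_def)
  then show ?thesis
    using artin ring_opp[OF ring_R] h eta_central by (auto simp: artin_alg_def artin_algebra_def)
qed

text \<open>Makes \<open>fg_homk\<close> applicable to \<open>k\<close>-linear maps, which is how
  duals are seen to be finitely generated.\<close>

lemma artin_alg_base: "artin_alg k (\<lambda>c. c) k"
proof -
  have "fg_module k (restrict_scalars (\<lambda>c. c) (regular k))"
  proof (rule fg_surj[OF fg_regular[OF k.ring_axioms]])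
    show "mhom k (regular k) (restrict_scalars (\<lambda>c. c) (regular k)) (\<lambda>x. x)" by (intro mhomI) auto
    show "left_module k (restrict_scalars (\<lambda>c. c) (regular k))"
      by (rule left_module_restrict_scalars[OF k.ring_axioms _ k.reg]) (simp add: ring_hom_def)
  qed auto
  then show ?thesis
    using k.artinian k.ring_axioms k.m_comm by (simp add: artin_alg_def artin_algebra_def ring_hom_def)
qed

subsection \<open>The dual and the dual over the ring\<close>

lemma dual_simps [simp]:
  "carrier (dual k \<eta> X) = lin k (restrict_scalars \<eta> X) (dualizing k)"
  "\<zero>\<^bsub>dual k \<eta> X\<^esub> = lin_zero (restrict_scalars \<eta> X) (dualizing k)"
  "add (dual k \<eta> X) = lin_add (restrict_scalars \<eta> X) (dualizing k)"
  "x \<in> carrier X \<Longrightarrow> (a \<odot>\<^bsub>dual k \<eta> X\<^esub> f) x = f (a \<odot>\<^bsub>X\<^esub> x)"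
  by (simp_all add: dual_def Let_def)

lemma left_module_dual:
  assumes "left_module (opp R) X"
  shows "left_module R (dual k \<eta> X)"
proof -
  interpret O: artin_alg k \<eta> "opp R" by (rule artin_alg_opp)
  interpret X: left_module "opp R" X by fact
  let ?X = "restrict_scalars \<eta> X" and ?J = "dualizing k"
  note Xl = O.left_module_restrict[OF assms] and Jl = fg_left_module[OF injective_fg[OF k.dualizing_injective]]
  note Rs = X.smult_closed[simplified] X.smult_assoc[simplified] X.smult_l_distr[simplified] X.smult_r_distr[simplified]
    X.smult_one[simplified]
  have cl: "a \<odot>\<^bsub>dual k \<eta> X\<^esub> f \<in> lin k ?X ?J" if "a \<in> carrier R" "f \<in> lin k ?X ?J" for a f
  proof -
    have "mhom k ?X ?X (\<lambda>x. a \<odot>\<^bsub>X\<^esub> x)"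
      using that(1) O.smult_commute[OF assms] Rs by (intro mhomI) auto
    then show ?thesis
      using lin_restrict[OF Xl mhom_comp[OF _ lin_mhom[OF that(2)]]] by (simp add: dual_def Let_def)
  qed
  show ?thesis
  proof (rule left_module_lin[OF Xl Jl ring_R])
    fix a b f x assume "a \<in> carrier R" "b \<in> carrier R" "f \<in> lin k ?X ?J" "x \<in> carrier ?X"
    then show "((a \<oplus>\<^bsub>R\<^esub> b) \<odot>\<^bsub>dual k \<eta> X\<^esub> f) x = (a \<odot>\<^bsub>dual k \<eta> X\<^esub> f) x \<oplus>\<^bsub>?J\<^esub> (b \<odot>\<^bsub>dual k \<eta> X\<^esub> f) x"
      using Rs mhom_add[OF lin_mhom, of f k ?X ?J "a \<odot>\<^bsub>X\<^esub> x" "b \<odot>\<^bsub>X\<^esub> x"] by simp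
  qed (use cl Rs in \<open>auto simp: lin_add_nth\<close>)
qed

lemma fg_dual:
  assumes "left_module (opp R) X" "fg_module k (restrict_scalars \<eta> X)"
  shows "fg_module R (dual k \<eta> X)"
proof (rule fg_unrestrict[OF left_module_dual[OF assms(1)]])
  interpret K: artin_alg k "\<lambda>c. c" k by (rule artin_alg_base)
  let ?X = "restrict_scalars \<eta> X" and ?J = "dualizing k"
  note J = injective_fg[OF k.dualizing_injective]
  note Jl = fg_left_module[OF J]
  have f: "fg_module k (homk (\<lambda>c. c) k ?X ?J)" by (rule K.fg_homk[OF assms(2) J])
  show "fg_module k (restrict_scalars \<eta> (dual k \<eta> X))"
  proof (rule fg_surj[OF f left_module_restrict[OF left_module_dual[OF assms(1)]]])
    \<comment> \<open>In \<open>homk\<close> the scalars act on values, in \<open>dual\<close> on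
      arguments; the two agree by linearity of \<open>f\<close>.\<close>
    show "mhom k (homk (\<lambda>c. c) k ?X ?J) (restrict_scalars \<eta> (dual k \<eta> X)) (\<lambda>f. f)"
    proof (rule mhomI)
      fix c f assume c: "c \<in> carrier k" "f \<in> carrier (homk (\<lambda>c. c) k ?X ?J)"
      then have fm: "mhom k ?X ?J f" by (auto dest: lin_mhom)
      have *: "left_module R (dual k \<eta> X)" by (rule left_module_dual[OF assms(1)])
      note Hl = K.left_module_homk[OF fg_left_module[OF assms(2)] Jl]
      show "c \<odot>\<^bsub>homk (\<lambda>c. c) k ?X ?J\<^esub> f = c \<odot>\<^bsub>restrict_scalars \<eta> (dual k \<eta> X)\<^esub> f"
      proof (rule lin_eqI[of _ k ?X ?J])
        show "c \<odot>\<^bsub>homk (\<lambda>c. c) k ?X ?J\<^esub> f \<in> lin k ?X ?J"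
          using left_module.smult_closed[OF Hl c] by simp
        show "c \<odot>\<^bsub>restrict_scalars \<eta> (dual k \<eta> X)\<^esub> f \<in> lin k ?X ?J"
          using left_module.smult_closed[OF *, of "\<eta> c" f] c by simp
        show "(c \<odot>\<^bsub>homk (\<lambda>c. c) k ?X ?J\<^esub> f) x = (c \<odot>\<^bsub>restrict_scalars \<eta> (dual k \<eta> X)\<^esub> f) x"
          if "x \<in> carrier ?X" for x
          using that mhom_smult[OF fm c(1)] by simp
      qed
    qed auto
  qed simp
qed

lemma ring_dual_simps [simp]:
  "carrier (ring_dual R M) = lin R M (regular R)" "\<zero>\<^bsub>ring_dual R M\<^esub> = lin_zero M (regular R)"
  "add (ring_dual R M) = lin_add M (regular R)"
  "x \<in> carrier M \<Longrightarrow> (a \<odot>\<^bsub>ring_dual R M\<^esub> f) x = f x \<otimes>\<^bsub>R\<^esub> a"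
  by (simp_all add: ring_dual_def)

lemma regular_simps [simp]:
  "carrier (regular R) = carrier R" "\<zero>\<^bsub>regular R\<^esub> = \<zero>\<^bsub>R\<^esub>" "x \<oplus>\<^bsub>regular R\<^esub> y = x \<oplus>\<^bsub>R\<^esub> y" "a \<odot>\<^bsub>regular R\<^esub> x = a \<otimes>\<^bsub>R\<^esub> x"
  by (auto simp: regular_def)

lemma mhom_rmult: "a \<in> carrier R \<Longrightarrow> mhom R (regular R) (regular R) (\<lambda>x. x \<otimes>\<^bsub>R\<^esub> a)"
  by (intro mhomI) (auto simp: l_distr m_assoc)

lemma left_module_ring_dual:
  assumes "left_module R M"
  shows "left_module (opp R) (ring_dual R M)"
proof -
  have cl: "a \<odot>\<^bsub>ring_dual R M\<^esub> f \<in> lin R M (regular R)" if "a \<in> carrier R" "f \<in> lin R M (regular R)" for a f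
    using lin_restrict[OF assms mhom_comp[OF lin_mhom[OF that(2)] mhom_rmult[OF that(1)]]] by (simp add: ring_dual_def)
  have fc: "f x \<in> carrier R" if "f \<in> lin R M (regular R)" "x \<in> carrier M" for f x
    using mhom_closed[OF lin_mhom[OF that(1)] that(2)] by simp
  show ?thesis
    by (rule left_module_lin[OF assms left_module_regular[OF ring_R] ring_opp[OF ring_R]])
      (use cl fc in \<open>auto simp: lin_add_nth r_distr l_distr m_assoc\<close>)
qed

lemma fg_ring_dual:
  fixes M :: "('a, 'm) module"
  assumes "fg_module R M"
  shows "fg_module k (restrict_scalars \<eta> (ring_dual R M))"
proof -
  interpret O: artin_alg k \<eta> "opp R" by (rule artin_alg_opp)
  note M = fg_left_module[OF assms]
  note Dl = left_module_ring_dual[OF M]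
  show ?thesis
  proof (rule fg_surj[OF fg_homk[OF assms fg_regular[OF ring_R]] O.left_module_restrict[OF Dl]])
    \<comment> \<open>In \<open>homk\<close> the scalars multiply values from the left, in
      \<open>ring_dual\<close> from the right; they agree because \<open>\<eta> c\<close> is
      central.\<close>
    show "mhom k (homk \<eta> R M (regular R)) (restrict_scalars \<eta> (ring_dual R M)) (\<lambda>f. f)"
    proof (rule mhomI)
      fix c f assume c: "c \<in> carrier k" "f \<in> carrier (homk \<eta> R M (regular R))"
      then have fm: "mhom R M (regular R) f" by (auto dest: lin_mhom)
      show "c \<odot>\<^bsub>homk \<eta> R M (regular R)\<^esub> f = c \<odot>\<^bsub>restrict_scalars \<eta> (ring_dual R M)\<^esub> f"
      proof (rule lin_eqI[of _ R M "regular R"])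
        show "c \<odot>\<^bsub>homk \<eta> R M (regular R)\<^esub> f \<in> lin R M (regular R)"
          using left_module.smult_closed[OF left_module_homk[OF M left_module_regular[OF ring_R]] c] by simp
        show "c \<odot>\<^bsub>restrict_scalars \<eta> (ring_dual R M)\<^esub> f \<in> lin R M (regular R)"
          using left_module.smult_closed[OF Dl, of "\<eta> c" f] c by simp
        show "(c \<odot>\<^bsub>homk \<eta> R M (regular R)\<^esub> f) x = (c \<odot>\<^bsub>restrict_scalars \<eta> (ring_dual R M)\<^esub> f) x"
          if "x \<in> carrier M" for x
          using that mhom_closed[OF fm that] c by (simp add: eta_central)
      qed
    qed auto
  qed simp
qed

subsection \<open>The endomorphism ring\<close>

lemma End_simps [simp]:
  "carrier (End_ring R T) = lin R T T" "\<zero>\<^bsub>End_ring R T\<^esub> = lin_zero T T" "add (End_ring R T) = lin_add T T"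
  "\<one>\<^bsub>End_ring R T\<^esub> = (\<lambda>x\<in>carrier T. x)" "monoid.mult (End_ring R T) = compose (carrier T)"
  by (simp_all add: End_ring_def)

lemma compose_lin:
  assumes "left_module R X" "f \<in> lin R X Y" "mhom R Y Z g"
  shows "compose (carrier X) g f \<in> lin R X Z"
  using lin_restrict[OF assms(1) mhom_comp[OF lin_mhom[OF assms(2)] assms(3)]] by (simp add: compose_def)

lemma ring_End:
  assumes "left_module R T"
  shows "ring (End_ring R T)"
proof (rule ringI)
  note cl = lin_add_closed[OF assms assms] lin_zero_closed[OF assms assms]
  have c: "f x \<in> carrier T" if "f \<in> lin R T T" "x \<in> carrier T" for f x
    using mhom_closed[OF lin_mhom[OF that(1)] that(2)] .
  have cc: "compose (carrier T) f g \<in> lin R T T" if "f \<in> lin R T T" "g \<in> lin R T T" for f g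
    by (rule compose_lin[OF assms that(2) lin_mhom[OF that(1)]])
  have one: "(\<lambda>x\<in>carrier T. x) \<in> lin R T T" by (rule lin_restrict[OF assms mhom_id])
  show "abelian_group (End_ring R T)"
    using lin_group[OF assms assms] cl by (intro abelian_groupI) simp_all
  show "Group.monoid (End_ring R T)"
    by (intro monoidI) (use cc one c in \<open>auto simp: compose_eq intro!: lin_eqI[of _ R T T]\<close>)
  show "(f \<oplus>\<^bsub>End_ring R T\<^esub> g) \<otimes>\<^bsub>End_ring R T\<^esub> h = f \<otimes>\<^bsub>End_ring R T\<^esub> h \<oplus>\<^bsub>End_ring R T\<^esub> g \<otimes>\<^bsub>End_ring R T\<^esub> h"
    if "f \<in> carrier (End_ring R T)" "g \<in> carrier (End_ring R T)" "h \<in> carrier (End_ring R T)" for f g h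
    using that cl cc c by (auto simp: compose_eq lin_add_nth intro!: lin_eqI[of _ R T T])
  show "h \<otimes>\<^bsub>End_ring R T\<^esub> (f \<oplus>\<^bsub>End_ring R T\<^esub> g) = h \<otimes>\<^bsub>End_ring R T\<^esub> f \<oplus>\<^bsub>End_ring R T\<^esub> h \<otimes>\<^bsub>End_ring R T\<^esub> g"
    if "f \<in> carrier (End_ring R T)" "g \<in> carrier (End_ring R T)" "h \<in> carrier (End_ring R T)" for f g h
    using that cl cc c by (auto simp: compose_eq lin_add_nth mhom_add[OF lin_mhom] intro!: lin_eqI[of _ R T T])
qed

text \<open>Puts the opposite endomorphism ring on the same footing as \<open>R\<close>, so that the
  results on finite length, projectives and dimensions apply to it unchanged.\<close>

lemma artin_alg_End:
  fixes T :: "('a, 'm) module"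
  assumes "fg_module R T"
  shows "artin_alg k (\<lambda>c. \<lambda>x\<in>carrier T. \<eta> c \<odot>\<^bsub>T\<^esub> x) (opp (End_ring R T))"
proof -
  let ?B = "opp (End_ring R T)" and ?\<theta> = "\<lambda>c. \<lambda>x\<in>carrier T. \<eta> c \<odot>\<^bsub>T\<^esub> x"
  note T = fg_left_module[OF assms]
  interpret T: left_module R T by (rule T)
  have B: "ring ?B" by (rule ring_opp[OF ring_End[OF T]])
  have th: "?\<theta> c \<in> lin R T T" if "c \<in> carrier k" for c by (rule lin_restrict[OF T mhom_eta[OF T that]])
  have c: "f x \<in> carrier T" if "f \<in> lin R T T" "x \<in> carrier T" for f x
    using mhom_closed[OF lin_mhom[OF that(1)] that(2)] .
  have cc: "compose (carrier T) f g \<in> lin R T T" if "f \<in> lin R T T" "g \<in> lin R T T" for f g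
    by (rule compose_lin[OF T that(2) lin_mhom[OF that(1)]])
  have hom: "?\<theta> \<in> ring_hom k ?B"
  proof (rule ring_hom_memI)
    fix b c assume *: "b \<in> carrier k" "c \<in> carrier k"
    show "?\<theta> (b \<otimes>\<^bsub>k\<^esub> c) = ?\<theta> b \<otimes>\<^bsub>?B\<^esub> ?\<theta> c"
      using * smult_commute[OF T *(1) eta(1)[OF *(2)]]
      by (auto simp: opp_def compose_def T.smult_assoc intro!: restrict_ext)
    show "?\<theta> (b \<oplus>\<^bsub>k\<^esub> c) = ?\<theta> b \<oplus>\<^bsub>?B\<^esub> ?\<theta> c"
      using * by (auto simp: opp_def lin_add_def T.smult_l_distr intro!: restrict_ext)
  next
    show "?\<theta> \<one>\<^bsub>k\<^esub> = \<one>\<^bsub>?B\<^esub>" by (auto simp: opp_def intro!: restrict_ext)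
  qed (use th in \<open>simp add: opp_def\<close>)
  have central: "?\<theta> c \<otimes>\<^bsub>?B\<^esub> f = f \<otimes>\<^bsub>?B\<^esub> ?\<theta> c" if "c \<in> carrier k" "f \<in> carrier ?B" for c f
    using that th cc mhom_smult[OF lin_mhom, of f R T T "\<eta> c"] cc[OF _ th[OF that(1)], of f]
    by (auto simp: opp_def compose_def c intro!: restrict_ext)
  have "fg_module k (restrict_scalars ?\<theta> (regular ?B))"
  proof (rule fg_surj[OF fg_homk[OF assms assms]])
    show "mhom k (homk \<eta> R T T) (restrict_scalars ?\<theta> (regular ?B)) (\<lambda>f. f)"
    proof (rule mhomI)
      fix a f assume "a \<in> carrier k" "f \<in> carrier (homk \<eta> R T T)"
      then show "a \<odot>\<^bsub>homk \<eta> R T T\<^esub> f = a \<odot>\<^bsub>restrict_scalars ?\<theta> (regular ?B)\<^esub> f"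
        using mhom_smult[OF lin_mhom, of f R T T "\<eta> a"]
        by (auto simp: homk_def regular_def opp_def compose_def intro!: restrict_ext)
    qed (auto simp: regular_def opp_def)
    show "left_module k (restrict_scalars ?\<theta> (regular ?B))"
      by (rule left_module_restrict_scalars[OF k.ring_axioms hom left_module_regular[OF B]])
  qed (auto simp: regular_def opp_def)
  then show ?thesis using artin B hom central by (simp add: artin_alg_def artin_algebra_def)
qed

end

section \<open>Modules generated by projective-injective modules\<close>

text \<open>The torsion modules of the overview. A single \<open>E\<close> is enough, since finite
  sums of projective-injective modules are again projective-injective.\<close>

definition pi_gen :: "('a, 'c) ring_scheme \<Rightarrow> ('a, 'm) module \<Rightarrow> bool" where
  "pi_gen R M \<longleftrightarrow> fg_module R M \<and> (\<exists>(E :: 'a umod) p. projective R E \<and> injective R E \<and>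
     mhom R E M p \<and> p ` carrier E = carrier M)"

text \<open>The trace of \<open>T\<close> in \<open>M\<close> is all of \<open>M\<close>. In this
  form no epimorphism from a power of \<open>T\<close> has to be carried along.\<close>

definition gen_by :: "('a, 'c) ring_scheme \<Rightarrow> ('a, 'm) module \<Rightarrow> ('a, 'n) module \<Rightarrow> bool" where
  "gen_by R T M \<longleftrightarrow> (\<forall>N. submodule N R M \<and> (\<forall>h. mhom R T M h \<longrightarrow> h ` carrier T \<subseteq> N) \<longrightarrow> N = carrier M)"

definition hom_zero :: "('a, 'c) ring_scheme \<Rightarrow> ('a, 'm) module \<Rightarrow> ('a, 'n) module \<Rightarrow> bool" where
  "hom_zero R T K \<longleftrightarrow> (\<forall>h. mhom R T K h \<longrightarrow> (\<forall>x\<in>carrier T. h x = \<zero>\<^bsub>K\<^esub>))"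

text \<open>\<open>ext_prop R P1 P0 d M\<close>: every map from \<open>P1\<close> to \<open>M\<close> extends along \<open>d\<close>. If
  \<open>0 \<rightarrow> P1 \<rightarrow> P0 \<rightarrow> X \<rightarrow> 0\<close> is exact with \<open>P0\<close> projective, this says \<open>Ext\<^sup>1(X, M) = 0\<close>.\<close>

definition ext_prop :: "('a, 'c) ring_scheme \<Rightarrow> ('a, 'm) module \<Rightarrow> ('a, 'n) module \<Rightarrow> ('m \<Rightarrow> 'n) \<Rightarrow> ('a, 'u) module \<Rightarrow> bool" where
  "ext_prop R P1 P0 d M \<longleftrightarrow> (\<forall>g. mhom R P1 M g \<longrightarrow> (\<exists>t. mhom R P0 M t \<and> (\<forall>x\<in>carrier P1. t (d x) = g x)))"

lemma hom_zeroD: "hom_zero R T K \<Longrightarrow> mhom R T K h \<Longrightarrow> x \<in> carrier T \<Longrightarrow> h x = \<zero>\<^bsub>K\<^esub>"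
  by (auto simp: hom_zero_def)

lemma gen_byD:
  "gen_by R T M \<Longrightarrow> submodule N R M \<Longrightarrow> \<forall>h. mhom R T M h \<longrightarrow> (\<forall>x\<in>carrier T. h x \<in> N) \<Longrightarrow> N = carrier M"
  unfolding gen_by_def by (metis image_subsetI)

lemma gen_byI:
  "(\<And>N. submodule N R M \<Longrightarrow> \<forall>h. mhom R T M h \<longrightarrow> (\<forall>x\<in>carrier T. h x \<in> N) \<Longrightarrow> carrier M \<subseteq> N) \<Longrightarrow> gen_by R T M"
  unfolding gen_by_def by (meson image_subset_iff submodule_subset subset_antisym)

text \<open>The preimage of \<open>N\<close> under \<open>i\<close> contains the images of all maps
  from \<open>T\<close>, hence is all of \<open>A\<close>. With \<open>i\<close> the identity and
  \<open>N\<close> the kernel of a difference, this reduces equations between maps to their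
  composites with maps from \<open>T\<close>.\<close>

lemma gen_by_image:
  assumes "gen_by R T A" "left_module R A" "left_module R U" "mhom R A U i" "submodule N R U"
    "\<forall>h. mhom R T U h \<longrightarrow> (\<forall>x\<in>carrier T. h x \<in> N)" "a \<in> carrier A"
  shows "i a \<in> N"
proof -
  have "h x \<in> {x \<in> carrier A. i x \<in> N}" if "mhom R T A h" "x \<in> carrier T" for h x
    using mhom_closed[OF that] assms(6)[rule_format, OF mhom_comp[OF that(1) assms(4)] that(2)] by simp
  then have "\<forall>h. mhom R T A h \<longrightarrow> (\<forall>x\<in>carrier T. h x \<in> {x \<in> carrier A. i x \<in> N})" by blast
  then have "{x \<in> carrier A. i x \<in> N} = carrier A"
    by (rule gen_byD[OF assms(1) submodule_vimage[OF assms(2-5)]])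
  then show ?thesis using assms(7) by blast
qed

lemma gen_by_surj:
  assumes "gen_by R T M" "left_module R M" "left_module R N" "mhom R M N p" "p ` carrier M = carrier N"
  shows "gen_by R T N"
proof (rule gen_byI)
  fix L assume L: "submodule L R N" "\<forall>h. mhom R T N h \<longrightarrow> (\<forall>x\<in>carrier T. h x \<in> L)"
  have "p x \<in> L" if "x \<in> carrier M" for x by (rule gen_by_image[OF assms(1-4) L that])
  then have "p ` carrier M \<subseteq> L" by blast
  then show "carrier N \<subseteq> L" unfolding assms(5) .
qed

lemma gen_by_self: "gen_by R T T"
proof (rule gen_byI)
  fix N assume "\<forall>h. mhom R T T h \<longrightarrow> (\<forall>x\<in>carrier T. h x \<in> N)"
  then show "carrier T \<subseteq> N" using mhom_id by blast
qed

lemma gen_by_biprod: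
  assumes "biprod R A C U i j p q" "gen_by R T A" "gen_by R T C"
  shows "gen_by R T U"
proof (rule gen_byI)
  note b = biprodD[OF assms(1)]
  fix N assume N: "submodule N R U" "\<forall>h. mhom R T U h \<longrightarrow> (\<forall>x\<in>carrier T. h x \<in> N)"
  have i: "i a \<in> N" if "a \<in> carrier A" for a by (rule gen_by_image[OF assms(2) b(1,3,4) N that])
  have j: "j c \<in> N" if "c \<in> carrier C" for c by (rule gen_by_image[OF assms(3) b(2,3,5) N that])
  show "carrier U \<subseteq> N" using biprod_split[OF assms(1) N(1) i j] by simp
qed

lemma gen_by_mpow:
  assumes "ring R" "left_module R M" "gen_by R T M"
  shows "gen_by R T (mpow M n)"
proof (induction n)
  case 0
  have "left_module R (mpow M 0)" by (rule left_module_dsum[OF assms(1,2)])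
  have "carrier (mpow M 0) = {\<zero>\<^bsub>mpow M 0\<^esub>}" by (auto simp: dsum_def)
  then show ?case by (intro gen_byI) (simp add: submodule_zero)
next
  case (Suc n)
  show ?case by (rule gen_by_biprod[OF biprod_dsum_Suc[OF assms(1,2)] Suc assms(3)])
qed

lemma hom_zero_gen_by:
  assumes "gen_by R T M" "hom_zero R T K" "left_module R M" "left_module R K"
  shows "hom_zero R M K"
  unfolding hom_zero_def
proof (intro allI impI ballI)
  fix h x assume h: "mhom R M K h" "x \<in> carrier M"
  have "h x \<in> {\<zero>\<^bsub>K\<^esub>}"
    by (rule gen_by_image[OF assms(1,3,4) h(1) submodule_trivial[OF assms(4)] _ h(2)]) (use hom_zeroD[OF assms(2)] in simp)
  then show "h x = \<zero>\<^bsub>K\<^esub>" by simp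
qed

lemma complementary_retract:
  assumes "left_module R M" "complementary R M A B"
  obtains q where "mhom R M (subm M A) q" "\<And>a. a \<in> A \<Longrightarrow> q a = a"
proof -
  interpret M: left_module R M by fact
  have A: "submodule A R M" and B: "submodule B R M" and int: "A \<inter> B = {\<zero>\<^bsub>M\<^esub>}" and sum: "A <+>\<^bsub>M\<^esub> B = carrier M"
    using assms(2) by (auto simp: complementary_def)
  note Al = left_module_subm[OF assms(1) A] and Bl = left_module_subm[OF assms(1) B]
  note b = biprod_pmod[OF Al Bl]
  let ?D = "pmod (subm M A) (subm M B)"
  obtain h where h: "mhom R ?D M h" "\<And>x. x \<in> carrier ?D \<Longrightarrow> h x = fst x \<oplus>\<^bsub>M\<^esub> snd x"
    using biprod_copair[OF b assms(1) mhom_subm_incl[OF A] mhom_subm_incl[OF B]] by metis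
  have D: "x \<in> carrier ?D \<longleftrightarrow> fst x \<in> A \<and> snd x \<in> B" for x by (cases x) (auto simp: pmod_def)
  note Dl = left_module_pmod[OF Al Bl]
  have inj: "inj_on h (carrier ?D)"
  proof (subst mhom_inj_iff[OF Dl assms(1) h(1)], intro ballI impI)
    fix x assume x: "x \<in> carrier ?D" "h x = \<zero>\<^bsub>M\<^esub>"
    then have ab: "fst x \<in> A" "snd x \<in> B" "fst x \<oplus>\<^bsub>M\<^esub> snd x = \<zero>\<^bsub>M\<^esub>" using D h(2) by auto
    have c: "fst x \<in> carrier M" "snd x \<in> carrier M"
      using submodule_carrierD[OF A ab(1)] submodule_carrierD[OF B ab(2)] by auto
    have "fst x = \<ominus>\<^bsub>M\<^esub> snd x" using ab(3) c M.M.minus_equality by metis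
    then have "fst x \<in> A \<inter> B" using ab submodule_neg[OF B ab(2)] by simp
    then have "fst x = \<zero>\<^bsub>M\<^esub>" using int by simp
    moreover have "snd x = \<zero>\<^bsub>M\<^esub>" using ab(3) c calculation by simp
    ultimately show "x = \<zero>\<^bsub>?D\<^esub>" by (cases x) (simp add: pmod_def)
  qed
  have "carrier M \<subseteq> h ` carrier ?D"
  proof
    fix m assume "m \<in> carrier M"
    then have "m \<in> A <+>\<^bsub>M\<^esub> B" using sum by simp
    then obtain a c where "a \<in> A" "c \<in> B" "m = a \<oplus>\<^bsub>M\<^esub> c" by (auto simp: set_add_def')
    then have "m = h (a, c)" "(a, c) \<in> carrier ?D" using D h(2) by auto
    then show "m \<in> h ` carrier ?D" by blast
  qed
  then have surj: "h ` carrier ?D = carrier M" using mhom_closed[OF h(1)] by blast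
  note inv = mhom_inverse[OF Dl h(1) inj surj]
  have "fst (inv_into (carrier ?D) h a) = a" if "a \<in> A" for a
  proof -
    have "(a, \<zero>\<^bsub>M\<^esub>) \<in> carrier ?D" "h (a, \<zero>\<^bsub>M\<^esub>) = a"
      using that D h(2) submodule_zero[OF B] submodule_carrierD[OF A that] by auto
    then show ?thesis using inv_into_f_f[OF inj, of "(a, \<zero>\<^bsub>M\<^esub>)"] by simp
  qed
  then show ?thesis using that[OF mhom_comp[OF inv biprodD(6)[OF b]]] by blast
qed

text \<open>The complement is forgotten: membership in \<open>add T\<close> is used only through an
  inclusion into a power of \<open>T\<close> and a retraction.\<close>

lemma in_add_retract:
  assumes "left_module R T" "left_module R M" "in_add R T M"
  obtains n i r where "mhom R M (mpow T n) i" "mhom R (mpow T n) M r" "\<And>x. x \<in> carrier M \<Longrightarrow> r (i x) = x"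
proof -
  interpret T: left_module R T by fact
  obtain n A B f where nAB: "complementary R (mpow T n) A B" "f \<in> lin R M (subm (mpow T n) A)" "bij_betw f (carrier M) A"
    using assms(3) by (auto simp: in_add_def mod_iso_def)
  let ?P = "mpow T n"
  have Pl: "left_module R ?P" by (rule left_module_dsum[OF T.R.ring_axioms assms(1)])
  have A: "submodule A R ?P" using nAB(1) by (simp add: complementary_def)
  obtain q where q: "mhom R ?P (subm ?P A) q" "\<And>a. a \<in> A \<Longrightarrow> q a = a"
    using complementary_retract[OF Pl nAB(1)] by metis
  note f = lin_mhom[OF nAB(2)]
  have i: "miso R M (subm ?P A) f (inv_into (carrier M) f)"
    using misoI_bij[OF assms(2) f] nAB(3) by (simp add: bij_betw_def)
  note d = misoD[OF i]
  show ?thesis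
  proof (rule that[OF mhom_from_subm[OF f A] mhom_comp[OF q(1) d(2)]])
    show "inv_into (carrier M) f (q (f x)) = x" if "x \<in> carrier M" for x
      using q(2)[of "f x"] mhom_closed[OF f that] d(3)[OF that] by simp
  qed
qed

section \<open>Torsion modules, lifting properties and minimal covers\<close>

context finite_length_ring
begin

lemma pi_gen_fg: "pi_gen R M \<Longrightarrow> fg_module R M"
  by (simp add: pi_gen_def)

lemma pi_genI:
  fixes E :: "('a, 'e) module"
  assumes "projective R E" "injective R E" "mhom R E M p" "p ` carrier E = carrier M" "left_module R M"
  shows "pi_gen R M"
proof -
  note Ef = projective_fg[OF assms(1)]
  obtain E' :: "'a umod" and f g where E': "fg_module R E'" "miso R E E' f g" using ex_umod[OF Ef] by blast
  note E'l = fg_left_module[OF E'(1)]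
  have "(\<lambda>x. p (g x)) ` carrier E' = carrier M" using misoD(8)[OF E'(2)] assms(4) image_image[of p g] by metis
  then show ?thesis
    unfolding pi_gen_def
    using fg_surj[OF Ef assms(5,3,4)] projective_miso[OF assms(1) E'l E'(2)] injective_miso[OF assms(2) E'l E'(2)]
      mhom_comp[OF misoD(2)[OF E'(2)] assms(3)] by blast
qed

lemma pi_genE:
  assumes "pi_gen R M"
  obtains E :: "'a umod" and p where "projective R E" "injective R E" "mhom R E M p" "p ` carrier E = carrier M"
  using assms unfolding pi_gen_def by blast

lemma pi_gen_surj:
  assumes "pi_gen R M" "left_module R N" "mhom R M N f" "f ` carrier M = carrier N"
  shows "pi_gen R N"
proof -
  obtain E :: "'a umod" and p where E: "projective R E" "injective R E" "mhom R E M p" "p ` carrier E = carrier M"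
    using pi_genE[OF assms(1)] by blast
  have "(\<lambda>x. f (p x)) ` carrier E = carrier N" using E(4) assms(4) image_image[of f p] by metis
  then show ?thesis by (rule pi_genI[OF E(1,2) mhom_comp[OF E(3) assms(3)] _ assms(2)])
qed

lemma pi_gen_biprod:
  assumes "biprod R A C U i j p q" "pi_gen R A" "pi_gen R C"
  shows "pi_gen R U"
proof -
  note b = biprodD[OF assms(1)]
  interpret U: left_module R U by (rule b(3))
  obtain E :: "'a umod" and e where E: "projective R E" "injective R E" "mhom R E A e" "e ` carrier E = carrier A"
    using pi_genE[OF assms(2)] by blast
  obtain F :: "'a umod" and f where F: "projective R F" "injective R F" "mhom R F C f" "f ` carrier F = carrier C"
    using pi_genE[OF assms(3)] by blast
  obtain D :: "'a umod" and i' j' p' q' where D: "biprod R E F D i' j' p' q'"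
    by (rule ex_biprod[OF projective_fg[OF E(1)] projective_fg[OF F(1)]], rule that)
  note d = biprodD[OF D]
  obtain h where h: "mhom R D U h" "\<And>a. a \<in> carrier E \<Longrightarrow> h (i' a) = i (e a)" "\<And>a. a \<in> carrier F \<Longrightarrow> h (j' a) = j (f a)"
    using biprod_copair[OF D b(3) mhom_comp[OF E(3) b(4)] mhom_comp[OF F(3) b(5)]] by metis
  have R: "submodule (h ` carrier D) R U" by (rule submodule_range[OF d(3) b(3) h(1)])
  have "h ` carrier D = carrier U"
  proof (rule biprod_split[OF assms(1) R])
    fix a assume "a \<in> carrier A"
    then obtain x where x: "x \<in> carrier E" "a = e x" using E(4) by (metis imageE)
    then show "i a \<in> h ` carrier D" using h(2)[OF x(1)] mhom_closed[OF d(4) x(1)] by (metis imageI)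
  next
    fix a assume "a \<in> carrier C"
    then obtain x where x: "x \<in> carrier F" "a = f x" using F(4) by (metis imageE)
    then show "j a \<in> h ` carrier D" using h(3)[OF x(1)] mhom_closed[OF d(5) x(1)] by (metis imageI)
  qed
  then show ?thesis
    by (rule pi_genI[OF projective_biprod[OF D E(1) F(1)] injective_biprod[OF D E(2) F(2)] h(1) _ b(3)])
qed

lemma pi_gen_zero: "left_module R M \<Longrightarrow> carrier M = {\<zero>\<^bsub>M\<^esub>} \<Longrightarrow> pi_gen R M"
  by (rule pi_genI[OF projective_zero injective_zero mhom_id]) auto

lemma pi_gen_mpow:
  assumes "pi_gen R M"
  shows "pi_gen R (mpow M n)"
proof (induction n)
  case 0
  show ?case by (rule pi_gen_zero[OF zero_dsum])
next
  case (Suc n)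
  show ?case
    by (rule pi_gen_biprod[OF biprod_dsum_Suc[OF ring_axioms] Suc assms]) (rule fg_left_module[OF pi_gen_fg[OF assms]])
qed

text \<open>A maximal torsion submodule is the largest one, because the sum of two torsion
  submodules is a quotient of their direct sum and so is torsion.\<close>

lemma ex_torsion:
  fixes K :: "('a, 'm) module"
  assumes "fg_module R K"
  obtains N where "submodule N R K" "pi_gen R (subm K N)"
    "\<And>L. submodule L R K \<Longrightarrow> pi_gen R (subm K L) \<Longrightarrow> L \<subseteq> N"
proof -
  note Kl = fg_left_module[OF assms]
  interpret K: left_module R K by (rule Kl)
  let ?P = "\<lambda>N. pi_gen R (subm K N)"
  obtain n where n: "len_le R K n" using fg_len[OF assms] by blast
  have z: "?P {\<zero>\<^bsub>K\<^esub>}" using left_module_subm[OF Kl submodule_trivial[OF Kl]] by (intro pi_gen_zero) auto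
  obtain N where N: "submodule N R K" "?P N" "\<And>N'. submodule N' R K \<Longrightarrow> ?P N' \<Longrightarrow> N \<subseteq> N' \<Longrightarrow> N' = N"
    by (rule len_max[where P = ?P, OF n submodule_trivial[OF Kl] z]) (rule that)
  have "L \<subseteq> N" if L: "submodule L R K" "?P L" for L
  proof -
    note Nl = left_module_subm[OF Kl N(1)] and Ll = left_module_subm[OF Kl L(1)]
    note b = biprod_pmod[OF Nl Ll]
    note d = biprodD[OF b]
    obtain h where h: "mhom R (pmod (subm K N) (subm K L)) K h" "\<And>a. a \<in> carrier (subm K N) \<Longrightarrow> h (a, \<zero>\<^bsub>subm K L\<^esub>) = a"
      "\<And>a. a \<in> carrier (subm K L) \<Longrightarrow> h (\<zero>\<^bsub>subm K N\<^esub>, a) = a"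
      using biprod_copair[OF b Kl mhom_subm_incl[OF N(1)] mhom_subm_incl[OF L(1)]] by metis
    let ?S = "h ` carrier (pmod (subm K N) (subm K L))"
    have S: "submodule ?S R K" by (rule submodule_range[OF d(3) Kl h(1)])
    have "?P ?S"
      by (rule pi_gen_surj[OF pi_gen_biprod[OF b N(2) L(2)] left_module_subm[OF Kl S] mhom_to_subm[OF h(1)]]) auto
    moreover have "N \<subseteq> ?S"
    proof
      fix a assume "a \<in> N"
      then show "a \<in> ?S" using h(2)[of a] mhom_closed[OF d(4), of a] by (intro image_eqI[of _ _ "(a, \<zero>\<^bsub>subm K L\<^esub>)"]) simp_all
    qed
    ultimately have "?S = N" using N(3)[OF S] by blast
    moreover have "L \<subseteq> ?S"
    proof
      fix a assume "a \<in> L"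
      then show "a \<in> ?S" using h(3)[of a] mhom_closed[OF d(5), of a] by (intro image_eqI[of _ _ "(\<zero>\<^bsub>subm K N\<^esub>, a)"]) simp_all
    qed
    ultimately show ?thesis by simp
  qed
  with N(1,2) show ?thesis by (rule that)
qed

lemma torsion_image:
  fixes K :: "('a, 'm) module" and X :: "('a, 'x) module"
  assumes "left_module R K" "\<And>L. submodule L R K \<Longrightarrow> pi_gen R (subm K L) \<Longrightarrow> L \<subseteq> N"
    "pi_gen R X" "mhom R X K h" "x \<in> carrier X"
  shows "h x \<in> N"
proof -
  note Xl = fg_left_module[OF pi_gen_fg[OF assms(3)]]
  have S: "submodule (h ` carrier X) R K" by (rule submodule_range[OF Xl assms(1,4)])
  have "pi_gen R (subm K (h ` carrier X))"
    by (rule pi_gen_surj[OF assms(3) left_module_subm[OF assms(1) S] mhom_to_subm[OF assms(4)]]) auto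
  then show ?thesis using assms(2)[OF S] assms(5) by blast
qed

text \<open>A map from \<open>P1\<close> to \<open>M\<close> lifts to the projective-injective cover
  \<open>E\<close> of \<open>M\<close>, extends along \<open>d\<close> because \<open>E\<close> is
  injective, and is pushed down to \<open>M\<close> again.\<close>

lemma pi_gen_ext_prop:
  fixes P1 :: "('a, 'p) module" and P0 :: "('a, 'q) module"
  assumes "projective R P1" "fg_module R P0" "mhom R P1 P0 d" "inj_on d (carrier P1)" "pi_gen R M"
  shows "ext_prop R P1 P0 d M"
  unfolding ext_prop_def
proof (intro allI impI)
  fix g assume g: "mhom R P1 M g"
  obtain E :: "'a umod" and p where E: "projective R E" "injective R E" "mhom R E M p" "p ` carrier E = carrier M"
    using pi_genE[OF assms(5)] by blast
  obtain l where l: "mhom R P1 E l" "\<And>x. x \<in> carrier P1 \<Longrightarrow> p (l x) = g x"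
    using proj_lift[OF assms(1) projective_fg[OF E(1)] E(3,4) fg_left_module[OF pi_gen_fg[OF assms(5)]] g] by blast
  obtain t where t: "mhom R P0 E t" "\<And>x. x \<in> carrier P1 \<Longrightarrow> t (d x) = l x"
    using inj_extend[OF E(2) projective_fg[OF assms(1)] assms(2-4) l(1)] by blast
  show "\<exists>t. mhom R P0 M t \<and> (\<forall>x\<in>carrier P1. t (d x) = g x)"
    using mhom_comp[OF t(1) E(3)] t(2) l(2) by (intro exI[of _ "\<lambda>x. p (t x)"]) simp
qed

text \<open>The piece of the long exact sequence that is needed: maps from \<open>X0\<close> lift
  along \<open>p\<close> when the obstruction in the kernel vanishes. The composite with
  \<open>\<pi>\<close> lifts to \<open>P0\<close>; on \<open>P1\<close> this lift takes values in
  \<open>K\<close>, and extending those to \<open>P0\<close> and subtracting makes it descend to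
  \<open>X0\<close>.\<close>

lemma ext_prop_lift:
  fixes P1 :: "('a, 'p) module" and P0 :: "('a, 'q) module" and X0 :: "('a, 'r) module"
    and K :: "('a, 'm) module" and Y :: "('a, 'n) module" and X :: "('a, 'u) module"
  assumes "ses R P1 P0 X0 d \<pi>" "projective R P0" "ses R K Y X i p" "fg_module R Y" "ext_prop R P1 P0 d K" "mhom R X0 X h"
  obtains h' where "mhom R X0 Y h'" "\<And>x. x \<in> carrier X0 \<Longrightarrow> p (h' x) = h x"
proof -
  note a = sesD[OF assms(1)] and b = sesD[OF assms(3)]
  interpret Y: left_module R Y by (rule b(2))
  interpret X: left_module R X by (rule b(3))
  obtain s where s: "mhom R P0 Y s" "\<And>x. x \<in> carrier P0 \<Longrightarrow> p (s x) = h (\<pi> x)"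
    using proj_lift[OF assms(2,4) b(5,7,3) mhom_comp[OF a(5) assms(6)]] by blast
  have hz: "h \<zero>\<^bsub>X0\<^esub> = \<zero>\<^bsub>X\<^esub>" by (rule mhom_zero[OF a(3) b(3) assms(6)])
  have "s (d x) \<in> i ` carrier K" if "x \<in> carrier P1" for x
    using that mhom_closed[OF a(4)] mhom_closed[OF s(1)] by (intro b(10)) (auto simp: s(2) a(9) hz)
  then obtain g where g: "mhom R P1 K g" "\<And>x. x \<in> carrier P1 \<Longrightarrow> i (g x) = s (d x)"
    using factor_through_mono[OF b(1) a(1) b(4,6) mhom_comp[OF a(4) s(1)]] by metis
  obtain t where t: "mhom R P0 K t" "\<And>x. x \<in> carrier P1 \<Longrightarrow> t (d x) = g x"
    using assms(5) g(1) unfolding ext_prop_def by blast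
  let ?f = "\<lambda>x. s x \<ominus>\<^bsub>Y\<^esub> i (t x)"
  have f: "mhom R P0 Y ?f" by (rule mhom_diff[OF b(2) s(1) mhom_comp[OF t(1) b(4)]])
  have "?f x = \<zero>\<^bsub>Y\<^esub>" if x: "x \<in> carrier P0" "\<pi> x = \<zero>\<^bsub>X0\<^esub>" for x
  proof -
    obtain y where y: "y \<in> carrier P1" "x = d y" using a(10)[OF x] by blast
    then show ?thesis using g(2)[OF y(1)] t(2)[OF y(1)] mhom_closed[OF s(1) x(1)] by simp
  qed
  then obtain h' where h': "mhom R X0 Y h'" "\<And>x. x \<in> carrier P0 \<Longrightarrow> h' (\<pi> x) = ?f x"
    using factor_through[OF a(2,3) b(2) a(5,7) f] by metis
  have "p (h' x) = h x" if "x \<in> carrier X0" for x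
  proof -
    have "x \<in> \<pi> ` carrier P0" using that a(7) by simp
    then obtain y where y: "y \<in> carrier P0" "x = \<pi> y" by blast
    then show ?thesis using mhom_closed[OF s(1)] mhom_closed[OF t(1)] mhom_closed[OF b(4)] mhom_closed[OF b(5)]
      by (simp add: h'(2) mhom_minus[OF b(2,3,5)] b(9) s(2)[symmetric])
  qed
  then show ?thesis using that h'(1) by blast
qed

lemma mpow_lift:
  assumes "left_module R T" "left_module R Y" "left_module R X" "mhom R Y X p"
    "\<And>h. mhom R T X h \<Longrightarrow> \<exists>h'. mhom R T Y h' \<and> (\<forall>x\<in>carrier T. p (h' x) = h x)" "mhom R (mpow T n) X h"
  shows "\<exists>h'. mhom R (mpow T n) Y h' \<and> (\<forall>x\<in>carrier (mpow T n). p (h' x) = h x)"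
  using assms(6)
proof (induction n arbitrary: h)
  case 0
  show ?case using mhom_const_zero[OF assms(2)] mhom_zero[OF assms(2-4)] mhom_zero[OF zero_dsum(1) assms(3) "0"] zero_dsum(2)[of "\<lambda>_. T"]
    by (intro exI[of _ "\<lambda>_. \<zero>\<^bsub>Y\<^esub>"]) auto
next
  case (Suc n)
  note b = biprod_dsum_Suc[OF ring_axioms, of n "\<lambda>_. T", OF assms(1)]
  note d = biprodD[OF b]
  obtain f where f: "mhom R (mpow T n) Y f" "\<And>x. x \<in> carrier (mpow T n) \<Longrightarrow>
      p (f x) = h (\<lambda>i\<in>{..<Suc n}. if i < n then x i else \<zero>\<^bsub>T\<^esub>)"
    using Suc.IH[OF mhom_comp[OF d(4) Suc.prems]] by blast
  obtain g where g: "mhom R T Y g" "\<And>x. x \<in> carrier T \<Longrightarrow> p (g x) = h (\<lambda>i\<in>{..<Suc n}. if i < n then \<zero>\<^bsub>T\<^esub> else x)"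
    using assms(5)[OF mhom_comp[OF d(5) Suc.prems]] by blast
  obtain h' where h': "mhom R (mpow T (Suc n)) Y h'"
    "\<And>u. u \<in> carrier (mpow T (Suc n)) \<Longrightarrow> h' u = f (restrict u {..<n}) \<oplus>\<^bsub>Y\<^esub> g (u n)"
    using biprod_copair[OF b assms(2) f(1) g(1)] by metis
  have "p (h' u) = h u" if u: "u \<in> carrier (mpow T (Suc n))" for u
  proof -
    note c = mhom_closed[OF d(6) u] mhom_closed[OF d(7) u]
    have "p (h' u) = h (\<lambda>i\<in>{..<Suc n}. if i < n then restrict u {..<n} i else \<zero>\<^bsub>T\<^esub>) \<oplus>\<^bsub>X\<^esub>
        h (\<lambda>i\<in>{..<Suc n}. if i < n then \<zero>\<^bsub>T\<^esub> else u n)"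
      unfolding h'(2)[OF u] mhom_add[OF assms(4) mhom_closed[OF f(1) c(1)] mhom_closed[OF g(1) c(2)]]
      using f(2)[OF c(1)] g(2)[OF c(2)] by simp
    also have "\<dots> = h u"
      unfolding mhom_add[OF Suc.prems mhom_closed[OF d(4) c(1)] mhom_closed[OF d(5) c(2)], symmetric] d(12)[OF u] ..
    finally show ?thesis .
  qed
  with h'(1) show ?case by blast
qed

text \<open>If \<open>g\<close> is onto but not injective, taking preimages embeds the submodules of
  \<open>N\<close> strictly monotonically into those containing the nonzero kernel. So every length
  bound can be lowered by one, forever.\<close>

lemma surj_endo_inj:
  fixes N :: "('a, 'm) module"
  assumes "fg_module R N" "mhom R N N g" "g ` carrier N = carrier N"
  shows "inj_on g (carrier N)"
proof (rule ccontr)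
  assume ni: "\<not> inj_on g (carrier N)"
  note Nl = fg_left_module[OF assms(1)]
  have v: "submodule {x \<in> carrier N. g x \<in> L} R N" if "submodule L R N" for L
    by (rule submodule_vimage[OF Nl Nl assms(2) that])
  have step: "n > 0 \<and> len_le R N (n - 1)" if "len_le R N n" for n
  proof -
    obtain \<rho> where \<rho>: "\<And>L. submodule L R N \<Longrightarrow> \<rho> L \<le> n"
      "\<And>L L'. submodule L R N \<Longrightarrow> submodule L' R N \<Longrightarrow> L \<subset> L' \<Longrightarrow> \<rho> L < (\<rho> L' :: nat)"
      using \<open>len_le R N n\<close> by (rule len_leE) blast
    let ?v = "\<lambda>L. {x \<in> carrier N. g x \<in> L}"
    obtain x where x: "x \<in> carrier N" "g x = \<zero>\<^bsub>N\<^esub>" "x \<noteq> \<zero>\<^bsub>N\<^esub>" using ni mhom_inj_iff[OF Nl Nl assms(2)] by blast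
    have pos: "\<rho> (?v L) > 0" if L: "submodule L R N" for L
    proof -
      have "x \<in> ?v L" using x submodule_zero[OF L] by simp
      then have "{\<zero>\<^bsub>N\<^esub>} \<subset> ?v L" using x submodule_zero[OF v[OF L]] by blast
      then show ?thesis using \<rho>(2)[OF submodule_trivial[OF Nl] v[OF L]] by simp
    qed
    have "n > 0" using pos[OF submodule_carrier[OF Nl]] \<rho>(1)[OF v[OF submodule_carrier[OF Nl]]] by linarith
    moreover have "len_le R N (n - 1)"
    proof (rule len_leI[of _ _ "\<lambda>L. \<rho> (?v L) - 1"])
      fix L assume L: "submodule L R N"
      then show "\<rho> (?v L) - 1 \<le> n - 1" using \<rho>(1)[OF v[OF L]] by simp
    next
      fix L L' assume *: "submodule L R N" "submodule L' R N" "L \<subset> L'"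
      then obtain y where y: "y \<in> L'" "y \<notin> L" by blast
      then obtain z where "z \<in> carrier N" "g z = y" using assms(3) submodule_carrierD[OF *(2) y(1)] by (metis imageE)
      then have "?v L \<subset> ?v L'" using * y by blast
      then have "\<rho> (?v L) < \<rho> (?v L')" by (rule \<rho>(2)[OF v[OF *(1)] v[OF *(2)]])
      then show "\<rho> (?v L) - 1 < \<rho> (?v L') - 1" using pos[OF *(1)] by linarith
    qed
    ultimately show ?thesis ..
  qed
  have "\<not> len_le R N n" for n
  proof (induction n)
    case 0
    then show ?case using step[of 0] by blast
  next
    case (Suc n)
    then show ?case using step[of "Suc n"] by auto
  qed
  then show False using fg_len[OF assms(1)] by blast
qed

lemma set_add_ker:
  assumes "left_module R M" "left_module R X" "mhom R M X e" "submodule N R M"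
  shows "N <+>\<^bsub>M\<^esub> ker M X e = carrier M \<longleftrightarrow> e ` N = e ` carrier M"
proof -
  interpret M: left_module R M by fact
  interpret X: left_module R X by fact
  note Nc = submodule_carrierD[OF assms(4)]
  show ?thesis
  proof
    assume s: "N <+>\<^bsub>M\<^esub> ker M X e = carrier M"
    have "e x \<in> e ` N" if x: "x \<in> carrier M" for x
    proof -
      have "x \<in> N <+>\<^bsub>M\<^esub> ker M X e" using x s by simp
      then obtain n c where nc: "n \<in> N" "c \<in> carrier M" "e c = \<zero>\<^bsub>X\<^esub>" "x = n \<oplus>\<^bsub>M\<^esub> c"
        by (auto simp: set_add_def' ker_def)
      then have "e x = e n" using Nc mhom_closed[OF assms(3)] by (simp add: mhom_add[OF assms(3)])
      then show ?thesis using nc(1) by blast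
    qed
    then show "e ` N = e ` carrier M" using Nc by blast
  next
    assume s: "e ` N = e ` carrier M"
    have "x \<in> N <+>\<^bsub>M\<^esub> ker M X e" if x: "x \<in> carrier M" for x
    proof -
      obtain n where n: "n \<in> N" "e x = e n" using x s by (metis imageE imageI)
      have "x \<ominus>\<^bsub>M\<^esub> n \<in> ker M X e" using n x Nc[OF n(1)] mhom_closed[OF assms(3)]
        by (simp add: ker_def mhom_minus[OF assms(1-3)])
      moreover have "x = n \<oplus>\<^bsub>M\<^esub> (x \<ominus>\<^bsub>M\<^esub> n)" using x Nc[OF n(1)] by simp
      ultimately show ?thesis using n(1) by (auto simp: set_add_def')
    qed
    then show "N <+>\<^bsub>M\<^esub> ker M X e = carrier M" using Nc by (auto simp: set_add_def' ker_def)
  qed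
qed

text \<open>A minimal submodule of a projective module mapping onto \<open>M\<close> is a direct summand, since an
  epimorphic endomorphism of a module of finite length is an automorphism.\<close>

lemma ex_min_projective_cover:
  fixes M :: "('a, 'm) module"
  assumes "fg_module R M"
  shows "\<exists>(P :: 'a umod) e. projective_cover R M P e"
proof -
  note Ml = fg_left_module[OF assms]
  obtain P :: "'a umod" and e where P: "projective R P" "mhom R P M e" "e ` carrier P = carrier M"
    using ex_projective_cover[OF assms] by blast
  note Pf = projective_fg[OF P(1)] note Pl = fg_left_module[OF Pf]
  obtain n where n: "len_le R P n" using fg_len[OF Pf] by blast
  obtain N where N: "submodule N R P" "e ` N = carrier M"
    "\<And>N'. submodule N' R P \<Longrightarrow> e ` N' = carrier M \<Longrightarrow> N' \<subseteq> N \<Longrightarrow> N' = N"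
    by (rule len_min[where P = "\<lambda>N. e ` N = carrier M", OF n submodule_carrier[OF Pl] P(3)]) (rule that)
  note Nl = left_module_subm[OF Pl N(1)] and Nc = submodule_carrierD[OF N(1)]
  have eN: "mhom R (subm P N) M e" by (rule mhom_restrict_dom[OF P(2) N(1)])
  obtain g where g: "mhom R P (subm P N) g" "\<And>x. x \<in> carrier P \<Longrightarrow> e (g x) = e x"
    using proj_lift[OF P(1) fg_subm[OF Pf N(1)] eN _ Ml P(2)] N(2) by auto
  have gN: "mhom R (subm P N) (subm P N) g" by (rule mhom_restrict_dom[OF g(1) N(1)])
  have sub: "submodule (g ` N) R P"
    using submodule_range[OF Nl Nl gN] submodule_subm[OF Pl N(1), of "g ` N"] mhom_closed[OF gN] by auto
  have "e ` (g ` N) = carrier M" using g(2) Nc N(2) by (auto simp: image_image)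
  then have gs: "g ` N = N" using N(3)[OF sub] mhom_closed[OF gN] by auto
  then have inj: "inj_on g (carrier (subm P N))" using surj_endo_inj[OF fg_subm[OF Pf N(1)] gN] by simp
  let ?i = "inv_into (carrier (subm P N)) g"
  have mi: "miso R (subm P N) (subm P N) g ?i" using misoI_bij[OF Nl gN inj] gs by simp
  note d = misoD[OF mi]
  have "projective R (subm P N)"
    by (rule projective_retract[OF P(1) Nl mhom_subm_incl[OF N(1)] mhom_comp[OF g(1) d(2)]]) (use d(3) in simp)
  moreover have "mod_epi R (subm P N) M (restrict e N)"
    using lin_restrict[OF Nl eN] N(2) by (simp add: mod_epi_def)
  moreover have "superfluous R (subm P N) (a_kernel (subm P N) M (restrict e N))"
  proof -
    have k: "a_kernel (subm P N) M (restrict e N) = ker (subm P N) M e" unfolding a_kernel_ker by (auto simp: ker_def)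
    have "L = N" if L: "submodule L R (subm P N)" "L <+>\<^bsub>subm P N\<^esub> ker (subm P N) M e = carrier (subm P N)" for L
    proof -
      have "e ` L = carrier M" using set_add_ker[OF Nl Ml eN L(1)] L(2) N(2) by simp
      moreover have "L \<subseteq> N" using submodule_subset[OF L(1)] by simp
      ultimately show ?thesis using N(3) L(1) submodule_subm[OF Pl N(1)] by blast
    qed
    then show ?thesis unfolding superfluous_def k using submodule_ker[OF Nl Ml eN] by simp
  qed
  ultimately show ?thesis unfolding projective_cover_def by blast
qed

lemma projective_cover_image:
  fixes M :: "('a, 'm) module" and P :: "'a umod" and E :: "('a, 'n) module"
  assumes "projective_cover R M P e" "left_module R M" "left_module R E" "mhom R E P t" "e ` (t ` carrier E) = carrier M"
  shows "t ` carrier E = carrier P"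
proof -
  have P: "projective R P" and e: "mhom R P M e" "e ` carrier P = carrier M"
    and sf: "\<And>N. submodule N R P \<Longrightarrow> N <+>\<^bsub>P\<^esub> ker P M e = carrier P \<Longrightarrow> N = carrier P"
    using assms(1) by (auto simp: projective_cover_def mod_epi_def lin_iff superfluous_def a_kernel_ker)
  note Pl = fg_left_module[OF projective_fg[OF P]]
  have S: "submodule (t ` carrier E) R P" by (rule submodule_range[OF assms(3) Pl assms(4)])
  show ?thesis by (rule sf[OF S]) (use set_add_ker[OF Pl assms(2) e(1) S] assms(5) e(2) in simp)
qed

text \<open>The cokernel of \<open>u\<close> has dimension at most \<open>Suc n\<close> by the
  global bound, so \<open>pd_le_sub\<close> passes the bound from \<open>V\<close> to
  \<open>K\<close>.\<close>

lemma pd_le_submodule: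
  fixes K :: "('a, 'm) module" and V :: "('a, 'n) module"
  assumes "gldim R \<le> enat (Suc n)" "left_module R K" "mhom R K V u" "inj_on u (carrier K)" "pd_le R n V"
  shows "pd_le R n K"
proof -
  note Vf = pd_le_fg[OF assms(5)] note Vl = fg_left_module[OF Vf]
  have S: "submodule (u ` carrier K) R V" by (rule submodule_range[OF assms(2) Vl assms(3)])
  obtain Q :: "'a umod" and p where Q: "fg_module R Q" "mhom R V Q p" "p ` carrier V = carrier Q"
    "\<And>x. x \<in> carrier V \<Longrightarrow> p x = \<zero>\<^bsub>Q\<^esub> \<longleftrightarrow> x \<in> u ` carrier K" using ex_quot[OF Vf S] by blast
  have "ses R K V Q u p"
    using Q(4) mhom_closed[OF assms(3)] by (intro sesI[OF assms(2) Vl fg_left_module[OF Q(1)] assms(3) Q(2) assms(4) Q(3)]) auto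
  then show ?thesis by (rule pd_le_sub[OF _ assms(5) gldim_le_pd_le[OF assms(1) Q(1)]])
qed

end

section \<open>The tilting module\<close>

lemma retract_surj:
  fixes A :: "('a, 'm) module" and M :: "('a, 'n) module"
  assumes "mhom R A M i" "mhom R M A r" "\<And>x. x \<in> carrier A \<Longrightarrow> r (i x) = x"
  shows "r ` carrier M = carrier A"
  using assms(3) mhom_closed[OF assms(1)] mhom_closed[OF assms(2)] by force

locale tilted = artin_alg k \<eta> R
  for k :: "('k, 'd) ring_scheme" and \<eta> :: "'k \<Rightarrow> 'a" and R :: "('a, 'c) ring_scheme" (structure) +
  fixes T :: "('a, 'm) module"
  assumes tilt: "tilting R T" and inC: "in_C R T"
begin

lemma T_fg: "fg_module R T"
  using tilt by (simp add: tilting_def)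

lemmas T_left = fg_left_module[OF T_fg]

lemma T_pd: "pd_le R 1 T"
  using tilt projdim_le_iff[OF T_left, of 1] by (simp add: tilting_def one_enat_def)

lemma T_C:
  shows T_pi_gen: "pi_gen R T"
    and T_embed: "\<exists>(E :: 'a umod) u. projective R E \<and> injective R E \<and> mhom R T E u \<and> inj_on u (carrier T)"
proof -
  obtain Q where Q: "is_proj_inj_sum R Q" "in_Gen R Q T" "in_Cogen R Q T" using inC by (auto simp: in_C_def)
  have "projective R Q" "injective R Q"
    using Q(1) by (auto simp: is_proj_inj_sum_def intro!: projective_dsum injective_dsum)
  then have pi: "projective R (mpow Q m)" "injective R (mpow Q m)" for m
    by (auto intro!: projective_dsum injective_dsum)
  obtain m p where p: "mod_epi R (mpow Q m) T p" using Q(2) by (auto simp: in_Gen_def)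
  then show "pi_gen R T" using pi_genI[OF pi _ _ T_left] by (auto simp: mod_epi_def lin_iff)
  obtain m' u where u: "mod_mono R T (mpow Q m') u" using Q(3) by (auto simp: in_Cogen_def)
  obtain E :: "'a umod" and f g where E: "fg_module R E" "miso R (mpow Q m') E f g"
    using ex_umod[OF projective_fg[OF pi(1)]] by blast
  note El = fg_left_module[OF E(1)] and d = misoD[OF E(2)]
  have u': "mhom R T (mpow Q m') u" "inj_on u (carrier T)" using u by (auto simp: mod_mono_def lin_iff)
  have "inj_on (\<lambda>x. f (u x)) (carrier T)"
    using comp_inj_on[OF u'(2) inj_on_subset[OF d(5)]] mhom_closed[OF u'(1)] by (auto simp: comp_def)
  then show "\<exists>(E :: 'a umod) u. projective R E \<and> injective R E \<and> mhom R T E u \<and> inj_on u (carrier T)"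
    using projective_miso[OF pi(1) El E(2)] injective_miso[OF pi(2) El E(2)] mhom_comp[OF u'(1) d(1)] by blast
qed

lemma coresolution:
  obtains T0 T1 :: "'a umod" and f g n0 i0 r0 n1 i1 r1 where "fg_module R T0" "fg_module R T1" "ses R (regular R) T0 T1 f g"
    "mhom R T0 (mpow T n0) i0" "mhom R (mpow T n0) T0 r0" "\<And>x. x \<in> carrier T0 \<Longrightarrow> r0 (i0 x) = x"
    "mhom R T1 (mpow T n1) i1" "mhom R (mpow T n1) T1 r1" "\<And>x. x \<in> carrier T1 \<Longrightarrow> r1 (i1 x) = x"
proof -
  obtain T0 T1 :: "'a umod" and f g where T: "fg_module R T0" "fg_module R T1" "in_add R T T0" "in_add R T T1"
    "mod_mono R (regular R) T0 f" "mod_epi R T0 T1 g" "f ` carrier (regular R) = a_kernel T0 T1 g"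
    using tilt by (auto simp: tilting_def)
  note l = fg_left_module[OF T(1)] fg_left_module[OF T(2)]
  have s: "ses R (regular R) T0 T1 f g"
    using T(5-7) l left_module_regular[OF ring_R] by (simp add: ses_def mod_mono_def mod_epi_def lin_iff a_kernel_ker)
  obtain n0 i0 r0 where a: "mhom R T0 (mpow T n0) i0" "mhom R (mpow T n0) T0 r0" "\<And>x. x \<in> carrier T0 \<Longrightarrow> r0 (i0 x) = x"
    using in_add_retract[OF T_left l(1) T(3)] by metis
  obtain n1 i1 r1 where b: "mhom R T1 (mpow T n1) i1" "mhom R (mpow T n1) T1 r1" "\<And>x. x \<in> carrier T1 \<Longrightarrow> r1 (i1 x) = x"
    using in_add_retract[OF T_left l(2) T(4)] by metis
  show ?thesis by (rule that[OF T(1,2) s a b])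
qed

lemma left_module_mpow: "left_module R M \<Longrightarrow> left_module R (mpow M n)"
  by (rule left_module_dsum[OF ring_R])

text \<open>\<open>E\<close> is a summand of a free module, which the coresolution embeds into a
  power of \<open>T0\<close>. As \<open>E\<close> is injective it splits off there, so it is a
  quotient of a module generated by \<open>T\<close>.\<close>

lemma gen_by_T_pi:
  fixes E :: "('a, 'e) module"
  assumes "projective R E" "injective R E"
  shows "gen_by R T E"
proof -
  obtain T0 T1 :: "'a umod" and f g n0 i0 r0 where c: "fg_module R T0" "ses R (regular R) T0 T1 f g"
    "mhom R T0 (mpow T n0) i0" "mhom R (mpow T n0) T0 r0" "\<And>x. x \<in> carrier T0 \<Longrightarrow> r0 (i0 x) = x"
    by (rule coresolution, rule that)
  note s = sesD[OF c(2)]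
  note Ef = projective_fg[OF assms(1)] note El = fg_left_module[OF Ef]
  have T0: "gen_by R T T0"
    by (rule gen_by_surj[OF gen_by_mpow[OF ring_R T_left gen_by_self] left_module_mpow[OF T_left] s(2) c(4) retract_surj[OF c(3,4), OF c(5)]])
  obtain n h where h: "mhom R (mpow (regular R) n) E h" "h ` carrier (mpow (regular R) n) = carrier E"
    using fg_free_cover[OF Ef] by blast
  obtain t where t: "mhom R E (mpow (regular R) n) t" "\<And>x. x \<in> carrier E \<Longrightarrow> h (t x) = x"
    by (rule proj_lift[OF assms(1) fg_dsum[OF fg_regular[OF ring_R]] h El mhom_id]) (rule that)
  let ?F = "\<lambda>x. \<lambda>i\<in>{..<n}. f (x i)"
  have F: "mhom R (mpow (regular R) n) (mpow T0 n) ?F" by (rule mpow_mhom[OF s(1,2,4)])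
  have "inj_on t (carrier E)" using t(2) by (intro inj_on_inverseI[of _ h]) simp
  then have inj: "inj_on (\<lambda>x. ?F (t x)) (carrier E)"
    using comp_inj_on[OF _ inj_on_subset[OF mpow_inj[OF s(6), of n]], of t "carrier E"] mhom_closed[OF t(1)]
    by (auto simp: comp_def)
  have u: "mhom R E (mpow T0 n) (\<lambda>x. ?F (t x))" by (rule mhom_comp[OF t(1) F])
  obtain r where r: "mhom R (mpow T0 n) E r" "\<And>x. x \<in> carrier E \<Longrightarrow> r (?F (t x)) = x"
    by (rule inj_extend[OF assms(2) Ef fg_dsum[OF c(1)] u inj mhom_id]) (rule that)
  show ?thesis
    by (rule gen_by_surj[OF gen_by_mpow[OF ring_R s(2) T0] left_module_mpow[OF s(2)] El r(1) retract_surj[OF u r(1)]])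
      (rule r(2))
qed

lemma gen_by_T_pi_gen:
  assumes "pi_gen R M"
  shows "gen_by R T M"
proof -
  obtain E :: "'a umod" and p where E: "projective R E" "injective R E" "mhom R E M p" "p ` carrier E = carrier M"
    using pi_genE[OF assms] by blast
  show ?thesis
    by (rule gen_by_surj[OF gen_by_T_pi[OF E(1,2)] fg_left_module[OF projective_fg[OF E(1)]] fg_left_module[OF pi_gen_fg[OF assms]] E(3,4)])
qed

lemma pi_gen_hom_zero:
  assumes "pi_gen R M" "hom_zero R T K" "left_module R K" "mhom R M K h" "x \<in> carrier M"
  shows "h x = \<zero>\<^bsub>K\<^esub>"
  by (rule hom_zeroD[OF hom_zero_gen_by[OF gen_by_T_pi_gen[OF assms(1)] assms(2) fg_left_module[OF pi_gen_fg[OF assms(1)]] assms(3)] assms(4,5)])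

text \<open>The projective cover of \<open>T\<close> is a summand of a projective-injective module mapping onto \<open>T\<close>,
  and its kernel is projective, so the next map of a minimal presentation is injective.\<close>

lemma min_presentation:
  fixes P1 P0 :: "'a umod"
  assumes "min_projective_presentation R T P1 P0 d e"
  shows "ses R P1 P0 T d e" "projective R P1" "projective R P0" "injective R P0"
proof -
  let ?K = "subm P0 (ker P0 T e)"
  have cov0: "projective_cover R T P0 e" and cov1: "projective_cover R ?K P1 d"
    using assms by (auto simp: min_projective_presentation_def a_kernel_ker)
  show P0: "projective R P0" using cov0 by (simp add: projective_cover_def)
  show P1: "projective R P1" using cov1 by (simp add: projective_cover_def)
  have e: "mhom R P0 T e" "e ` carrier P0 = carrier T" using cov0 by (auto simp: projective_cover_def mod_epi_def lin_iff)
  have d: "mhom R P1 ?K d" "d ` carrier P1 = carrier ?K" using cov1 by (auto simp: projective_cover_def mod_epi_def lin_iff)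
  note P0f = projective_fg[OF P0] note P0l = fg_left_module[OF P0f]
  note P1f = projective_fg[OF P1] note P1l = fg_left_module[OF P1f]
  interpret P1: left_module R P1 by (rule P1l)
  have K: "submodule (ker P0 T e) R P0" by (rule submodule_ker[OF P0l T_left e(1)])
  note Kl = left_module_subm[OF P0l K]
  obtain E :: "'a umod" and p where E: "projective R E" "injective R E" "mhom R E T p" "p ` carrier E = carrier T"
    using pi_genE[OF T_pi_gen] by blast
  note El = fg_left_module[OF projective_fg[OF E(1)]]
  obtain t where t: "mhom R E P0 t" "\<And>x. x \<in> carrier E \<Longrightarrow> e (t x) = p x"
    by (rule proj_lift[OF E(1) P0f e T_left E(3)]) (rule that)
  have "e ` (t ` carrier E) = carrier T" using t(2) E(4) by (simp add: image_image)
  then have ts: "t ` carrier E = carrier P0" by (rule projective_cover_image[OF cov0 T_left El t(1)])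
  obtain s where s: "mhom R P0 E s" "\<And>x. x \<in> carrier P0 \<Longrightarrow> t (s x) = x"
    by (rule proj_lift[OF P0 projective_fg[OF E(1)] t(1) ts P0l mhom_id]) (rule that)
  show "injective R P0" by (rule injective_retract[OF E(2) P0l s(1) t(1) s(2)])
  have "pd_le R 0 ?K"
    by (rule pd_le_sub[OF ses_ker[OF P0l T_left e] pd_le_projective[OF P0]]) (use T_pd in simp)
  then have Kp: "projective R ?K" by (simp add: pd_le_0)
  \<comment> \<open>A section of \<open>d\<close> is onto by minimality of \<open>P1\<close>, and
    this makes \<open>d\<close> injective.\<close>
  obtain q where q: "mhom R ?K P1 q" "\<And>x. x \<in> carrier ?K \<Longrightarrow> d (q x) = x"
    by (rule proj_lift[OF Kp P1f d Kl mhom_id]) (rule that)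
  have "d ` (q ` carrier ?K) = carrier ?K" using q(2) by (force simp: image_image)
  then have qs: "q ` carrier ?K = carrier P1" by (rule projective_cover_image[OF cov1 Kl Kl q(1)])
  have inj: "inj_on d (carrier P1)"
  proof (rule inj_onI)
    fix x y assume xy: "x \<in> carrier P1" "y \<in> carrier P1" "d x = d y"
    have "q (d z) = z" if "z \<in> carrier P1" for z
    proof -
      have "z \<in> q ` carrier ?K" using that qs by simp
      then obtain w where w: "w \<in> carrier ?K" "z = q w" by blast
      then show ?thesis using q(2)[OF w(1)] by simp
    qed
    then show "x = y" using xy by metis
  qed
  show "ses R P1 P0 T d e"
    unfolding ses_def using P1l P0l T_left mhom_from_subm[OF d(1) K] e inj d(2) by simp
qed

text \<open>The kernel of a minimal cover of \<open>T\<close> is projective because \<open>T\<close>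
  has dimension at most one; so it is its own projective cover, with zero kernel.\<close>

lemma ex_min_presentation: "\<exists>(P1 :: 'a umod) (P0 :: 'a umod) d e. min_projective_presentation R T P1 P0 d e"
proof -
  obtain P0 :: "'a umod" and e where cov: "projective_cover R T P0 e" using ex_min_projective_cover[OF T_fg] by blast
  let ?K = "subm P0 (ker P0 T e)"
  have P0: "projective R P0" and e: "mhom R P0 T e" "e ` carrier P0 = carrier T"
    using cov by (auto simp: projective_cover_def mod_epi_def lin_iff)
  note P0l = fg_left_module[OF projective_fg[OF P0]]
  have K: "submodule (ker P0 T e) R P0" by (rule submodule_ker[OF P0l T_left e(1)])
  note Kl = left_module_subm[OF P0l K]
  interpret K: left_module R ?K by (rule Kl)
  have "pd_le R 0 ?K"
    by (rule pd_le_sub[OF ses_ker[OF P0l T_left e] pd_le_projective[OF P0]]) (use T_pd in simp)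
  then have Kp: "projective R ?K" by (simp add: pd_le_0)
  let ?i = "restrict (\<lambda>x. x) (carrier ?K)"
  have i: "?i \<in> lin R ?K ?K" by (rule lin_restrict[OF Kl mhom_id])
  have k: "a_kernel ?K ?K ?i = {\<zero>\<^bsub>?K\<^esub>}" using K.M.zero_closed by (auto simp: a_kernel_ker ker_def)
  have "N = carrier ?K" if N: "submodule N R ?K" "N <+>\<^bsub>?K\<^esub> {\<zero>\<^bsub>?K\<^esub>} = carrier ?K" for N
  proof -
    have "x \<in> N" if "x \<in> carrier ?K" for x
    proof -
      have "x \<in> N <+>\<^bsub>?K\<^esub> {\<zero>\<^bsub>?K\<^esub>}" using N(2) that by simp
      then obtain y where y: "y \<in> N" "x = y \<oplus>\<^bsub>?K\<^esub> \<zero>\<^bsub>?K\<^esub>" unfolding set_add_def' by blast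
      then have "x = y" using K.M.r_zero[OF submodule_carrierD[OF N(1) y(1)]] by simp
      then show ?thesis using y(1) by simp
    qed
    then show ?thesis using submodule_subset[OF N(1)] by blast
  qed
  then have "superfluous R ?K (a_kernel ?K ?K ?i)"
    unfolding superfluous_def k using submodule_trivial[OF Kl] by blast
  then have "projective_cover R ?K ?K ?i" unfolding projective_cover_def mod_epi_def using Kp i by simp
  then show ?thesis unfolding min_projective_presentation_def a_kernel_ker using cov by blast
qed

abbreviation \<tau>T where "\<tau>T \<equiv> AR_translate k \<eta> R T"

lemma AR_presentation:
  obtains P1 P0 :: "'a umod" and d e where "min_projective_presentation R T P1 P0 d e"
    "\<tau>T = dual k \<eta> (quot_module (ring_dual R P1) {compose (carrier P1) f d | f. f \<in> lin R P0 (regular R)})"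
proof -
  let ?P = "\<lambda>(P1 :: 'a umod, P0 :: 'a umod, d). \<exists>e. min_projective_presentation R T P1 P0 d e"
  have "\<exists>x. ?P x" using ex_min_presentation by auto
  then have s: "?P (SOME x. ?P x)" by (rule someI_ex)
  obtain P1 P0 :: "'a umod" and d where x: "(SOME x. ?P x) = (P1, P0, d)"
    by (rule prod_cases3[of "SOME x. ?P x"])
  then obtain e where "min_projective_presentation R T P1 P0 d e" using s by auto
  then show ?thesis using that[of P1 P0 d e] x by (simp add: AR_translate_def Tr_def)
qed

end

text \<open>Fixes the presentation picked by the choice operator in \<open>Tr\<close>, so that the
  translate is the dual of a concrete cokernel.\<close>

locale tilted_pres = tilted k \<eta> R T
  for k :: "('k, 'd) ring_scheme" and \<eta> :: "'k \<Rightarrow> 'a" and R :: "('a, 'c) ring_scheme" (structure)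
    and T :: "('a, 'm) module" +
  fixes P1 P0 :: "'a umod" and d :: "(nat \<Rightarrow> 'a) set \<Rightarrow> (nat \<Rightarrow> 'a) set" and e :: "(nat \<Rightarrow> 'a) set \<Rightarrow> 'm"
  assumes pres: "min_projective_presentation R T P1 P0 d e"
    and tau: "AR_translate k \<eta> R T = dual k \<eta> (quot_module (ring_dual R P1) {compose (carrier P1) f d | f. f \<in> lin R P0 (regular R)})"
begin

lemmas P_ses = min_presentation(1)[OF pres] and P1_proj = min_presentation(2)[OF pres]
  and P0_proj = min_presentation(3)[OF pres] and P0_inj = min_presentation(4)[OF pres]

lemmas P1_left = sesD(1)[OF P_ses] and P0_left = sesD(2)[OF P_ses] and d_hom = sesD(4)[OF P_ses] and e_hom = sesD(5)[OF P_ses]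
  and d_inj = sesD(6)[OF P_ses]

lemmas P1_fg = projective_fg[OF P1_proj] and P0_fg = projective_fg[OF P0_proj]

lemma P0_pi_gen: "pi_gen R P0"
  by (rule pi_genI[OF P0_proj P0_inj mhom_id _ P0_left]) simp

lemma pi_gen_ext: "pi_gen R M \<Longrightarrow> ext_prop R P1 P0 d M"
  by (rule pi_gen_ext_prop[OF P1_proj P0_fg d_hom d_inj])

lemma T_lift:
  fixes K :: "('a, 'x) module" and Y :: "('a, 'y) module" and X :: "('a, 'z) module"
  assumes "ses R K Y X i p" "fg_module R Y" "ext_prop R P1 P0 d K" "mhom R T X h"
  obtains h' where "mhom R T Y h'" "\<And>x. x \<in> carrier T \<Longrightarrow> p (h' x) = h x"
  by (rule ext_prop_lift[OF P_ses P0_proj assms]) (rule that)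

text \<open>For \<open>y\<close> in \<open>M\<close> the coresolution of \<open>R\<close> is pushed
  out along the map sending the unit to \<open>y\<close>. The resulting extension of
  \<open>T1\<close> by \<open>M\<close> splits, since maps from \<open>T\<close> lift and
  \<open>T1\<close> is a summand of a power of \<open>T\<close>. Retracting to \<open>M\<close>
  gives a map from the torsion module \<open>T0\<close> that reaches \<open>y\<close>.\<close>

lemma ext_pi_gen:
  fixes M :: "('a, 'x) module"
  assumes "fg_module R M" "ext_prop R P1 P0 d M"
  shows "pi_gen R M"
proof -
  note Ml = fg_left_module[OF assms(1)]
  interpret M: left_module R M by (rule Ml)
  obtain T0 T1 :: "'a umod" and f g n0 i0 r0 n1 i1 r1 where c: "fg_module R T0" "fg_module R T1" "ses R (regular R) T0 T1 f g"
    "mhom R T0 (mpow T n0) i0" "mhom R (mpow T n0) T0 r0" "\<And>x. x \<in> carrier T0 \<Longrightarrow> r0 (i0 x) = x"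
    "mhom R T1 (mpow T n1) i1" "mhom R (mpow T n1) T1 r1" "\<And>x. x \<in> carrier T1 \<Longrightarrow> r1 (i1 x) = x"
    by (rule coresolution) (rule that)
  note s = sesD[OF c(3)]
  have T0: "pi_gen R T0" by (rule pi_gen_surj[OF pi_gen_mpow[OF T_pi_gen] s(2) c(5) retract_surj[OF c(4,5), OF c(6)]])
  obtain N where N: "submodule N R M" "pi_gen R (subm M N)" "\<And>L. submodule L R M \<Longrightarrow> pi_gen R (subm M L) \<Longrightarrow> L \<subseteq> N"
    by (rule ex_torsion[OF assms(1)]) (rule that)
  have "y \<in> N" if y: "y \<in> carrier M" for y
  proof -
    let ?g = "\<lambda>a. a \<odot>\<^bsub>M\<^esub> y"
    have g: "mhom R (regular R) M ?g" by (rule mhom_regular[OF Ml y])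
    obtain W :: "'a umod" and j v where W: "fg_module R W" "mhom R M W j" "inj_on j (carrier M)" "mhom R T0 W v"
      "\<And>a. a \<in> carrier (regular R) \<Longrightarrow> v (f a) = j (?g a)"
      "\<And>w. w \<in> carrier W \<Longrightarrow> \<exists>c\<in>carrier M. \<exists>b\<in>carrier T0. w = j c \<oplus>\<^bsub>W\<^esub> v b"
      "\<And>c b. c \<in> carrier M \<Longrightarrow> b \<in> carrier T0 \<Longrightarrow> j c \<oplus>\<^bsub>W\<^esub> v b = \<zero>\<^bsub>W\<^esub> \<Longrightarrow>
        \<exists>a\<in>carrier (regular R). b = f a \<and> c = \<ominus>\<^bsub>M\<^esub> ?g a"
      by (rule ex_pushout[OF s(1) c(1) assms(1) s(4,6) g]) (rule that)
    note Wl = fg_left_module[OF W(1)]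
    obtain h where h: "ses R M W T1 j h" "\<And>b. b \<in> carrier T0 \<Longrightarrow> h (v b) = g b"
      by (rule pushout_cokernel[OF c(3) Ml Wl g W(2-7)]) (assumption+, rule that)
    note hs = sesD[OF h(1)]
    have lift: "\<exists>a'. mhom R T W a' \<and> (\<forall>x\<in>carrier T. h (a' x) = a x)" if a: "mhom R T T1 a" for a
    proof -
      obtain a' where "mhom R T W a'" "\<And>x. x \<in> carrier T \<Longrightarrow> h (a' x) = a x"
        by (rule T_lift[OF h(1) W(1) assms(2) a]) (rule that)
      then show ?thesis by blast
    qed
    obtain r' where r': "mhom R (mpow T n1) W r'" "\<forall>x\<in>carrier (mpow T n1). h (r' x) = r1 x"
      using mpow_lift[OF T_left Wl s(3) hs(5) lift c(8)] by blast
    have "h (r' (i1 x)) = x" if "x \<in> carrier T1" for x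
      using r'(2) mhom_closed[OF c(7) that] c(9)[OF that] by simp
    then obtain \<rho> where "biprod R M T1 W j (\<lambda>x. r' (i1 x)) \<rho> h"
      using ses_section[OF h(1) mhom_comp[OF c(7) r'(1)]] by blast
    note b = biprodD[OF this]
    have f1: "f \<one>\<^bsub>R\<^esub> \<in> carrier T0" by (rule mhom_closed[OF s(4)]) simp
    have "\<rho> (v (f \<one>\<^bsub>R\<^esub>)) \<in> N" using torsion_image[OF Ml _ T0 mhom_comp[OF W(4) b(6)] f1] N(3) by blast
    then show ?thesis using W(5)[of "\<one>\<^bsub>R\<^esub>"] b(8) y by simp
  qed
  then have "N = carrier M" using submodule_subset[OF N(1)] by blast
  then show ?thesis using N(2) by simp
qed

subsection \<open>The Auslander-Reiten translate\<close>

abbreviation "Dp \<equiv> ring_dual R P1"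
abbreviation "V \<equiv> {compose (carrier P1) f d | f. f \<in> lin R P0 (regular R)}"
abbreviation "Q \<equiv> quot_module Dp V"
abbreviation "pr \<equiv> \<lambda>f. V +>\<^bsub>Dp\<^esub> f"
abbreviation "J \<equiv> dualizing k"

sublocale opp: artin_alg k \<eta> "opp R"
  by (rule artin_alg_opp)

lemma Dp_left: "left_module (opp R) Dp"
  by (rule left_module_ring_dual[OF P1_left])

lemma V_submodule: "submodule V (opp R) Dp"
proof -
  have c: "compose (carrier P1) f d \<in> lin R P1 (regular R)" if "f \<in> lin R P0 (regular R)" for f
    using lin_restrict[OF P1_left mhom_comp[OF d_hom lin_mhom[OF that]]] by (simp add: compose_def)
  have "mhom (opp R) (ring_dual R P0) Dp (\<lambda>f. compose (carrier P1) f d)"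
  proof (rule mhomI)
    note l0 = left_module_ring_dual[OF P0_left]
    fix f g assume *: "f \<in> carrier (ring_dual R P0)" "g \<in> carrier (ring_dual R P0)"
    then show "compose (carrier P1) (f \<oplus>\<^bsub>ring_dual R P0\<^esub> g) d = compose (carrier P1) f d \<oplus>\<^bsub>Dp\<^esub> compose (carrier P1) g d"
      using mhom_closed[OF d_hom] by (auto simp: compose_def lin_add_def intro!: restrict_ext)
  next
    fix a f assume *: "a \<in> carrier (opp R)" "f \<in> carrier (ring_dual R P0)"
    then show "compose (carrier P1) (a \<odot>\<^bsub>ring_dual R P0\<^esub> f) d = a \<odot>\<^bsub>Dp\<^esub> compose (carrier P1) f d"
      using mhom_closed[OF d_hom] by (auto simp: compose_def ring_dual_def intro!: restrict_ext)
  qed (use c in simp)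
  from submodule_range[OF left_module_ring_dual[OF P0_left] Dp_left this]
  show ?thesis by (simp add: image_Collect[symmetric] Setcompr_eq_image)
qed

lemmas Q_left = left_module_quot[OF Dp_left V_submodule] and pr_hom = mhom_quot[OF Dp_left V_submodule]
  and pr_surj = quot_surj[OF Dp_left V_submodule] and pr_zero_iff = quot_zero_iff[OF Dp_left V_submodule]

lemma Q_fg_k: "fg_module k (restrict_scalars \<eta> Q)"
  by (rule fg_surj[OF fg_ring_dual[OF P1_fg] opp.left_module_restrict[OF Q_left] opp.mhom_restrict[OF pr_hom]])
    (use pr_surj in simp)

lemma tau_left: "left_module R \<tau>T" and tau_fg: "fg_module R \<tau>T"
  unfolding tau by (rule left_module_dual[OF Q_left], rule fg_dual[OF Q_left Q_fg_k])

lemma tau_simps: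
  "carrier \<tau>T = lin k (restrict_scalars \<eta> Q) J" "\<zero>\<^bsub>\<tau>T\<^esub> = lin_zero (restrict_scalars \<eta> Q) J"
  "add \<tau>T = lin_add (restrict_scalars \<eta> Q) J"
  "x \<in> carrier Q \<Longrightarrow> (a \<odot>\<^bsub>\<tau>T\<^esub> f) x = f (a \<odot>\<^bsub>Q\<^esub> x)"
  unfolding tau by (rule dual_simps)+

lemma pr_closed: "f \<in> lin R P1 (regular R) \<Longrightarrow> pr f \<in> carrier Q"
  using mhom_closed[OF pr_hom] by simp

text \<open>Elements of the translate are functionals on the cokernel \<open>Q\<close>, so they are
  compared on classes of maps \<open>P1 \<rightarrow> R\<close>; computations in the translate take
  this form.\<close>

lemma tau_eqI:
  assumes "u \<in> carrier \<tau>T" "v \<in> carrier \<tau>T" "\<And>f. f \<in> lin R P1 (regular R) \<Longrightarrow> u (pr f) = v (pr f)"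
  shows "u = v"
proof (rule lin_eqI)
  show "u \<in> lin k (restrict_scalars \<eta> Q) J" "v \<in> lin k (restrict_scalars \<eta> Q) J" using assms(1,2) by (simp_all add: tau_simps)
  fix x assume "x \<in> carrier (restrict_scalars \<eta> Q)"
  then have "x \<in> pr ` carrier Dp" using pr_surj by simp
  then show "u x = v x" using assms(3) by auto
qed

lemma tau_smult_pr:
  assumes "a \<in> carrier R" "f \<in> lin R P1 (regular R)"
  shows "(a \<odot>\<^bsub>\<tau>T\<^esub> u) (pr f) = u (pr (a \<odot>\<^bsub>Dp\<^esub> f))"
  using assms mhom_smult[OF pr_hom, of a f] pr_closed[OF assms(2)] by (simp add: tau_simps(4))

lemma tau_zero_pr: "f \<in> lin R P1 (regular R) \<Longrightarrow> \<zero>\<^bsub>\<tau>T\<^esub> (pr f) = \<zero>\<^bsub>J\<^esub>"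
  using pr_closed by (simp add: tau_simps lin_zero_nth)

text \<open>By linearity \<open>v w\<close> is a sum of multiples by the coordinates of
  \<open>w\<close>, so each coordinate can be treated on its own.\<close>

lemma mpow_regular_tau:
  assumes f: "f \<in> lin R P1 (regular R)"
  shows "w \<in> carrier (mpow (regular R) n) \<Longrightarrow> mhom R (mpow (regular R) n) \<tau>T v \<Longrightarrow>
    (\<And>j z. j < n \<Longrightarrow> z \<in> carrier \<tau>T \<Longrightarrow> (w j \<odot>\<^bsub>\<tau>T\<^esub> z) (pr f) = \<zero>\<^bsub>J\<^esub>) \<Longrightarrow> v w (pr f) = \<zero>\<^bsub>J\<^esub>"
proof (induction n arbitrary: w v)
  case 0
  have "w = \<zero>\<^bsub>mpow (regular R) 0\<^esub>" using zero_dsum(2)[of "\<lambda>_. regular R"] 0(1) by simp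
  then show ?case using mhom_zero[OF zero_dsum(1) tau_left 0(2)] tau_zero_pr[OF f] by simp
next
  case (Suc n)
  interpret J: left_module k J by (rule fg_left_module[OF injective_fg[OF k.dualizing_injective]])
  note reg = left_module_regular[OF ring_R]
  note b = biprod_dsum_Suc[OF ring_R, of n "\<lambda>_. regular R", OF reg]
  note bd = biprodD[OF b]
  let ?i = "\<lambda>x. \<lambda>i\<in>{..<Suc n}. if i < n then x i else \<zero>\<^bsub>regular R\<^esub>"
  let ?j = "\<lambda>y. \<lambda>i\<in>{..<Suc n}. if i < n then \<zero>\<^bsub>regular R\<^esub> else y"
  note c = mhom_closed[OF bd(6) Suc.prems(1)] mhom_closed[OF bd(7) Suc.prems(1)]
  have 1: "v (?i (restrict w {..<n})) (pr f) = \<zero>\<^bsub>J\<^esub>"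
    by (rule Suc.IH[OF c(1) mhom_comp[OF bd(4) Suc.prems(2)]]) (use Suc.prems(3) in simp)
  have o: "\<one>\<^bsub>R\<^esub> \<in> carrier (regular R)" by simp
  have vj: "mhom R (regular R) \<tau>T (\<lambda>y. v (?j y))" by (rule mhom_comp[OF bd(5) Suc.prems(2)])
  have "v (?j (w n)) = w n \<odot>\<^bsub>\<tau>T\<^esub> v (?j \<one>\<^bsub>R\<^esub>)"
  proof -
    have "w n \<in> carrier R" using c(2) by simp
    then have "w n \<odot>\<^bsub>regular R\<^esub> \<one>\<^bsub>R\<^esub> = w n" by simp
    then show ?thesis using mhom_smult[OF vj \<open>w n \<in> carrier R\<close> o] by (simp only:)
  qed
  then have 2: "v (?j (w n)) (pr f) = \<zero>\<^bsub>J\<^esub>" using Suc.prems(3)[of n] mhom_closed[OF vj o] by simp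
  have "v w = v (?i (restrict w {..<n})) \<oplus>\<^bsub>\<tau>T\<^esub> v (?j (w n))"
    by (subst (1) bd(12)[OF Suc.prems(1), symmetric])
      (rule mhom_add[OF Suc.prems(2) mhom_closed[OF bd(4) c(1)] mhom_closed[OF bd(5) c(2)]])
  then show ?case using 1 2 pr_closed[OF f] by (simp add: tau_simps lin_add_nth)
qed

text \<open>If \<open>E\<close> is a summand of a free module, an element of \<open>E\<close> multiplies every \<open>P1 \<rightarrow> R\<close> into the maps that
  extend to \<open>P0\<close>, because \<open>E\<close> is injective.\<close>

lemma hom_pi_tau:
  fixes E :: "'a umod"
  assumes E: "projective R E" "injective R E" and u: "mhom R E \<tau>T u" and q: "q \<in> carrier E"
  shows "u q = \<zero>\<^bsub>\<tau>T\<^esub>"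
proof -
  note Ef = projective_fg[OF E(1)] note El = fg_left_module[OF Ef]
  interpret E: left_module R E by (rule El)
  interpret tl: left_module R \<tau>T by (rule tau_left)
  obtain n h where h: "mhom R (mpow (regular R) n) E h" "h ` carrier (mpow (regular R) n) = carrier E"
    using fg_free_cover[OF Ef] by blast
  obtain s where s: "mhom R E (mpow (regular R) n) s" "\<And>x. x \<in> carrier E \<Longrightarrow> h (s x) = x"
    by (rule proj_lift[OF E(1) fg_dsum[OF fg_regular[OF ring_R]] h El mhom_id]) (rule that)
  show ?thesis
  proof (rule tau_eqI[OF mhom_closed[OF u q] tl.M.zero_closed])
    fix f assume f: "f \<in> lin R P1 (regular R)"
    note fm = lin_mhom[OF f]
    obtain G where G: "mhom R P0 E G" "\<And>p. p \<in> carrier P1 \<Longrightarrow> G (d p) = f p \<odot>\<^bsub>E\<^esub> q"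
      by (rule inj_extend[OF E(2) P1_fg P0_fg d_hom d_inj mhom_comp[OF fm mhom_regular[OF El q]]]) (rule that)
    let ?w = "s q"
    have w: "?w \<in> carrier (mpow (regular R) n)" by (rule mhom_closed[OF s(1) q])
    have z: "(?w j \<odot>\<^bsub>\<tau>T\<^esub> z) (pr f) = \<zero>\<^bsub>J\<^esub>" if j: "j < n" and z: "z \<in> carrier \<tau>T" for j z
    proof -
      have wj: "?w j \<in> carrier R" using w j by (auto simp: dsum_carrier)
      \<comment> \<open>The coordinate \<open>j\<close> of \<open>s\<close> after \<open>G\<close>
        extends the product of \<open>f\<close> with \<open>?w j\<close> to \<open>P0\<close>, so
        this multiple of \<open>f\<close> vanishes in the cokernel.\<close>
      let ?G = "restrict (\<lambda>x. s (G x) j) (carrier P0)"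
      have "mhom R (mpow (regular R) n) (regular R) (\<lambda>x. x j)"
        using j by (intro mhomI) (auto simp: dsum_carrier dsum_nth)
      then have G': "?G \<in> lin R P0 (regular R)" by (intro lin_restrict[OF P0_left] mhom_comp[OF G(1)] mhom_comp[OF s(1)])
      have "?w j \<odot>\<^bsub>Dp\<^esub> f = compose (carrier P1) ?G d"
      proof -
        have "f p \<otimes>\<^bsub>R\<^esub> ?w j = s (G (d p)) j" if p: "p \<in> carrier P1" for p
          using mhom_smult[OF s(1) _ q, of "f p"] mhom_closed[OF fm p] j by (simp add: G(2)[OF p] dsum_nth)
        then show ?thesis using mhom_closed[OF d_hom] by (auto simp: ring_dual_def compose_def intro!: restrict_ext)
      qed
      then have "?w j \<odot>\<^bsub>Dp\<^esub> f \<in> V" using G' by blast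
      moreover have "?w j \<odot>\<^bsub>Dp\<^esub> f \<in> carrier Dp" using left_module.smult_closed[OF Dp_left, of "?w j" f] wj f by simp
      ultimately have "pr (?w j \<odot>\<^bsub>Dp\<^esub> f) = \<zero>\<^bsub>Q\<^esub>" using pr_zero_iff by blast
      moreover have "z \<zero>\<^bsub>Q\<^esub> = \<zero>\<^bsub>J\<^esub>"
        using mhom_zero[OF opp.left_module_restrict[OF Q_left] fg_left_module[OF injective_fg[OF k.dualizing_injective]] lin_mhom, of z] z
        by (simp add: tau_simps)
      ultimately show ?thesis by (simp add: tau_smult_pr[OF wj f])
    qed
    have "u (h ?w) (pr f) = \<zero>\<^bsub>J\<^esub>" by (rule mpow_regular_tau[OF f w mhom_comp[OF h(1) u] z])
    then show "u q (pr f) = \<zero>\<^bsub>\<tau>T\<^esub> (pr f)" using s(2)[OF q] tau_zero_pr[OF f] by simp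
  qed
qed

lemma hom_zero_tau: "hom_zero R T \<tau>T"
  unfolding hom_zero_def
proof (intro allI impI ballI)
  fix h x assume h: "mhom R T \<tau>T h" and x: "x \<in> carrier T"
  obtain E :: "'a umod" and p where E: "projective R E" "injective R E" "mhom R E T p" "p ` carrier E = carrier T"
    using pi_genE[OF T_pi_gen] by blast
  have "x \<in> p ` carrier E" using x E(4) by simp
  then obtain y where y: "y \<in> carrier E" "x = p y" by blast
  then show "h x = \<zero>\<^bsub>\<tau>T\<^esub>" using hom_pi_tau[OF E(1,2) mhom_comp[OF E(3) h] y(1)] by simp
qed

text \<open>When \<open>Hom(T, K) = 0\<close>, a functional \<open>\<phi>\<close> on \<open>Hom(P1, K)\<close> yields a map from \<open>K\<close> to the translate,
  sending \<open>y\<close> to \<open>f \<mapsto> \<phi> (p \<mapsto> f(p) y)\<close>; it is well defined since \<open>Hom(P0, K) = 0\<close>.\<close>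

lemma functional_hom:
  assumes K: "left_module R K" "hom_zero R T K" and \<phi>: "mhom k (homk \<eta> R P1 K) J \<phi>"
  obtains u where "mhom R K \<tau>T u" "\<And>y f. y \<in> carrier K \<Longrightarrow> f \<in> lin R P1 (regular R) \<Longrightarrow>
    u y (pr f) = \<phi> (\<lambda>p\<in>carrier P1. f p \<odot>\<^bsub>K\<^esub> y)"
proof -
  interpret K: left_module R K by (rule K(1))
  interpret tl: left_module R \<tau>T by (rule tau_left)
  interpret Qm: left_module "opp R" Q by (rule Q_left)
  let ?a = "\<lambda>f y. \<lambda>p\<in>carrier P1. f p \<odot>\<^bsub>K\<^esub> y"
  have fc: "f p \<in> carrier R" if "f \<in> lin R P1 (regular R)" "p \<in> carrier P1" for f p
    using mhom_closed[OF lin_mhom[OF that(1)] that(2)] by simp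
  have a: "?a f y \<in> lin R P1 K" if "f \<in> lin R P1 (regular R)" "y \<in> carrier K" for f y
    by (rule lin_restrict[OF P1_left mhom_comp[OF lin_mhom[OF that(1)] mhom_regular[OF K(1) that(2)]]])
  note Jl = fg_left_module[OF injective_fg[OF k.dualizing_injective]]
  have ex: "\<exists>w\<in>carrier \<tau>T. \<forall>f\<in>lin R P1 (regular R). w (pr f) = \<phi> (?a f y)" if y: "y \<in> carrier K" for y
  proof -
    have b: "mhom k (restrict_scalars \<eta> Dp) J (\<lambda>f. \<phi> (?a f y))"
    proof (rule mhomI)
      fix f g assume fg: "f \<in> carrier (restrict_scalars \<eta> Dp)" "g \<in> carrier (restrict_scalars \<eta> Dp)"
      have "?a (f \<oplus>\<^bsub>restrict_scalars \<eta> Dp\<^esub> g) y = lin_add P1 K (?a f y) (?a g y)"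
        using fg fc y by (auto simp: lin_add_def K.smult_l_distr intro!: restrict_ext)
      then show "\<phi> (?a (f \<oplus>\<^bsub>restrict_scalars \<eta> Dp\<^esub> g) y) = \<phi> (?a f y) \<oplus>\<^bsub>J\<^esub> \<phi> (?a g y)"
        using mhom_add[OF \<phi>, of "?a f y" "?a g y"] fg a y by simp
    next
      fix c f assume cf: "c \<in> carrier k" "f \<in> carrier (restrict_scalars \<eta> Dp)"
      have "?a (c \<odot>\<^bsub>restrict_scalars \<eta> Dp\<^esub> f) y = c \<odot>\<^bsub>homk \<eta> R P1 K\<^esub> ?a f y"
        using cf fc y by (auto simp: homk_def ring_dual_def K.smult_assoc[symmetric] eta_central intro!: restrict_ext)
      then show "\<phi> (?a (c \<odot>\<^bsub>restrict_scalars \<eta> Dp\<^esub> f) y) = c \<odot>\<^bsub>J\<^esub> \<phi> (?a f y)"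
        using mhom_smult[OF \<phi> cf(1), of "?a f y"] cf a y by simp
    qed (use a y mhom_closed[OF \<phi>] in simp)
    have v: "\<phi> (?a f y) = \<zero>\<^bsub>J\<^esub>" if f: "f \<in> carrier (restrict_scalars \<eta> Dp)" "pr f = \<zero>\<^bsub>restrict_scalars \<eta> Q\<^esub>" for f
    proof -
      have "f \<in> V" using f pr_zero_iff[of f] by simp
      then obtain g where g: "g \<in> lin R P0 (regular R)" "f = compose (carrier P1) g d" by blast
      have "g x \<odot>\<^bsub>K\<^esub> y = \<zero>\<^bsub>K\<^esub>" if "x \<in> carrier P0" for x
        using pi_gen_hom_zero[OF P0_pi_gen K(2,1) mhom_comp[OF lin_mhom[OF g(1)] mhom_regular[OF K(1) y]] that] by simp
      then have "?a f y = lin_zero P1 K"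
        using mhom_closed[OF d_hom] by (auto simp: g(2) lin_zero_def compose_def intro!: restrict_ext)
      then show ?thesis
        using mhom_zero[OF left_module_homk[OF P1_left K(1)] Jl \<phi>] by simp
    qed
    obtain w where w: "mhom k (restrict_scalars \<eta> Q) J w" "\<And>f. f \<in> carrier (restrict_scalars \<eta> Dp) \<Longrightarrow> w (pr f) = \<phi> (?a f y)"
      by (rule factor_through[OF opp.left_module_restrict[OF Dp_left] opp.left_module_restrict[OF Q_left] Jl
            opp.mhom_restrict[OF pr_hom] _ b v]) (use pr_surj in simp, assumption+, rule that)
    have "restrict w (carrier Q) \<in> carrier \<tau>T"
      using lin_restrict[OF opp.left_module_restrict[OF Q_left] w(1)] by (simp add: tau_simps)
    then show ?thesis using w(2) pr_closed by (intro bexI[of _ "restrict w (carrier Q)"]) auto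
  qed
  then have "\<forall>y\<in>carrier K. \<exists>w. w \<in> carrier \<tau>T \<and> (\<forall>f\<in>lin R P1 (regular R). w (pr f) = \<phi> (?a f y))" by blast
  then obtain u where "\<forall>y\<in>carrier K. u y \<in> carrier \<tau>T \<and> (\<forall>f\<in>lin R P1 (regular R). u y (pr f) = \<phi> (?a f y))"
    by (rule bchoice[THEN exE])
  then have u: "\<And>y. y \<in> carrier K \<Longrightarrow> u y \<in> carrier \<tau>T"
    "\<And>y f. y \<in> carrier K \<Longrightarrow> f \<in> lin R P1 (regular R) \<Longrightarrow> u y (pr f) = \<phi> (?a f y)" by simp_all
  have "mhom R K \<tau>T u"
  proof (rule mhomI)
    fix x y assume *: "x \<in> carrier K" "y \<in> carrier K"
    show "u (x \<oplus>\<^bsub>K\<^esub> y) = u x \<oplus>\<^bsub>\<tau>T\<^esub> u y"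
    proof (rule tau_eqI)
      fix f assume f: "f \<in> lin R P1 (regular R)"
      have "?a f (x \<oplus>\<^bsub>K\<^esub> y) = lin_add P1 K (?a f x) (?a f y)"
        using f fc * by (auto simp: lin_add_def K.smult_r_distr intro!: restrict_ext)
      then show "u (x \<oplus>\<^bsub>K\<^esub> y) (pr f) = (u x \<oplus>\<^bsub>\<tau>T\<^esub> u y) (pr f)"
        using mhom_add[OF \<phi>, of "?a f x" "?a f y"] f a * pr_closed[OF f] by (simp add: u(2) tau_simps lin_add_nth)
    qed (use u(1) * in auto)
  next
    fix b x assume *: "b \<in> carrier R" "x \<in> carrier K"
    show "u (b \<odot>\<^bsub>K\<^esub> x) = b \<odot>\<^bsub>\<tau>T\<^esub> u x"
    proof (rule tau_eqI)
      fix f assume f: "f \<in> lin R P1 (regular R)"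
      have bf: "b \<odot>\<^bsub>Dp\<^esub> f \<in> lin R P1 (regular R)" using left_module.smult_closed[OF Dp_left, of b f] * f by simp
      have "?a (b \<odot>\<^bsub>Dp\<^esub> f) x = ?a f (b \<odot>\<^bsub>K\<^esub> x)"
        using f fc * by (auto simp: K.smult_assoc intro!: restrict_ext)
      then show "u (b \<odot>\<^bsub>K\<^esub> x) (pr f) = (b \<odot>\<^bsub>\<tau>T\<^esub> u x) (pr f)"
        using * f bf by (simp add: u(2) tau_smult_pr)
    qed (use u(1) * in auto)
  qed (rule u(1))
  then show ?thesis using that u(2) by blast
qed

text \<open>If every product \<open>f p\<close> times \<open>x\<close> were zero, all maps from
  \<open>P1\<close> to the submodule generated by \<open>x\<close> would vanish. That submodule
  would have the extension property and be torsion, contradicting \<open>Hom(T, K) = 0\<close>. So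
  some map in \<open>Hom(P1, K)\<close> built from \<open>x\<close> is nonzero, and a functional not
  killing it gives \<open>u\<close>.\<close>

lemma hom_zero_cogenerated:
  fixes K :: "('a, 'x) module"
  assumes K: "fg_module R K" "hom_zero R T K" and x: "x \<in> carrier K" "x \<noteq> \<zero>\<^bsub>K\<^esub>"
  obtains u where "mhom R K \<tau>T u" "u x \<noteq> \<zero>\<^bsub>\<tau>T\<^esub>"
proof -
  note Kl = fg_left_module[OF K(1)]
  interpret K: left_module R K by (rule Kl)
  have "\<exists>f\<in>lin R P1 (regular R). \<exists>p\<in>carrier P1. f p \<odot>\<^bsub>K\<^esub> x \<noteq> \<zero>\<^bsub>K\<^esub>"
  proof (rule ccontr)
    assume n: "\<not> ?thesis"
    let ?N = "(\<lambda>a. a \<odot>\<^bsub>K\<^esub> x) ` carrier R"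
    have N: "submodule ?N R K" using submodule_range[OF left_module_regular[OF ring_R] Kl mhom_regular[OF Kl x(1)]] by simp
    note Nl = left_module_subm[OF Kl N]
    have p: "mhom R (regular R) (subm K ?N) (\<lambda>a. a \<odot>\<^bsub>K\<^esub> x)" by (rule mhom_to_subm[OF mhom_regular[OF Kl x(1)]]) simp
    have "ext_prop R P1 P0 d (subm K ?N)"
      unfolding ext_prop_def
    proof (intro allI impI)
      fix g assume g: "mhom R P1 (subm K ?N) g"
      obtain f where f: "mhom R P1 (regular R) f" "\<And>p. p \<in> carrier P1 \<Longrightarrow> f p \<odot>\<^bsub>K\<^esub> x = g p"
        by (rule proj_lift[OF P1_proj fg_regular[OF ring_R] p _ Nl g]) (simp, rule that)
      have "g p = \<zero>\<^bsub>K\<^esub>" if "p \<in> carrier P1" for p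
        using n lin_restrict[OF P1_left f(1)] f(2)[OF that] that by force
      then show "\<exists>t. mhom R P0 (subm K ?N) t \<and> (\<forall>x\<in>carrier P1. t (d x) = g x)"
        using mhom_const_zero[OF Nl] by (intro exI[of _ "\<lambda>_. \<zero>\<^bsub>subm K ?N\<^esub>"]) simp
    qed
    then have "pi_gen R (subm K ?N)" by (rule ext_pi_gen[OF fg_subm[OF K(1) N]])
    moreover have "x \<in> carrier (subm K ?N)" using x(1) by (auto intro: image_eqI[of _ _ "\<one>\<^bsub>R\<^esub>"])
    ultimately show False using pi_gen_hom_zero[OF _ K(2) Kl mhom_subm_incl[OF N]] x(2) by blast
  qed
  then obtain f p where fp: "f \<in> lin R P1 (regular R)" "p \<in> carrier P1" "f p \<odot>\<^bsub>K\<^esub> x \<noteq> \<zero>\<^bsub>K\<^esub>" by blast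
  let ?a = "\<lambda>p\<in>carrier P1. f p \<odot>\<^bsub>K\<^esub> x"
  have "?a \<in> carrier (homk \<eta> R P1 K)"
    using lin_restrict[OF P1_left mhom_comp[OF lin_mhom[OF fp(1)] mhom_regular[OF Kl x(1)]]] by simp
  moreover have "?a \<noteq> \<zero>\<^bsub>homk \<eta> R P1 K\<^esub>"
  proof
    assume "?a = \<zero>\<^bsub>homk \<eta> R P1 K\<^esub>"
    then have "?a p = lin_zero P1 K p" by simp
    then show False using fp by (simp add: lin_zero_nth)
  qed
  ultimately obtain \<phi> where \<phi>: "mhom k (homk \<eta> R P1 K) J \<phi>" "\<phi> ?a \<noteq> \<zero>\<^bsub>J\<^esub>"
    using k.dualizing_cogenerator[OF fg_homk[OF P1_fg K(1)]] by blast
  obtain u where u: "mhom R K \<tau>T u" "\<And>y f. y \<in> carrier K \<Longrightarrow> f \<in> lin R P1 (regular R) \<Longrightarrow>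
      u y (pr f) = \<phi> (\<lambda>p\<in>carrier P1. f p \<odot>\<^bsub>K\<^esub> y)"
    by (rule functional_hom[OF Kl K(2) \<phi>(1)]) (rule that)
  have "u x \<noteq> \<zero>\<^bsub>\<tau>T\<^esub>" using u(2)[OF x(1) fp(1)] \<phi>(2) tau_zero_pr[OF fp(1)] by auto
  then show ?thesis using that u(1) by blast
qed

text \<open>Each nonzero element survives in some map to the translate. By finite length, finitely
  many such maps suffice to embed \<open>K\<close> into a module of dimension at most
  \<open>n\<close>.\<close>

lemma pd_le_hom_zero:
  fixes K :: "('a, 'x) module"
  assumes "gldim R \<le> enat (Suc n)" "pd_le R n \<tau>T" and K: "fg_module R K" "hom_zero R T K"
  shows "pd_le R n K"
proof -
  note Kl = fg_left_module[OF K(1)]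
  interpret K: left_module R K by (rule Kl)
  let ?P = "\<lambda>N. \<exists>(V :: 'a umod) u. pd_le R n V \<and> mhom R K V u \<and> N = ker K V u"
  obtain m where m: "len_le R K m" using fg_len[OF K(1)] by blast
  obtain Z :: "'a umod" where Z: "left_module R Z" "projective R Z" using ex_zero_umod by blast
  have "ker K Z (\<lambda>_. \<zero>\<^bsub>Z\<^esub>) = carrier K" by (auto simp: ker_def)
  then have P0: "?P (carrier K)" using pd_le_projective[OF Z(2)] mhom_const_zero[OF Z(1)] by blast
  obtain N where N: "submodule N R K" "?P N" "\<And>N'. submodule N' R K \<Longrightarrow> ?P N' \<Longrightarrow> N' \<subseteq> N \<Longrightarrow> N' = N"
    by (rule len_min[where P = ?P, OF m submodule_carrier[OF Kl] P0]) (rule that)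
  obtain V :: "'a umod" and u where V: "pd_le R n V" "mhom R K V u" "N = ker K V u" using N(2) by blast
  note Vf = pd_le_fg[OF V(1)] note Vl = fg_left_module[OF Vf]
  have "inj_on u (carrier K)"
  proof (subst mhom_inj_iff[OF Kl Vl V(2)], intro ballI impI, rule ccontr)
    fix x assume x: "x \<in> carrier K" "u x = \<zero>\<^bsub>V\<^esub>" "x \<noteq> \<zero>\<^bsub>K\<^esub>"
    obtain w where w: "mhom R K \<tau>T w" "w x \<noteq> \<zero>\<^bsub>\<tau>T\<^esub>" using hom_zero_cogenerated[OF K x(1,3)] by blast
    obtain U :: "'a umod" and i j p q where U: "biprod R V \<tau>T U i j p q" "fg_module R U"
      by (rule ex_biprod[OF Vf tau_fg]) (rule that)
    note b = biprodD[OF U(1)]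
    have pdU: "pd_le R n U" by (rule pd_le_ext[OF ses_biprod[OF U(1)] U(2) V(1) assms(2)])
    obtain h where h: "mhom R K U h" "\<And>x. x \<in> carrier K \<Longrightarrow> p (h x) = u x" "\<And>x. x \<in> carrier K \<Longrightarrow> q (h x) = w x"
      using biprod_pair[OF U(1) V(2) w(1)] by metis
    have "ker K U h \<subseteq> N"
      using h(2)[symmetric] mhom_zero[OF b(3,1,6)] unfolding V(3) by (auto simp: ker_def)
    then have "ker K U h = N" using N(3)[OF submodule_ker[OF Kl b(3) h(1)]] pdU h(1) by blast
    moreover have "x \<in> N" using x by (simp add: V(3) ker_def)
    ultimately have "h x = \<zero>\<^bsub>U\<^esub>" by (auto simp: ker_def)
    then show False using h(3)[OF x(1)] w(2) mhom_zero[OF b(3,2,7)] by simp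
  qed
  then show ?thesis by (rule pd_le_submodule[OF assms(1) Kl V(2) _ V(1)])
qed

text \<open>Finitely many pushouts along \<open>P1 \<rightarrow> P0\<close> make all maps from \<open>P1\<close> to \<open>K\<close>
  extendable.\<close>

lemma universal_extension:
  fixes K :: "('a, 'x) module"
  assumes K: "fg_module R K"
  obtains M :: "'a umod" and n j q where "ses R K M (mpow T n) j q" "pi_gen R M"
proof -
  note Kl = fg_left_module[OF K]
  interpret K: left_module R K by (rule Kl)
  let ?H = "homk \<eta> R P1 K"
  have Hl: "left_module k ?H" by (rule left_module_homk[OF P1_left Kl])
  let ?ext = "\<lambda>(M :: 'a umod) j a. \<exists>t. mhom R P0 M t \<and> (\<forall>x\<in>carrier P1. t (d x) = j (a x))"
  obtain S where S: "finite S" "S \<subseteq> carrier ?H" "\<And>L. submodule L k ?H \<Longrightarrow> S \<subseteq> L \<Longrightarrow> L = carrier ?H"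
    using fg_gens[OF fg_homk[OF P1_fg K]] by metis
  have ex: "\<exists>(M :: 'a umod) n j q. fg_module R M \<and> ses R K M (mpow T n) j q \<and> (\<forall>a\<in>S'. ?ext M j a)" if "S' \<subseteq> S" for S'
    using finite_subset[OF that S(1)] that
  proof (induction S')
    case empty
    obtain M :: "'a umod" and f g where M: "fg_module R M" "miso R K M f g" using ex_umod[OF K] by blast
    note Ml = fg_left_module[OF M(1)]
    interpret Z: left_module R "mpow T 0" by (rule left_module_mpow[OF T_left])
    have "ses R K M (mpow T 0) f (\<lambda>_. \<zero>\<^bsub>mpow T 0\<^esub>)"
      using misoD[OF M(2)] Ml zero_dsum(2)[of "\<lambda>_. T"] submodule_zero[OF submodule_carrier[OF Ml]]
      by (intro sesI Kl mhom_const_zero left_module_mpow[OF T_left]) auto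
    then show ?case using M(1) by (intro exI[of _ M] exI[of _ 0] exI conjI) auto
  next
    case (insert a S')
    then obtain M :: "'a umod" and n j q where M: "fg_module R M" "ses R K M (mpow T n) j q" "\<forall>a\<in>S'. ?ext M j a" by auto
    note s = sesD[OF M(2)]
    interpret Tn: left_module R "mpow T n" by (rule s(3))
    interpret Tm: left_module R T by (rule T_left)
    have a: "mhom R P1 K a" using insert.prems S(2) by (intro lin_mhom) auto
    have ja: "mhom R P1 M (\<lambda>x. j (a x))" by (rule mhom_comp[OF a s(4)])
    \<comment> \<open>The pushout makes \<open>a\<close> extendable in \<open>W\<close>, at the
      price of one more copy of \<open>T\<close> in the quotient.\<close>
    obtain W :: "'a umod" and j' v where W: "fg_module R W" "mhom R M W j'" "inj_on j' (carrier M)" "mhom R P0 W v"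
      "\<And>x. x \<in> carrier P1 \<Longrightarrow> v (d x) = j' (j (a x))"
      "\<And>w. w \<in> carrier W \<Longrightarrow> \<exists>c\<in>carrier M. \<exists>b\<in>carrier P0. w = j' c \<oplus>\<^bsub>W\<^esub> v b"
      "\<And>c b. c \<in> carrier M \<Longrightarrow> b \<in> carrier P0 \<Longrightarrow> j' c \<oplus>\<^bsub>W\<^esub> v b = \<zero>\<^bsub>W\<^esub> \<Longrightarrow>
        \<exists>x\<in>carrier P1. b = d x \<and> c = \<ominus>\<^bsub>M\<^esub> j (a x)"
      by (rule ex_pushout[OF P1_left P0_fg M(1) d_hom d_inj ja]) (rule that)
    note Wl = fg_left_module[OF W(1)]
    interpret W: left_module R W by (rule Wl)
    interpret Mm: left_module R M by (rule s(2))
    obtain h where h: "ses R M W T j' h" "\<And>b. b \<in> carrier P0 \<Longrightarrow> h (v b) = e b"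
      by (rule pushout_cokernel[OF P_ses s(2) Wl ja W(2-7)]) (assumption+, rule that)
    note hs = sesD[OF h(1)]
    have qja: "\<zero>\<^bsub>mpow T n\<^esub> = q (j (a x))" if "x \<in> carrier P1" for x using s(9)[OF mhom_closed[OF a that]] by simp
    obtain q' where q': "mhom R W (mpow T n) q'" "\<And>b. b \<in> carrier P0 \<Longrightarrow> q' (v b) = \<zero>\<^bsub>mpow T n\<^esub>" "\<And>c. c \<in> carrier M \<Longrightarrow> q' (j' c) = q c"
      by (rule pushout_universal[OF s(3) P1_left P0_left s(2) Wl d_hom ja W(2,4,6,7) s(5) mhom_const_zero[OF s(3)] qja])
        (assumption+, rule that)
    note b = biprod_dsum_Suc[OF ring_R, of n "\<lambda>_. T", OF T_left] note bd = biprodD[OF b]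
    obtain p where p: "mhom R W (mpow T (Suc n)) p" "\<And>w. w \<in> carrier W \<Longrightarrow> restrict (p w) {..<n} = q' w"
      "\<And>w. w \<in> carrier W \<Longrightarrow> p w n = h w"
      by (rule biprod_pair[OF b q'(1) hs(5)], rule that)
    note c = mhom_closed[OF W(2)] mhom_closed[OF W(4)] mhom_closed[OF s(4)] mhom_closed[OF s(5)] mhom_closed[OF q'(1)] mhom_closed[OF hs(5)]
      mhom_closed[OF a] mhom_closed[OF p(1)]
    have "ses R K W (mpow T (Suc n)) (\<lambda>x. j' (j x)) p"
    proof (rule sesI[OF Kl Wl left_module_mpow[OF T_left] mhom_comp[OF s(4) W(2)] p(1)])
      show "inj_on (\<lambda>x. j' (j x)) (carrier K)"
        using comp_inj_on[OF s(6) inj_on_subset[OF W(3)]] c(3) by (auto simp: comp_def)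
      show "p (j' (j x)) = \<zero>\<^bsub>mpow T (Suc n)\<^esub>" if x: "x \<in> carrier K" for x
      proof (rule biprod_eqI[OF b])
        show "p (j' (j x)) \<in> carrier (mpow T (Suc n))"
          by (intro mhom_closed[OF p(1)] mhom_closed[OF W(2)] mhom_closed[OF s(4)] x)
        show "\<zero>\<^bsub>mpow T (Suc n)\<^esub> \<in> carrier (mpow T (Suc n))" using submodule_zero[OF submodule_carrier[OF bd(3)]] .
        have jx: "j x \<in> carrier M" "j' (j x) \<in> carrier W"
          by (intro mhom_closed[OF W(2)] mhom_closed[OF s(4)] x)+
        show "restrict (p (j' (j x))) {..<n} = restrict \<zero>\<^bsub>mpow T (Suc n)\<^esub> {..<n}"
          using mhom_zero[OF bd(3,1,6)] by (simp add: p(2)[OF jx(2)] q'(3)[OF jx(1)] s(9)[OF x])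
        show "p (j' (j x)) n = \<zero>\<^bsub>mpow T (Suc n)\<^esub> n"
          using mhom_zero[OF bd(3,2,7)] by (simp add: p(3)[OF jx(2)] hs(9)[OF jx(1)])
      qed
      show "p ` carrier W = carrier (mpow T (Suc n))"
      proof
        show "carrier (mpow T (Suc n)) \<subseteq> p ` carrier W"
        proof
          fix y assume y: "y \<in> carrier (mpow T (Suc n))"
          note y' = mhom_closed[OF bd(6) y] mhom_closed[OF bd(7) y]
          have "y n \<in> e ` carrier P0" using sesD(7)[OF P_ses] y'(2) by simp
          then obtain b0 where b0: "b0 \<in> carrier P0" "e b0 = y n" by auto
          have "restrict y {..<n} \<in> q ` carrier M" using s(7) y'(1) by simp
          then obtain m where m: "m \<in> carrier M" "q m = restrict y {..<n}" by auto
          let ?w = "j' m \<oplus>\<^bsub>W\<^esub> v b0"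
          have mc: "j' m \<in> carrier W" "v b0 \<in> carrier W"
            by (rule mhom_closed[OF W(2) m(1)], rule mhom_closed[OF W(4) b0(1)])
          have w: "?w \<in> carrier W" using mc by simp
          have "q' ?w = restrict y {..<n}"
            using mhom_add[OF q'(1) mc] q'(2)[OF b0(1)] q'(3)[OF m(1)] m(2) y'(1) by simp
          moreover have "h ?w = y n"
            using mhom_add[OF hs(5) mc] h(2)[OF b0(1)] hs(9)[OF m(1)] b0(2) y'(2) by simp
          ultimately have "p ?w = y" using w by (intro biprod_eqI[OF b c(8)[OF w] y]) (simp_all add: p(2,3))
          then show "y \<in> p ` carrier W" using w by blast
        qed
      qed (use c(8) in blast)
      fix w assume w: "w \<in> carrier W" "p w = \<zero>\<^bsub>mpow T (Suc n)\<^esub>"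
      have "h w = \<zero>\<^bsub>T\<^esub>" using p(3)[OF w(1)] w(2) mhom_zero[OF bd(3,2,7)] by simp
      then obtain m where m: "m \<in> carrier M" "w = j' m" using hs(10)[OF w(1)] by blast
      have "q m = \<zero>\<^bsub>mpow T n\<^esub>" using q'(3)[OF m(1)] p(2)[OF w(1)] w(2) m(2) mhom_zero[OF bd(3,1,6)] by simp
      then show "w \<in> (\<lambda>x. j' (j x)) ` carrier K" using s(10)[OF m(1)] m(2) by blast
    qed
    moreover have "?ext W (\<lambda>x. j' (j x)) a'" if "a' \<in> insert a S'" for a'
    proof (cases "a' = a")
      case True
      then show ?thesis using W(4,5) by blast
    next
      case False
      then obtain t where t: "mhom R P0 M t" "\<forall>x\<in>carrier P1. t (d x) = j (a' x)" using \<open>a' \<in> insert a S'\<close> M(3) by blast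
      then show ?thesis using mhom_comp[OF t(1) W(2)] by (intro exI[of _ "\<lambda>x. j' (t x)"]) simp
    qed
    ultimately show ?case using W(1) by blast
  qed
  obtain M :: "'a umod" and n j q where M: "fg_module R M" "ses R K M (mpow T n) j q" "\<forall>a\<in>S. ?ext M j a"
    using ex[OF subset_refl] by (elim exE conjE) (rule that)
  note s = sesD[OF M(2)]
  interpret Mm: left_module R M by (rule s(2))
  \<comment> \<open>The extendable maps form a \<open>k\<close>-submodule, so extendability of the
    generators is enough.\<close>
  let ?L = "{a \<in> carrier ?H. ?ext M j a}"
  have "submodule ?L k ?H"
  proof (rule submoduleI'[OF Hl])
    show "\<zero>\<^bsub>?H\<^esub> \<in> ?L"
      using lin_zero_closed[OF P1_left Kl] mhom_const_zero[OF s(2)] mhom_zero[OF Kl s(2,4)]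
      by (auto simp: lin_zero_nth intro!: exI[of _ "\<lambda>_. \<zero>\<^bsub>M\<^esub>"])
  next
    fix a b assume *: "a \<in> ?L" "b \<in> ?L"
    then obtain t t' where t: "mhom R P0 M t" "\<forall>x\<in>carrier P1. t (d x) = j (a x)"
      "mhom R P0 M t'" "\<forall>x\<in>carrier P1. t' (d x) = j (b x)" by blast
    have ab: "mhom R P1 K a" "mhom R P1 K b" using * by (auto dest: lin_mhom)
    have "t (d x) \<oplus>\<^bsub>M\<^esub> t' (d x) = j ((a \<oplus>\<^bsub>?H\<^esub> b) x)" if "x \<in> carrier P1" for x
      using that t mhom_closed[OF ab(1) that] mhom_closed[OF ab(2) that] by (simp add: lin_add_nth mhom_add[OF s(4)])
    then show "a \<oplus>\<^bsub>?H\<^esub> b \<in> ?L"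
      using mhom_plus[OF s(2) t(1,3)] lin_add_closed[OF P1_left Kl] * by auto
  next
    fix b a assume *: "b \<in> carrier k" "a \<in> ?L"
    then obtain t where t: "mhom R P0 M t" "\<forall>x\<in>carrier P1. t (d x) = j (a x)" by blast
    have a: "mhom R P1 K a" using * by (auto dest: lin_mhom)
    have "\<eta> b \<odot>\<^bsub>M\<^esub> t (d x) = j ((b \<odot>\<^bsub>?H\<^esub> a) x)" if "x \<in> carrier P1" for x
      using that t mhom_closed[OF a that] *(1) by (simp add: mhom_smult[OF s(4)])
    then show "b \<odot>\<^bsub>?H\<^esub> a \<in> ?L"
      using mhom_comp[OF t(1) mhom_eta[OF s(2) *(1)]] left_module.smult_closed[OF Hl *(1), of a] * by auto
  qed auto
  then have L: "?L = carrier ?H" by (rule S(3)) (use M(3) S(2) in auto)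
  have "ext_prop R P1 P0 d M"
    unfolding ext_prop_def
  proof (intro allI impI)
    fix g assume g: "mhom R P1 M g"
    \<comment> \<open>The image of \<open>g\<close> in the power of \<open>T\<close> extends to
      \<open>P0\<close>, and the extension lifts to \<open>M\<close>. After subtracting this lift,
      what remains of \<open>g\<close> takes values in \<open>K\<close>, where every map from
      \<open>P1\<close> extends into \<open>M\<close>.\<close>
    have "ext_prop R P1 P0 d (mpow T n)" by (rule pi_gen_ext[OF pi_gen_mpow[OF T_pi_gen]])
    then obtain t where t: "mhom R P0 (mpow T n) t" "\<forall>x\<in>carrier P1. t (d x) = q (g x)"
      using mhom_comp[OF g s(5)] unfolding ext_prop_def by blast
    obtain t' where t': "mhom R P0 M t'" "\<And>x. x \<in> carrier P0 \<Longrightarrow> q (t' x) = t x"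
      by (rule proj_lift[OF P0_proj M(1) s(5,7,3) t(1)]) (rule that)
    let ?f = "\<lambda>x. g x \<ominus>\<^bsub>M\<^esub> t' (d x)"
    have f: "mhom R P1 M ?f" by (rule mhom_diff[OF s(2) g mhom_comp[OF d_hom t'(1)]])
    note c = mhom_closed[OF g] mhom_closed[OF d_hom] mhom_closed[OF t'(1)] mhom_closed[OF s(5)] mhom_closed[OF t(1)]
    interpret Tn: left_module R "mpow T n" by (rule s(3))
    have "?f x \<in> j ` carrier K" if "x \<in> carrier P1" for x
      using that c t(2) by (intro s(10)) (auto simp: mhom_minus[OF s(2,3,5)] t'(2))
    then obtain a where a: "mhom R P1 K a" "\<And>x. x \<in> carrier P1 \<Longrightarrow> j (a x) = ?f x"
      using factor_through_mono[OF Kl P1_left s(4,6) f] by metis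
    have "restrict a (carrier P1) \<in> ?L" unfolding L using lin_restrict[OF P1_left a(1)] by simp
    then obtain r where r: "mhom R P0 M r" "\<forall>x\<in>carrier P1. r (d x) = j (restrict a (carrier P1) x)" by blast
    have "r (d x) \<oplus>\<^bsub>M\<^esub> t' (d x) = g x" if "x \<in> carrier P1" for x
      using r(2) a(2)[OF that] that c by simp
    then show "\<exists>t. mhom R P0 M t \<and> (\<forall>x\<in>carrier P1. t (d x) = g x)"
      using mhom_plus[OF s(2) r(1) t'(1)] by (intro exI[of _ "\<lambda>x. r x \<oplus>\<^bsub>M\<^esub> t' x"]) simp
  qed
  then have "pi_gen R M" by (rule ext_pi_gen[OF M(1)])
  then show ?thesis using that M(2) by blast
qed

end

section \<open>The functor represented by the tilting module\<close>

text \<open>Precomposition is a right action of the endomorphism ring, hence a left action of its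
  opposite.\<close>

definition hom_mod :: "('a, 'c) ring_scheme \<Rightarrow> ('a, 'm) module \<Rightarrow> ('a, 'n) module \<Rightarrow> ('m \<Rightarrow> 'm, 'm \<Rightarrow> 'n) module" where
  "hom_mod R T X = \<lparr>carrier = lin R T X, monoid.mult = undefined, one = undefined,
     ring.zero = lin_zero T X, add = lin_add T X, smult = (\<lambda>b f. compose (carrier T) f b)\<rparr>"

lemma hom_mod_simps [simp]:
  "carrier (hom_mod R T X) = lin R T X" "\<zero>\<^bsub>hom_mod R T X\<^esub> = lin_zero T X" "add (hom_mod R T X) = lin_add T X"
  "b \<odot>\<^bsub>hom_mod R T X\<^esub> f = compose (carrier T) f b"
  by (simp_all add: hom_mod_def)

context tilted
begin

abbreviation B where "B \<equiv> opp (End_ring R T)"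
abbreviation F where "F X \<equiv> hom_mod R T X"
abbreviation Fmap where "Fmap \<phi> \<equiv> \<lambda>f. compose (carrier T) \<phi> f"

lemma B_simps [simp]:
  "carrier B = lin R T T" "\<zero>\<^bsub>B\<^esub> = lin_zero T T" "add B = lin_add T T"
  "\<one>\<^bsub>B\<^esub> = (\<lambda>x\<in>carrier T. x)" "a \<otimes>\<^bsub>B\<^esub> b = compose (carrier T) b a"
  by (simp_all add: opp_def)

end

sublocale tilted \<subseteq> B: artin_alg k "\<lambda>c. \<lambda>x\<in>carrier T. \<eta> c \<odot>\<^bsub>T\<^esub> x" "opp (End_ring R T)"
  by (rule artin_alg_End[OF T_fg])

context tilted
begin

lemma lin_closed: "f \<in> lin R T X \<Longrightarrow> x \<in> carrier T \<Longrightarrow> f x \<in> carrier X"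
  by (rule mhom_closed[OF lin_mhom])

lemma Fmap_closed: "f \<in> lin R T X \<Longrightarrow> mhom R X Y \<phi> \<Longrightarrow> Fmap \<phi> f \<in> lin R T Y"
  by (rule compose_lin[OF T_left])

lemma F_left:
  assumes "left_module R X"
  shows "left_module B (F X)"
proof (rule left_module_lin[OF T_left assms B.ring_R])
  show "a \<odot>\<^bsub>F X\<^esub> f \<in> lin R T X" if "a \<in> carrier B" "f \<in> lin R T X" for a f
    using Fmap_closed[OF _ lin_mhom[OF that(2)], of a] that(1) by simp
qed (auto simp: compose_eq lin_add_nth lin_closed mhom_add[OF lin_mhom])

lemma Fmap_hom:
  assumes "left_module R X" "left_module R Y" "mhom R X Y \<phi>"
  shows "mhom B (F X) (F Y) (Fmap \<phi>)"
proof (rule mhomI)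
  fix f g assume "f \<in> carrier (F X)" "g \<in> carrier (F X)"
  then show "Fmap \<phi> (f \<oplus>\<^bsub>F X\<^esub> g) = Fmap \<phi> f \<oplus>\<^bsub>F Y\<^esub> Fmap \<phi> g"
    by (auto simp: compose_def lin_add_def lin_closed mhom_add[OF assms(3)] intro!: restrict_ext)
next
  fix b f assume "b \<in> carrier B" "f \<in> carrier (F X)"
  then show "Fmap \<phi> (b \<odot>\<^bsub>F X\<^esub> f) = b \<odot>\<^bsub>F Y\<^esub> Fmap \<phi> f"
    by (auto simp: compose_def lin_closed intro!: restrict_ext)
qed (use Fmap_closed[OF _ assms(3)] in simp)

text \<open>Scalars from \<open>k\<close> act through endomorphisms of \<open>T\<close>, so
  \<open>B\<close>-submodules are \<open>k\<close>-submodules and the finite length from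
  \<open>fg_homk\<close> suffices.\<close>

lemma F_fg:
  fixes X :: "('a, 'x) module"
  assumes "fg_module R X"
  shows "fg_module B (F X)"
proof -
  note Xl = fg_left_module[OF assms]
  interpret X: left_module R X by (rule Xl)
  obtain n where n: "len_le k (homk \<eta> R T X) n" using k.fg_len[OF fg_homk[OF T_fg assms]] by blast
  have "submodule N k (homk \<eta> R T X)" if N: "submodule N B (F X)" for N
  proof (rule submoduleI'[OF left_module_homk[OF T_left Xl]])
    fix c f assume c: "c \<in> carrier k" and f: "f \<in> N"
    have fl: "f \<in> lin R T X" using submodule_carrierD[OF N f] by simp
    have "c \<odot>\<^bsub>homk \<eta> R T X\<^esub> f = (\<lambda>x\<in>carrier T. \<eta> c \<odot>\<^bsub>T\<^esub> x) \<odot>\<^bsub>F X\<^esub> f"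
      using c mhom_smult[OF lin_mhom[OF fl]] by (auto simp: homk_def compose_def intro!: restrict_ext)
    then show "c \<odot>\<^bsub>homk \<eta> R T X\<^esub> f \<in> N" using submodule_smult[OF N B.eta(1)[OF c] f] by simp
  qed (use submodule_subset[OF N] submodule_zero[OF N] submodule_add[OF N] in auto)
  then show ?thesis by (rule B.len_fg[OF F_left[OF Xl] len_le_weaken[OF n]])
qed

lemma F_biprod:
  assumes "biprod R A C U i j p q"
  shows "biprod B (F A) (F C) (F U) (Fmap i) (Fmap j) (Fmap p) (Fmap q)"
  unfolding biprod_def
proof (intro conjI ballI)
  note b = biprodD[OF assms]
  show "left_module B (F A)" "left_module B (F C)" "left_module B (F U)" using F_left b(1-3) by auto
  show "mhom B (F A) (F U) (Fmap i)" "mhom B (F C) (F U) (Fmap j)" "mhom B (F U) (F A) (Fmap p)" "mhom B (F U) (F C) (Fmap q)"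
    using Fmap_hom b(1-7) by auto
  note cl = Fmap_closed[OF Fmap_closed]
  fix f assume "f \<in> carrier (F A)"
  then have f: "f \<in> lin R T A" by simp
  show "Fmap p (Fmap i f) = f"
    by (rule lin_eqI[OF cl[OF f b(4) b(6)] f]) (simp add: compose_eq b(8) lin_closed[OF f])
  show "Fmap q (Fmap i f) = \<zero>\<^bsub>F C\<^esub>" unfolding hom_mod_simps
    by (rule lin_eqI[OF cl[OF f b(4) b(7)] lin_zero_closed[OF T_left b(2)]]) (simp add: compose_eq b(9) lin_closed[OF f] lin_zero_nth)
next
  note b = biprodD[OF assms]
  note cl = Fmap_closed[OF Fmap_closed]
  fix f assume "f \<in> carrier (F C)"
  then have f: "f \<in> lin R T C" by simp
  show "Fmap q (Fmap j f) = f"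
    by (rule lin_eqI[OF cl[OF f b(5) b(7)] f]) (simp add: compose_eq b(11) lin_closed[OF f])
  show "Fmap p (Fmap j f) = \<zero>\<^bsub>F A\<^esub>" unfolding hom_mod_simps
    by (rule lin_eqI[OF cl[OF f b(5) b(6)] lin_zero_closed[OF T_left b(1)]]) (simp add: compose_eq b(10) lin_closed[OF f] lin_zero_nth)
next
  note b = biprodD[OF assms]
  note cl = Fmap_closed[OF Fmap_closed]
  fix f assume "f \<in> carrier (F U)"
  then have f: "f \<in> lin R T U" by simp
  show "Fmap i (Fmap p f) \<oplus>\<^bsub>F U\<^esub> Fmap j (Fmap q f) = f" unfolding hom_mod_simps
    by (rule lin_eqI[OF lin_add_closed[OF T_left b(3) cl[OF f b(6) b(4)] cl[OF f b(7) b(5)]] f])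
      (simp add: compose_eq b(12) lin_closed[OF f] lin_add_nth)
qed

lemma F_T: "mhom B (regular B) (F T) (\<lambda>f. f)" "mhom B (F T) (regular B) (\<lambda>f. f)"
  by (auto intro!: mhomI simp: regular_def)

lemma F_T_projective: "projective B (F T)"
  by (rule projective_retract[OF projective_regular[OF B.ring_R] F_left[OF T_left] F_T(2) F_T(1)]) simp

lemma F_zero:
  assumes "left_module R X" "carrier X = {\<zero>\<^bsub>X\<^esub>}"
  shows "carrier (F X) = {\<zero>\<^bsub>F X\<^esub>}"
proof -
  have "f = lin_zero T X" if "f \<in> lin R T X" for f
  proof (rule lin_eqI[OF that lin_zero_closed[OF T_left assms(1)]])
    fix x assume x: "x \<in> carrier T"
    have "f x \<in> {\<zero>\<^bsub>X\<^esub>}" using lin_closed[OF that x] unfolding assms(2) .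
    then show "f x = lin_zero T X x" using lin_zero_nth[OF x, of X] by (metis singletonD)
  qed
  then have "lin R T X = {lin_zero T X}" using lin_zero_closed[OF T_left assms(1)] by blast
  then show ?thesis unfolding hom_mod_simps .
qed

lemma F_mpow_projective: "projective B (F (mpow T n))"
proof (induction n)
  case 0
  show ?case by (rule B.projective_zero[OF F_left[OF zero_dsum(1)] F_zero[OF zero_dsum]])
next
  case (Suc n)
  show ?case by (rule B.projective_biprod[OF F_biprod[OF biprod_dsum_Suc[OF ring_R T_left]] Suc F_T_projective])
qed

text \<open>The free cover is written as \<open>F\<close> of a power of \<open>T\<close>, so that
  its kernel can be described by maps into that power.\<close>

lemma F_cover:
  assumes "fg_module B N"
  obtains n h where "mhom B (F (mpow T n)) N h" "h ` lin R T (mpow T n) = carrier N"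
proof -
  note Nl = fg_left_module[OF assms]
  interpret N: left_module B N by (rule Nl)
  obtain S where S: "finite S" "S \<subseteq> carrier N" "\<And>L. submodule L B N \<Longrightarrow> S \<subseteq> L \<Longrightarrow> L = carrier N"
    using fg_gens[OF assms] by metis
  have "\<exists>n h. mhom B (F (mpow T n)) N h \<and> S \<subseteq> h ` lin R T (mpow T n)"
    using S(1,2)
  proof (induction S)
    case empty
    then show ?case using mhom_const_zero[OF Nl] by blast
  next
    case (insert s S)
    then obtain n h where h: "mhom B (F (mpow T n)) N h" "S \<subseteq> h ` lin R T (mpow T n)" by auto
    note b = F_biprod[OF biprod_dsum_Suc[OF ring_R, of n "\<lambda>_. T", OF T_left]]
    note bd = biprodD[OF b]
    have s: "s \<in> carrier N" using insert.prems by simp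
    obtain h' where h': "mhom B (F (mpow T (Suc n))) N h'"
      "\<And>a. a \<in> carrier (F (mpow T n)) \<Longrightarrow> h' (Fmap (\<lambda>x. \<lambda>i\<in>{..<Suc n}. if i < n then x i else \<zero>\<^bsub>T\<^esub>) a) = h a"
      "\<And>c. c \<in> carrier (F T) \<Longrightarrow> h' (Fmap (\<lambda>x. \<lambda>i\<in>{..<Suc n}. if i < n then \<zero>\<^bsub>T\<^esub> else x) c) = c \<odot>\<^bsub>N\<^esub> s"
      by (rule biprod_copair[OF b Nl h(1) mhom_comp[OF F_T(2) mhom_regular[OF Nl s]]]) (rule that)
    have one: "\<one>\<^bsub>B\<^esub> \<in> carrier (F T)" using B.one_closed by simp
    have "s = h' (Fmap (\<lambda>x. \<lambda>i\<in>{..<Suc n}. if i < n then \<zero>\<^bsub>T\<^esub> else x) \<one>\<^bsub>B\<^esub>)"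
      unfolding h'(3)[OF one] using s N.smult_one by (simp del: B_simps)
    then have "s \<in> h' ` carrier (F (mpow T (Suc n)))" using mhom_closed[OF bd(5) one] by (rule image_eqI)
    moreover have "a \<in> h' ` carrier (F (mpow T (Suc n)))" if "a \<in> S" for a
    proof -
      obtain g where g: "g \<in> carrier (F (mpow T n))" "a = h g" using subsetD[OF h(2) \<open>a \<in> S\<close>] unfolding hom_mod_simps by blast
      show ?thesis unfolding g(2) h'(2)[OF g(1), symmetric] by (rule imageI[OF mhom_closed[OF bd(4) g(1)]])
    qed
    ultimately show ?case using h'(1) by (intro exI[of _ "Suc n"] exI[of _ h']) auto
  qed
  then obtain n h where h: "mhom B (F (mpow T n)) N h" "S \<subseteq> h ` lin R T (mpow T n)" by blast
  have "submodule (h ` carrier (F (mpow T n))) B N" by (rule submodule_range[OF F_left[OF left_module_mpow[OF T_left]] Nl h(1)])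
  then have "h ` lin R T (mpow T n) = carrier N" using S(3)[OF _ h(2)] by simp
  then show ?thesis using that h(1) by blast
qed

text \<open>The given maps are the components of \<open>\<phi>\<close>. A \<open>B\<close>-linear
  combination of them is \<open>\<phi>\<close> after the map \<open>T \<rightarrow> T^r\<close>
  whose components are the coefficients.\<close>

lemma F_gens:
  fixes Y :: "('a, 'y) module"
  assumes "left_module R Y" "finite S" "S \<subseteq> lin R T Y"
  shows "\<exists>r \<phi>. mhom R (mpow T r) Y \<phi> \<and> Fmap \<phi> ` lin R T (mpow T r) = span B (F Y) S"
  using assms(2,3)
proof (induction S)
  case empty
  interpret Y: left_module R Y by (rule assms(1))
  note Fl = F_left[OF assms(1)]
  have "span B (F Y) {} = {lin_zero T Y}"
    using submodule_zero[OF submodule_span[OF Fl], of "{}"] span_least[OF submodule_trivial[OF Fl], of "{}"] by auto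
  moreover have "Fmap (\<lambda>_. \<zero>\<^bsub>Y\<^esub>) f = lin_zero T Y" for f by (simp add: compose_def lin_zero_def)
  then have "Fmap (\<lambda>_. \<zero>\<^bsub>Y\<^esub>) ` lin R T (mpow T 0) = {lin_zero T Y}"
    using lin_zero_closed[OF T_left left_module_mpow[OF T_left, of 0]] by auto
  ultimately show ?case using mhom_const_zero[OF assms(1)] by (intro exI[of _ 0] exI[of _ "\<lambda>_. \<zero>\<^bsub>Y\<^esub>"]) simp
next
  case (insert l S)
  then obtain r \<phi> where \<phi>: "mhom R (mpow T r) Y \<phi>" "Fmap \<phi> ` lin R T (mpow T r) = span B (F Y) S" by auto
  have l: "l \<in> lin R T Y" using insert.prems by simp
  note Fl = F_left[OF assms(1)]
  note b = biprod_dsum_Suc[OF ring_R, of r "\<lambda>_. T", OF T_left] note bd = biprodD[OF b]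
  let ?i = "\<lambda>x. \<lambda>i\<in>{..<Suc r}. if i < r then x i else \<zero>\<^bsub>T\<^esub>"
  let ?j = "\<lambda>x. \<lambda>i\<in>{..<Suc r}. if i < r then \<zero>\<^bsub>T\<^esub> else x"
  obtain \<psi> where \<psi>: "mhom R (mpow T (Suc r)) Y \<psi>" "\<And>a. a \<in> carrier (mpow T r) \<Longrightarrow> \<psi> (?i a) = \<phi> a"
    "\<And>c. c \<in> carrier T \<Longrightarrow> \<psi> (?j c) = l c"
    "\<And>u. u \<in> carrier (mpow T (Suc r)) \<Longrightarrow> \<psi> u = \<phi> (restrict u {..<r}) \<oplus>\<^bsub>Y\<^esub> l (u r)"
    by (rule biprod_copair[OF b assms(1) \<phi>(1) lin_mhom[OF l]]) (rule that)
  let ?I = "Fmap \<psi> ` lin R T (mpow T (Suc r))" and ?S = "span B (F Y) (insert l S)"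
  have I: "submodule ?I B (F Y)"
    using submodule_range[OF F_left[OF bd(3)] Fl Fmap_hom[OF bd(3) assms(1) \<psi>(1)]] by simp
  have sp: "submodule ?S B (F Y)" by (rule submodule_span[OF Fl]) (use insert.prems in simp)
  have sub: "span B (F Y) S \<subseteq> ?S" by (rule span_least[OF sp]) (use span_superset[of "insert l S" B "F Y"] in blast)
  have "?I \<subseteq> ?S"
  proof (rule image_subsetI)
    fix h assume h: "h \<in> lin R T (mpow T (Suc r))"
    let ?h1 = "Fmap (\<lambda>x. restrict x {..<r}) h" and ?h2 = "Fmap (\<lambda>x. x r) h"
    have h1: "?h1 \<in> lin R T (mpow T r)" by (rule Fmap_closed[OF h bd(6)])
    have h2: "?h2 \<in> lin R T T" by (rule Fmap_closed[OF h bd(7)])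
    have "Fmap \<psi> h = Fmap \<phi> ?h1 \<oplus>\<^bsub>F Y\<^esub> ?h2 \<odot>\<^bsub>F Y\<^esub> l"
      using lin_closed[OF h] by (auto simp: compose_def lin_add_def \<psi>(4) intro!: restrict_ext)
    moreover have "Fmap \<phi> ?h1 \<in> ?S" using \<phi>(2) h1 sub by blast
    moreover have "?h2 \<odot>\<^bsub>F Y\<^esub> l \<in> ?S"
      by (rule submodule_smult[OF sp]) (use h2 span_superset[of "insert l S" B "F Y"] in auto)
    ultimately show "Fmap \<psi> h \<in> ?S" using submodule_add[OF sp] by (simp only:)
  qed
  moreover have "?S \<subseteq> ?I"
  proof (rule span_least[OF I], rule insert_subsetI)
    let ?one = "\<lambda>x\<in>carrier T. x"
    have one: "?one \<in> lin R T T" by (rule lin_restrict[OF T_left mhom_id])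
    have "l = Fmap \<psi> (Fmap ?j ?one)"
    proof (rule lin_eqI[OF l Fmap_closed[OF Fmap_closed[OF one bd(5)] \<psi>(1)]])
      show "l x = Fmap \<psi> (Fmap ?j ?one) x" if "x \<in> carrier T" for x
        unfolding compose_eq[OF that] restrict_apply'[OF that] by (rule \<psi>(3)[OF that, symmetric])
    qed
    then show "l \<in> ?I" using Fmap_closed[OF one bd(5)] by (rule image_eqI)
    show "S \<subseteq> ?I"
    proof
      fix a assume a: "a \<in> S"
      then have "a \<in> Fmap \<phi> ` lin R T (mpow T r)" using \<phi>(2) span_superset[of S B "F Y"] by blast
      then obtain g where g: "g \<in> lin R T (mpow T r)" "a = Fmap \<phi> g" by blast
      have "a = Fmap \<psi> (Fmap ?i g)"
        unfolding g(2) compose_def using lin_closed[OF g(1)] \<psi>(2) by (intro restrict_ext) (simp del: restrict_apply add: restrict_apply'[of _ "carrier T"])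
      then show "a \<in> ?I" using Fmap_closed[OF g(1) bd(4)] by (rule image_eqI)
    qed
  qed
  ultimately have "?I = ?S" by (rule subset_antisym)
  then show ?case using \<psi>(1) by blast
qed

text \<open>A Yoneda argument: a \<open>B\<close>-linear map on \<open>F T\<close> is determined by
  the image of the identity, and these images for the coordinates are the components of
  \<open>\<sigma>\<close>.\<close>

lemma F_full:
  fixes Y :: "('a, 'y) module"
  assumes "left_module R Y" "mhom B (F (mpow T r)) (F Y) \<Phi>"
  shows "\<exists>\<sigma>. mhom R (mpow T r) Y \<sigma> \<and> (\<forall>f\<in>lin R T (mpow T r). \<Phi> f = Fmap \<sigma> f)"
  using assms(2)
proof (induction r arbitrary: \<Phi>)
  case 0
  interpret Y: left_module R Y by (rule assms(1))
  note z = F_zero[OF zero_dsum, of "\<lambda>_. T"]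
  have "\<Phi> f = Fmap (\<lambda>_. \<zero>\<^bsub>Y\<^esub>) f" if "f \<in> lin R T (mpow T 0)" for f
  proof -
    have "f = \<zero>\<^bsub>F (mpow T 0)\<^esub>" using that z by simp
    then have "\<Phi> f = \<zero>\<^bsub>F Y\<^esub>" using mhom_zero[OF F_left[OF zero_dsum(1)] F_left[OF assms(1)] 0] by simp
    then show ?thesis by (simp add: compose_def lin_zero_def)
  qed
  then show ?case using mhom_const_zero[OF assms(1)] by blast
next
  case (Suc r)
  interpret Y: left_module R Y by (rule assms(1))
  note b0 = biprod_dsum_Suc[OF ring_R, of r "\<lambda>_. T", OF T_left] note b0d = biprodD[OF b0]
  note b = F_biprod[OF b0] note bd = biprodD[OF b]
  let ?i = "\<lambda>x. \<lambda>i\<in>{..<Suc r}. if i < r then x i else \<zero>\<^bsub>T\<^esub>"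
  let ?j = "\<lambda>x. \<lambda>i\<in>{..<Suc r}. if i < r then \<zero>\<^bsub>T\<^esub> else x"
  obtain \<sigma> where \<sigma>: "mhom R (mpow T r) Y \<sigma>" "\<And>f. f \<in> lin R T (mpow T r) \<Longrightarrow> \<Phi> (Fmap ?i f) = Fmap \<sigma> f"
    using Suc.IH[OF mhom_comp[OF bd(4) Suc.prems]] by blast
  let ?one = "\<lambda>x\<in>carrier T. x"
  have one: "?one \<in> lin R T T" by (rule lin_restrict[OF T_left mhom_id])
  let ?l = "\<Phi> (Fmap ?j ?one)"
  have Pj: "mhom B (F T) (F Y) (\<lambda>f. \<Phi> (Fmap ?j f))" by (rule mhom_comp[OF bd(5) Suc.prems])
  have l: "?l \<in> lin R T Y" using mhom_closed[OF Pj, of ?one] one by simp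
  have lj: "\<Phi> (Fmap ?j f) = Fmap ?l f" if f: "f \<in> lin R T T" for f
  proof -
    have "f \<odot>\<^bsub>F T\<^esub> ?one = f"
      using f lin_closed[OF f] by (intro lin_eqI[of _ R T T]) (auto simp: compose_eq intro: Fmap_closed[OF _ lin_mhom[OF one]])
    then show ?thesis using mhom_smult[OF Pj, of f ?one] f one by simp
  qed
  obtain \<psi> where \<psi>: "mhom R (mpow T (Suc r)) Y \<psi>" "\<And>u. u \<in> carrier (mpow T (Suc r)) \<Longrightarrow> \<psi> u = \<sigma> (restrict u {..<r}) \<oplus>\<^bsub>Y\<^esub> ?l (u r)"
    by (rule biprod_copair[OF b0 assms(1) \<sigma>(1) lin_mhom[OF l]], rule that)
  have "\<Phi> f = Fmap \<psi> f" if f: "f \<in> lin R T (mpow T (Suc r))" for f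
  proof -
    let ?f1 = "Fmap (\<lambda>x. restrict x {..<r}) f" and ?f2 = "Fmap (\<lambda>x. x r) f"
    have f1: "?f1 \<in> lin R T (mpow T r)" by (rule Fmap_closed[OF f b0d(6)])
    have f2: "?f2 \<in> lin R T T" by (rule Fmap_closed[OF f b0d(7)])
    have "f \<in> carrier (F (mpow T (Suc r)))" using f by simp
    note e = bd(12)[OF this]
    have "\<Phi> f = \<Phi> (Fmap ?i ?f1) \<oplus>\<^bsub>F Y\<^esub> \<Phi> (Fmap ?j ?f2)"
      by (subst (1) e[symmetric], rule mhom_add[OF Suc.prems mhom_closed[OF bd(4)] mhom_closed[OF bd(5)]]) (use f1 f2 in simp_all)
    also have "\<dots> = lin_add T Y (Fmap \<sigma> ?f1) (Fmap ?l ?f2)" unfolding \<sigma>(2)[OF f1] lj[OF f2] by simp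
    also have "\<dots> = Fmap \<psi> f"
      using lin_closed[OF f] by (auto simp: compose_def lin_add_def \<psi>(2) intro!: restrict_ext)
    finally show ?thesis .
  qed
  with \<psi>(1) show ?case by blast
qed

end

context tilted_pres
begin

text \<open>Left exactness is formal; surjectivity on the right is \<open>T_lift\<close>.\<close>

lemma F_ses:
  fixes K :: "('a, 'x) module" and Y :: "('a, 'y) module" and X :: "('a, 'z) module"
  assumes "ses R K Y X i p" "fg_module R Y" "ext_prop R P1 P0 d K"
  shows "ses B (F K) (F Y) (F X) (Fmap i) (Fmap p)"
proof (rule sesI)
  note s = sesD[OF assms(1)]
  show "left_module B (F K)" "left_module B (F Y)" "left_module B (F X)" using F_left s(1-3) by auto
  show "mhom B (F K) (F Y) (Fmap i)" "mhom B (F Y) (F X) (Fmap p)" using Fmap_hom s(1-5) by auto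
  show "inj_on (Fmap i) (carrier (F K))"
  proof (rule inj_onI)
    fix f g assume fg: "f \<in> carrier (F K)" "g \<in> carrier (F K)" "Fmap i f = Fmap i g"
    have "f x = g x" if "x \<in> carrier T" for x
      using fun_cong[OF fg(3), of x] that inj_onD[OF s(6), of "f x" "g x"] lin_closed[of f K x] lin_closed[of g K x] fg(1,2)
      by (simp add: compose_eq)
    then show "f = g" using lin_eqI[of f R T K g] fg(1,2) by simp
  qed
  show "Fmap p ` carrier (F Y) = carrier (F X)"
  proof
    show "Fmap p ` carrier (F Y) \<subseteq> carrier (F X)" using Fmap_closed[OF _ s(5)] by auto
    show "carrier (F X) \<subseteq> Fmap p ` carrier (F Y)"
    proof
      fix h assume "h \<in> carrier (F X)"
      then have h: "h \<in> lin R T X" by simp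
      obtain h' where h': "mhom R T Y h'" "\<And>x. x \<in> carrier T \<Longrightarrow> p (h' x) = h x"
        by (rule T_lift[OF assms lin_mhom[OF h]]) (rule that)
      have r: "restrict h' (carrier T) \<in> lin R T Y" by (rule lin_restrict[OF T_left h'(1)])
      have "h = Fmap p (restrict h' (carrier T))"
        by (rule lin_eqI[OF h Fmap_closed[OF r s(5)]]) (simp add: compose_eq h'(2))
      then show "h \<in> Fmap p ` carrier (F Y)" using r by simp
    qed
  qed
  show "Fmap p (Fmap i f) = \<zero>\<^bsub>F X\<^esub>" if "f \<in> carrier (F K)" for f
    using lin_closed[of f K] that s(9) by (auto simp: compose_def lin_zero_def intro!: restrict_ext)
  fix g assume "g \<in> carrier (F Y)" "Fmap p g = \<zero>\<^bsub>F X\<^esub>"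
  then have g: "g \<in> lin R T Y" "Fmap p g = lin_zero T X" by simp_all
  have "g x \<in> i ` carrier K" if "x \<in> carrier T" for x
    using s(10)[OF lin_closed[OF g(1) that]] fun_cong[OF g(2), of x] that by (simp add: compose_eq lin_zero_nth)
  then obtain h where h: "mhom R T K h" "\<And>x. x \<in> carrier T \<Longrightarrow> i (h x) = g x"
    using factor_through_mono[OF s(1) T_left s(4,6) lin_mhom[OF g(1)]] by metis
  have r: "restrict h (carrier T) \<in> lin R T K" by (rule lin_restrict[OF T_left h(1)])
  have "g = Fmap i (restrict h (carrier T))"
    by (rule lin_eqI[OF g(1) Fmap_closed[OF r s(4)]]) (simp add: compose_eq h(2))
  then show "g \<in> Fmap i ` carrier (F K)" using r by simp
qed

text \<open>Generators of \<open>Hom(T, M)\<close> over \<open>B\<close> are combined into one map,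
  so every map from \<open>T\<close> to \<open>M\<close> factors through it. It is onto because
  \<open>T\<close> generates \<open>M\<close>, and the factorisations make its kernel
  torsion.\<close>

lemma approximation:
  fixes M :: "('a, 'x) module"
  assumes "pi_gen R M"
  obtains M1 :: "'a umod" and r i \<pi> where "ses R M1 (mpow T r) M i \<pi>" "pi_gen R M1"
proof -
  note Mf = pi_gen_fg[OF assms] note Ml = fg_left_module[OF Mf]
  obtain S where S: "finite S" "S \<subseteq> carrier (F M)" "\<And>L. submodule L B (F M) \<Longrightarrow> S \<subseteq> L \<Longrightarrow> L = carrier (F M)"
    using fg_gens[OF F_fg[OF Mf]] by metis
  have sp: "span B (F M) S = lin R T M"
    using S(3)[OF submodule_span[OF F_left[OF Ml] S(2)] span_superset] by simp
  obtain r \<pi> where \<pi>: "mhom R (mpow T r) M \<pi>" "Fmap \<pi> ` lin R T (mpow T r) = lin R T M"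
    using F_gens[OF Ml S(1)] S(2) sp by auto
  let ?P = "mpow T r"
  note Pl = left_module_mpow[OF T_left, of r]
  note Pg = pi_gen_mpow[OF T_pi_gen, of r] note Pf = pi_gen_fg[OF Pg]
  interpret P: left_module R ?P by (rule Pl)
  interpret M: left_module R M by (rule Ml)
  have fac: "\<exists>h'. mhom R T ?P h' \<and> (\<forall>x\<in>carrier T. \<pi> (h' x) = h x)" if h: "mhom R T M h" for h
  proof -
    have "restrict h (carrier T) \<in> Fmap \<pi> ` lin R T ?P" unfolding \<pi>(2) by (rule lin_restrict[OF T_left h])
    then obtain h' where h': "h' \<in> lin R T ?P" "restrict h (carrier T) = Fmap \<pi> h'" by blast
    have "\<pi> (h' x) = h x" if "x \<in> carrier T" for x using fun_cong[OF h'(2), of x] that by (simp add: compose_eq)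
    then show ?thesis using lin_mhom[OF h'(1)] by blast
  qed
  have "\<pi> ` carrier ?P = carrier M"
  proof (rule gen_byD[OF gen_by_T_pi_gen[OF assms] submodule_range[OF Pl Ml \<pi>(1)]], intro allI impI ballI)
    fix h x assume "mhom R T M h" "x \<in> carrier T"
    then obtain h' where "mhom R T ?P h'" "\<pi> (h' x) = h x" using fac by blast
    then show "h x \<in> \<pi> ` carrier ?P" using mhom_closed[of R T ?P h' x] \<open>x \<in> carrier T\<close> by (metis imageI)
  qed
  note ker = ses_ker[OF Pl Ml \<pi>(1) this]
  let ?K = "subm ?P (ker ?P M \<pi>)"
  have K: "submodule (ker ?P M \<pi>) R ?P" by (rule submodule_ker[OF Pl Ml \<pi>(1)])
  have "ext_prop R P1 P0 d ?K"
    unfolding ext_prop_def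
  proof (intro allI impI)
    fix g assume g: "mhom R P1 ?K g"
    note g' = mhom_from_subm[OF g K]
    \<comment> \<open>\<open>t\<close> extends \<open>g\<close> but need not stay in the kernel. Its
      composite with \<open>\<pi>\<close> kills \<open>P1\<close> and thus descends to a map from
      \<open>T\<close>, which factors through \<open>\<pi>\<close>. Subtracting that factor brings
      \<open>t\<close> into the kernel without changing it on \<open>P1\<close>.\<close>
    obtain t where t: "mhom R P0 ?P t" "\<forall>x\<in>carrier P1. t (d x) = g x"
      using pi_gen_ext[OF Pg] g' unfolding ext_prop_def by blast
    have "\<pi> (t x) = \<zero>\<^bsub>M\<^esub>" if x: "x \<in> carrier P0" "e x = \<zero>\<^bsub>T\<^esub>" for x
    proof -
      obtain y where y: "y \<in> carrier P1" "x = d y" using sesD(10)[OF P_ses x] by blast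
      then show ?thesis using t(2) mhom_closed[OF g y(1)] by (simp add: ker_def)
    qed
    then obtain w where w: "mhom R T M w" "\<And>x. x \<in> carrier P0 \<Longrightarrow> w (e x) = \<pi> (t x)"
      using factor_through[OF P0_left T_left Ml e_hom sesD(7)[OF P_ses] mhom_comp[OF t(1) \<pi>(1)]] by metis
    obtain w' where w': "mhom R T ?P w'" "\<forall>x\<in>carrier T. \<pi> (w' x) = w x" using fac[OF w(1)] by blast
    let ?f = "\<lambda>x. t x \<ominus>\<^bsub>?P\<^esub> w' (e x)"
    have f: "mhom R P0 ?P ?f" by (rule mhom_diff[OF Pl t(1) mhom_comp[OF e_hom w'(1)]])
    note c = mhom_closed[OF t(1)] mhom_closed[OF e_hom] mhom_closed[OF w'(1)] mhom_closed[OF \<pi>(1)]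
    have "mhom R P0 ?K ?f"
    proof (rule mhom_to_subm[OF f])
      fix x assume x: "x \<in> carrier P0"
      have "\<pi> (?f x) = \<zero>\<^bsub>M\<^esub>" using x c w'(2) by (simp add: mhom_minus[OF Pl Ml \<pi>(1)] w(2))
      then show "?f x \<in> ker ?P M \<pi>" using mhom_closed[OF f x] by (simp add: ker_def)
    qed
    moreover have "?f (d x) = g x" if x: "x \<in> carrier P1" for x
      using t(2) x sesD(9)[OF P_ses x] mhom_zero[OF T_left Pl w'(1)] mhom_closed[OF g' x] by simp
    ultimately show "\<exists>t. mhom R P0 ?K t \<and> (\<forall>x\<in>carrier P1. t (d x) = g x)" by blast
  qed
  then have Kg: "pi_gen R ?K" by (rule ext_pi_gen[OF fg_subm[OF Pf K]])
  obtain M1 :: "'a umod" and f g where M1: "fg_module R M1" "miso R ?K M1 f g" using ex_umod[OF pi_gen_fg[OF Kg]] by blast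
  note M1l = fg_left_module[OF M1(1)] and m = misoD[OF M1(2)]
  have "ses R M1 ?P M g \<pi>"
  proof (rule sesI[OF M1l Pl Ml mhom_from_subm[OF m(2) K] \<pi>(1) m(6) sesD(7)[OF ker]])
    show "\<pi> (g a) = \<zero>\<^bsub>M\<^esub>" if "a \<in> carrier M1" for a using mhom_closed[OF m(2) that] by (simp add: ker_def)
    show "b \<in> g ` carrier M1" if "b \<in> carrier ?P" "\<pi> b = \<zero>\<^bsub>M\<^esub>" for b unfolding m(8) using that by (simp add: ker_def)
  qed
  then show ?thesis using that pi_gen_surj[OF Kg M1l m(1,7)] by blast
qed

lemma mpow_T_pd: "pd_le R (Suc n) (mpow T r)"
  by (rule pd_le_mono[OF _ pd_le_dsum[where m = 1]]) (use T_pd in simp_all)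

text \<open>The kernel of an approximation loses one dimension as long as the power of
  \<open>T\<close>, of dimension at most one, permits; its image under \<open>F\<close> is a syzygy
  of \<open>F M\<close>. At the start the approximation itself splits, so \<open>F M\<close> is a
  summand of a projective module.\<close>

lemma pd_F:
  fixes M :: "'a umod"
  shows "pi_gen R M \<Longrightarrow> pd_le R (Suc n) M \<Longrightarrow> pd_le B n (F M)"
proof (induction n arbitrary: M)
  case 0
  note Ml = fg_left_module[OF pi_gen_fg[OF 0(1)]]
  obtain M1 :: "'a umod" and r i \<pi> where a: "ses R M1 (mpow T r) M i \<pi>" "pi_gen R M1" using approximation[OF 0(1)] by blast
  note s = sesD[OF a(1)]
  obtain X :: "'a umod" and p where X: "projective R X" "mhom R X M p" "p ` carrier X = carrier M"
    "pd_le R 0 (subm X (ker X M p))" using pd_le_SucE[OF 0(2)] by blast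
  note Xl = fg_left_module[OF projective_fg[OF X(1)]]
  note sx = ses_ker[OF Xl Ml X(2,3)]
  have "projective R (subm X (ker X M p))" using X(4) by (simp add: pd_le_0)
  \<comment> \<open>The vanishing of \<open>Ext\<close> from \<open>M\<close> to \<open>M1\<close>,
    read off a projective presentation of \<open>M\<close>: its syzygy is projective and
    \<open>M1\<close> is torsion.\<close>
  then have ext: "ext_prop R (subm X (ker X M p)) X (\<lambda>x. x) M1"
    by (rule pi_gen_ext_prop[OF _ projective_fg[OF X(1)] sesD(4,6)[OF sx] a(2)])
  obtain h where h: "mhom R M (mpow T r) h" "\<And>x. x \<in> carrier M \<Longrightarrow> \<pi> (h x) = x"
    by (rule ext_prop_lift[OF sx X(1) a(1) pi_gen_fg[OF pi_gen_mpow[OF T_pi_gen]] ext mhom_id]) (rule that)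
  have "Fmap \<pi> (Fmap h f) = f" if "f \<in> carrier (F M)" for f
  proof -
    have f: "f \<in> lin R T M" using that by simp
    show ?thesis
      by (rule lin_eqI[OF Fmap_closed[OF Fmap_closed[OF f h(1)] s(5)] f]) (simp add: compose_eq h(2) lin_closed[OF f])
  qed
  then have "projective B (F M)"
    by (rule projective_retract[OF F_mpow_projective F_left[OF Ml] Fmap_hom[OF Ml s(2) h(1)] Fmap_hom[OF s(2,3,5)]])
  then show ?case by (simp add: B.pd_le_0)
next
  case (Suc n)
  obtain M1 :: "'a umod" and r i \<pi> where a: "ses R M1 (mpow T r) M i \<pi>" "pi_gen R M1" using approximation[OF Suc.prems(1)] by blast
  have "pd_le R (Suc n) M1" by (rule pd_le_sub[OF a(1) mpow_T_pd Suc.prems(2)])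
  then have IH: "pd_le B n (F M1)" by (rule Suc.IH[OF a(2)])
  have "ses B (F M1) (F (mpow T r)) (F M) (Fmap i) (Fmap \<pi>)"
    by (rule F_ses[OF a(1) pi_gen_fg[OF pi_gen_mpow[OF T_pi_gen]] pi_gen_ext[OF a(2)]])
  then show ?case by (rule B.pd_le_quotient[OF _ IH B.pd_le_projective[OF F_mpow_projective]])
qed

text \<open>By \<open>F_full\<close> a \<open>B\<close>-linear section of \<open>Fmap \<pi>\<close>
  is induced, after precomposition with \<open>Fmap \<pi>\<close>, by an endomorphism
  \<open>\<sigma>\<close> of the power of \<open>T\<close>. It kills \<open>M1\<close> and satisfies
  \<open>\<pi> \<sigma> = \<pi>\<close>, as both can be tested on maps from \<open>T\<close>. So it
  factors through a section of \<open>\<pi>\<close>, and \<open>M\<close> is a summand of a power of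
  \<open>T\<close>.\<close>

lemma F_projective_pd:
  fixes M :: "'a umod"
  assumes "pi_gen R M" "projective B (F M)"
  shows "pd_le R (Suc 0) M"
proof -
  note Ml = fg_left_module[OF pi_gen_fg[OF assms(1)]]
  obtain M1 :: "'a umod" and r i \<pi> where a': "ses R M1 (mpow T r) M i \<pi>" "pi_gen R M1" using approximation[OF assms(1)] by blast
  note s = sesD[OF a'(1)]
  let ?P = "mpow T r"
  interpret P: left_module R ?P by (rule s(2))
  interpret M: left_module R M by (rule Ml)
  have Fs: "ses B (F M1) (F ?P) (F M) (Fmap i) (Fmap \<pi>)"
    by (rule F_ses[OF a'(1) pi_gen_fg[OF pi_gen_mpow[OF T_pi_gen]] pi_gen_ext[OF a'(2)]])
  note fs = sesD[OF Fs]
  obtain t where t: "mhom B (F M) (F ?P) t" "\<And>x. x \<in> carrier (F M) \<Longrightarrow> Fmap \<pi> (t x) = x"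
    by (rule proj_lift[OF assms(2) projective_fg[OF F_mpow_projective] fs(5,7,3) mhom_id]) (rule that)
  obtain \<sigma> where \<sigma>: "mhom R ?P ?P \<sigma>" "\<forall>f\<in>lin R T ?P. t (Fmap \<pi> f) = Fmap \<sigma> f"
    using F_full[OF s(2) mhom_comp[OF fs(5) t(1)]] by blast
  have \<pi>\<sigma>: "\<pi> (\<sigma> (f x)) = \<pi> (f x)" if f: "f \<in> lin R T ?P" and x: "x \<in> carrier T" for f x
  proof -
    have "Fmap \<pi> f \<in> carrier (F M)" using Fmap_closed[OF f s(5)] by simp
    then have "Fmap \<pi> (Fmap \<sigma> f) = Fmap \<pi> f" using t(2)[of "Fmap \<pi> f"] bspec[OF \<sigma>(2) f] by (simp only:)
    from fun_cong[OF this, of x] show ?thesis using x by (simp add: compose_eq)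
  qed
  have \<sigma>i: "\<sigma> (i a) = \<zero>\<^bsub>?P\<^esub>" if a: "a \<in> carrier M1" for a
  proof -
    have "(\<lambda>y. y) a \<in> ker M1 ?P (\<lambda>y. \<sigma> (i y))"
    proof (rule gen_by_image[OF gen_by_T_pi_gen[OF a'(2)] s(1) s(1) mhom_id submodule_ker[OF s(1,2) mhom_comp[OF s(4) \<sigma>(1)]]])
      show "\<forall>h. mhom R T M1 h \<longrightarrow> (\<forall>x\<in>carrier T. h x \<in> ker M1 ?P (\<lambda>y. \<sigma> (i y)))"
      proof (intro allI impI ballI)
        fix h x assume h: "mhom R T M1 h" and x: "x \<in> carrier T"
        let ?f = "restrict (\<lambda>x. i (h x)) (carrier T)"
        have f: "?f \<in> lin R T ?P" by (rule lin_restrict[OF T_left mhom_comp[OF h s(4)]])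
        have "Fmap \<pi> ?f = \<zero>\<^bsub>F M\<^esub>" using s(9) mhom_closed[OF h] by (auto simp: compose_def lin_zero_def intro!: restrict_ext)
        then have "Fmap \<sigma> ?f = lin_zero T ?P" using bspec[OF \<sigma>(2) f] mhom_zero[OF fs(3,2) t(1)] by (simp only: hom_mod_simps)
        from fun_cong[OF this, of x] have "\<sigma> (i (h x)) = \<zero>\<^bsub>?P\<^esub>" using x by (simp add: compose_eq lin_zero_nth)
        then show "h x \<in> ker M1 ?P (\<lambda>y. \<sigma> (i y))" using mhom_closed[OF h x] by (simp add: ker_def)
      qed
      show "a \<in> carrier M1" by (rule a)
    qed
    then show ?thesis by (simp add: ker_def)
  qed
  obtain s' where s': "mhom R M ?P s'" "\<And>x. x \<in> carrier ?P \<Longrightarrow> s' (\<pi> x) = \<sigma> x"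
  proof (rule factor_through[OF s(2,3,2,5,7) \<sigma>(1)])
    fix x assume "x \<in> carrier ?P" "\<pi> x = \<zero>\<^bsub>M\<^esub>"
    then obtain a where "a \<in> carrier M1" "x = i a" using s(10) by blast
    then show "\<sigma> x = \<zero>\<^bsub>?P\<^esub>" using \<sigma>i by simp
  qed (rule that)
  have "\<pi> (s' y) = y" if y: "y \<in> carrier M" for y
  proof -
    obtain x where x: "x \<in> carrier ?P" "y = \<pi> x" using s(7) y by blast
    have "(\<lambda>y. y) x \<in> ker ?P M (\<lambda>y. \<pi> (\<sigma> y) \<ominus>\<^bsub>M\<^esub> \<pi> y)" (is "_ \<in> ?K")
    proof (rule gen_by_image[OF gen_by_mpow[OF ring_R T_left gen_by_self] s(2) s(2) mhom_id
          submodule_ker[OF s(2,3) mhom_diff[OF s(3) mhom_comp[OF \<sigma>(1) s(5)] s(5)]]])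
      show "\<forall>h. mhom R T ?P h \<longrightarrow> (\<forall>x\<in>carrier T. h x \<in> ?K)"
      proof (intro allI impI ballI)
        fix h x assume h: "mhom R T ?P h" and x: "x \<in> carrier T"
        note hx = mhom_closed[OF h x]
        show "h x \<in> ?K"
          using \<pi>\<sigma>[OF lin_restrict[OF T_left h] x] x hx mhom_closed[OF s(5) hx] by (simp add: ker_def)
      qed
      show "x \<in> carrier ?P" by (rule x(1))
    qed
    then have "\<pi> (\<sigma> x) \<ominus>\<^bsub>M\<^esub> \<pi> x = \<zero>\<^bsub>M\<^esub>" by (simp add: ker_def)
    then show ?thesis
      using mhom_closed[OF s(5)] mhom_closed[OF \<sigma>(1) x(1)] x s'(2)[OF x(1)] by simp
  qed
  then show ?thesis by (rule pd_le_retract[OF mpow_T_pd Ml s'(1) s(5)])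
qed

lemma F_pd:
  fixes M :: "'a umod"
  shows "pi_gen R M \<Longrightarrow> pd_le B n (F M) \<Longrightarrow> pd_le R (Suc n) M"
proof (induction n arbitrary: M)
  case 0
  then show ?case using F_projective_pd by (simp add: B.pd_le_0)
next
  case (Suc n)
  obtain M1 :: "'a umod" and r i \<pi> where a: "ses R M1 (mpow T r) M i \<pi>" "pi_gen R M1" using approximation[OF Suc.prems(1)] by blast
  have "ses B (F M1) (F (mpow T r)) (F M) (Fmap i) (Fmap \<pi>)"
    by (rule F_ses[OF a(1) pi_gen_fg[OF pi_gen_mpow[OF T_pi_gen]] pi_gen_ext[OF a(2)]])
  then have "pd_le B n (F M1)" by (rule B.pd_le_sub[OF _ B.pd_le_projective[OF F_mpow_projective] Suc.prems(2)])
  then have "pd_le R (Suc n) M1" by (rule Suc.IH[OF a(2)])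
  then show ?case by (rule pd_le_quotient[OF a(1) _ mpow_T_pd])
qed

end

context tilted
begin

lemma mpow_T_embed:
  obtains E :: "('a, nat \<Rightarrow> (nat \<Rightarrow> 'a) set) module" and u
  where "projective R E" "mhom R (mpow T n) E u" "inj_on u (carrier (mpow T n))"
proof -
  obtain E :: "'a umod" and u where E: "projective R E" "mhom R T E u" "inj_on u (carrier T)" using T_embed by blast
  show ?thesis
    by (rule that[OF projective_dsum mpow_mhom[OF T_left fg_left_module[OF projective_fg[OF E(1)]] E(2)] mpow_inj[OF E(3)]]) (rule E(1))
qed

text \<open>With dimension at most one, submodules of projectives are projective. As
  \<open>T\<close> embeds in a projective module, \<open>T0\<close> and \<open>T1\<close> are
  projective; and \<open>T0\<close>, being torsion as well, is a summand of a projective-injective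
  module. Once \<open>R\<close> is injective so is every projective syzygy, which then splits off
  its cover, and all modules are projective.\<close>

lemma gldim_not_1:
  assumes "gldim R \<le> enat 1"
  shows "gldim R \<le> enat 0"
proof -
  have g: "gldim R \<le> enat (Suc 0)" using assms by simp
  have summand_projective: "projective R A" if A: "left_module R A" "mhom R A (mpow T n) i" "mhom R (mpow T n) A r" "\<And>x. x \<in> carrier A \<Longrightarrow> r (i x) = x"
    for A :: "'a umod" and n i r
  proof -
    obtain E :: "('a, nat \<Rightarrow> (nat \<Rightarrow> 'a) set) module" and u
      where E: "projective R E" "mhom R (mpow T n) E u" "inj_on u (carrier (mpow T n))" by (rule mpow_T_embed)
    have "inj_on i (carrier A)" by (rule inj_on_inverseI[of _ r]) (rule A(4))
    moreover have "i ` carrier A \<subseteq> carrier (mpow T n)" using mhom_closed[OF A(2)] by blast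
    ultimately have "inj_on (\<lambda>x. u (i x)) (carrier A)"
      using comp_inj_on[of i "carrier A" u] inj_on_subset[OF E(3)] by (simp add: comp_def)
    then have "pd_le R 0 A" by (rule pd_le_submodule[OF g A(1) mhom_comp[OF A(2) E(2)]]) (simp add: pd_le_0 E(1))
    then show ?thesis by (simp add: pd_le_0)
  qed
  obtain T0 T1 :: "'a umod" and f q n0 i0 r0 n1 i1 r1 where T01: "fg_module R T0" "fg_module R T1"
    "ses R (regular R) T0 T1 f q"
    "mhom R T0 (mpow T n0) i0" "mhom R (mpow T n0) T0 r0" "\<And>x. x \<in> carrier T0 \<Longrightarrow> r0 (i0 x) = x"
    "mhom R T1 (mpow T n1) i1" "mhom R (mpow T n1) T1 r1" "\<And>x. x \<in> carrier T1 \<Longrightarrow> r1 (i1 x) = x"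
    by (rule coresolution) (rule that)
  note s = sesD[OF T01(3)]
  have T0: "projective R T0" by (rule summand_projective[OF s(2) T01(4,5)]) (rule T01(6))
  have T1: "projective R T1" by (rule summand_projective[OF s(3) T01(7,8)]) (rule T01(9))
  have "pi_gen R T0" by (rule pi_gen_surj[OF pi_gen_mpow[OF T_pi_gen] s(2) T01(5) retract_surj[OF T01(4,5)]]) (rule T01(6))
  then obtain E :: "'a umod" and p where E: "projective R E" "injective R E" "mhom R E T0 p" "p ` carrier E = carrier T0"
    by (rule pi_genE) (rule that)
  obtain t where t: "mhom R T0 E t" "\<And>x. x \<in> carrier T0 \<Longrightarrow> p (t x) = x"
    by (rule proj_lift[OF T0 projective_fg[OF E(1)] E(3,4) s(2) mhom_id]) (rule that)
  have T0i: "injective R T0" by (rule injective_retract[OF E(2) s(2) t(1) E(3) t(2)])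
  obtain v r where "biprod R (regular R) T1 T0 f v r q" by (rule ses_projective_split[OF T01(3) T1 T01(1)]) (rule that)
  note b = biprodD[OF this]
  have reg: "injective R (regular R)" by (rule injective_retract[OF T0i s(1) s(4) b(6) b(8)])
  have inj: "injective R P" if P: "projective R P" for P :: "'a umod"
  proof -
    obtain n h where h: "mhom R (mpow (regular R) n) P h" "h ` carrier (mpow (regular R) n) = carrier P"
      by (rule fg_free_cover[OF projective_fg[OF P]]) (rule that)
    note Pl = fg_left_module[OF projective_fg[OF P]]
    have free: "injective R (mpow (regular R) n)" by (rule injective_dsum[OF reg])
    obtain t where t: "mhom R P (mpow (regular R) n) t" "\<And>x. x \<in> carrier P \<Longrightarrow> h (t x) = x"
      by (rule proj_lift[OF P injective_fg[OF free] h Pl mhom_id]) (rule that)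
    show ?thesis by (rule injective_retract[OF free Pl t(1) h(1)]) (rule t(2))
  qed
  show ?thesis
    unfolding gldim_le_iff
  proof (intro allI impI)
    fix M :: "'a umod" assume M: "fg_module R M"
    note Ml = fg_left_module[OF M]
    obtain P :: "'a umod" and e where P: "projective R P" "mhom R P M e" "e ` carrier P = carrier M" "pd_le R 0 (subm P (ker P M e))"
      by (rule pd_le_SucE[OF gldim_le_pd_le[OF g M]]) (rule that)
    note Pf = projective_fg[OF P(1)] note sP = ses_ker[OF fg_left_module[OF Pf] Ml P(2,3)]
    have "injective R (subm P (ker P M e))" by (rule inj) (use P(4) in \<open>simp add: pd_le_0\<close>)
    then obtain v r where "biprod R (subm P (ker P M e)) M P (\<lambda>x. x) v r e"
      by (rule ses_injective_split[OF sP _ Pf]) (rule that)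
    note b = biprodD[OF this]
    have "projective R M" by (rule projective_retract[OF P(1) Ml b(5) P(2) b(11)])
    then show "pd_le R 0 M" by (simp add: pd_le_0)
  qed
qed

end

section \<open>The two implications\<close>

context tilted_pres
begin

text \<open>Lift a free presentation of a \<open>B\<close>-module along \<open>F\<close> and divide the source by the torsion part of the kernel.\<close>

lemma F_presentation:
  fixes N :: "('m \<Rightarrow> 'm) umod"
  assumes "fg_module B N"
  obtains M :: "'a umod" and n \<phi> h where "mhom R M (mpow T n) \<phi>" "pi_gen R M"
    "hom_zero R T (subm M (ker M (mpow T n) \<phi>))" "ses B (F M) (F (mpow T n)) N (Fmap \<phi>) h"
proof -
  note Nl = fg_left_module[OF assms]
  obtain n h where h: "mhom B (F (mpow T n)) N h" "h ` lin R T (mpow T n) = carrier N" by (rule F_cover[OF assms]) (rule that)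
  let ?Y = "mpow T n"
  note Yl = left_module_mpow[OF T_left, of n] note Yf = pi_gen_fg[OF pi_gen_mpow[OF T_pi_gen, of n]]
  note FYl = F_left[OF Yl]
  let ?L = "ker (F ?Y) N h"
  have L: "submodule ?L B (F ?Y)" by (rule submodule_ker[OF FYl Nl h(1)])
  obtain S where S: "finite S" "S \<subseteq> carrier (subm (F ?Y) ?L)"
    "\<And>L'. submodule L' B (subm (F ?Y) ?L) \<Longrightarrow> S \<subseteq> L' \<Longrightarrow> L' = carrier (subm (F ?Y) ?L)"
    by (rule fg_gens[OF B.fg_subm[OF F_fg[OF Yf] L]]) (rule that)
  have SL: "S \<subseteq> ?L" using S(2) by simp
  have SF: "S \<subseteq> carrier (F ?Y)" by (rule order_trans[OF SL submodule_subset[OF L]])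
  have le: "span B (F ?Y) S \<subseteq> ?L" by (rule span_least[OF L SL])
  have "submodule (span B (F ?Y) S) B (subm (F ?Y) ?L)"
    unfolding submodule_subm[OF FYl L le] by (rule submodule_span[OF FYl SF])
  from S(3)[OF this span_superset] have span: "span B (F ?Y) S = ?L" by simp
  obtain r \<phi> where \<phi>: "mhom R (mpow T r) ?Y \<phi>" "Fmap \<phi> ` lin R T (mpow T r) = ?L"
    using F_gens[OF Yl S(1)] SF span by auto
  let ?X = "mpow T r"
  note Xl = left_module_mpow[OF T_left, of r] note Xg = pi_gen_mpow[OF T_pi_gen, of r] note Xf = pi_gen_fg[OF Xg]
  let ?K = "ker ?X ?Y \<phi>"
  have K: "submodule ?K R ?X" by (rule submodule_ker[OF Xl Yl \<phi>(1)])
  \<comment> \<open>Only the torsion part is divided out, so that the new kernel receives no nonzero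
    map from \<open>T\<close>; this makes the induced map on \<open>F\<close> injective.\<close>
  obtain N0 where N0: "submodule N0 R (subm ?X ?K)" "pi_gen R (subm (subm ?X ?K) N0)"
    "\<And>L. submodule L R (subm ?X ?K) \<Longrightarrow> pi_gen R (subm (subm ?X ?K) L) \<Longrightarrow> L \<subseteq> N0"
    by (rule ex_torsion[OF fg_subm[OF Xf K]]) (rule that)
  have N0K: "N0 \<subseteq> ?K" using submodule_subset[OF N0(1)] by simp
  have N0s: "submodule N0 R ?X" using N0(1) unfolding submodule_subm[OF Xl K N0K] .
  have N0g: "pi_gen R (subm ?X N0)" using N0(2) by simp
  obtain M :: "'a umod" and p where M: "fg_module R M" "mhom R ?X M p" "p ` carrier ?X = carrier M"
    "\<And>x. x \<in> carrier ?X \<Longrightarrow> p x = \<zero>\<^bsub>M\<^esub> \<longleftrightarrow> x \<in> N0"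
    by (rule ex_quot[OF Xf N0s]) (rule that)
  note Ml = fg_left_module[OF M(1)]
  have Mg: "pi_gen R M" by (rule pi_gen_surj[OF Xg Ml M(2,3)])
  have sM: "ses R (subm ?X N0) ?X M (\<lambda>x. x) p" by (rule ses_sub_quot[OF Xl Ml M(2,3) N0s M(4)])
  obtain \<psi> where \<psi>: "mhom R M ?Y \<psi>" "\<And>x. x \<in> carrier ?X \<Longrightarrow> \<psi> (p x) = \<phi> x"
  proof (rule factor_through[OF Xl Ml Yl M(2,3) \<phi>(1)])
    fix x assume "x \<in> carrier ?X" "p x = \<zero>\<^bsub>M\<^esub>"
    then have "x \<in> ?K" using M(4) N0K by blast
    then show "\<phi> x = \<zero>\<^bsub>?Y\<^esub>" by (simp add: ker_def)
  qed (rule that)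
  have lift: "\<exists>g'. mhom R T ?X g' \<and> (\<forall>x\<in>carrier T. p (g' x) = g x)" if g: "mhom R T M g" for g
  proof -
    obtain g' where "mhom R T ?X g'" "\<And>x. x \<in> carrier T \<Longrightarrow> p (g' x) = g x"
      by (rule T_lift[OF sM Xf pi_gen_ext[OF N0g] g]) (rule that)
    then show ?thesis by blast
  qed
  \<comment> \<open>\<open>N0\<close> is torsion, so \<open>g\<close> lifts to the power of
    \<open>T\<close>. The lift lands in the kernel of \<open>\<phi>\<close>, hence in its largest
    torsion submodule \<open>N0\<close>, and dies in \<open>M\<close>. Both the vanishing of maps
    into the kernel and the injectivity under \<open>F\<close> come from this.\<close>
  have hz: "g x = \<zero>\<^bsub>M\<^esub>" if g: "mhom R T M g" and 0: "\<And>x. x \<in> carrier T \<Longrightarrow> \<psi> (g x) = \<zero>\<^bsub>?Y\<^esub>" and x: "x \<in> carrier T" for g x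
  proof -
    obtain g' where g': "mhom R T ?X g'" "\<forall>x\<in>carrier T. p (g' x) = g x" using lift[OF g] by blast
    have "mhom R T (subm ?X ?K) g'"
    proof (rule mhom_to_subm[OF g'(1)])
      fix y assume y: "y \<in> carrier T"
      show "g' y \<in> ?K" using \<psi>(2)[OF mhom_closed[OF g'(1) y]] 0[OF y] g'(2) y mhom_closed[OF g'(1) y] by (simp add: ker_def)
    qed
    note g'K = this
    have "g' x \<in> N0"
    proof (rule torsion_image[OF left_module_subm[OF Xl K] _ T_pi_gen g'K x])
      show "L \<subseteq> N0" if "submodule L R (subm ?X ?K)" "pi_gen R (subm (subm ?X ?K) L)" for L
        by (rule N0(3)[OF that])
    qed
    then show ?thesis using M(4)[OF mhom_closed[OF g'(1) x]] g'(2) x by simp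
  qed
  have ker: "submodule (ker M ?Y \<psi>) R M" by (rule submodule_ker[OF Ml Yl \<psi>(1)])
  have "hom_zero R T (subm M (ker M ?Y \<psi>))"
    unfolding hom_zero_def
  proof (intro allI impI ballI)
    fix g x assume g: "mhom R T (subm M (ker M ?Y \<psi>)) g" and x: "x \<in> carrier T"
    have "g x = \<zero>\<^bsub>M\<^esub>"
      by (rule hz[OF mhom_from_subm[OF g ker] _ x]) (use mhom_closed[OF g] in \<open>simp add: ker_def\<close>)
    then show "g x = \<zero>\<^bsub>subm M (ker M ?Y \<psi>)\<^esub>" by simp
  qed
  moreover have "ses B (F M) (F ?Y) N (Fmap \<psi>) h"
  proof (rule sesI[OF F_left[OF Ml] FYl Nl Fmap_hom[OF Ml Yl \<psi>(1)] h(1)])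
    show "inj_on (Fmap \<psi>) (carrier (F M))"
    proof (subst mhom_inj_iff[OF F_left[OF Ml] FYl Fmap_hom[OF Ml Yl \<psi>(1)]], intro ballI impI)
      fix g assume "g \<in> carrier (F M)" and e: "Fmap \<psi> g = \<zero>\<^bsub>F ?Y\<^esub>"
      then have g: "g \<in> lin R T M" by simp
      have z: "\<psi> (g x) = \<zero>\<^bsub>?Y\<^esub>" if "x \<in> carrier T" for x
        using fun_cong[OF e, of x] that by (simp add: compose_eq lin_zero_nth)
      show "g = \<zero>\<^bsub>F M\<^esub>" unfolding hom_mod_simps
        by (rule lin_eqI[OF g lin_zero_closed[OF T_left Ml]]) (simp add: hz[OF lin_mhom[OF g] z] lin_zero_nth)
    qed
    show "h ` carrier (F ?Y) = carrier N" using h(2) by simp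
    show "h (Fmap \<psi> g) = \<zero>\<^bsub>N\<^esub>" if "g \<in> carrier (F M)" for g
    proof -
      have g: "g \<in> lin R T M" using that by simp
      obtain g' where g': "mhom R T ?X g'" "\<forall>x\<in>carrier T. p (g' x) = g x" using lift[OF lin_mhom[OF g]] by blast
      have r: "restrict g' (carrier T) \<in> lin R T ?X" by (rule lin_restrict[OF T_left g'(1)])
      have "Fmap \<psi> g = Fmap \<phi> (restrict g' (carrier T))"
      proof (rule lin_eqI[OF Fmap_closed[OF g \<psi>(1)] Fmap_closed[OF r \<phi>(1)]])
        fix x assume x: "x \<in> carrier T"
        show "Fmap \<psi> g x = Fmap \<phi> (restrict g' (carrier T)) x"
          using \<psi>(2)[OF mhom_closed[OF g'(1) x]] g'(2) x by (simp add: compose_eq)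
      qed
      then have "Fmap \<psi> g \<in> Fmap \<phi> ` lin R T ?X" using r by (rule image_eqI)
      then show ?thesis unfolding \<phi>(2) by (simp add: ker_def)
    qed
    fix l assume "l \<in> carrier (F ?Y)" "h l = \<zero>\<^bsub>N\<^esub>"
    then have "l \<in> Fmap \<phi> ` lin R T ?X" unfolding \<phi>(2) by (simp add: ker_def)
    then obtain g where g: "g \<in> lin R T ?X" "l = Fmap \<phi> g" by blast
    have c: "Fmap p g \<in> lin R T M" by (rule Fmap_closed[OF g(1) M(2)])
    have "l = Fmap \<psi> (Fmap p g)"
      unfolding g(2) by (rule lin_eqI[OF Fmap_closed[OF g(1) \<phi>(1)] Fmap_closed[OF c \<psi>(1)]])
        (simp add: compose_eq \<psi>(2) lin_closed[OF g(1)])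
    then show "l \<in> Fmap \<psi> ` carrier (F M)" using c by (intro image_eqI) simp_all
  qed
  ultimately show ?thesis using that \<psi>(1) Mg by blast
qed

text \<open>Here \<open>m\<close> is the global dimension minus two: it bounds \<open>F M\<close>,
  which is a first syzygy of \<open>N\<close>.\<close>

lemma gldim_B_le:
  assumes "gldim R \<le> enat (Suc (Suc m))" "pd_le R (Suc m) \<tau>T"
  shows "gldim B \<le> enat (Suc m)"
  unfolding B.gldim_le_iff
proof (intro allI impI)
  fix N :: "('m \<Rightarrow> 'm) umod" assume "fg_module B N"
  then obtain M :: "'a umod" and n \<phi> h where M: "mhom R M (mpow T n) \<phi>" "pi_gen R M"
    "hom_zero R T (subm M (ker M (mpow T n) \<phi>))" and s: "ses B (F M) (F (mpow T n)) N (Fmap \<phi>) h"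
    by (rule F_presentation) (rule that)
  let ?Y = "mpow T n" and ?I = "subm (mpow T n) (\<phi> ` carrier M)"
  note Mf = pi_gen_fg[OF M(2)] note Ml = fg_left_module[OF Mf] note Yl = left_module_mpow[OF T_left, of n]
  have I: "submodule (\<phi> ` carrier M) R ?Y" by (rule submodule_range[OF Ml Yl M(1)])
  note Il = left_module_subm[OF Yl I]
  obtain E :: "('a, nat \<Rightarrow> (nat \<Rightarrow> 'a) set) module" and u
    where E: "projective R E" "mhom R ?Y E u" "inj_on u (carrier ?Y)" by (rule mpow_T_embed)
  have "pd_le R (Suc m) ?I"
    by (rule pd_le_submodule[OF assms(1) Il mhom_restrict_dom[OF E(2) I] _ pd_le_projective[OF E(1)]])
      (use inj_on_subset[OF E(3) submodule_subset[OF I]] in simp)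
  moreover have "pd_le R (Suc m) (subm M (ker M ?Y \<phi>))"
    by (rule pd_le_hom_zero[OF assms fg_subm[OF Mf submodule_ker[OF Ml Yl M(1)]] M(3)])
  moreover have "ses R (subm M (ker M ?Y \<phi>)) M ?I (\<lambda>x. x) \<phi>"
    using ses_ker[OF Ml Il mhom_to_subm[OF M(1)]] by (simp add: ker_def)
  ultimately have "pd_le R (Suc m) M" using pd_le_ext Mf by blast
  then have "pd_le B m (F M)" by (rule pd_F[OF M(2)])
  then show "pd_le B (Suc m) N" by (rule B.pd_le_quotient[OF s _ B.pd_le_projective[OF F_mpow_projective]])
qed

text \<open>As \<open>T\<close> has no nonzero map to the translate, \<open>F\<close> turns the
  universal extension into an embedding of \<open>F M\<close> in a projective
  \<open>B\<close>-module. The bound found for \<open>M\<close> passes to its submodule, the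
  translate.\<close>

lemma pd_tau_le:
  assumes "gldim R \<le> enat (Suc (Suc m))" "gldim B \<le> enat (Suc m)"
  shows "pd_le R (Suc m) \<tau>T"
proof -
  obtain M :: "'a umod" and n j q where M: "ses R \<tau>T M (mpow T n) j q" "pi_gen R M"
    by (rule universal_extension[OF tau_fg]) (rule that)
  note s = sesD[OF M(1)]
  note Fq = Fmap_hom[OF s(2,3,5)]
  have "inj_on (Fmap q) (carrier (F M))"
  proof (subst mhom_inj_iff[OF F_left[OF s(2)] F_left[OF s(3)] Fq], intro ballI impI)
    fix g assume "g \<in> carrier (F M)" and e: "Fmap q g = \<zero>\<^bsub>F (mpow T n)\<^esub>"
    then have g: "g \<in> lin R T M" by simp
    have "g x \<in> j ` carrier \<tau>T" if x: "x \<in> carrier T" for x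
      using s(10)[OF lin_closed[OF g x]] fun_cong[OF e, of x] x by (simp add: compose_eq lin_zero_nth)
    then obtain w where w: "mhom R T \<tau>T w" "\<And>x. x \<in> carrier T \<Longrightarrow> j (w x) = g x"
      by (rule factor_through_mono[OF s(1) T_left s(4,6) lin_mhom[OF g]]) (assumption, rule that)
    have "g x = \<zero>\<^bsub>M\<^esub>" if x: "x \<in> carrier T" for x
      using w(2)[OF x] hom_zeroD[OF hom_zero_tau w(1) x] mhom_zero[OF s(1,2,4)] by simp
    then show "g = \<zero>\<^bsub>F M\<^esub>" unfolding hom_mod_simps
      by (intro lin_eqI[OF g lin_zero_closed[OF T_left s(2)]]) (simp add: lin_zero_nth)
  qed
  then have "pd_le B m (F M)"
    by (rule B.pd_le_submodule[OF assms(2) F_left[OF s(2)] Fq _ B.pd_le_projective[OF F_mpow_projective]])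
  then have "pd_le R (Suc m) M" by (rule F_pd[OF M(2)])
  then show ?thesis by (rule pd_le_submodule[OF assms(1) tau_left s(4,6)])
qed

end

theorem theorem3p2p9:
  fixes k :: "('k, 'd) ring_scheme"
    and \<eta> :: "'k \<Rightarrow> 'a"
    and \<Gamma> :: "('a, 'c) ring_scheme"
    and T :: "('a, 'm) module"
  assumes "artin_algebra k \<eta> \<Gamma>"
    and "gldim \<Gamma> < \<infinity>"
    and "domdim \<Gamma> \<ge> 2"
    and "tilting \<Gamma> T"
    and "in_C \<Gamma> T"
  shows "gldim (opp (End_ring \<Gamma> T)) < gldim \<Gamma> \<longleftrightarrow>
         projdim \<Gamma> (AR_translate k \<eta> \<Gamma> T) < gldim \<Gamma>"
proof -
  interpret artin_alg k \<eta> \<Gamma> by unfold_locales (rule assms(1))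
  interpret tilted k \<eta> \<Gamma> T by unfold_locales (rule assms(4), rule assms(5))
  obtain P1 P0 :: "'a umod" and d e where pr: "min_projective_presentation \<Gamma> T P1 P0 d e"
    "\<tau>T = dual k \<eta> (quot_module (ring_dual \<Gamma> P1) {compose (carrier P1) f d | f. f \<in> lin \<Gamma> P0 (regular \<Gamma>)})"
    by (rule AR_presentation) (rule that)
  interpret tilted_pres k \<eta> \<Gamma> T P1 P0 d e by unfold_locales (rule pr(1), rule pr(2))
  obtain g where g: "gldim \<Gamma> = enat g" using assms(2) by (cases "gldim \<Gamma>") auto
  \<comment> \<open>For \<open>g = 0\<close> nothing lies below the global dimension, so both sides
    are false; \<open>g = 1\<close> contradicts \<open>gldim_not_1\<close>. In the last case strict
    inequality means at most \<open>Suc m\<close>, the form of the two implications.\<close>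
  consider "g = 0" | "g = 1" | m where "g = Suc (Suc m)" by (metis One_nat_def not0_implies_Suc)
  then show ?thesis
  proof cases
    case 1
    then show ?thesis using g by (simp add: enat_0)
  next
    case 2
    then show ?thesis using gldim_not_1 g by simp
  next
    case (3 m)
    have lt: "x < gldim \<Gamma> \<longleftrightarrow> x \<le> enat (Suc m)" for x
      unfolding g 3 by (cases x) auto
    show ?thesis
      unfolding lt projdim_le_iff[OF tau_left]
      using gldim_B_le[of m] pd_tau_le[of m] g 3 by auto
  qed
qed

end
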